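(* Let $d\in\{1,2,3\}$ and let $$P_{1}(z)=\frac{4z}{1-z}+\frac{5z^{2}}{(1-z)^{2}}+\frac{4z^{3}}{(1-z)^{3}}.$$ Let $u_{0}\in\mathcal{A}_{0}$ be a real-valued zero-mean function on $\mathbb{T}^{d}$ (i.e. $\int_{\mathbb{T}^{d}}u_{0}\,dx=0$) such that $$|u_{0}|_{0}<1\qquad\text{and}\qquad d^{2}P_{1}(|u_{0}|_{0})<1 .$$ Then there is a strong solution $u$, defined for all times $t\ge 0$, of $$u_{t}+\sum_{i,j=1}^{d}\partial_{i}\partial_{j}\big((u+1)\,\partial_{i}\partial_{j}\log(u+1)\big)=0,\qquad u(0,x)=u_{0}(x),\qquad x\in\mathbb{T}^{d},$$ such that for all $T>0$ $$u\in L^{\infty}([0,T];L^{\infty})\cap L^{p}(0,T;\mathcal{A}_{4/p})\qquad\text{for all }1<p<\infty .$$ Moreover, $u$ converges uniformly to $0$ exponentially in time: $$\|u(t)\|_{L^{\infty}}\le |u_{0}|_{0}\,e^{-(1-d^{2}P_{1}(|u_{0}|_{0}))t}.$$ Finally, $u$ becomes instantaneously spatially analytic with increasing radius of analyticity, in the following sense: for $\sigma>0$ small enough that $1-\sigma-d^{2}P_{1}(|u_{0}|_{0})>0$, $$e^{\sigma t|k|}\,\widehat{u}(t,k)\in L^{\infty}(0,T;\ell^{1}(\mathbb{Z}^{d}))\qquad\text{for all }T>0.$$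
   Context: $\mathbb{T}^{d}$ is the flat torus $[-\pi,\pi]^{d}$ with periodic boundary conditions. Fourier coefficients are $\widehat{u}(k)=\frac{1}{(2\pi)^{d}}\int_{\mathbb{T}^{d}}u(x)e^{-ik\cdot x}\,dx$, $k\in\mathbb{Z}^{d}$; for $u=u(t,x)$, $\widehat{u}(t,k)$ denotes the Fourier coefficient in $x$. For $s\ge 0$ the Wiener space is $$\mathcal{A}_{s}=\Big\{u\in L^{1}(\mathbb{T}^{d}):\ |u|_{s}:=\sum_{k\in\mathbb{Z}^{d}}|k|^{s}|\widehat{u}(k)|<\infty\Big\}.$$ For a Banach space $X$, $L^{p}_{T}X=L^{p}(0,T;X)$ is the Bochner space of functions from $(0,T)$ to $X$. Strong solution: $u$ is a strong solution on $[0,T]$ with initial datum $u_{0}$ if $u\in L^{\infty}_{T}L^{\infty}\cap L^{2}_{T}H^{1}\cap L^{1}_{T}W^{2,1}$ and $$-\int_{0}^{T}\!\int_{\mathbb{T}^{d}}\partial_{t}\phi\,u\,dx\,dt-\int_{\mathbb{T}^{d}}\phi(0,x)u_{0}(x)\,dx+\int_{0}^{T}\!\int_{\mathbb{T}^{d}}\sum_{i,j=1}^{d}(u+1)\,\partial_{i}\partial_{j}\big(\log(u+1)\big)\,\partial_{i}\partial_{j}\phi\,dx\,dt=0$$ for all $\phi\in C^{\infty}([0,\infty)\times\mathbb{T}^{d})$ with support contained in $[0,T')\times\mathbb{T}^{d}$ for some $T'<T$. Here $(u+1)\partial_{i}\partial_{j}\log(u+1)$ is understood as $\partial_{i}\partial_{j}u-\frac{\partial_{i}u\,\partial_{j}u}{1+u}$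 (with $1+u>0$). A solution defined for all times is a function on $[0,\infty)\times\mathbb{T}^{d}$ that is a strong solution on $[0,T]$ for every $T>0$. *)

theory Defs
  imports "HOL-Analysis.Analysis" "HOL-Probability.Essential_Supremum"
begin

text \<open>
  Functions on the torus are represented by functions on real^'n that have period 2 pi in each
  coordinate, and integration over the torus is Lebesgue integration over the fundamental cube.
  The dimension is CARD('n). All function spaces below consist of representatives: functions that
  agree almost everywhere are at distance 0 from each other.
\<close>

definition torus :: "(real ^ 'n::finite) measure" where
  "torus = lebesgue_on (cbox (\<chi> i. - pi) (\<chi> i. pi))"

definition periodic :: "(real ^ 'n::finite \<Rightarrow> 'b) \<Rightarrow> bool" where
  "periodic f \<longleftrightarrow> (\<forall>x i. f (x + axis i (2 * pi)) = f x)"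


section \<open>Lebesgue spaces on the torus\<close>

definition L1 :: "(real ^ 'n::finite \<Rightarrow> real) set" where
  "L1 = {f. periodic f \<and> integrable torus f}"

definition L1_norm :: "(real ^ 'n::finite \<Rightarrow> real) \<Rightarrow> real" where
  "L1_norm f = (LINT x|torus. \<bar>f x\<bar>)"

definition L2 :: "(real ^ 'n::finite \<Rightarrow> real) set" where
  "L2 = {f. periodic f \<and> f \<in> borel_measurable torus \<and> integrable torus (\<lambda>x. (f x)\<^sup>2)}"

definition L2_norm :: "(real ^ 'n::finite \<Rightarrow> real) \<Rightarrow> real" where
  "L2_norm f = sqrt (LINT x|torus. (f x)\<^sup>2)"

definition Linf :: "(real ^ 'n::finite \<Rightarrow> real) set" where
  "Linf = {f. periodic f \<and> f \<in> borel_measurable torus \<and> (\<exists>C. AE x in torus. \<bar>f x\<bar> \<le> C)}"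

definition Linf_norm :: "(real ^ 'n::finite \<Rightarrow> real) \<Rightarrow> real" where
  "Linf_norm f = real_of_ereal (esssup torus (\<lambda>x. ereal \<bar>f x\<bar>))"


section \<open>Smooth functions\<close>

text \<open>
  The derivative is taken within \<open>S\<close>, which is either the whole space or the half-space
  of nonnegative times; in both cases it is unique. On the boundary of the half-space the time
  derivative is one-sided.
\<close>

definition partial_on :: "'a::euclidean_space set \<Rightarrow> 'a \<Rightarrow> ('a \<Rightarrow> real) \<Rightarrow> 'a \<Rightarrow> real" where
  "partial_on S b f x = frechet_derivative f (at x within S) b"

primrec Ck_on :: "nat \<Rightarrow> 'a::euclidean_space set \<Rightarrow> ('a \<Rightarrow> real) \<Rightarrow> bool" where
  "Ck_on 0 S f \<longleftrightarrow> continuous_on S f"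
| "Ck_on (Suc k) S f \<longleftrightarrow> f differentiable_on S \<and> (\<forall>b\<in>Basis. Ck_on k S (partial_on S b f))"

definition smooth_on :: "'a::euclidean_space set \<Rightarrow> ('a \<Rightarrow> real) \<Rightarrow> bool" where
  "smooth_on S f \<longleftrightarrow> (\<forall>k. Ck_on k S f)"


section \<open>Weak derivatives and Sobolev spaces on the torus\<close>

definition has_weak_deriv ::
    "'n::finite \<Rightarrow> (real ^ 'n \<Rightarrow> real) \<Rightarrow> (real ^ 'n \<Rightarrow> real) \<Rightarrow> bool" where
  "has_weak_deriv i f g \<longleftrightarrow> f \<in> L1 \<and> g \<in> L1 \<and>
     (\<forall>\<psi>. smooth_on UNIV \<psi> \<and> periodic \<psi> \<longrightarrow>
        (LINT x|torus. f x * partial_on UNIV (axis i 1) \<psi> x) = - (LINT x|torus. g x * \<psi> x))"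

text \<open>Meaningful only if the weak derivative exists; it is then unique up to null sets.\<close>

definition weak_deriv :: "'n::finite \<Rightarrow> (real ^ 'n \<Rightarrow> real) \<Rightarrow> real ^ 'n \<Rightarrow> real" where
  "weak_deriv i f = (SOME g. has_weak_deriv i f g)"

definition H1 :: "(real ^ 'n::finite \<Rightarrow> real) set" where
  "H1 = {f \<in> L2. \<forall>i. \<exists>g\<in>L2. has_weak_deriv i f g}"

definition H1_norm :: "(real ^ 'n::finite \<Rightarrow> real) \<Rightarrow> real" where
  "H1_norm f = sqrt ((L2_norm f)\<^sup>2 + (\<Sum>i\<in>UNIV. (L2_norm (weak_deriv i f))\<^sup>2))"

definition W21 :: "(real ^ 'n::finite \<Rightarrow> real) set" where
  "W21 = {f \<in> L1. \<forall>j. \<exists>g. has_weak_deriv j f g \<and> (\<forall>i. \<exists>h. has_weak_deriv i g h)}"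

definition W21_norm :: "(real ^ 'n::finite \<Rightarrow> real) \<Rightarrow> real" where
  "W21_norm f = L1_norm f + (\<Sum>j\<in>UNIV. L1_norm (weak_deriv j f))
     + (\<Sum>i\<in>UNIV. \<Sum>j\<in>UNIV. L1_norm (weak_deriv i (weak_deriv j f)))"


section \<open>Fourier coefficients and Wiener spaces\<close>

definition freq :: "int ^ 'n::finite \<Rightarrow> real ^ 'n" where
  "freq k = (\<chi> i. of_int (k $ i))"

definition fourier_coeff :: "(real ^ 'n::finite \<Rightarrow> real) \<Rightarrow> int ^ 'n \<Rightarrow> complex" where
  "fourier_coeff f k =
     (LINT x|torus. of_real (f x) * exp (- (\<i> * of_real (freq k \<bullet> x)))) / (2 * pi) ^ CARD('n)"

text \<open>The weight \<open>|k|\<^sup>s\<close>, with \<open>|0|\<^sup>0 = 1\<close> (whereas \<open>0 powr 0 = 0\<close>).\<close>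

definition wiener_weight :: "real \<Rightarrow> int ^ 'n::finite \<Rightarrow> real" where
  "wiener_weight s k = (if s = 0 then 1 else norm (freq k) powr s)"

definition wiener :: "real \<Rightarrow> (real ^ 'n::finite \<Rightarrow> real) set" where
  "wiener s = {f \<in> L1. (\<lambda>k. wiener_weight s k * cmod (fourier_coeff f k)) summable_on UNIV}"

definition wiener_norm :: "real \<Rightarrow> (real ^ 'n::finite \<Rightarrow> real) \<Rightarrow> real" where
  "wiener_norm s f = (\<Sum>\<^sub>\<infinity>k. wiener_weight s k * cmod (fourier_coeff f k))"

text \<open>
  For \<open>s > 0\<close>, \<open>wiener_norm s\<close> vanishes on constants. As a Banach space,
  \<open>wiener s\<close> carries the following norm, which is \<open>wiener_norm s\<close> on zero-mean
  functions.
\<close>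

definition wiener_full_norm :: "real \<Rightarrow> (real ^ 'n::finite \<Rightarrow> real) \<Rightarrow> real" where
  "wiener_full_norm s f = cmod (fourier_coeff f 0) + wiener_norm s f"

definition ell1 :: "(int ^ 'n::finite \<Rightarrow> complex) set" where
  "ell1 = {c. (\<lambda>k. cmod (c k)) summable_on UNIV}"

definition ell1_norm :: "(int ^ 'n::finite \<Rightarrow> complex) \<Rightarrow> real" where
  "ell1_norm c = (\<Sum>\<^sub>\<infinity>k. cmod (c k))"


section \<open>Bochner spaces\<close>

text \<open>
  The library's Bochner integral needs the target to be a Banach type; here the target is the
  Banach space obtained from a set \<open>X\<close> of representatives with a (semi)norm \<open>N\<close>
  by identifying elements at distance 0. Strong measurability: almost everywhere a limit of
  simple functions.
\<close>

definition strongly_measurable ::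
    "real \<Rightarrow> 'v::minus set \<Rightarrow> ('v \<Rightarrow> real) \<Rightarrow> (real \<Rightarrow> 'v) \<Rightarrow> bool" where
  "strongly_measurable T X N u \<longleftrightarrow>
     (\<exists>s. (\<forall>n::nat. simple_function (lebesgue_on {0<..<T}) (s n) \<and> s n ` {0<..<T} \<subseteq> X) \<and>
          (AE t in lebesgue_on {0<..<T}. (\<lambda>n. N (s n t - u t)) \<longlonglongrightarrow> 0))"

definition bochner_Lp ::
    "real \<Rightarrow> real \<Rightarrow> 'v::minus set \<Rightarrow> ('v \<Rightarrow> real) \<Rightarrow> (real \<Rightarrow> 'v) set" where
  "bochner_Lp p T X N = {u. (AE t in lebesgue_on {0<..<T}. u t \<in> X) \<and> strongly_measurable T X N u \<and>
     integrable (lebesgue_on {0<..<T}) (\<lambda>t. N (u t) powr p)}"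

definition bochner_Linf ::
    "real \<Rightarrow> 'v::minus set \<Rightarrow> ('v \<Rightarrow> real) \<Rightarrow> (real \<Rightarrow> 'v) set" where
  "bochner_Linf T X N = {u. (AE t in lebesgue_on {0<..<T}. u t \<in> X) \<and> strongly_measurable T X N u \<and>
     (\<exists>C. AE t in lebesgue_on {0<..<T}. N (u t) \<le> C)}"


section \<open>Strong solutions\<close>

text \<open>\<open>(v + 1) \<partial>\<^sub>i \<partial>\<^sub>j log (v + 1)\<close>, understood in expanded form.\<close>

definition flux :: "'n::finite \<Rightarrow> 'n \<Rightarrow> (real ^ 'n \<Rightarrow> real) \<Rightarrow> real ^ 'n \<Rightarrow> real" where
  "flux i j v x = weak_deriv i (weak_deriv j v) x - weak_deriv i v x * weak_deriv j v x / (1 + v x)"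

abbreviation spacetime :: "(real \<times> (real ^ 'n::finite)) set" where
  "spacetime \<equiv> {0..} \<times> UNIV"

abbreviation dt :: "(real \<times> (real ^ 'n::finite) \<Rightarrow> real) \<Rightarrow> real \<times> (real ^ 'n) \<Rightarrow> real" where
  "dt \<equiv> partial_on spacetime (1, 0)"

abbreviation dx :: "'n::finite \<Rightarrow> (real \<times> (real ^ 'n) \<Rightarrow> real) \<Rightarrow> real \<times> (real ^ 'n) \<Rightarrow> real" where
  "dx i \<equiv> partial_on spacetime (0, axis i 1)"

definition test_function :: "real \<Rightarrow> (real \<times> (real ^ 'n::finite) \<Rightarrow> real) \<Rightarrow> bool" where
  "test_function T \<phi> \<longleftrightarrow> smooth_on spacetime \<phi> \<and> (\<forall>t\<ge>0. periodic (\<lambda>x. \<phi> (t, x))) \<and>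
     (\<exists>T'<T. \<forall>t\<ge>0. \<forall>x. t \<ge> T' \<longrightarrow> \<phi> (t, x) = 0)"

text \<open>
  The positivity of \<open>1 + u\<close> and the integrability of the flux make the weak formulation
  meaningful (the integral of a non-integrable function would be 0).
\<close>

definition strong_solution ::
    "real \<Rightarrow> (real ^ 'n::finite \<Rightarrow> real) \<Rightarrow> (real \<Rightarrow> real ^ 'n \<Rightarrow> real) \<Rightarrow> bool" where
  "strong_solution T u0 u \<longleftrightarrow>
     u \<in> bochner_Linf T Linf Linf_norm \<and>
     u \<in> bochner_Lp 2 T H1 H1_norm \<and>
     u \<in> bochner_Lp 1 T W21 W21_norm \<and>
     (AE t in lebesgue_on {0<..<T}. AE x in torus. 1 + u t x > 0) \<and>
     (\<forall>i j. (\<lambda>t. flux i j (u t)) \<in> bochner_Lp 1 T L1 L1_norm) \<and>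
     (\<forall>\<phi>. test_function T \<phi> \<longrightarrow>
        - (LINT t|lebesgue_on {0<..<T}. LINT x|torus. dt \<phi> (t, x) * u t x)
        - (LINT x|torus. \<phi> (0, x) * u0 x)
        + (LINT t|lebesgue_on {0<..<T}. LINT x|torus.
             (\<Sum>i\<in>UNIV. \<Sum>j\<in>UNIV. flux i j (u t) x * dx i (dx j \<phi>) (t, x))) = 0)"

definition P1 :: "real \<Rightarrow> real" where
  "P1 z = 4 * z / (1 - z) + 5 * z\<^sup>2 / (1 - z)\<^sup>2 + 4 * z ^ 3 / (1 - z) ^ 3"

end

theory Submission
  imports Defs "HOL-Complex_Analysis.Great_Picard"
begin

text \<open>
  The Fourier coefficients of a solution satisfy
  \<open>c' = - |k|\<^sup>4 c - \<Sum>\<^bsub>i,j\<^esub> k\<^sub>i k\<^sub>j F(\<partial>\<^sub>iu \<partial>\<^sub>ju / (1 + u))\<close>. For a submultiplicative weight \<open>w\<close>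
  the inequality \<open>|k + l| \<le> |k| + |l|\<close> is a Leibniz rule for weighted \<open>\<ell>\<^sup>1\<close> norms; together with
  log-convexity of the moments \<open>\<Sum> |k|\<^sup>m w |c|\<close> it bounds the nonlinear term by
  \<open>d\<^sup>2 P\<^sub>1(z) \<Sum> |k|\<^sup>4 w |c|\<close> as long as \<open>\<Sum> w |c| \<le> z\<close>, so that dissipation wins.

  Solutions are limits of the explicit Euler scheme with step \<open>h\<close>, truncated to \<open>|k| \<le> n\<close> with
  \<open>h n\<^sup>4 \<le> 1\<close>: a step then does not increase \<open>\<Sum> w |c|\<close>, even when the weight grows from
  \<open>(1 + b h |k|)\<^sup>j\<close> to \<open>(1 + b h |k|)\<^bsup>j+1\<^esup>\<close>. These weights tend to \<open>exp (\<delta> t |k|)\<close> with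
  \<open>\<delta> = 1 - d\<^sup>2 P\<^sub>1(z)\<close>, which gives analyticity and, the mean being zero, exponential decay. The
  dissipated quantity bounds the time integral of \<open>\<Sum> |k|\<^sup>4 |c|\<close>, hence makes every mode
  equicontinuous in time; a diagonal subsequence converges. For \<open>t > 0\<close> the exponential bound makes
  all series converge uniformly, so the limit solves the differential equation mode by mode.
\<close>

section \<open>Exponentials and integration over the torus\<close>

text \<open>The obstacle is the initial time. The datum need not have any finite positive moment, so
  near t = 0 the right-hand side of a mode is controlled only through the dissipation. That is an L1
  bound in time, and alone it does not exclude jumps in the limit. The remedy: in a single mode the
  nonlinear term costs only the square of the first moment, hence at most a second moment, and for
  every \<epsilon> the second moment is at most \<epsilon> times the fourth plus 1 / \<epsilon>. The
  part that is merely integrable can thus be made as small as desired, the rest is proportional to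
  the elapsed time, and the limit is continuous down to t = 0, where it takes up the datum. The
  equation itself is derived for t > 0 only.

  An explicit scheme lets one weighted estimate per step provide existence, persistence of the
  smallness, growth of the weight and dissipation at once, by induction over the steps. The same
  growing weights also bound all moments of the scheme, uniformly in the step size, as soon as t is
  bounded away from 0; this is what makes the nonlinear term pass to the limit.\<close>

definition wave :: "int ^ 'n::finite \<Rightarrow> real ^ 'n \<Rightarrow> complex" where
  "wave k x = cis (freq k \<bullet> x)"

lemma freq_add: "freq (k + l) = freq k + freq l"
  by (simp add: freq_def vec_eq_iff)

lemma freq_uminus: "freq (- k) = - freq k"
  by (simp add: freq_def vec_eq_iff)

lemma freq_0 [simp]: "freq 0 = 0"
  by (simp add: freq_def vec_eq_iff)

lemma freq_axis: "freq (axis i m) = axis i (of_int m)"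
  by (simp add: freq_def vec_eq_iff axis_def)

lemma norm_freq_uminus [simp]: "norm (freq (- k)) = norm (freq k)"
  by (simp add: freq_uminus)

lemma norm_freq_add_le: "norm (freq (k + l)) \<le> norm (freq k) + norm (freq l)"
  by (simp add: freq_add norm_triangle_ineq)

text \<open>Frequencies are integer vectors, so there is a gap at 0. For sequences without zero mode
  the gap bounds every lower moment by the fourth, and it turns a weight growing in |k| into decay
  in time.\<close>

lemma norm_freq_ge_1: "k \<noteq> 0 \<Longrightarrow> 1 \<le> norm (freq k)"
proof -
  assume "k \<noteq> 0"
  then obtain i where "k $ i \<noteq> 0"
    by (auto simp: vec_eq_iff)
  then have "1 \<le> \<bar>real_of_int (k $ i)\<bar>"
    by linarith
  also have "\<dots> = \<bar>freq k $ i\<bar>"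
    by (simp add: freq_def)
  also have "\<dots> \<le> norm (freq k)"
    by (rule component_le_norm_cart)
  finally show ?thesis .
qed

lemma wave_add: "wave (k + l) x = wave k x * wave l x"
  by (simp add: wave_def freq_add inner_add_left cis_mult)

lemma wave_0 [simp]: "wave 0 x = 1"
  by (simp add: wave_def)

lemma norm_wave [simp]: "norm (wave k x) = 1"
  by (simp add: wave_def)

lemma cnj_wave: "cnj (wave k x) = wave (- k) x"
  by (simp add: wave_def freq_uminus cis_cnj)

lemma wave_plus: "wave k (x + y) = wave k x * wave k y"
  by (simp add: wave_def inner_add_right cis_mult)

lemma wave_axis: "wave k (axis i h) = cis (of_int (k $ i) * h)"
  by (simp add: wave_def inner_axis freq_def)

lemma continuous_on_wave [continuous_intros]:
  "continuous_on S g \<Longrightarrow> continuous_on S (\<lambda>x. wave k (g x))"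
  unfolding wave_def cis_conv_exp by (intro continuous_intros)

lemma periodic_wave: "periodic (wave k)"
proof -
  have "cis (of_int m * (2 * pi)) = 1" for m :: int
    using cis_multiple_2pi[of m] by (simp add: mult_ac)
  then show ?thesis
    by (simp add: periodic_def wave_plus wave_axis)
qed

section \<open>Integration over the torus: translations, exponentials and derivatives\<close>

lemma torus_space: "space torus = cbox (\<chi> i. - pi) (\<chi> i. pi)"
  by (simp add: torus_def)

lemma finite_measure_torus: "finite_measure (torus :: (real ^ 'n::finite) measure)"
  unfolding torus_def by (rule finite_measure_lebesgue_on) simp

lemma measure_torus: "measure (torus :: (real ^ 'n::finite) measure) (space torus) = (2 * pi) ^ CARD('n)"
proof -
  have "measure (torus :: (real ^ 'n) measure) (space torus)
      = measure lborel (cbox (\<chi> i. - pi) (\<chi> i. pi) :: (real ^ 'n) set)"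
    unfolding torus_def by (simp add: measure_restrict_space)
  also have "\<dots> = (2 * pi) ^ CARD('n)"
    by (subst content_cbox_cart) (auto simp: interval_eq_empty_cart not_less)
  finally show ?thesis .
qed

lemma borel_measurable_torus:
  fixes f :: "real ^ 'n::finite \<Rightarrow> 'b::euclidean_space"
  assumes "continuous_on UNIV f"
  shows "f \<in> borel_measurable torus"
  unfolding torus_def
  by (rule continuous_imp_measurable_on_sets_lebesgue)
     (auto intro: continuous_on_subset[OF assms])

lemma integrable_torus_continuous:
  fixes f :: "real ^ 'n::finite \<Rightarrow> 'b::euclidean_space"
  assumes "continuous_on UNIV f"
  shows "integrable torus f"
  unfolding torus_def
  by (rule continuous_imp_integrable) (auto intro: continuous_on_subset[OF assms])

lemma integral_torus:
  fixes f :: "real ^ 'n::finite \<Rightarrow> 'b::euclidean_space"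
  assumes "integrable torus f"
  shows "(LINT x|torus. f x) = integral (cbox (\<chi> i. - pi) (\<chi> i. pi)) f"
  using assms unfolding torus_def by (intro lebesgue_integral_eq_integral) auto

text \<open>Adding \<open>axis i (c - q $ i)\<close> replaces the i-th coordinate of
  \<open>q\<close> by \<open>c\<close>; the additive form combines with the shifts of boxes in
  direction i that follow.\<close>

lemma integral_cbox_split:
  fixes f :: "real ^ 'n::finite \<Rightarrow> 'b::euclidean_space"
  assumes f: "continuous_on UNIV f" and c: "p $ i \<le> c" "c \<le> q $ i"
  shows "integral (cbox p q) f
    = integral (cbox p (q + axis i (c - q $ i))) f + integral (cbox (p + axis i (c - p $ i)) q) f"
proof -
  have "f integrable_on cbox p q"
    by (intro integrable_continuous continuous_on_subset[OF f]) auto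
  moreover have "axis i 1 \<in> (Basis :: (real ^ 'n) set)"
    by simp
  ultimately have "integral (cbox p q) f
    = integral (cbox p q \<inter> {x. x \<bullet> axis i 1 \<le> c}) f + integral (cbox p q \<inter> {x. x \<bullet> axis i 1 \<ge> c}) f"
    by (rule integral_split)
  moreover have "cbox p q \<inter> {x. x \<bullet> axis i 1 \<le> c} = cbox p (q + axis i (c - q $ i))"
  proof (rule set_eqI)
    fix x
    have "(\<forall>j. p $ j \<le> x $ j \<and> x $ j \<le> q $ j) \<and> x $ i \<le> c \<longleftrightarrow>
        (\<forall>j. p $ j \<le> x $ j \<and> x $ j \<le> q $ j + (if j = i then c - q $ i else 0))"
      using c by (smt (verit))
    then show "x \<in> cbox p q \<inter> {x. x \<bullet> axis i 1 \<le> c} \<longleftrightarrow> x \<in> cbox p (q + axis i (c - q $ i))"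
      by (simp add: mem_box_cart inner_axis) (simp add: axis_def)
  qed
  moreover have "cbox p q \<inter> {x. x \<bullet> axis i 1 \<ge> c} = cbox (p + axis i (c - p $ i)) q"
  proof (rule set_eqI)
    fix x
    have "(\<forall>j. p $ j \<le> x $ j \<and> x $ j \<le> q $ j) \<and> c \<le> x $ i \<longleftrightarrow>
        (\<forall>j. p $ j + (if j = i then c - p $ i else 0) \<le> x $ j \<and> x $ j \<le> q $ j)"
      using c by (smt (verit))
    then show "x \<in> cbox p q \<inter> {x. x \<bullet> axis i 1 \<ge> c} \<longleftrightarrow> x \<in> cbox (p + axis i (c - p $ i)) q"
      by (simp add: mem_box_cart inner_axis) (simp add: axis_def)
  qed
  ultimately show ?thesis
    by simp
qed

text \<open>The shifted cube is cut along the hyperplane where the i-th coordinate is pi. By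
  periodicity the overhanging slab may be moved back by 2 pi, where it completes the remaining piece
  to the original cube.\<close>

lemma integral_torus_translate_nonneg:
  fixes f :: "real ^ 'n::finite \<Rightarrow> 'b::euclidean_space"
  assumes f: "continuous_on UNIV f" "periodic f" and h: "0 \<le> h" "h \<le> 2 * pi"
  shows "(LINT x|torus. f (x + axis i h)) = (LINT x|torus. f x)"
proof -
  define a b :: "real ^ 'n" where "a = (\<chi> i. - pi)" and "b = (\<chi> i. pi)"
  have [simp]: "a $ i = - pi" "b $ i = pi" for i
    by (simp_all add: a_def b_def)
  have "continuous_on UNIV (\<lambda>x. f (x + axis i h))"
    by (intro continuous_on_compose2[OF f(1)] continuous_intros) auto
  then have "(LINT x|torus. f (x + axis i h)) = integral (cbox a b) (\<lambda>x. f (x + axis i h))"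
    by (simp add: integral_torus integrable_torus_continuous a_def b_def)
  also have "\<dots> = integral (cbox (a + axis i h) (b + axis i h)) f"
    using integral_shift_cbox[of "a + axis i h" "axis i h" "b + axis i h" f] by simp
  also have "\<dots> = integral (cbox (a + axis i h) b) f
      + integral (cbox (a + axis i (2 * pi)) (b + axis i h)) f"
  proof -
    have 1: "b + axis i h + axis i (pi - (b + axis i h) $ i) = b"
      and 2: "a + axis i h + axis i (pi - (a + axis i h) $ i) = a + axis i (2 * pi)"
      by (auto simp: vec_eq_iff axis_def)
    show ?thesis
      using integral_cbox_split[OF f(1), of "a + axis i h" i pi "b + axis i h"] h
      unfolding 1 2 by simp
  qed
  also have "integral (cbox (a + axis i (2 * pi)) (b + axis i h)) f
      = integral (cbox a (b + axis i (h - 2 * pi))) (\<lambda>x. f (x + axis i (2 * pi)))"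
  proof -
    have 1: "b + axis i h - axis i (2 * pi) = b + axis i (h - 2 * pi)"
      by (auto simp: vec_eq_iff axis_def)
    show ?thesis
      using integral_shift_cbox[of "a + axis i (2 * pi)" "axis i (2 * pi)" "b + axis i h" f]
      unfolding 1 by simp
  qed
  also have "(\<lambda>x. f (x + axis i (2 * pi))) = f"
    using f(2) by (auto simp: periodic_def)
  also have "integral (cbox (a + axis i h) b) f + integral (cbox a (b + axis i (h - 2 * pi))) f
      = integral (cbox a b) f"
  proof -
    have 1: "b + axis i (- pi + h - b $ i) = b + axis i (h - 2 * pi)"
      and 2: "a + axis i (- pi + h - a $ i) = a + axis i h"
      by (auto simp: vec_eq_iff axis_def)
    show ?thesis
      using integral_cbox_split[OF f(1), of a i "- pi + h" b] h unfolding 1 2 by simp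
  qed
  also have "\<dots> = (LINT x|torus. f x)"
    using f(1) by (simp add: integral_torus integrable_torus_continuous a_def b_def)
  finally show ?thesis .
qed

text \<open>If \<open>k $ i \<noteq> 0\<close>, translation by pi / |k_i| in direction i multiplies
  the exponential by -1 and leaves the integral unchanged, so the integral is its own
  negative.\<close>

lemma integral_torus_wave:
  fixes k :: "int ^ 'n::finite"
  shows "(LINT x|torus. wave k x) = (if k = 0 then (2 * pi) ^ CARD('n) else 0)"
proof (cases "k = 0")
  case True
  then show ?thesis
    by (simp add: measure_torus[where 'n = 'n] scaleR_conv_of_real)
next
  case False
  then obtain i where i: "k $ i \<noteq> 0"
    by (auto simp: vec_eq_iff)
  define m where "m = real_of_int \<bar>k $ i\<bar>"
  have m: "m \<ge> 1"
    using i by (simp add: m_def)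
  have "(LINT x|torus. wave k x) = (LINT x|torus. wave k (x + axis i (pi / m)))"
    using m by (intro integral_torus_translate_nonneg[symmetric] periodic_wave continuous_intros)
      (auto simp: field_simps intro: order_trans[of _ "pi * 1"])
  also have "\<dots> = (LINT x|torus. wave k x) * wave k (axis i (pi / m))"
    by (simp add: wave_plus)
  also have "wave k (axis i (pi / m)) = - 1"
  proof (cases "k $ i > 0")
    case True
    then have "of_int (k $ i) * (pi / m) = pi"
      using m by (simp add: m_def)
    then show ?thesis
      by (simp add: wave_axis del: times_divide_eq_right)
  next
    case False
    then have "of_int (k $ i) * (pi / m) = - pi"
      using m i by (simp add: m_def)
    then show ?thesis
      by (simp add: wave_axis cis.ctr complex_eq_iff del: times_divide_eq_right)
  qed
  finally show ?thesis
    using False by (simp add: complex_eq_iff)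
qed

text \<open>Difference quotients have integral 0 by translation invariance. They converge pointwise
  to \<open>f'\<close> and are bounded by the mean value inequality, so the integral of the limit
  vanishes as well.\<close>

lemma integral_torus_derivative:
  fixes f f' :: "real ^ 'n::finite \<Rightarrow> 'b::euclidean_space"
  assumes f: "continuous_on UNIV f" "periodic f" and f': "continuous_on UNIV f'"
    and D: "\<And>x. ((\<lambda>s. f (x + axis i s)) has_vector_derivative f' x) (at 0)"
  shows "(LINT x|torus. f' x) = 0"
proof -
  \<comment> \<open>\<open>q n\<close> is the difference quotient with increment 1 / (n + 1).
    \<open>K\<close> extends the cube upwards by 1, so that segments of such a length in a
    coordinate direction stay inside it when they start in the cube.\<close>
  define q where "q n x = (inverse (inverse (real (Suc n)))) *\<^sub>R (f (x + axis i (inverse (real (Suc n)))) - f x)" for n x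
  define K where "K = (cbox (\<chi> i. - pi) (\<chi> i. pi + 1) :: (real ^ 'n) set)"
  have "compact (f' ` K)"
    unfolding K_def by (intro compact_continuous_image continuous_on_subset[OF f']) auto
  then obtain B where B: "\<And>x. x \<in> K \<Longrightarrow> norm (f' x) \<le> B"
    by (meson bounded_iff compact_imp_bounded imageI)
  have D': "((\<lambda>s. f (x + axis i s)) has_vector_derivative f' (x + axis i s)) (at s)" for x s
  proof -
    have "((\<lambda>h. f ((x + axis i s) + axis i h)) has_vector_derivative f' (x + axis i s)) (at (s - s))"
      using D by simp
    then have "((\<lambda>h. f ((x + axis i s) + axis i (h - s))) has_vector_derivative 1 *\<^sub>R f' (x + axis i s)) (at s)"
      by (intro vector_diff_chain_at[where g = "\<lambda>h. f ((x + axis i s) + axis i h)", unfolded o_def])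
         (auto intro!: derivative_eq_intros)
    moreover have "(x + axis i s) + axis i (h - s) = x + axis i h" for h
      by (auto simp: vec_eq_iff axis_def)
    ultimately show ?thesis
      by simp
  qed
  have qB: "norm (q n x) \<le> B" if x: "x \<in> space torus" for n x
  proof -
    define h where "h = inverse (real (Suc n))"
    have h: "0 < h" "h \<le> 1"
      by (auto simp: h_def inverse_le_1_iff)
    have "norm (f (x + axis i h) - f (x + axis i 0)) \<le> B * norm (h - 0)"
    proof (rule differentiable_bound[where S = "{0..h}" and f' = "\<lambda>s t. t *\<^sub>R f' (x + axis i s)"])
      show "((\<lambda>s. f (x + axis i s)) has_derivative (\<lambda>t. t *\<^sub>R f' (x + axis i s))) (at s within {0..h})" for s
        using D'[of x s] unfolding has_vector_derivative_def by (rule has_derivative_at_withinI)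
      show "onorm (\<lambda>t. t *\<^sub>R f' (x + axis i s)) \<le> B" if "s \<in> {0..h}" for s
      proof (rule onorm_le)
        have "x + axis i s \<in> K"
          using x that h unfolding torus_space K_def mem_box_cart
          by (auto simp: axis_def add_mono intro: order_trans[of _ pi]) (smt (verit))+
        then show "norm (t *\<^sub>R f' (x + axis i s)) \<le> B * norm t" for t
          using B[of "x + axis i s"] by (metis mult.commute mult_left_mono norm_ge_zero norm_scaleR real_norm_def)
      qed
    qed (use h in auto)
    moreover have "axis i 0 = (0 :: real ^ 'n)"
      by (simp add: vec_eq_iff axis_def)
    ultimately show ?thesis
      using h unfolding q_def h_def[symmetric] by (simp add: divide_simps mult.commute)
  qed
  have "(\<lambda>n. LINT x|torus. q n x) \<longlonglongrightarrow> (LINT x|torus. f' x)"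
  proof (rule integral_dominated_convergence[where w = "\<lambda>_. B"])
    show "f' \<in> borel_measurable torus"
      by (intro borel_measurable_torus f')
    show "q n \<in> borel_measurable torus" for n
      unfolding q_def
      by (intro borel_measurable_torus continuous_intros f continuous_on_compose2[OF f(1)]) auto
    show "integrable torus (\<lambda>_::real ^ 'n. B)"
      by (intro integrable_torus_continuous continuous_intros)
    show "AE x in torus. (\<lambda>n. q n x) \<longlonglongrightarrow> f' x"
    proof (rule AE_I2)
      fix x :: "real ^ 'n"
      have "((\<lambda>s. (f (x + axis i s) - f (x + axis i 0)) /\<^sub>R (s - 0)) \<longlongrightarrow> f' x) (at 0)"
      proof -
        have "((\<lambda>s. norm (f (x + axis i s) - f (x + axis i 0) - s *\<^sub>R f' x) / norm s) \<longlongrightarrow> 0) (at 0)"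
          using D[of x] unfolding has_vector_derivative_def has_derivative_at by simp
        moreover have "\<forall>\<^sub>F s in at 0. norm (f (x + axis i s) - f (x + axis i 0) - s *\<^sub>R f' x) / norm s
            = norm ((f (x + axis i s) - f (x + axis i 0)) /\<^sub>R (s - 0) - f' x)"
        proof (intro eventually_at_filter[THEN iffD2] always_eventually allI impI)
          fix s :: real assume "s \<noteq> 0"
          then have "(f (x + axis i s) - f (x + axis i 0)) /\<^sub>R s - f' x
              = (f (x + axis i s) - f (x + axis i 0) - s *\<^sub>R f' x) /\<^sub>R s"
            by (simp add: scaleR_diff_right)
          then show "norm (f (x + axis i s) - f (x + axis i 0) - s *\<^sub>R f' x) / norm s
            = norm ((f (x + axis i s) - f (x + axis i 0)) /\<^sub>R (s - 0) - f' x)"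
            by (simp add: divide_inverse mult.commute)
        qed
        ultimately show ?thesis
          by (subst LIM_zero_iff[symmetric], subst tendsto_norm_zero_iff[symmetric])
             (rule Lim_transform_eventually)
      qed
      moreover have "filterlim (\<lambda>n. inverse (real (Suc n))) (at 0) sequentially"
        unfolding filterlim_at using LIMSEQ_inverse_real_of_nat by auto
      ultimately have "(\<lambda>n. (f (x + axis i (inverse (real (Suc n)))) - f (x + axis i 0))
          /\<^sub>R (inverse (real (Suc n)) - 0)) \<longlonglongrightarrow> f' x"
        by (rule filterlim_compose)
      moreover have "axis i 0 = (0 :: real ^ 'n)"
        by (simp add: vec_eq_iff axis_def)
      ultimately show "(\<lambda>n. q n x) \<longlonglongrightarrow> f' x"
        by (simp add: q_def)
    qed
    show "AE x in torus. norm (q n x) \<le> B" for n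
      using qB by (intro AE_I2)
  qed
  moreover have "(LINT x|torus. q n x) = 0" for n
  proof -
    have "inverse (real (Suc n)) \<le> 1"
      by (simp add: inverse_le_1_iff)
    then have "inverse (real (Suc n)) \<le> 2 * pi"
      using pi_gt3 by linarith
    then have "(LINT x|torus. f (x + axis i (inverse (real (Suc n))))) = (LINT x|torus. f x)"
      by (intro integral_torus_translate_nonneg f) auto
    moreover have "integrable torus (\<lambda>x. f (x + axis i (inverse (real (Suc n)))))"
      by (intro integrable_torus_continuous continuous_on_compose2[OF f(1)] continuous_intros) auto
    ultimately show ?thesis
      using integrable_torus_continuous[OF f(1)] unfolding q_def by simp
  qed
  ultimately show ?thesis
    by (simp add: LIMSEQ_const_iff)
qed

section \<open>Uniqueness of Fourier coefficients\<close>

text \<open>Products and series are handled as complex functions, before they are known to be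
  real.\<close>

definition fc :: "(real ^ 'n::finite \<Rightarrow> complex) \<Rightarrow> int ^ 'n \<Rightarrow> complex" where
  "fc f k = (LINT x|torus. f x * wave (- k) x) / (2 * pi) ^ CARD('n)"

lemma fourier_coeff_eq_fc: "fourier_coeff f = fc (\<lambda>x. of_real (f x))"
  by (rule ext) (simp add: fourier_coeff_def fc_def wave_def freq_uminus cis_conv_exp)

lemma borel_measurable_wave_torus [measurable]: "wave k \<in> borel_measurable torus"
  by (intro borel_measurable_torus continuous_intros)

lemma integrable_torus_mult_bounded:
  fixes f h :: "real ^ 'n::finite \<Rightarrow> complex"
  assumes f: "integrable torus f" and h: "h \<in> borel_measurable torus"
    and B: "\<And>x. x \<in> space torus \<Longrightarrow> norm (h x) \<le> B"
  shows "integrable torus (\<lambda>x. f x * h x)"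
proof (rule Bochner_Integration.integrable_bound)
  show "integrable torus (\<lambda>x. B * norm (f x))"
    using f by simp
  show "AE x in torus. norm (f x * h x) \<le> norm (B * norm (f x))"
  proof (rule AE_I2)
    fix x assume "x \<in> space (torus :: (real ^ 'n) measure)"
    then have "norm (h x) \<le> B"
      by (rule B)
    then show "norm (f x * h x) \<le> norm (B * norm (f x))"
      by (smt (verit) mult.commute mult_right_mono norm_ge_zero norm_mult real_norm_def)
  qed
qed (use f h in measurable)

lemma integrable_torus_mult_wave:
  "integrable torus f \<Longrightarrow> integrable torus (\<lambda>x. f x * wave k x)"
  by (rule integrable_torus_mult_bounded[where B = 1]) auto

lemma fc_mult_wave: "fc (\<lambda>x. f x * wave m x) k = fc f (k - m)"
proof -
  have "f x * wave m x * wave (- k) x = f x * wave (- (k - m)) x" for x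
    using wave_add[of m "- k" x] by simp
  then show ?thesis
    by (simp only: fc_def)
qed

lemma fc_add:
  "integrable torus f \<Longrightarrow> integrable torus g \<Longrightarrow> fc (\<lambda>x. f x + g x) k = fc f k + fc g k"
  by (simp add: fc_def distrib_right integrable_torus_mult_wave add_divide_distrib)

lemma fc_diff:
  "integrable torus f \<Longrightarrow> integrable torus g \<Longrightarrow> fc (\<lambda>x. f x - g x) k = fc f k - fc g k"
  by (simp add: fc_def left_diff_distrib integrable_torus_mult_wave diff_divide_distrib)

lemma fc_mult_const: "fc (\<lambda>x. f x * c) k = fc f k * c"
proof -
  have "(\<lambda>x. f x * c * wave (- k) x) = (\<lambda>x. f x * wave (- k) x * c)"
    by (simp add: mult_ac)
  then show ?thesis
    by (simp add: fc_def)
qed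

lemma fc_cong_AE:
  assumes "AE x in torus. f x = g x" "f \<in> borel_measurable torus" "g \<in> borel_measurable torus"
  shows "fc f k = fc g k"
proof -
  have "(LINT x|torus. f x * wave (- k) x) = (LINT x|torus. g x * wave (- k) x)"
    by (rule integral_cong_AE) (use assms in auto)
  then show ?thesis
    by (simp add: fc_def)
qed

text \<open>
  Bounded functions that preserve the annihilator of the exponentials form an algebra closed under
  bounded pointwise limits. It contains \<open>cos (x\<^sub>i - \<theta>)\<close>, hence polynomials in it, hence indicators of
  intervals in one coordinate, hence indicators of boxes; the averages of an annihilated function
  over small boxes therefore vanish.
\<close>

definition annih :: "(real ^ 'n::finite \<Rightarrow> complex) \<Rightarrow> bool" where
  "annih g \<longleftrightarrow> integrable torus g \<and> (\<forall>k. fc g k = 0)"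

definition annih_multiplier :: "(real ^ 'n::finite \<Rightarrow> complex) \<Rightarrow> bool" where
  "annih_multiplier h \<longleftrightarrow> h \<in> borel_measurable torus \<and> (\<exists>B. \<forall>x\<in>space torus. norm (h x) \<le> B) \<and>
     (\<forall>g. annih g \<longrightarrow> annih (\<lambda>x. g x * h x))"

lemma annih_multiplierI:
  assumes "h \<in> borel_measurable torus" "\<And>x. x \<in> space torus \<Longrightarrow> norm (h x) \<le> B"
    "\<And>g. annih g \<Longrightarrow> annih (\<lambda>x. g x * h x)"
  shows "annih_multiplier h"
  unfolding annih_multiplier_def using assms by blast

lemma annih_multiplier_const: "annih_multiplier (\<lambda>_. c)"
proof (rule annih_multiplierI)
  show "norm c \<le> norm c" ..
  show "annih (\<lambda>x. g x * c)" if "annih g" for g :: "real ^ 'n \<Rightarrow> complex"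
    using that unfolding annih_def fc_mult_const by simp
qed simp

lemma annih_multiplier_wave: "annih_multiplier (wave k)"
proof (rule annih_multiplierI)
  show "norm (wave k x) \<le> 1" for x
    by simp
  show "annih (\<lambda>x. g x * wave k x)" if "annih g" for g
    using that unfolding annih_def fc_mult_wave by (simp add: integrable_torus_mult_wave)
qed (rule borel_measurable_wave_torus)

lemma annih_multiplier_mult:
  assumes "annih_multiplier h" "annih_multiplier h'"
  shows "annih_multiplier (\<lambda>x. h x * h' x)"
proof -
  obtain B B' where B: "\<And>x. x \<in> space torus \<Longrightarrow> norm (h x) \<le> B"
      and B': "\<And>x. x \<in> space torus \<Longrightarrow> norm (h' x) \<le> B'"
    using assms unfolding annih_multiplier_def by blast
  show ?thesis
  proof (rule annih_multiplierI)
    show "(\<lambda>x. h x * h' x) \<in> borel_measurable torus"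
      using assms unfolding annih_multiplier_def by (intro borel_measurable_times) auto
    show "norm (h x * h' x) \<le> \<bar>B\<bar> * \<bar>B'\<bar>" if "x \<in> space torus" for x
      unfolding norm_mult using B[OF that] B'[OF that] by (intro mult_mono) auto
    show "annih (\<lambda>x. g x * (h x * h' x))" if "annih g" for g
      using assms that unfolding annih_multiplier_def mult.assoc[symmetric] by blast
  qed
qed

lemma annih_multiplier_add:
  assumes "annih_multiplier h" "annih_multiplier h'"
  shows "annih_multiplier (\<lambda>x. h x + h' x)"
proof -
  obtain B B' where B: "\<And>x. x \<in> space torus \<Longrightarrow> norm (h x) \<le> B"
      and B': "\<And>x. x \<in> space torus \<Longrightarrow> norm (h' x) \<le> B'"
    using assms unfolding annih_multiplier_def by blast
  show ?thesis
  proof (rule annih_multiplierI)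
    show "(\<lambda>x. h x + h' x) \<in> borel_measurable torus"
      using assms unfolding annih_multiplier_def by (intro borel_measurable_add) auto
    show "norm (h x + h' x) \<le> B + B'" if "x \<in> space torus" for x
      using B[OF that] B'[OF that] by (intro norm_triangle_le) auto
    show "annih (\<lambda>x. g x * (h x + h' x))" if "annih g" for g
    proof -
      have "annih (\<lambda>x. g x * h x)" "annih (\<lambda>x. g x * h' x)"
        using assms that unfolding annih_multiplier_def by blast+
      then show ?thesis
        unfolding annih_def distrib_left by (simp add: fc_add)
    qed
  qed
qed

lemma annih_multiplier_prod:
  "finite I \<Longrightarrow> (\<And>i. i \<in> I \<Longrightarrow> annih_multiplier (h i)) \<Longrightarrow> annih_multiplier (\<lambda>x. \<Prod>i\<in>I. h i x)"
  by (induction I rule: finite_induct) (auto intro: annih_multiplier_const annih_multiplier_mult)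

lemma annih_multiplier_limit:
  fixes h :: "nat \<Rightarrow> real ^ 'n::finite \<Rightarrow> complex"
  assumes h: "\<And>n. annih_multiplier (h n)"
    and B: "\<And>n x. x \<in> space torus \<Longrightarrow> norm (h n x) \<le> B"
    and lim: "\<And>x. x \<in> space torus \<Longrightarrow> (\<lambda>n. h n x) \<longlonglongrightarrow> h' x"
  shows "annih_multiplier h'"
proof -
  have meas [measurable]: "h n \<in> borel_measurable torus" for n
    using h by (simp add: annih_multiplier_def)
  have meas' [measurable]: "h' \<in> borel_measurable torus"
    by (rule borel_measurable_LIMSEQ_metric[OF meas lim])
  have B': "norm (h' x) \<le> B" if "x \<in> space torus" for x
    using that by (intro LIMSEQ_le_const2[OF tendsto_norm[OF lim]]) (auto intro: B)
  have "annih (\<lambda>x. g x * h' x)" if g: "annih g" for g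
    unfolding annih_def
  proof (intro conjI allI)
    have gi: "integrable torus g"
      using g by (simp add: annih_def)
    then show "integrable torus (\<lambda>x. g x * h' x)"
      by (rule integrable_torus_mult_bounded[OF _ meas' B'])
    fix k
    have "(\<lambda>n. LINT x|torus. g x * h n x * wave (- k) x) \<longlonglongrightarrow> (LINT x|torus. g x * h' x * wave (- k) x)"
    proof (rule integral_dominated_convergence[where w = "\<lambda>x. norm (g x) * B"])
      show "AE x in torus. (\<lambda>n. g x * h n x * wave (- k) x) \<longlonglongrightarrow> g x * h' x * wave (- k) x"
        by (intro AE_I2 tendsto_intros lim)
      show "AE x in torus. norm (g x * h n x * wave (- k) x) \<le> norm (g x) * B" for n
        by (intro AE_I2) (simp add: norm_mult mult_left_mono B)
      show "integrable torus (\<lambda>x. norm (g x) * B)"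
        using gi by simp
    qed (use gi in measurable)
    moreover have "(LINT x|torus. g x * h n x * wave (- k) x) = 0" for n
      using h[of n] g by (simp add: annih_multiplier_def annih_def fc_def)
    ultimately show "fc (\<lambda>x. g x * h' x) k = 0"
      by (simp add: fc_def LIMSEQ_const_iff)
  qed
  then show ?thesis
    using annih_multiplierI[of h' B] meas' B' by blast
qed

lemma annih_multiplier_cos: "annih_multiplier (\<lambda>x. of_real (cos (x $ i - \<theta>)))"
proof -
  have "of_real (cos (x $ i - \<theta>))
      = wave (axis i 1) x * (cis (- \<theta>) / 2) + wave (- axis i 1) x * (cis \<theta> / 2)" for x
    by (simp add: complex_eq_iff wave_def freq_uminus freq_axis inner_axis' cos_diff diff_divide_distrib)
  then show ?thesis
    by (simp only:) (intro annih_multiplier_add annih_multiplier_mult annih_multiplier_wave annih_multiplier_const)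
qed

lemma annih_multiplier_polynomial:
  assumes "real_polynomial_function p" "annih_multiplier (\<lambda>x. of_real (h x))"
  shows "annih_multiplier (\<lambda>x. of_real (p (h x)))"
  using assms(1)
proof induction
  case (linear f)
  have "of_real (f (h x)) = of_real (h x) * complex_of_real (f 1)" for x
    using linear_scale[OF bounded_linear.linear[OF linear], of "h x" 1] by simp
  then show ?case
    using assms(2) by (simp add: annih_multiplier_mult annih_multiplier_const)
next
  case (const c)
  then show ?case
    by (rule annih_multiplier_const)
next
  case (add f g)
  then show ?case
    by (simp add: annih_multiplier_add)
next
  case (mult f g)
  then show ?case
    by (simp add: annih_multiplier_mult)
qed

lemma annih_multiplier_indicator_cos:
  "annih_multiplier (\<lambda>x. of_real (if c \<le> cos (x $ i - \<theta>) then 1 else 0))"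
proof -
  \<comment> \<open>For n > 0 the ramp \<open>\<phi> n\<close> is 1 for y \<ge> c and 0 for y \<le>
    c - 1 / n; hence it converges to the indicator of c \<le> y also at the jump.\<close>
  define \<phi> :: "nat \<Rightarrow> real \<Rightarrow> real" where "\<phi> n y = max 0 (min 1 (1 + real n * (y - c)))" for n y
  have "\<exists>p. real_polynomial_function p \<and> (\<forall>y\<in>{-1..1}. \<bar>\<phi> n y - p y\<bar> < inverse (real (Suc n)))" for n
    unfolding \<phi>_def
    by (rule Stone_Weierstrass_real_polynomial_function[of "{-1..1}" "\<lambda>y. max 0 (min 1 (1 + real n * (y - c)))"
          "inverse (real (Suc n))"]) (auto intro!: continuous_intros)
  then obtain p where p: "\<And>n. real_polynomial_function (p n)"
    and p_approx: "\<And>n y. y \<in> {-1..1} \<Longrightarrow> \<bar>\<phi> n y - p n y\<bar> < inverse (real (Suc n))"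
    by metis
  have lim\<phi>: "(\<lambda>n. \<phi> n y) \<longlonglongrightarrow> (if c \<le> y then 1 else 0)" for y
  proof (cases "c \<le> y")
    case True
    then show ?thesis
      by (simp add: \<phi>_def)
  next
    case False
    have "\<forall>\<^sub>F n in sequentially. 1 / (c - y) \<le> real n"
      by (rule eventually_sequentiallyI[of "nat \<lceil>1 / (c - y)\<rceil>"]) linarith
    then have "\<forall>\<^sub>F n in sequentially. \<phi> n y = 0"
    proof eventually_elim
      case (elim n)
      then have "1 + real n * (y - c) \<le> 0"
        using False by (simp add: divide_simps algebra_simps split: if_splits)
      then show ?case
        by (simp add: \<phi>_def)
    qed
    then show ?thesis
      using False by (simp add: tendsto_eventually)
  qed
  have limp: "(\<lambda>n. p n y) \<longlonglongrightarrow> (if c \<le> y then 1 else 0)" if "y \<in> {-1..1}" for y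
  proof -
    have "(\<lambda>n. \<phi> n y - p n y) \<longlonglongrightarrow> 0"
      by (rule Lim_null_comparison[OF _ LIMSEQ_inverse_real_of_nat])
         (use p_approx[OF that] in \<open>auto intro!: always_eventually less_imp_le\<close>)
    from tendsto_diff[OF lim\<phi>[of y] this] show ?thesis
      by simp
  qed
  have cos: "cos t \<in> {-1..1}" for t :: real
    by simp
  show ?thesis
  proof (rule annih_multiplier_limit[where h = "\<lambda>n x. of_real (p n (cos (x $ i - \<theta>)))" and B = 2])
    show "annih_multiplier (\<lambda>x. of_real (p n (cos (x $ i - \<theta>))))" for n
      by (rule annih_multiplier_polynomial[OF p annih_multiplier_cos])
    \<comment> \<open>A ramp is at most 1 and the error of its polynomial approximation is at most
      1.\<close>
    show "norm (complex_of_real (p n (cos (x $ i - \<theta>)))) \<le> 2" for n x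
    proof -
      have "inverse (real (Suc n)) \<le> 1"
        by (simp add: inverse_le_1_iff)
      moreover have "\<bar>\<phi> n (cos (x $ i - \<theta>))\<bar> \<le> 1"
        by (simp add: \<phi>_def)
      ultimately show ?thesis
        using p_approx[OF cos[of "x $ i - \<theta>"], of n] unfolding norm_of_real by linarith
    qed
    show "(\<lambda>n. complex_of_real (p n (cos (x $ i - \<theta>)))) \<longlonglongrightarrow> of_real (if c \<le> cos (x $ i - \<theta>) then 1 else 0)" for x
      by (intro tendsto_of_real limp cos)
  qed
qed

text \<open>Within one period the condition describes an arc of length h about the midpoint x + h /
  2. As the interval lies strictly inside (-pi, pi), the distance of y from the midpoint stays below
  2 pi - h / 2, so y does not reach the next copy of the arc.\<close>

lemma cos_ge_iff_near:
  assumes "\<bar>y\<bar> \<le> pi" "0 < h" "- pi < x" "x + h < pi"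
  shows "cos (h / 2) \<le> cos (y - (x + h / 2)) \<longleftrightarrow> x \<le> y \<and> y \<le> x + h"
proof -
  define d where "d = \<bar>y - (x + h / 2)\<bar>"
  have cosd: "cos (y - (x + h / 2)) = cos d"
    unfolding d_def by (simp add: abs_if) (metis cos_minus minus_diff_eq)
  have near: "x \<le> y \<and> y \<le> x + h \<longleftrightarrow> d \<le> h / 2"
    unfolding d_def by (auto simp: abs_le_iff field_simps)
  have "d < 2 * pi - h / 2" "0 \<le> d" "h / 2 \<le> pi"
    using assms unfolding d_def by (auto simp: abs_less_iff abs_le_iff)
  have "cos (h / 2) \<le> cos d \<longleftrightarrow> d \<le> h / 2"
  proof (cases "d \<le> pi")
    case True
    then show ?thesis
      using \<open>0 \<le> d\<close> \<open>h / 2 \<le> pi\<close> assms by (subst cos_mono_le_eq) auto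
  next
    case False
    have "cos d = cos (2 * pi - d)"
      by (simp add: cos_diff)
    also have "\<dots> < cos (h / 2)"
      using False \<open>d < 2 * pi - h / 2\<close> assms by (subst cos_mono_less_eq) auto
    finally show ?thesis
      using False \<open>h / 2 \<le> pi\<close> by auto
  qed
  then show ?thesis
    by (simp add: cosd near)
qed

text \<open>Lebesgue differentiation: outside a null set \<open>g x\<close> is the limit of averages
  over cubes with lower corner x. These averages vanish because indicators of boxes inside the open
  cube are multipliers, and the faces of the torus cube are null.\<close>

lemma fc_eq_0_imp_AE_eq_0:
  fixes f :: "real ^ 'n::finite \<Rightarrow> complex"
  assumes f: "integrable torus f" and fc0: "\<And>k. fc f k = 0"
  shows "AE x in torus. f x = 0"
proof -
  define Q where "Q = (cbox (\<chi> i. - pi) (\<chi> i. pi) :: (real ^ 'n) set)"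
  define g where "g x = (if x \<in> Q then f x else 0)" for x
  have gint: "integrable lebesgue g"
  proof -
    have "integrable lebesgue (\<lambda>x. indicator Q x *\<^sub>R f x)"
      using f unfolding torus_def Q_def[symmetric]
      by (subst (asm) integrable_restrict_space) (auto simp: Q_def)
    moreover have "(\<lambda>x. indicator Q x *\<^sub>R f x) = g"
      by (auto simp: g_def)
    ultimately show ?thesis
      by simp
  qed
  then have gabs: "g absolutely_integrable_on UNIV"
    by (simp add: set_integrable_def)
  have gbox: "g integrable_on cbox a b" for a b
    using integrable_on_lebesgue[OF gint] integrable_on_subcbox by blast
  obtain N where N: "negligible N"
    and lim: "\<And>x e. x \<notin> N \<Longrightarrow> 0 < e \<Longrightarrow> \<exists>d>0. \<forall>h. 0 < h \<and> h < d \<longrightarrow>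
       norm (integral (cbox x (x + h *\<^sub>R One)) g /\<^sub>R h ^ DIM(real ^ 'n) - g x) < e"
    using integrable_ccontinuous_explicit[OF gbox] by metis
  have box0: "integral (cbox x (x + h *\<^sub>R One)) g = 0"
    if h: "0 < h" and x: "\<And>i. - pi < x $ i" "\<And>i. x $ i + h < pi" for x :: "real ^ 'n" and h
  proof -
    define b where "b = x + h *\<^sub>R One"
    have b: "b $ i = x $ i + h" for i
    proof -
      have "One $ i = One \<bullet> (axis i 1 :: real ^ 'n)"
        by (simp add: inner_axis)
      also have "\<dots> = 1"
        by (simp add: inner_sum_left inner_Basis)
      finally show ?thesis
        by (simp add: b_def)
    qed
    have sub: "cbox x b \<subseteq> Q"
      using x unfolding Q_def by (auto simp: subset_interval_cart b intro: less_imp_le)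
    \<comment> \<open>On \<open>Q\<close> this product of arcs in the single coordinates is the
      indicator of the box.\<close>
    define H where "H y = (\<Prod>i\<in>UNIV. complex_of_real (if cos (h / 2) \<le> cos (y $ i - (x $ i + h / 2)) then 1 else 0))" for y :: "real ^ 'n"
    have "annih_multiplier H"
      unfolding H_def by (intro annih_multiplier_prod annih_multiplier_indicator_cos) auto
    moreover have "annih f"
      using f fc0 by (simp add: annih_def)
    ultimately have an: "annih (\<lambda>y. f y * H y)"
      by (simp add: annih_multiplier_def)
    have H: "H y = indicator (cbox x b) y" if "y \<in> Q" for y
    proof -
      have "\<bar>y $ i\<bar> \<le> pi" for i
        using that by (auto simp: Q_def mem_box_cart abs_le_iff) (metis minus_le_iff)
      then have "(cos (h / 2) \<le> cos (y $ i - (x $ i + h / 2))) = (x $ i \<le> y $ i \<and> y $ i \<le> b $ i)" for i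
        using cos_ge_iff_near[of "y $ i" h "x $ i"] h x by (simp add: b)
      then show ?thesis
        unfolding H_def by (auto simp: indicator_def mem_box_cart)
    qed
    have "integral (cbox x b) g = integral UNIV (\<lambda>y. if y \<in> cbox x b then g y else 0)"
      by (simp add: integral_restrict_UNIV)
    also have "\<dots> = integral Q (\<lambda>y. f y * H y)"
    proof -
      have "integral Q (\<lambda>y. f y * H y) = integral UNIV (\<lambda>y. if y \<in> Q then f y * H y else 0)"
        by (simp add: integral_restrict_UNIV)
      moreover have "(if y \<in> Q then f y * H y else 0) = (if y \<in> cbox x b then g y else 0)" for y
        using sub by (auto simp: H g_def)
      ultimately show ?thesis
        by simp
    qed
    also have "\<dots> = (LINT y|torus. f y * H y)"
      using an unfolding Q_def annih_def by (intro integral_torus[symmetric]) auto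
    also have "\<dots> = 0"
      using an[unfolded annih_def, THEN conjunct2, rule_format, of 0] by (simp add: fc_def)
    finally show ?thesis
      by (simp add: b_def)
  qed
  have zero: "g x = 0" if x: "x \<notin> N" "x \<in> box (\<chi> i. - pi) (\<chi> i. pi)" for x
  proof (rule ccontr)
    assume "g x \<noteq> 0"
    then obtain d where d: "d > 0"
      and small: "\<And>h. 0 < h \<Longrightarrow> h < d \<Longrightarrow> norm (integral (cbox x (x + h *\<^sub>R One)) g /\<^sub>R h ^ DIM(real ^ 'n) - g x) < norm (g x)"
      using lim[OF x(1), of "norm (g x)"] by auto
    have xi: "- pi < x $ i" "x $ i < pi" for i
      using x(2) by (auto simp: mem_box_cart)
    \<comment> \<open>The distance to the nearest upper face, capped by \<open>d\<close>; half of it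
      is an admissible side length.\<close>
    define m where "m = Min (insert d (range (\<lambda>i. pi - x $ i)))"
    have m: "0 < m" "m \<le> d"
      using d xi by (auto simp: m_def)
    have m3: "m \<le> pi - x $ i" for i
      unfolding m_def by (rule Min_le) auto
    have "x $ i + m / 2 < pi" for i
      using m(1) m3[of i] by linarith
    then have "integral (cbox x (x + (m / 2) *\<^sub>R One)) g = 0"
      using m xi by (intro box0) auto
    then show False
      using small[of "m / 2"] m by simp
  qed
  have sub: "{x \<in> Q. f x \<noteq> 0} \<subseteq> N \<union> (Q - box (\<chi> i. - pi) (\<chi> i. pi))"
  proof (intro subsetI)
    fix x assume "x \<in> {x \<in> Q. f x \<noteq> 0}"
    then have "x \<in> Q" "g x \<noteq> 0"
      by (auto simp: g_def)
    then show "x \<in> N \<union> (Q - box (\<chi> i. - pi) (\<chi> i. pi))"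
      using zero[of x] by blast
  qed
  have "negligible (N \<union> (Q - box (\<chi> i. - pi) (\<chi> i. pi)))"
    using N negligible_frontier_interval unfolding Q_def by (simp add: negligible_Un)
  then have "negligible {x \<in> Q. f x \<noteq> 0}"
    using sub negligible_subset by blast
  then have "AE x in lebesgue. x \<notin> {x \<in> Q. f x \<noteq> 0}"
    unfolding negligible_iff_null_sets by (rule AE_not_in)
  then have "AE x in lebesgue. x \<in> Q \<longrightarrow> f x = 0"
    by eventually_elim auto
  then show ?thesis
    unfolding torus_def Q_def[symmetric] by (subst AE_restrict_space_iff) (auto simp: Q_def)
qed

section \<open>Absolutely convergent Fourier series\<close>

lemma sigma_finite_torus: "sigma_finite_measure (torus :: (real ^ 'n::finite) measure)"
  using finite_measure_torus unfolding finite_measure_def by blast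

lemma sigma_finite_count: "sigma_finite_measure (count_space (UNIV :: 'k::countable set))"
  by (rule sigma_finite_measure_count_space_countable) simp

text \<open>Sums over frequencies are written as integrals against counting measure, so that Fubini,
  Fatou and dominated convergence serve sums and integrals alike.\<close>

lemma integral_count_space_swap:
  fixes f :: "'k::countable \<Rightarrow> 'x \<Rightarrow> 'b::{banach, second_countable_topology}"
  assumes M: "sigma_finite_measure M" and f: "\<And>k. f k \<in> borel_measurable M"
    and fin: "(\<integral>\<^sup>+k. \<integral>\<^sup>+x. ennreal (norm (f k x)) \<partial>M \<partial>count_space UNIV) < \<infinity>"
  shows "(\<integral>x. (\<integral>k. f k x \<partial>count_space UNIV) \<partial>M) = (\<integral>k. (\<integral>x. f k x \<partial>M) \<partial>count_space UNIV)"
    and "integrable M (\<lambda>x. \<integral>k. f k x \<partial>count_space UNIV)"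
    and "integrable (count_space UNIV) (\<lambda>k. \<integral>x. f k x \<partial>M)"
    and "AE x in M. integrable (count_space UNIV) (\<lambda>k. f k x)"
proof -
  interpret C: sigma_finite_measure "count_space (UNIV :: 'k set)"
    by (rule sigma_finite_count)
  interpret M: sigma_finite_measure M
    by (rule M)
  interpret P: pair_sigma_finite "count_space (UNIV :: 'k set)" M ..
  have meas [measurable]: "(\<lambda>(k, x). f k x) \<in> borel_measurable (count_space UNIV \<Otimes>\<^sub>M M)"
    using f by (intro measurable_pair_measure_countable1) auto
  have int: "integrable (count_space UNIV \<Otimes>\<^sub>M M) (\<lambda>(k, x). f k x)"
    unfolding integrable_iff_bounded
  proof
    have "(\<integral>\<^sup>+p. ennreal (norm (case p of (k, x) \<Rightarrow> f k x)) \<partial>(count_space UNIV \<Otimes>\<^sub>M M))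
        = (\<integral>\<^sup>+k. \<integral>\<^sup>+x. ennreal (norm (f k x)) \<partial>M \<partial>count_space UNIV)"
      by (subst M.nn_integral_fst[symmetric]) auto
    then show "(\<integral>\<^sup>+p. ennreal (norm (case p of (k, x) \<Rightarrow> f k x)) \<partial>(count_space UNIV \<Otimes>\<^sub>M M)) < \<infinity>"
      using fin by simp
  qed (rule meas)
  show "(\<integral>x. (\<integral>k. f k x \<partial>count_space UNIV) \<partial>M) = (\<integral>k. (\<integral>x. f k x \<partial>M) \<partial>count_space UNIV)"
    by (rule P.Fubini_integral[OF int])
  show "integrable M (\<lambda>x. \<integral>k. f k x \<partial>count_space UNIV)"
    by (rule P.integrable_snd[OF int])
  show "integrable (count_space UNIV) (\<lambda>k. \<integral>x. f k x \<partial>M)"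
    by (rule P.integrable_fst[OF int])
  show "AE x in M. integrable (count_space UNIV) (\<lambda>k. f k x)"
    by (rule P.AE_integrable_snd[OF int])
qed

text \<open>Fatou's lemma. It carries a norm bound to a limit that is known only coefficient by
  coefficient.\<close>

lemma nn_integral_limit_le:
  fixes u :: "nat \<Rightarrow> 'k \<Rightarrow> real"
  assumes u: "\<And>n. u n \<in> borel_measurable M" and lim: "AE k in M. (\<lambda>n. u n k) \<longlonglongrightarrow> v k"
    and le: "\<And>n. (\<integral>\<^sup>+k. ennreal (u n k) \<partial>M) \<le> C"
  shows "(\<integral>\<^sup>+k. ennreal (v k) \<partial>M) \<le> C"
proof -
  have "(\<integral>\<^sup>+k. ennreal (v k) \<partial>M) = (\<integral>\<^sup>+k. liminf (\<lambda>n. ennreal (u n k)) \<partial>M)"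
  proof (rule nn_integral_cong_AE)
    show "AE k in M. ennreal (v k) = liminf (\<lambda>n. ennreal (u n k))"
      using lim
    proof eventually_elim
      case (elim k)
      then have "(\<lambda>n. ennreal (u n k)) \<longlonglongrightarrow> ennreal (v k)"
        by (rule tendsto_ennrealI)
      then show ?case
        using lim_imp_Liminf trivial_limit_sequentially by fastforce
    qed
  qed
  also have "\<dots> \<le> liminf (\<lambda>n. \<integral>\<^sup>+k. ennreal (u n k) \<partial>M)"
    using u by (intro nn_integral_liminf) auto
  also have "\<dots> \<le> C"
    using le by (intro Liminf_le) (auto intro: always_eventually)
  finally show ?thesis .
qed

lemma continuous_on_integral_dominated:
  fixes f :: "'s::metric_space \<Rightarrow> 'k \<Rightarrow> 'b::{banach, second_countable_topology}"
  assumes cont: "\<And>k. k \<in> space M \<Longrightarrow> continuous_on S (\<lambda>s. f s k)"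
    and meas: "\<And>s. s \<in> S \<Longrightarrow> f s \<in> borel_measurable M"
    and le: "\<And>s k. s \<in> S \<Longrightarrow> k \<in> space M \<Longrightarrow> norm (f s k) \<le> g k" and g: "integrable M g"
  shows "continuous_on S (\<lambda>s. \<integral>k. f s k \<partial>M)"
  unfolding continuous_on_sequentially o_def
proof (intro allI ballI impI, elim conjE)
  fix x a assume a: "a \<in> S" and x: "\<forall>n. x n \<in> S" "x \<longlonglongrightarrow> a"
  show "(\<lambda>n. \<integral>k. f (x n) k \<partial>M) \<longlonglongrightarrow> (\<integral>k. f a k \<partial>M)"
  proof (rule integral_dominated_convergence[where w = g])
    show "AE k in M. (\<lambda>n. f (x n) k) \<longlonglongrightarrow> f a k"
      using x(1) by (intro AE_I2 continuous_on_tendsto_compose[OF cont x(2) a] always_eventually)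
    show "(\<lambda>k. f a k) \<in> borel_measurable M" "(\<lambda>k. f (x n) k) \<in> borel_measurable M" for n
      using meas a x(1) by blast+
    show "AE k in M. norm (f (x n) k) \<le> g k" for n
      using le x(1) by (intro AE_I2) blast
  qed (rule g)
qed

abbreviation l1 :: "(int ^ 'n::finite \<Rightarrow> complex) \<Rightarrow> bool" where
  "l1 a \<equiv> integrable (count_space UNIV) a"

definition ser :: "(int ^ 'n::finite \<Rightarrow> complex) \<Rightarrow> real ^ 'n \<Rightarrow> complex" where
  "ser a x = (\<integral>k. a k * wave k x \<partial>count_space UNIV)"

lemma l1_mult_wave: "l1 a \<Longrightarrow> l1 (\<lambda>k. a k * wave k x)"
  by (rule Bochner_Integration.integrable_bound[of _ a]) (auto simp: norm_mult)

lemma norm_ser_le: "norm (ser a x) \<le> (\<integral>k. norm (a k) \<partial>count_space UNIV)"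
  unfolding ser_def by (rule order_trans[OF integral_norm_bound]) (simp add: norm_mult)

lemma continuous_on_ser:
  assumes "l1 a"
  shows "continuous_on S (ser a)"
  unfolding ser_def
  by (rule continuous_on_integral_dominated[where g = "\<lambda>k. norm (a k)"])
     (use assms in \<open>auto intro!: continuous_intros simp: norm_mult\<close>)

lemma periodic_ser: "periodic (ser (a :: int ^ 'n::finite \<Rightarrow> complex))"
proof -
  have "wave k (x + axis i (2 * pi)) = wave k x" for k :: "int ^ 'n" and x i
    using periodic_wave[of k] unfolding periodic_def by blast
  then show ?thesis
    by (simp add: periodic_def ser_def)
qed

lemma ser_diff: "l1 a \<Longrightarrow> l1 b \<Longrightarrow> ser (\<lambda>k. a k - b k) x = ser a x - ser b x"
  by (simp add: ser_def left_diff_distrib l1_mult_wave)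

text \<open>Fubini, the exponentials being bounded and the coefficients summable. Fourier
  coefficients of series, products, weak derivatives and the weak formulation all rest on this
  pairing.\<close>

lemma ser_swap:
  fixes a :: "int ^ 'n::finite \<Rightarrow> complex" and g :: "real ^ 'n \<Rightarrow> complex"
  assumes a: "l1 a" and g: "integrable torus g"
  shows "(LINT x|torus. ser a x * g x) = (\<integral>k. a k * (LINT x|torus. wave k x * g x) \<partial>count_space UNIV)"
proof -
  have gw: "integrable torus (\<lambda>x. wave k x * g x)" for k
    using integrable_torus_mult_wave[OF g, of k] by (simp add: mult.commute)
  have "(LINT x|torus. ser a x * g x) = (LINT x|torus. (\<integral>k. a k * (wave k x * g x) \<partial>count_space UNIV))"
  proof (intro Bochner_Integration.integral_cong refl)
    fix x
    have "ser a x * g x = (\<integral>k. (a k * wave k x) * g x \<partial>count_space UNIV)"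
      unfolding ser_def by (rule integral_mult_left_zero[symmetric])
    then show "ser a x * g x = (\<integral>k. a k * (wave k x * g x) \<partial>count_space UNIV)"
      by (simp only: mult.assoc)
  qed
  also have "\<dots> = (\<integral>k. (LINT x|torus. a k * (wave k x * g x)) \<partial>count_space UNIV)"
  proof (rule integral_count_space_swap(1)[OF sigma_finite_torus])
    show "(\<lambda>x. a k * (wave k x * g x)) \<in> borel_measurable torus" for k
      using borel_measurable_integrable[OF gw[of k]] by (rule borel_measurable_times[OF borel_measurable_const])
    have "(\<integral>\<^sup>+k. \<integral>\<^sup>+x. ennreal (norm (a k * (wave k x * g x))) \<partial>torus \<partial>count_space UNIV)
        = (\<integral>\<^sup>+k. ennreal (norm (a k)) * (\<integral>\<^sup>+x. ennreal (norm (g x)) \<partial>torus) \<partial>count_space UNIV)"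
      using g by (intro nn_integral_cong) (simp add: norm_mult ennreal_mult nn_integral_cmult)
    also have "\<dots> = (\<integral>\<^sup>+k. ennreal (norm (a k)) \<partial>count_space UNIV) * (\<integral>\<^sup>+x. ennreal (norm (g x)) \<partial>torus)"
      by (simp add: nn_integral_multc)
    also have "\<dots> < \<infinity>"
      using a g by (simp add: integrable_iff_bounded ennreal_mult_less_top)
    finally show "(\<integral>\<^sup>+k. \<integral>\<^sup>+x. ennreal (norm (a k * (wave k x * g x))) \<partial>torus \<partial>count_space UNIV) < \<infinity>" .
  qed
  finally show ?thesis
    by simp
qed

lemma fc_ser:
  fixes a :: "int ^ 'n::finite \<Rightarrow> complex"
  assumes "l1 a"
  shows "fc (ser a) m = a m"
proof -
  have "(LINT x|torus. wave k x * wave (- m) x) = (if k = m then (2 * pi) ^ CARD('n) else 0)" for k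
    using integral_torus_wave[of "k - m"] by (simp flip: wave_add)
  then have "(LINT x|torus. ser a x * wave (- m) x)
      = (\<integral>k. a k * of_real (if k = m then (2 * pi) ^ CARD('n) else 0) \<partial>count_space UNIV)"
    by (subst ser_swap[OF assms]) (auto intro!: integrable_torus_continuous continuous_intros Bochner_Integration.integral_cong)
  also have "\<dots> = (\<integral>k. a m * (2 * pi) ^ CARD('n) * indicator {m} k \<partial>count_space UNIV)"
    by (intro Bochner_Integration.integral_cong) (auto simp: indicator_def)
  also have "\<dots> = a m * (2 * pi) ^ CARD('n)"
    by (subst lebesgue_integral_count_space_finite_support)
       (cases "a m = 0"; auto simp: indicator_def Collect_conv_if)+
  finally show ?thesis
    by (simp add: fc_def)
qed

lemma fc_ser_eq: "l1 a \<Longrightarrow> fc (ser a) = a"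
  by (rule ext) (rule fc_ser)

definition wien :: "(real ^ 'n::finite \<Rightarrow> complex) \<Rightarrow> bool" where
  "wien f \<longleftrightarrow> integrable torus f \<and> l1 (fc f)"

lemma integrable_torus_ser: "l1 a \<Longrightarrow> integrable torus (ser a)"
  by (intro integrable_torus_continuous continuous_on_ser)

lemma wien_ser: "l1 a \<Longrightarrow> wien (ser a)"
  by (simp add: wien_def integrable_torus_ser fc_ser_eq)

text \<open>The difference of the two sides is integrable with vanishing coefficients, so uniqueness
  applies.\<close>

lemma wien_AE_eq_ser:
  assumes "wien f"
  shows "AE x in torus. f x = ser (fc f) x"
proof -
  have i: "integrable torus f" "l1 (fc f)"
    using assms by (auto simp: wien_def)
  have "AE x in torus. f x - ser (fc f) x = 0"
    by (rule fc_eq_0_imp_AE_eq_0)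
       (use i in \<open>auto simp: integrable_torus_ser fc_diff fc_ser\<close>)
  then show ?thesis
    by simp
qed

text \<open>Only \<open>f\<close> is expanded into its series; of \<open>g\<close> nothing but
  integrability is required.\<close>

lemma fc_mult:
  fixes f g :: "real ^ 'n::finite \<Rightarrow> complex"
  assumes f: "wien f" and g: "integrable torus g"
  shows "fc (\<lambda>x. f x * g x) m = (\<integral>k. fc f k * fc g (m - k) \<partial>count_space UNIV)"
proof -
  have i: "integrable torus f" "l1 (fc f)"
    using f by (auto simp: wien_def)
  have "(LINT x|torus. f x * g x * wave (- m) x) = (LINT x|torus. ser (fc f) x * (g x * wave (- m) x))"
  proof (rule integral_cong_AE)
    show "AE x in torus. f x * g x * wave (- m) x = ser (fc f) x * (g x * wave (- m) x)"
      using wien_AE_eq_ser[OF f] by eventually_elim simp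
    have m: "f \<in> borel_measurable torus" "g \<in> borel_measurable torus" "ser (fc f) \<in> borel_measurable torus"
      using i g integrable_torus_ser[OF i(2)] by (auto intro: borel_measurable_integrable)
    then show "(\<lambda>x. f x * g x * wave (- m) x) \<in> borel_measurable torus"
      "(\<lambda>x. ser (fc f) x * (g x * wave (- m) x)) \<in> borel_measurable torus"
      by (intro borel_measurable_times borel_measurable_wave_torus; simp)+
  qed
  also have "\<dots> = (\<integral>k. fc f k * (LINT x|torus. wave k x * (g x * wave (- m) x)) \<partial>count_space UNIV)"
    by (rule ser_swap[OF i(2) integrable_torus_mult_wave[OF g]])
  also have "\<dots> = (\<integral>k. fc f k * fc g (m - k) * (2 * pi) ^ CARD('n) \<partial>count_space UNIV)"
  proof (intro Bochner_Integration.integral_cong refl)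
    fix k
    have "fc g (m - k) = fc (\<lambda>x. g x * wave k x) m"
      by (simp add: fc_mult_wave)
    then show "fc f k * (LINT x|torus. wave k x * (g x * wave (- m) x))
        = fc f k * fc g (m - k) * (2 * pi) ^ CARD('n)"
      by (simp add: fc_def mult_ac)
  qed
  finally show ?thesis
    by (simp add: fc_def)
qed

text \<open>Values in \<open>ennreal\<close> allow a bound to be stated before finiteness is
  known.\<close>

definition wnorm :: "(int ^ 'n::finite \<Rightarrow> real) \<Rightarrow> (real ^ 'n \<Rightarrow> complex) \<Rightarrow> ennreal" where
  "wnorm W f = (\<integral>\<^sup>+k. ennreal (W k * norm (fc f k)) \<partial>count_space UNIV)"

lemma wien_iff: "wien f \<longleftrightarrow> integrable torus f \<and> wnorm (\<lambda>_. 1) f < \<infinity>"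
  by (simp add: wien_def wnorm_def integrable_iff_bounded)

text \<open>Young's inequality for the convolution of the coefficients. A product rule enters as a
  decomposition of \<open>W (k + l)\<close> into a sum of products of weights.\<close>

lemma wnorm_mult_le:
  fixes W :: "int ^ 'n::finite \<Rightarrow> real"
  assumes f: "wien f" and g: "integrable torus g" and W: "\<And>k. 0 \<le> W k"
    and UV: "\<And>k l. W (k + l) \<le> (\<Sum>i\<in>I. U i k * V i l)"
    and nonneg: "\<And>i k. 0 \<le> U i k" "\<And>i k. 0 \<le> V i k"
  shows "wnorm W (\<lambda>x. f x * g x) \<le> (\<Sum>i\<in>I. wnorm (U i) f * wnorm (V i) g)"
proof -
  let ?C = "count_space (UNIV :: (int ^ 'n) set)"
  interpret C: sigma_finite_measure ?C
    by (rule sigma_finite_count)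
  interpret P: pair_sigma_finite ?C ?C ..
  have meas: "(\<lambda>(m, k). h m k) \<in> borel_measurable (?C \<Otimes>\<^sub>M ?C)" for h :: "_ \<Rightarrow> _ \<Rightarrow> ennreal"
    by (intro measurable_pair_measure_countable1) auto
  have "wnorm W (\<lambda>x. f x * g x) \<le> (\<integral>\<^sup>+m. \<integral>\<^sup>+k. ennreal (W m * (norm (fc f k) * norm (fc g (m - k)))) \<partial>?C \<partial>?C)"
    unfolding wnorm_def
  proof (rule nn_integral_mono)
    fix m
    \<comment> \<open>If the convolution sum is not absolutely convergent, its integral takes the
      default value 0 and the bound is trivial.\<close>
    have "ennreal (norm (fc (\<lambda>x. f x * g x) m)) \<le> (\<integral>\<^sup>+k. ennreal (norm (fc f k) * norm (fc g (m - k))) \<partial>?C)"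
      unfolding fc_mult[OF f g] using integral_norm_bound_ennreal[of ?C "\<lambda>k. fc f k * fc g (m - k)"]
      by (cases "integrable ?C (\<lambda>k. fc f k * fc g (m - k))")
         (auto simp: norm_mult not_integrable_integral_eq)
    then have "ennreal (W m) * ennreal (norm (fc (\<lambda>x. f x * g x) m))
        \<le> ennreal (W m) * (\<integral>\<^sup>+k. ennreal (norm (fc f k) * norm (fc g (m - k))) \<partial>?C)"
      by (rule mult_left_mono) simp
    then show "ennreal (W m * norm (fc (\<lambda>x. f x * g x) m))
        \<le> (\<integral>\<^sup>+k. ennreal (W m * (norm (fc f k) * norm (fc g (m - k)))) \<partial>?C)"
      using W by (simp add: ennreal_mult nn_integral_cmult)
  qed
  also have "\<dots> = (\<integral>\<^sup>+k. \<integral>\<^sup>+m. ennreal (W m * (norm (fc f k) * norm (fc g (m - k)))) \<partial>?C \<partial>?C)"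
    by (rule P.Fubini') (rule meas)
  also have "\<dots> = (\<integral>\<^sup>+k. \<integral>\<^sup>+l. ennreal (W (k + l) * (norm (fc f k) * norm (fc g l))) \<partial>?C \<partial>?C)"
  proof (rule nn_integral_cong)
    fix k :: "int ^ 'n"
    have "bij_betw ((+) k) UNIV UNIV"
      by (rule bij_betwI[where g = "\<lambda>m. m - k"]) auto
    from nn_integral_bij_count_space[OF this, of "\<lambda>m. ennreal (W m * (norm (fc f k) * norm (fc g (m - k))))"]
    show "(\<integral>\<^sup>+m. ennreal (W m * (norm (fc f k) * norm (fc g (m - k)))) \<partial>?C)
        = (\<integral>\<^sup>+l. ennreal (W (k + l) * (norm (fc f k) * norm (fc g l))) \<partial>?C)"
      by simp
  qed
  also have "\<dots> \<le> (\<integral>\<^sup>+k. \<integral>\<^sup>+l. (\<Sum>i\<in>I. ennreal (U i k * norm (fc f k)) * ennreal (V i l * norm (fc g l))) \<partial>?C \<partial>?C)"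
  proof (intro nn_integral_mono)
    fix k l
    have "W (k + l) * (norm (fc f k) * norm (fc g l))
        \<le> (\<Sum>i\<in>I. U i k * V i l) * (norm (fc f k) * norm (fc g l))"
      by (intro mult_right_mono UV) auto
    also have "\<dots> = (\<Sum>i\<in>I. (U i k * norm (fc f k)) * (V i l * norm (fc g l)))"
      unfolding sum_distrib_right by (intro sum.cong refl) (simp add: mult_ac)
    finally have "ennreal (W (k + l) * (norm (fc f k) * norm (fc g l)))
        \<le> ennreal (\<Sum>i\<in>I. (U i k * norm (fc f k)) * (V i l * norm (fc g l)))"
      by (rule ennreal_leI)
    also have "\<dots> = (\<Sum>i\<in>I. ennreal (U i k * norm (fc f k)) * ennreal (V i l * norm (fc g l)))"
      using nonneg by (subst sum_ennreal[symmetric]) (auto simp: ennreal_mult)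
    finally show "ennreal (W (k + l) * (norm (fc f k) * norm (fc g l)))
        \<le> (\<Sum>i\<in>I. ennreal (U i k * norm (fc f k)) * ennreal (V i l * norm (fc g l)))" .
  qed
  also have "\<dots> = (\<Sum>i\<in>I. wnorm (U i) f * wnorm (V i) g)"
    by (simp add: nn_integral_sum nn_integral_cmult nn_integral_multc wnorm_def)
  finally show ?thesis .
qed

lemma wien_mult:
  assumes "wien f" "wien g"
  shows "wien (\<lambda>x. f x * g x)"
proof -
  have i: "integrable torus f" "integrable torus g" "l1 (fc f)"
    using assms by (auto simp: wien_def)
  have "wnorm (\<lambda>_. 1) (\<lambda>x. f x * g x) \<le> (\<Sum>i\<in>{()}. wnorm (\<lambda>_. 1) f * wnorm (\<lambda>_. 1) g)"
    by (rule wnorm_mult_le) (use assms i in auto)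
  also have "\<dots> < \<infinity>"
    using assms by (simp add: wien_iff ennreal_mult_less_top)
  finally have 1: "wnorm (\<lambda>_. 1) (\<lambda>x. f x * g x) < \<infinity>" .
  have meas: "ser (fc f) \<in> borel_measurable torus"
    using i by (intro borel_measurable_torus continuous_on_ser)
  \<comment> \<open>The series of \<open>f\<close> is bounded everywhere, whereas \<open>f\<close>
    itself may be unbounded on a null set.\<close>
  have "integrable torus (\<lambda>x. g x * ser (fc f) x)"
    using i by (intro integrable_torus_mult_bounded[OF _ meas norm_ser_le])
  then have "integrable torus (\<lambda>x. f x * g x)"
  proof (rule integrable_cong_AE_imp)
    show "AE x in torus. g x * ser (fc f) x = f x * g x"
      using wien_AE_eq_ser[OF assms(1)] by eventually_elim simp
    show "(\<lambda>x. f x * g x) \<in> borel_measurable torus"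
      using i by (intro borel_measurable_times borel_measurable_integrable)
  qed
  with 1 show ?thesis
    by (simp add: wien_iff)
qed

lemma wnorm_diff_le:
  assumes "integrable torus f" "integrable torus g" "\<And>k. 0 \<le> W k"
  shows "wnorm W (\<lambda>x. f x - g x) \<le> wnorm W f + wnorm W g"
proof -
  have "wnorm W (\<lambda>x. f x - g x) \<le> (\<integral>\<^sup>+k. ennreal (W k * norm (fc f k)) + ennreal (W k * norm (fc g k)) \<partial>count_space UNIV)"
    unfolding wnorm_def
  proof (intro nn_integral_mono)
    fix k
    have "W k * norm (fc (\<lambda>x. f x - g x) k) \<le> W k * (norm (fc f k) + norm (fc g k))"
      by (intro mult_left_mono assms) (simp add: fc_diff assms norm_triangle_ineq4)
    then show "ennreal (W k * norm (fc (\<lambda>x. f x - g x) k)) \<le> ennreal (W k * norm (fc f k)) + ennreal (W k * norm (fc g k))"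
      using assms(3) by (subst ennreal_plus[symmetric]) (auto simp: distrib_left simp del: ennreal_plus intro!: ennreal_leI)
  qed
  also have "\<dots> = wnorm W f + wnorm W g"
    by (simp add: wnorm_def nn_integral_add)
  finally show ?thesis .
qed

lemma fc_const: "fc (\<lambda>_::real ^ 'n::finite. c) k = (if k = 0 then c else 0)"
proof -
  have "fc (\<lambda>_::real ^ 'n. 1) k = (if k = 0 then 1 else 0)"
    using integral_torus_wave[of "- k"] by (auto simp: fc_def)
  then show ?thesis
    using fc_mult_const[of "\<lambda>_. 1" c k] by simp
qed

lemma wnorm_const: "wnorm W (\<lambda>_::real ^ 'n::finite. c) = ennreal (W 0 * norm c)"
proof -
  have "wnorm W (\<lambda>_::real ^ 'n. c) = (\<integral>\<^sup>+k. ennreal (W 0 * norm c) * indicator {0} (k :: int ^ 'n) \<partial>count_space UNIV)"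
    unfolding wnorm_def by (intro nn_integral_cong) (auto simp: fc_const indicator_def)
  then show ?thesis
    by (simp add: nn_integral_cmult_indicator)
qed

lemma wien_const: "wien (\<lambda>_. c)"
  by (simp add: wien_iff wnorm_const integrable_torus_continuous)

lemma wien_diff:
  assumes "wien f" "wien g"
  shows "wien (\<lambda>x. f x - g x)"
  using assms wnorm_diff_le[of f g "\<lambda>_. 1"] unfolding wien_iff
  by (auto intro: le_less_trans simp: ennreal_add_less_top)

section \<open>Weighted norms of products and inverses\<close>

text \<open>The value at 0 gives the constant function 1 the norm 1, and \<open>1 \<le> w k\<close>
  makes the weighted norm dominate the unweighted one.\<close>

definition submult :: "(int ^ 'n::finite \<Rightarrow> real) \<Rightarrow> bool" where
  "submult w \<longleftrightarrow> w 0 = 1 \<and> (\<forall>k. 1 \<le> w k) \<and> (\<forall>k l. w (k + l) \<le> w k * w l)"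

lemma submultD:
  assumes "submult w"
  shows "w 0 = 1" "1 \<le> w k" "0 \<le> w k" "w (k + l) \<le> w k * w l"
proof -
  show "w 0 = 1" "1 \<le> w k" "w (k + l) \<le> w k * w l"
    using assms unfolding submult_def by blast+
  then show "0 \<le> w k"
    by linarith
qed

lemma submult_1: "submult (\<lambda>_. 1)"
  by (simp add: submult_def)

definition mwt :: "(int ^ 'n::finite \<Rightarrow> real) \<Rightarrow> nat \<Rightarrow> int ^ 'n \<Rightarrow> real" where
  "mwt w j k = norm (freq k) ^ j * w k"

lemma mwt_nonneg: "submult w \<Longrightarrow> 0 \<le> mwt w j k"
  by (simp add: mwt_def submultD(3))

text \<open>Since \<open>ennreal\<close> sends negative numbers to 0, the sign of \<open>r\<close>
  is recorded separately; it is used whenever bounds are multiplied or added.\<close>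

definition bd :: "(int ^ 'n::finite \<Rightarrow> real) \<Rightarrow> nat \<Rightarrow> (real ^ 'n \<Rightarrow> complex) \<Rightarrow> real \<Rightarrow> bool" where
  "bd w j f r \<longleftrightarrow> 0 \<le> r \<and> wnorm (mwt w j) f \<le> ennreal r"

lemma bd_mono: "bd w j f r \<Longrightarrow> r \<le> s \<Longrightarrow> bd w j f s"
  unfolding bd_def using ennreal_leI order_trans by fastforce

text \<open>The Leibniz rule for weighted norms: |k + l|^j is at most (|k| + |l|)^j, which
  \<open>le\<close> expands, and \<open>w\<close> is submultiplicative. The expansion lists its
  monomials with repetition instead of carrying coefficients.\<close>

lemma bd_mult_gen:
  assumes w: "submult w" and f: "wien f" and g: "wien g"
    and le: "\<And>x y :: real. 0 \<le> x \<Longrightarrow> 0 \<le> y \<Longrightarrow> (x + y) ^ j \<le> (\<Sum>i\<in>I. x ^ p i * y ^ q i)"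
    and ab: "\<And>i. i \<in> I \<Longrightarrow> bd w (p i) f (a i)" "\<And>i. i \<in> I \<Longrightarrow> bd w (q i) g (b i)"
    and I: "finite I"
  shows "bd w j (\<lambda>x. f x * g x) (\<Sum>i\<in>I. a i * b i)"
proof -
  have g': "integrable torus g"
    using g by (simp add: wien_def)
  have ab0: "0 \<le> a i" "0 \<le> b i" if "i \<in> I" for i
    using ab[OF that] by (auto simp: bd_def)
  have "wnorm (mwt w j) (\<lambda>x. f x * g x) \<le> (\<Sum>i\<in>I. wnorm (mwt w (p i)) f * wnorm (mwt w (q i)) g)"
  proof (rule wnorm_mult_le[OF f g'])
    fix k l
    have "mwt w j (k + l) \<le> (norm (freq k) + norm (freq l)) ^ j * (w k * w l)"
      unfolding mwt_def
      by (intro mult_mono power_mono norm_freq_add_le submultD[OF w]) auto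
    also have "\<dots> \<le> (\<Sum>i\<in>I. norm (freq k) ^ p i * norm (freq l) ^ q i) * (w k * w l)"
      by (intro mult_right_mono le mult_nonneg_nonneg submultD[OF w]) auto
    also have "\<dots> = (\<Sum>i\<in>I. mwt w (p i) k * mwt w (q i) l)"
      unfolding sum_distrib_right mwt_def by (intro sum.cong) auto
    finally show "mwt w j (k + l) \<le> (\<Sum>i\<in>I. mwt w (p i) k * mwt w (q i) l)" .
  qed (rule mwt_nonneg[OF w])+
  also have "\<dots> \<le> (\<Sum>i\<in>I. ennreal (a i) * ennreal (b i))"
    using ab unfolding bd_def by (intro sum_mono mult_mono) auto
  also have "\<dots> = (\<Sum>i\<in>I. ennreal (a i * b i))"
    using ab0 by (intro sum.cong) (auto simp: ennreal_mult)
  also have "\<dots> = ennreal (\<Sum>i\<in>I. a i * b i)"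
    using ab0 by (intro sum_ennreal) auto
  finally show ?thesis
    using ab0 unfolding bd_def by (auto intro: sum_nonneg)
qed

lemma bd_mult_0:
  assumes "submult w" "wien f" "wien g" "bd w 0 f a" "bd w 0 g b"
  shows "bd w 0 (\<lambda>x. f x * g x) (a * b)"
  using bd_mult_gen[OF assms(1-3), where j = 0 and I = "{()}" and p = "\<lambda>_. 0" and q = "\<lambda>_. 0"
      and a = "\<lambda>_. a" and b = "\<lambda>_. b"] assms(4,5) by simp

lemma bd_mult_1:
  assumes "submult w" "wien f" "wien g" "bd w 0 f a0" "bd w 1 f a1" "bd w 0 g b0" "bd w 1 g b1"
  shows "bd w 1 (\<lambda>x. f x * g x) (a1 * b0 + a0 * b1)"
proof -
  have "bd w 1 (\<lambda>x. f x * g x) (\<Sum>i\<in>{0, 1::nat}. (if i = 0 then a1 else a0) * (if i = 0 then b0 else b1))"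
    by (rule bd_mult_gen[OF assms(1-3), where p = "\<lambda>i. 1 - i" and q = "\<lambda>i. i"])
       (use assms(4-7) in auto)
  then show ?thesis
    by simp
qed

lemma bd_mult_2:
  assumes "submult w" "wien f" "wien g" "bd w 0 f a0" "bd w 1 f a1" "bd w 2 f a2"
    "bd w 0 g b0" "bd w 1 g b1" "bd w 2 g b2"
  shows "bd w 2 (\<lambda>x. f x * g x) (a2 * b0 + 2 * (a1 * b1) + a0 * b2)"
proof -
  \<comment> \<open>Indices 1 and 2 both stand for the mixed term, which occurs twice.\<close>
  have "bd w 2 (\<lambda>x. f x * g x) (\<Sum>i\<in>{0, 1, 2, 3::nat}. (if i = 0 then a2 else if i = 3 then a0 else a1)
      * (if i = 0 then b0 else if i = 3 then b2 else b1))"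
    by (rule bd_mult_gen[OF assms(1-3), where p = "\<lambda>i. if i = 0 then 2 else if i = 3 then 0 else 1"
          and q = "\<lambda>i. if i = 0 then 0 else if i = 3 then 2 else 1"])
       (use assms(4-9) in \<open>auto simp: power2_eq_square algebra_simps\<close>)
  then show ?thesis
    by (simp add: algebra_simps)
qed

text \<open>The constant 1 sits at frequency 0, where |k|^j vanishes unless j = 0; only the zeroth
  moment notices it.\<close>

lemma bd_one_minus:
  assumes w: "submult w" and f: "integrable torus f" and bd: "bd w j f r"
  shows "bd w j (\<lambda>x. 1 - f x) ((if j = 0 then 1 else 0) + r)"
proof -
  have "wnorm (mwt w j) (\<lambda>x. 1 - f x) \<le> wnorm (mwt w j) (\<lambda>_. 1) + wnorm (mwt w j) f"
    by (rule wnorm_diff_le) (auto simp: f mwt_nonneg[OF w] integrable_torus_continuous)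
  also have "wnorm (mwt w j) (\<lambda>_. 1) = ennreal (if j = 0 then 1 else 0)"
    by (simp add: wnorm_const mwt_def submultD(1)[OF w])
  also have "\<dots> + wnorm (mwt w j) f \<le> ennreal (if j = 0 then 1 else 0) + ennreal r"
    using bd by (intro add_left_mono) (simp add: bd_def)
  also have "\<dots> = ennreal ((if j = 0 then 1 else 0) + r)"
    using bd by (simp add: bd_def)
  finally show ?thesis
    using bd by (simp add: bd_def)
qed

lemma bd_limit:
  assumes "\<And>k. (\<lambda>n. fc (g n) k) \<longlonglongrightarrow> fc h k" "\<And>n. bd w j (g n) r"
  shows "bd w j h r"
  unfolding bd_def wnorm_def
proof
  show "0 \<le> r"
    using assms(2)[of 0] by (simp add: bd_def)
  show "(\<integral>\<^sup>+k. ennreal (mwt w j k * norm (fc h k)) \<partial>count_space UNIV) \<le> ennreal r"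
  proof (rule nn_integral_limit_le)
    show "(\<integral>\<^sup>+k. ennreal (mwt w j k * norm (fc (g n) k)) \<partial>count_space UNIV) \<le> ennreal r" for n
      using assms(2)[of n] by (simp add: bd_def wnorm_def)
  qed (auto intro!: tendsto_intros assms(1) AE_I2)
qed

lemma wien_of_bd: "submult w \<Longrightarrow> integrable torus f \<Longrightarrow> bd w 0 f r \<Longrightarrow> wien f"
proof -
  assume w: "submult w" and f: "integrable torus f" "bd w 0 f r"
  have "wnorm (\<lambda>_. 1) f \<le> wnorm (mwt w 0) f"
    unfolding wnorm_def
    by (intro nn_integral_mono ennreal_leI mult_right_mono) (auto simp: mwt_def submultD[OF w])
  also have "\<dots> \<le> ennreal r"
    using f by (simp add: bd_def)
  also have "\<dots> < \<infinity>"
    by simp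
  finally show ?thesis
    using f by (simp add: wien_iff)
qed

text \<open>Partial sums of the geometric series for 1 / (1 + f), written as the iteration of h = 1
  - f h, so that the product rules bound them by induction.\<close>

primrec neumann :: "('x \<Rightarrow> complex) \<Rightarrow> nat \<Rightarrow> 'x \<Rightarrow> complex" where
  "neumann f 0 = (\<lambda>_. 0)"
| "neumann f (Suc n) = (\<lambda>x. 1 - f x * neumann f n x)"

lemma neumann_diff:
  assumes "1 + f x \<noteq> 0"
  shows "neumann f n x - 1 / (1 + f x) = - ((- f x) ^ n / (1 + f x))"
proof (induction n)
  case (Suc n)
  have "1 / (1 + f x) = 1 - f x * (1 / (1 + f x))"
    using assms by (simp add: divide_simps)
  then have "neumann f (Suc n) x - 1 / (1 + f x) = - f x * (neumann f n x - 1 / (1 + f x))"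
    by (simp add: algebra_simps)
  also have "\<dots> = - ((- f x) ^ Suc n / (1 + f x))"
    unfolding Suc.IH by simp
  finally show ?case .
qed simp

text \<open>The three bounds B0, B1, B2 solve B0 = 1 + A0 B0, B1 = A1 B0 + A0 B1 and B2 = A2 B0 + 2
  A1 B1 + A0 B2, the relations that the product rules give for h = 1 - f h. Hence they hold for all
  partial sums and, by Fatou, for the limit. The separate number \<open>q\<close> bounds f pointwise
  and provides the convergence.\<close>

lemma bd_inverse:
  fixes f :: "real ^ 'n::finite \<Rightarrow> complex"
  assumes w: "submult w" and f: "wien f" "f \<in> borel_measurable torus"
    and q: "\<And>x. norm (f x) \<le> q" "q < 1"
    and A: "bd w 0 f A0" "bd w 1 f A1" "bd w 2 f A2" "A0 < 1"
  shows "wien (\<lambda>x. 1 / (1 + f x))" "bd w 0 (\<lambda>x. 1 / (1 + f x)) (1 / (1 - A0))"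
    "bd w 1 (\<lambda>x. 1 / (1 + f x)) (A1 / (1 - A0)\<^sup>2)"
    "bd w 2 (\<lambda>x. 1 / (1 + f x)) (A2 / (1 - A0)\<^sup>2 + 2 * A1\<^sup>2 / (1 - A0) ^ 3)"
proof -
  define g where "g x = 1 / (1 + f x)" for x
  define h where "h = neumann f"
  have A0: "0 \<le> A0" "0 \<le> A1" "0 \<le> A2"
    using A by (auto simp: bd_def)
  have q0: "0 \<le> q"
    using q(1)[of 0] norm_ge_zero order_trans by blast
  have low: "1 - q \<le> norm (1 + f x)" for x
    using norm_triangle_ineq2[of 1 "- f x"] q(1)[of x] by simp
  then have nz: "1 + f x \<noteq> 0" for x
    using q(2) by (metis diff_gt_0_iff_gt norm_zero not_less)
  have hw: "wien (h n)" for n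
  proof (induction n)
    case (Suc n)
    then show ?case
      unfolding h_def by (simp add: wien_diff wien_const wien_mult f)
  qed (simp add: h_def wien_const)
  have hi: "integrable torus (h n)" for n
    using hw[of n] by (simp add: wien_def)
  have hsuc: "h (Suc n) = (\<lambda>x. 1 - f x * h n x)" for n
    by (simp add: h_def)
  have fi: "integrable torus (\<lambda>x. f x * h n x)" for n
    using wien_mult[OF f(1) hw[of n]] by (simp add: wien_def)
  have h0: "bd w j (h 0) r" if "0 \<le> r" for j r
    using that by (simp add: h_def bd_def wnorm_const)
  have b0: "bd w 0 (h n) (1 / (1 - A0))" for n
  proof (induction n)
    case 0
    show ?case
      using A by (intro h0) simp
  next
    case (Suc n)
    have "bd w 0 (h (Suc n)) (1 + A0 * (1 / (1 - A0)))"
      unfolding hsuc using bd_one_minus[OF w fi bd_mult_0[OF w f(1) hw A(1) Suc]] by simp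
    moreover have "1 + A0 * (1 / (1 - A0)) = 1 / (1 - A0)"
      using A(4) by (simp add: field_simps)
    ultimately show ?case
      by simp
  qed
  have b1: "bd w 1 (h n) (A1 / (1 - A0)\<^sup>2)" for n
  proof (induction n)
    case 0
    show ?case
      using A0 by (intro h0) simp
  next
    case (Suc n)
    have "bd w 1 (h (Suc n)) (A1 * (1 / (1 - A0)) + A0 * (A1 / (1 - A0)\<^sup>2))"
      unfolding hsuc using bd_one_minus[OF w fi bd_mult_1[OF w f(1) hw A(1,2) b0 Suc]] by simp
    moreover have "A1 * (1 / (1 - A0)) + A0 * (A1 / (1 - A0)\<^sup>2) = A1 / (1 - A0)\<^sup>2"
    proof -
      define y where "y = 1 - A0"
      have "y \<noteq> 0" and A0_eq: "A0 = 1 - y"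
        using A(4) by (auto simp: y_def)
      then show ?thesis
        unfolding A0_eq by (simp add: field_simps power2_eq_square)
    qed
    ultimately show ?case
      by simp
  qed
  have b2: "bd w 2 (h n) (A2 / (1 - A0)\<^sup>2 + 2 * A1\<^sup>2 / (1 - A0) ^ 3)" for n
  proof (induction n)
    case 0
    show ?case
      using A0 A(4) by (intro h0) simp
  next
    case (Suc n)
    have "bd w 2 (h (Suc n)) (A2 * (1 / (1 - A0)) + 2 * (A1 * (A1 / (1 - A0)\<^sup>2))
        + A0 * (A2 / (1 - A0)\<^sup>2 + 2 * A1\<^sup>2 / (1 - A0) ^ 3))"
      unfolding hsuc using bd_one_minus[OF w fi bd_mult_2[OF w f(1) hw A(1,2,3) b0 b1 Suc]] by simp
    moreover have "A2 * (1 / (1 - A0)) + 2 * (A1 * (A1 / (1 - A0)\<^sup>2))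
        + A0 * (A2 / (1 - A0)\<^sup>2 + 2 * A1\<^sup>2 / (1 - A0) ^ 3) = A2 / (1 - A0)\<^sup>2 + 2 * A1\<^sup>2 / (1 - A0) ^ 3"
    proof -
      define y where "y = 1 - A0"
      have "y \<noteq> 0" and A0_eq: "A0 = 1 - y"
        using A(4) by (auto simp: y_def)
      then show ?thesis
        unfolding A0_eq by (simp add: field_simps power2_eq_square power3_eq_cube)
    qed
    ultimately show ?case
      by simp
  qed
  have meas_h: "h n \<in> borel_measurable torus" for n
    using hi by (rule borel_measurable_integrable)
  have hlim: "(\<lambda>n. h n x) \<longlonglongrightarrow> g x" for x
  proof -
    have "(\<lambda>n. (- f x) ^ n) \<longlonglongrightarrow> 0"
      by (rule LIMSEQ_power_zero) (use q(1)[of x] q(2) in simp)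
    then have "(\<lambda>n. - ((- f x) ^ n / (1 + f x))) \<longlonglongrightarrow> - (0 / (1 + f x))"
      by (intro tendsto_minus tendsto_divide tendsto_const nz)
    then have "(\<lambda>n. h n x - g x) \<longlonglongrightarrow> 0"
      unfolding h_def g_def neumann_diff[where f = f, OF nz] by simp
    then show ?thesis
      by (rule LIM_zero_cancel)
  qed
  have gB: "norm (g x) \<le> 1 / (1 - q)" for x
    unfolding g_def norm_divide using low[of x] q(2) by (simp add: frac_le)
  \<comment> \<open>A bound uniform in n, for the dominated convergence of the coefficients: both
    the limit and the error of the partial sum are at most 1 / (1 - q).\<close>
  have hB: "norm (h n x) \<le> 2 / (1 - q)" for n x
  proof -
    have "norm (h n x - g x) \<le> 1 / (1 - q)"
    proof -
      have "norm (h n x - g x) = norm (f x) ^ n / norm (1 + f x)"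
        unfolding h_def g_def neumann_diff[where f = f, OF nz] by (simp add: norm_divide norm_power)
      also have "\<dots> \<le> 1 / (1 - q)"
        using low[of x] q(2) q(1)[of x] by (intro frac_le power_le_one) auto
      finally show ?thesis .
    qed
    then show ?thesis
      using gB[of x] norm_triangle_ineq[of "h n x - g x" "g x"] by (simp add: add_divide_distrib[symmetric])
  qed
  have meas_g: "g \<in> borel_measurable torus"
    unfolding g_def using f(2) by measurable
  have gint: "integrable torus g"
    using integrable_torus_mult_bounded[OF _ meas_g gB, of "\<lambda>_. 1"] by (simp add: integrable_torus_continuous)
  have fclim: "(\<lambda>n. fc (h n) k) \<longlonglongrightarrow> fc g k" for k
  proof -
    have "(\<lambda>n. LINT x|torus. h n x * wave (- k) x) \<longlonglongrightarrow> (LINT x|torus. g x * wave (- k) x)"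
    proof (rule integral_dominated_convergence[where w = "\<lambda>_. 2 / (1 - q)"])
      show "integrable torus (\<lambda>_::real ^ 'n. 2 / (1 - q))"
        by (simp add: integrable_torus_continuous)
      show "AE x in torus. (\<lambda>n. h n x * wave (- k) x) \<longlonglongrightarrow> g x * wave (- k) x"
        by (intro AE_I2 tendsto_intros hlim)
      show "AE x in torus. norm (h n x * wave (- k) x) \<le> 2 / (1 - q)" for n
        by (intro AE_I2) (simp add: norm_mult hB)
    qed (use meas_g meas_h in \<open>auto intro!: borel_measurable_times\<close>)
    then show ?thesis
      unfolding fc_def by (intro tendsto_intros) auto
  qed
  show "bd w 0 (\<lambda>x. 1 / (1 + f x)) (1 / (1 - A0))"
    using bd_limit[OF fclim b0] by (simp add: g_def[abs_def])
  then show "wien (\<lambda>x. 1 / (1 + f x))"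
    using wien_of_bd[OF w gint] by (simp add: g_def[abs_def])
  show "bd w 1 (\<lambda>x. 1 / (1 + f x)) (A1 / (1 - A0)\<^sup>2)"
    using bd_limit[OF fclim b1] by (simp add: g_def[abs_def])
  show "bd w 2 (\<lambda>x. 1 / (1 + f x)) (A2 / (1 - A0)\<^sup>2 + 2 * A1\<^sup>2 / (1 - A0) ^ 3)"
    using bd_limit[OF fclim b2] by (simp add: g_def[abs_def])
qed

section \<open>The nonlinear estimate\<close>

definition Dc :: "'n::finite \<Rightarrow> (int ^ 'n \<Rightarrow> complex) \<Rightarrow> int ^ 'n \<Rightarrow> complex" where
  "Dc i a k = \<i> * of_real (freq k $ i) * a k"

text \<open>
  \<open>Dc i a\<close>, \<open>Bc i j a\<close> and \<open>NL a\<close> are the coefficients of \<open>\<partial>\<^sub>iu\<close>, \<open>\<partial>\<^sub>iu \<partial>\<^sub>ju / (1 + u)\<close> and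
  \<open>\<Sum>\<^bsub>i,j\<^esub> \<partial>\<^sub>i\<partial>\<^sub>j(\<partial>\<^sub>iu \<partial>\<^sub>ju / (1 + u))\<close>, where \<open>u = ser a\<close>.
\<close>

definition Bc :: "'n::finite \<Rightarrow> 'n \<Rightarrow> (int ^ 'n \<Rightarrow> complex) \<Rightarrow> int ^ 'n \<Rightarrow> complex" where
  "Bc i j a = fc (\<lambda>x. ser (Dc i a) x * ser (Dc j a) x * (1 / (1 + ser a x)))"

definition NL :: "(int ^ 'n::finite \<Rightarrow> complex) \<Rightarrow> int ^ 'n \<Rightarrow> complex" where
  "NL a k = - (\<Sum>i\<in>UNIV. \<Sum>j\<in>UNIV. of_real (freq k $ i * freq k $ j) * Bc i j a k)"

definition mom :: "(int ^ 'n::finite \<Rightarrow> real) \<Rightarrow> nat \<Rightarrow> (int ^ 'n \<Rightarrow> complex) \<Rightarrow> real" where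
  "mom w j a = (\<integral>k. mwt w j k * norm (a k) \<partial>count_space UNIV)"

definition fin_mom :: "(int ^ 'n::finite \<Rightarrow> real) \<Rightarrow> (int ^ 'n \<Rightarrow> complex) \<Rightarrow> bool" where
  "fin_mom w a \<longleftrightarrow> (\<forall>j\<le>4. integrable (count_space UNIV) (\<lambda>k. mwt w j k * norm (a k)))"

lemma fin_momD: "fin_mom w a \<Longrightarrow> j \<le> 4 \<Longrightarrow> integrable (count_space UNIV) (\<lambda>k. mwt w j k * norm (a k))"
  by (simp add: fin_mom_def)

lemma norm_Dc_le: "norm (Dc i a k) \<le> norm (freq k) * norm (a k)"
  unfolding Dc_def norm_mult by (auto intro!: mult_right_mono component_le_norm_cart)

lemma mom_nonneg: "submult w \<Longrightarrow> 0 \<le> mom w j a"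
  unfolding mom_def by (intro Bochner_Integration.integral_nonneg) (simp add: mwt_nonneg)

section \<open>Interpolation between moments\<close>

lemma quadratic_nonneg_imp:
  fixes a b c :: real
  assumes "\<And>t. 0 \<le> a * t\<^sup>2 - 2 * b * t + c"
  shows "b\<^sup>2 \<le> a * c"
proof (cases "a = 0")
  case True
  have "b = 0"
  proof (rule ccontr)
    assume "b \<noteq> 0"
    then show False
      using assms[of "(c + 1) / (2 * b)"] True by simp
  qed
  then show ?thesis
    using True by simp
next
  case False
  have c: "0 \<le> c"
    using assms[of 0] by simp
  have "a > 0"
  proof (rule ccontr)
    assume "\<not> a > 0"
    with False have a: "a < 0" by simp
    \<comment> \<open>This makes t at least 1 and -a t at least 2 |b| + c + 1, so that the quadratic
      is negative at t.\<close>
    define t where "t = (\<bar>b\<bar> * 2 + c + 1) / (- a) + 1"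
    have t: "t \<ge> 1" "- a * t \<ge> \<bar>b\<bar> * 2 + c + 1"
      using a c by (auto simp: t_def field_simps)
    have "- a * t * t \<ge> (\<bar>b\<bar> * 2 + c + 1) * t"
      using t by (intro mult_right_mono) auto
    moreover have "(\<bar>b\<bar> * 2 + c + 1) * t = 2 * \<bar>b\<bar> * t + (c + 1) * t"
      by (simp add: algebra_simps)
    moreover have "(c + 1) * t \<ge> c + 1"
      using t c by (simp add: mult_le_cancel_left1)
    moreover have "2 * \<bar>b\<bar> * t \<ge> - (2 * b * t)"
      using t mult_right_mono[of "- b" "\<bar>b\<bar>" t] abs_ge_minus_self[of b]
      by (simp add: mult.commute[of t])
    ultimately show False
      using assms[of t] by (simp add: power2_eq_square algebra_simps)
  qed
  then show ?thesis
    using assms[of "b / a"] by (simp add: field_simps power2_eq_square)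
qed

text \<open>Cauchy-Schwarz for the measure w |a|: the sum of |k|^m (|k|^r t - 1)^2 w |a| is
  nonnegative for every t, which bounds its discriminant.\<close>

lemma mom_log_convex:
  assumes w: "submult w" and a: "fin_mom w a" and "m + 2 * r \<le> 4"
  shows "(mom w (m + r) a)\<^sup>2 \<le> mom w m a * mom w (m + 2 * r) a"
proof -
  have "(mom w (m + r) a)\<^sup>2 \<le> mom w (m + 2 * r) a * mom w m a"
  proof (rule quadratic_nonneg_imp)
    fix t :: real
    have i: "integrable (count_space UNIV) (\<lambda>k. mwt w j k * norm (a k))" if "j \<in> {m, m + r, m + 2 * r}" for j
      using that assms(3) by (intro fin_momD[OF a]) auto
    have "0 \<le> (\<integral>k. mwt w m k * (norm (freq k) ^ r * t - 1)\<^sup>2 * norm (a k) \<partial>count_space UNIV)"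
      by (intro Bochner_Integration.integral_nonneg mult_nonneg_nonneg mwt_nonneg[OF w]) auto
    also have "\<dots> = (\<integral>k. t\<^sup>2 * (mwt w (m + 2 * r) k * norm (a k)) - 2 * t * (mwt w (m + r) k * norm (a k))
        + mwt w m k * norm (a k) \<partial>count_space UNIV)"
    proof (intro Bochner_Integration.integral_cong refl)
      fix k
      have 1: "mwt w (m + r) k = norm (freq k) ^ r * mwt w m k"
        by (simp add: mwt_def power_add)
      have 2: "mwt w (m + 2 * r) k = norm (freq k) ^ r * (norm (freq k) ^ r * mwt w m k)"
        by (simp add: mwt_def power_add mult_2)
      show "mwt w m k * (norm (freq k) ^ r * t - 1)\<^sup>2 * norm (a k)
          = t\<^sup>2 * (mwt w (m + 2 * r) k * norm (a k)) - 2 * t * (mwt w (m + r) k * norm (a k)) + mwt w m k * norm (a k)"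
        unfolding 1 2 by (simp add: power2_eq_square algebra_simps)
    qed
    also have "\<dots> = t\<^sup>2 * mom w (m + 2 * r) a - 2 * t * mom w (m + r) a + mom w m a"
      using i[of m] i[of "m + r"] i[of "m + 2 * r"] by (simp add: mom_def)
    also have "\<dots> = mom w (m + 2 * r) a * t\<^sup>2 - 2 * mom w (m + r) a * t + mom w m a"
      by simp
    finally show "0 \<le> mom w (m + 2 * r) a * t\<^sup>2 - 2 * mom w (m + r) a * t + mom w m a" .
  qed
  then show ?thesis
    by (simp add: mult.commute)
qed

text \<open>By log-convexity a product of p moments whose orders add up to 4 is at most A_0^(p-1)
  A_4, where A_m is the m-th moment. Such products arise from two derivatives of \<partial>_i u
  \<partial>_j u / (1 + u).\<close>

lemma mom_interpolation:
  assumes w: "submult w" and a: "fin_mom w a"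
  shows "(mom w 2 a)\<^sup>2 \<le> mom w 0 a * mom w 4 a" "(mom w 1 a)\<^sup>2 \<le> mom w 0 a * mom w 2 a"
    "mom w 1 a * mom w 3 a \<le> mom w 0 a * mom w 4 a"
    "(mom w 1 a)\<^sup>2 * mom w 2 a \<le> (mom w 0 a)\<^sup>2 * mom w 4 a"
    "(mom w 1 a)\<^sup>2 * (mom w 1 a)\<^sup>2 \<le> (mom w 0 a) ^ 3 * mom w 4 a"
proof -
  note n = mom_nonneg[OF w, of _ a]
  show 1: "(mom w 2 a)\<^sup>2 \<le> mom w 0 a * mom w 4 a"
    using mom_log_convex[OF w a, of 0 2] by (simp add: eval_nat_numeral)
  show 2: "(mom w 1 a)\<^sup>2 \<le> mom w 0 a * mom w 2 a"
    using mom_log_convex[OF w a, of 0 1] by (simp add: eval_nat_numeral)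
  have 3: "(mom w 3 a)\<^sup>2 \<le> mom w 2 a * mom w 4 a"
    using mom_log_convex[OF w a, of 2 1] by (simp add: eval_nat_numeral)
  show "mom w 1 a * mom w 3 a \<le> mom w 0 a * mom w 4 a"
  proof (rule power2_le_imp_le)
    have "(mom w 1 a * mom w 3 a)\<^sup>2 \<le> (mom w 0 a * mom w 2 a) * (mom w 2 a * mom w 4 a)"
      unfolding power_mult_distrib by (intro mult_mono 2 3 mult_nonneg_nonneg n zero_le_power2)
    also have "\<dots> = (mom w 0 a * mom w 4 a) * (mom w 2 a)\<^sup>2"
      by (simp add: power2_eq_square)
    also have "\<dots> \<le> (mom w 0 a * mom w 4 a) * (mom w 0 a * mom w 4 a)"
      by (intro mult_left_mono 1 mult_nonneg_nonneg n)
    finally show "(mom w 1 a * mom w 3 a)\<^sup>2 \<le> (mom w 0 a * mom w 4 a)\<^sup>2"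
      by (simp add: power2_eq_square)
  qed (intro mult_nonneg_nonneg n)
  have "(mom w 1 a)\<^sup>2 * mom w 2 a \<le> mom w 0 a * mom w 2 a * mom w 2 a"
    by (intro mult_right_mono 2 n)
  also have "\<dots> = mom w 0 a * (mom w 2 a)\<^sup>2"
    by (simp add: power2_eq_square)
  also have "\<dots> \<le> mom w 0 a * (mom w 0 a * mom w 4 a)"
    by (intro mult_left_mono 1 n)
  finally show 4: "(mom w 1 a)\<^sup>2 * mom w 2 a \<le> (mom w 0 a)\<^sup>2 * mom w 4 a"
    by (simp add: power2_eq_square)
  have "(mom w 1 a)\<^sup>2 * (mom w 1 a)\<^sup>2 \<le> (mom w 1 a)\<^sup>2 * (mom w 0 a * mom w 2 a)"
    by (intro mult_left_mono 2) simp
  also have "\<dots> = mom w 0 a * ((mom w 1 a)\<^sup>2 * mom w 2 a)"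
    by simp
  also have "\<dots> \<le> mom w 0 a * ((mom w 0 a)\<^sup>2 * mom w 4 a)"
    by (intro mult_left_mono 4 n)
  finally show "(mom w 1 a)\<^sup>2 * (mom w 1 a)\<^sup>2 \<le> (mom w 0 a) ^ 3 * mom w 4 a"
    by (simp add: power2_eq_square power3_eq_cube)
qed

lemma fin_mom_l1:
  assumes w: "submult w" and a: "fin_mom w a"
  shows "l1 a" "l1 (Dc i a)"
proof -
  have w1: "x \<le> w k * x" if "0 \<le> x" for x k
    using mult_right_mono[OF submultD(2)[OF w, of k] that] by simp
  show "l1 a"
    by (rule Bochner_Integration.integrable_bound[OF fin_momD[OF a, of 0]])
       (auto simp: mwt_def abs_mult submultD(3)[OF w] intro!: AE_I2 w1)
  show "l1 (Dc i a)"
  proof (rule Bochner_Integration.integrable_bound[OF fin_momD[OF a, of 1]])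
    show "AE k in count_space UNIV. norm (Dc i a k) \<le> norm (mwt w 1 k * norm (a k))"
    proof (rule AE_I2)
      fix k
      have "norm (Dc i a k) \<le> w k * (norm (freq k) * norm (a k))"
        using norm_Dc_le[of i a k] w1[of "norm (freq k) * norm (a k)" k] by auto
      then show "norm (Dc i a k) \<le> norm (mwt w 1 k * norm (a k))"
        by (simp add: mwt_def abs_mult submultD(3)[OF w] mult_ac)
    qed
  qed auto
qed

lemma bd_ser:
  assumes w: "submult w" and a: "fin_mom w a" and j: "j \<le> 4"
  shows "bd w j (ser a) (mom w j a)"
  using nn_integral_eq_integral[OF fin_momD[OF a j]] mom_nonneg[OF w, of j a]
  by (simp add: bd_def wnorm_def mom_def fc_ser_eq[OF fin_mom_l1(1)[OF w a]] mwt_nonneg[OF w])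

text \<open>A derivative multiplies a coefficient by at most |k| in modulus, hence raises the order
  of the moment by one.\<close>

lemma bd_ser_Dc:
  assumes w: "submult w" and a: "fin_mom w a" and j: "j \<le> 3"
  shows "bd w j (ser (Dc i a)) (mom w (Suc j) a)"
proof -
  have "wnorm (mwt w j) (ser (Dc i a)) \<le> (\<integral>\<^sup>+k. ennreal (mwt w (Suc j) k * norm (a k)) \<partial>count_space UNIV)"
    unfolding wnorm_def fc_ser_eq[OF fin_mom_l1(2)[OF w a]]
  proof (intro nn_integral_mono ennreal_leI)
    fix k
    have "mwt w j k * norm (Dc i a k) \<le> mwt w j k * (norm (freq k) * norm (a k))"
      by (intro mult_left_mono norm_Dc_le mwt_nonneg[OF w])
    then show "mwt w j k * norm (Dc i a k) \<le> mwt w (Suc j) k * norm (a k)"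
      by (simp add: mwt_def mult_ac)
  qed
  also have "\<dots> = ennreal (mom w (Suc j) a)"
    using nn_integral_eq_integral[OF fin_momD[OF a, of "Suc j"]] j by (simp add: mom_def mwt_nonneg[OF w])
  finally show ?thesis
    using mom_nonneg[OF w, of "Suc j" a] by (simp add: bd_def)
qed

lemma norm_ser_le_mom:
  assumes w: "submult w" and a: "fin_mom w a"
  shows "norm (ser a x) \<le> mom w 0 a"
proof -
  have "norm (ser a x) \<le> (\<integral>k. norm (a k) \<partial>count_space UNIV)"
    by (rule norm_ser_le)
  also have "\<dots> \<le> mom w 0 a"
    unfolding mom_def
  proof (rule integral_mono)
    show "norm (a k) \<le> mwt w 0 k * norm (a k)" for k
      using mult_right_mono[OF submultD(2)[OF w, of k], of "norm (a k)"] by (simp add: mwt_def)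
  qed (use fin_mom_l1(1)[OF w a] fin_momD[OF a, of 0] in auto)
  finally show ?thesis .
qed

text \<open>The origin of \<open>P1\<close>. The moments of \<partial>_i u \<partial>_j u of orders
  0, 1, 2 are at most A_1^2, 2 A_1 A_2 and 2 A_1 A_3 + 2 A_2^2. Multiplied with the bounds for 1 /
  (1 + u), they give the last of these times y, then 5 A_1^2 A_2 y^2 (4 from the mixed products, 1
  from the second order of the inverse) and 2 A_1^4 y^3, where y = 1 / (1 - A_0). Interpolation
  turns each product of moments into a power of A_0 times A_4.\<close>

lemma Bc_bd:
  fixes a :: "int ^ 'n::finite \<Rightarrow> complex"
  assumes w: "submult w" and a: "fin_mom w a" and z: "mom w 0 a \<le> z" "z < 1"
  shows "bd w 0 (\<lambda>x. ser (Dc i a) x * ser (Dc j a) x * (1 / (1 + ser a x))) ((mom w 1 a)\<^sup>2 / (1 - z))"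
    and "bd w 2 (\<lambda>x. ser (Dc i a) x * ser (Dc j a) x * (1 / (1 + ser a x))) (P1 z * mom w 4 a)"
    and "wien (\<lambda>x. ser (Dc i a) x * ser (Dc j a) x * (1 / (1 + ser a x)))"
proof -
  define A where "A m = mom w m a" for m
  have A: "0 \<le> A m" for m
    unfolding A_def by (rule mom_nonneg[OF w])
  have z0: "A 0 \<le> z" "z < 1" "0 \<le> z" "A 0 < 1"
    using z A[of 0] by (auto simp: A_def)
  have wa: "wien (ser a)" "wien (ser (Dc i a))" for i
    by (intro wien_ser fin_mom_l1[OF w a])+
  have ma: "ser a \<in> borel_measurable torus"
    by (intro borel_measurable_torus continuous_on_ser fin_mom_l1[OF w a])
  have q: "norm (ser a x) \<le> A 0" for x
    unfolding A_def by (rule norm_ser_le_mom[OF w a])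
  have S: "bd w 0 (ser a) (A 0)" "bd w 1 (ser a) (A 1)" "bd w 2 (ser a) (A 2)"
    unfolding A_def by (simp_all add: bd_ser[OF w a])
  note inv = bd_inverse[OF w wa(1) ma q z0(4) S z0(4)]
  have D: "bd w 0 (ser (Dc i a)) (A 1)" "bd w 1 (ser (Dc i a)) (A 2)" "bd w 2 (ser (Dc i a)) (A 3)" for i
    using bd_ser_Dc[OF w a, of 0 i] bd_ser_Dc[OF w a, of 1 i] bd_ser_Dc[OF w a, of 2 i]
    by (simp_all add: A_def numeral_2_eq_2 numeral_3_eq_3)
  have E: "wien (\<lambda>x. ser (Dc i a) x * ser (Dc j a) x)"
    by (intro wien_mult wa)
  have E0: "bd w 0 (\<lambda>x. ser (Dc i a) x * ser (Dc j a) x) ((A 1)\<^sup>2)"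
    using bd_mult_0[OF w wa(2)[of i] wa(2)[of j] D(1) D(1)] by (simp add: power2_eq_square)
  have E1: "bd w 1 (\<lambda>x. ser (Dc i a) x * ser (Dc j a) x) (2 * (A 2 * A 1))"
    using bd_mult_1[OF w wa(2)[of i] wa(2)[of j] D(1,2) D(1,2)] by (simp add: mult.commute)
  have E2: "bd w 2 (\<lambda>x. ser (Dc i a) x * ser (Dc j a) x) (2 * (A 1 * A 3) + 2 * (A 2)\<^sup>2)"
    using bd_mult_2[OF w wa(2)[of i] wa(2)[of j] D D]
    by (simp add: power2_eq_square algebra_simps)
  show "wien (\<lambda>x. ser (Dc i a) x * ser (Dc j a) x * (1 / (1 + ser a x)))"
    by (rule wien_mult[OF E inv(1)])
  have "bd w 0 (\<lambda>x. ser (Dc i a) x * ser (Dc j a) x * (1 / (1 + ser a x))) ((A 1)\<^sup>2 * (1 / (1 - A 0)))"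
    by (rule bd_mult_0[OF w E inv(1) E0 inv(2)])
  moreover have "(A 1)\<^sup>2 * (1 / (1 - A 0)) \<le> (A 1)\<^sup>2 / (1 - z)"
    using z0 by (simp add: frac_le)
  ultimately show "bd w 0 (\<lambda>x. ser (Dc i a) x * ser (Dc j a) x * (1 / (1 + ser a x))) ((mom w 1 a)\<^sup>2 / (1 - z))"
    unfolding A_def by (rule bd_mono)
  define y where "y = 1 / (1 - A 0)"
  define Y where "Y = 1 / (1 - z)"
  have y: "0 \<le> y" "y \<le> Y"
    using z0 by (auto simp: y_def Y_def frac_le)
  have "bd w 2 (\<lambda>x. ser (Dc i a) x * ser (Dc j a) x * (1 / (1 + ser a x)))
      ((2 * (A 1 * A 3) + 2 * (A 2)\<^sup>2) * y + 2 * (2 * (A 2 * A 1) * (A 1 * y\<^sup>2))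
        + (A 1)\<^sup>2 * (A 2 * y\<^sup>2 + 2 * (A 1)\<^sup>2 * y ^ 3))"
    using bd_mult_2[OF w E inv(1) E0 E1 E2 inv(2,3,4)] by (simp add: y_def power_divide)
  moreover have "(2 * (A 1 * A 3) + 2 * (A 2)\<^sup>2) * y + 2 * (2 * (A 2 * A 1) * (A 1 * y\<^sup>2))
        + (A 1)\<^sup>2 * (A 2 * y\<^sup>2 + 2 * (A 1)\<^sup>2 * y ^ 3) \<le> P1 z * A 4"
  proof -
    note I = mom_interpolation[OF w a, folded A_def]
    have "(2 * (A 1 * A 3) + 2 * (A 2)\<^sup>2) * y + 2 * (2 * (A 2 * A 1) * (A 1 * y\<^sup>2))
        + (A 1)\<^sup>2 * (A 2 * y\<^sup>2 + 2 * (A 1)\<^sup>2 * y ^ 3)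
      = (2 * (A 1 * A 3) + 2 * (A 2)\<^sup>2) * y + 5 * ((A 1)\<^sup>2 * A 2) * y\<^sup>2 + 2 * ((A 1)\<^sup>2 * (A 1)\<^sup>2) * y ^ 3"
      by (simp add: algebra_simps power2_eq_square)
    also have "\<dots> \<le> (2 * (A 0 * A 4) + 2 * (A 0 * A 4)) * y + 5 * ((A 0)\<^sup>2 * A 4) * y\<^sup>2 + 2 * (A 0 ^ 3 * A 4) * y ^ 3"
      using y by (intro add_mono mult_right_mono mult_left_mono I) auto
    \<comment> \<open>\<open>A 0\<close> is replaced by its upper bound z, and the cubic coefficient
      is enlarged to the one in \<open>P1\<close>.\<close>
    also have "\<dots> \<le> (2 * (z * A 4) + 2 * (z * A 4)) * Y + 5 * (z\<^sup>2 * A 4) * Y\<^sup>2 + 4 * (z ^ 3 * A 4) * Y ^ 3"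
      using y z0 A[of 0] A[of 4] by (intro add_mono mult_mono power_mono mult_nonneg_nonneg add_nonneg_nonneg) auto
    also have "\<dots> = P1 z * A 4"
      by (simp add: P1_def Y_def power_divide algebra_simps)
    finally show ?thesis .
  qed
  ultimately show "bd w 2 (\<lambda>x. ser (Dc i a) x * ser (Dc j a) x * (1 / (1 + ser a x))) (P1 z * mom w 4 a)"
    unfolding A_def by (rule bd_mono)
qed

text \<open>|k_i k_j| \<le> |k|^2 reduces every summand to the second moment of one quotient; d^2
  counts the pairs (i, j).\<close>

lemma NL_estimate:
  fixes a :: "int ^ 'n::finite \<Rightarrow> complex"
  assumes w: "submult w" and a: "fin_mom w a" and z: "mom w 0 a \<le> z" "z < 1"
  shows "(\<integral>\<^sup>+k. ennreal (w k * norm (NL a k)) \<partial>count_space UNIV)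
      \<le> ennreal ((real CARD('n))\<^sup>2 * P1 z * mom w 4 a)"
proof -
  have "(\<integral>\<^sup>+k. ennreal (w k * norm (NL a k)) \<partial>count_space UNIV)
      \<le> (\<integral>\<^sup>+k. (\<Sum>i\<in>UNIV. \<Sum>j\<in>UNIV. ennreal (mwt w 2 k * norm (Bc i j a k))) \<partial>count_space UNIV)"
  proof (intro nn_integral_mono)
    fix k
    have "norm (NL a k) \<le> (\<Sum>i\<in>UNIV. \<Sum>j\<in>UNIV. norm (freq k) ^ 2 * norm (Bc i j a k))"
      unfolding NL_def norm_minus_cancel
    proof (intro sum_norm_le)
      fix i j
      have "\<bar>freq k $ i\<bar> * \<bar>freq k $ j\<bar> \<le> norm (freq k) * norm (freq k)"
        by (intro mult_mono component_le_norm_cart) auto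
      then show "norm (of_real (freq k $ i * freq k $ j) * Bc i j a k) \<le> norm (freq k) ^ 2 * norm (Bc i j a k)"
        by (simp add: norm_mult abs_mult power2_eq_square mult_right_mono)
    qed
    then have "w k * norm (NL a k) \<le> w k * (\<Sum>i\<in>UNIV. \<Sum>j\<in>UNIV. norm (freq k) ^ 2 * norm (Bc i j a k))"
      by (intro mult_left_mono submultD[OF w])
    also have "\<dots> = (\<Sum>i\<in>UNIV. \<Sum>j\<in>UNIV. mwt w 2 k * norm (Bc i j a k))"
      by (simp add: sum_distrib_left mwt_def mult_ac)
    finally show "ennreal (w k * norm (NL a k)) \<le> (\<Sum>i\<in>UNIV. \<Sum>j\<in>UNIV. ennreal (mwt w 2 k * norm (Bc i j a k)))"
      by (simp add: mwt_nonneg[OF w] sum_nonneg sum_ennreal ennreal_leI)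
  qed
  also have "\<dots> = (\<Sum>i\<in>UNIV. \<Sum>j\<in>UNIV. wnorm (mwt w 2) (\<lambda>x. ser (Dc i a) x * ser (Dc j a) x * (1 / (1 + ser a x))))"
    by (simp add: nn_integral_sum wnorm_def Bc_def)
  also have "\<dots> \<le> (\<Sum>i\<in>(UNIV :: 'n set). \<Sum>j\<in>(UNIV :: 'n set). ennreal (P1 z * mom w 4 a))"
    by (intro sum_mono) (use Bc_bd(2)[OF w a z] in \<open>auto simp: bd_def\<close>)
  also have "\<dots> = ennreal ((real CARD('n))\<^sup>2 * P1 z * mom w 4 a)"
  proof -
    have "0 \<le> P1 z * mom w 4 a"
      using Bc_bd(2)[OF w a z] by (simp add: bd_def)
    then show ?thesis
      by (simp add: power2_eq_square ennreal_of_nat_eq_real_of_nat ennreal_mult[symmetric] mult.assoc)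
  qed
  finally show ?thesis .
qed

section \<open>The truncated Euler scheme\<close>

lemma finite_freq_le: "finite {k :: int ^ 'n::finite. norm (freq k) \<le> r}"
proof -
  have "finite {f. f \<in> (UNIV :: 'n set) \<rightarrow>\<^sub>E {- \<lceil>r\<rceil>..\<lceil>r\<rceil>}}"
    using finite_PiE[of "UNIV :: 'n set" "\<lambda>_. {- \<lceil>r\<rceil>..\<lceil>r\<rceil>}"] by simp
  moreover have "vec_nth ` {k :: int ^ 'n. norm (freq k) \<le> r} \<subseteq> {f. f \<in> (UNIV :: 'n set) \<rightarrow>\<^sub>E {- \<lceil>r\<rceil>..\<lceil>r\<rceil>}}"
  proof -
    have "- \<lceil>r\<rceil> \<le> k $ i \<and> k $ i \<le> \<lceil>r\<rceil>" if "norm (freq k) \<le> r" for k :: "int ^ 'n" and i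
    proof -
      have "\<bar>real_of_int (k $ i)\<bar> \<le> r"
        using component_le_norm_cart[of "freq k" i] that by (simp add: freq_def)
      then show ?thesis
        by linarith
    qed
    then show ?thesis
      by (auto simp: PiE_UNIV_domain)
  qed
  moreover have "inj_on vec_nth {k :: int ^ 'n. norm (freq k) \<le> r}"
    by (auto intro: inj_onI simp: vec_eq_iff)
  ultimately show ?thesis
    by (meson finite_imageD finite_subset)
qed

lemma integrable_count_space_finite_support:
  fixes f :: "'k \<Rightarrow> 'b::{banach, second_countable_topology}"
  assumes "finite A" "\<And>k. k \<notin> A \<Longrightarrow> f k = 0"
  shows "integrable (count_space UNIV) f"
proof -
  have "(\<integral>\<^sup>+k. ennreal (norm (f k)) \<partial>count_space UNIV) = (\<Sum>k\<in>A. ennreal (norm (f k)))"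
    using assms by (intro nn_integral_count_space') auto
  also have "\<dots> < \<infinity>"
    using assms(1) by simp
  finally show ?thesis
    by (simp add: integrable_iff_bounded)
qed

lemma fin_mom_finite_support:
  assumes "finite A" "\<And>k. k \<notin> A \<Longrightarrow> a k = 0"
  shows "fin_mom w a"
  unfolding fin_mom_def using assms
  by (intro allI impI integrable_count_space_finite_support[OF assms(1)]) simp

text \<open>A discrete exponential, close to exp (b j |k|) for small b; one further factor is gained
  at each time step.\<close>

definition pw :: "real \<Rightarrow> nat \<Rightarrow> int ^ 'n::finite \<Rightarrow> real" where
  "pw b j k = (1 + b * norm (freq k)) ^ j"

text \<open>1 + b (x + y) \<le> (1 + b x) (1 + b y) for nonnegative b, x, y, and powers preserve the
  inequality.\<close>

lemma submult_pw:
  assumes "0 \<le> b"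
  shows "submult (pw b j)"
  unfolding submult_def pw_def
proof (intro conjI allI)
  fix k l :: "int ^ 'n"
  show "1 \<le> (1 + b * norm (freq k)) ^ j"
    using assms by (intro one_le_power) simp
  have "1 + b * norm (freq (k + l)) \<le> 1 + b * (norm (freq k) + norm (freq l))"
    using assms by (intro add_left_mono mult_left_mono norm_freq_add_le)
  also have "\<dots> \<le> (1 + b * norm (freq k)) * (1 + b * norm (freq l))"
    using assms by (simp add: algebra_simps)
  finally have "(1 + b * norm (freq (k + l))) ^ j \<le> ((1 + b * norm (freq k)) * (1 + b * norm (freq l))) ^ j"
    using assms by (intro power_mono) auto
  then show "(1 + b * norm (freq (k + l))) ^ j \<le> (1 + b * norm (freq k)) ^ j * (1 + b * norm (freq l)) ^ j"
    by (simp add: power_mult_distrib)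
qed simp

text \<open>The symmetry of the coefficients of a real-valued function.\<close>

definition herm :: "(int ^ 'n::finite \<Rightarrow> complex) \<Rightarrow> bool" where
  "herm a \<longleftrightarrow> (\<forall>k. a (- k) = cnj (a k))"

lemma herm_Dc: "herm a \<Longrightarrow> herm (Dc i a)"
  by (simp add: herm_def Dc_def freq_uminus)

lemma ser_real:
  assumes "herm a"
  shows "cnj (ser a x) = ser a x"
proof -
  have "cnj (ser a x) = (\<integral>k. cnj (a k * wave k x) \<partial>count_space UNIV)"
    unfolding ser_def by (rule Bochner_Integration.integral_cnj[symmetric])
  also have "\<dots> = (\<integral>k. a (- k) * wave (- k) x \<partial>count_space UNIV)"
    using assms by (simp add: herm_def cnj_wave)
  also have "\<dots> = ser a x"
    unfolding ser_def
    by (rule integral_bij_count_space) (rule bij_betwI[where g = uminus]; simp)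
  finally show ?thesis .
qed

lemma fc_uminus_of_real:
  assumes "\<And>x. cnj (f x) = f x"
  shows "fc f (- k) = cnj (fc f k)"
proof -
  have "cnj (LINT x|torus. f x * wave (- k) x) = (LINT x|torus. cnj (f x * wave (- k) x))"
    by (rule Bochner_Integration.integral_cnj[symmetric])
  also have "\<dots> = (LINT x|torus. f x * wave k x)"
    by (simp add: assms cnj_wave)
  finally have "cnj (LINT x|torus. f x * wave (- k) x) = (LINT x|torus. f x * wave k x)" .
  then show ?thesis
    by (simp add: fc_def)
qed

lemma herm_Bc: "herm a \<Longrightarrow> herm (Bc i j a)"
  unfolding Bc_def herm_def[of "fc _"]
  by (intro allI fc_uminus_of_real) (simp add: ser_real herm_Dc)

lemma herm_NL: "herm a \<Longrightarrow> herm (NL a)"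
  using herm_Bc[of a] by (simp add: herm_def[of "NL a"] herm_def[of "Bc _ _ a"] NL_def freq_uminus)

text \<open>The nonlinear term of a truncated sequence may have modes beyond the cutoff, so the
  truncation is applied to the result of each step.\<close>

definition euler_step :: "real \<Rightarrow> nat \<Rightarrow> (int ^ 'n::finite \<Rightarrow> complex) \<Rightarrow> int ^ 'n \<Rightarrow> complex" where
  "euler_step h n a k = (if norm (freq k) \<le> real n
     then a k + of_real h * (- of_real (norm (freq k) ^ 4) * a k + NL a k) else 0)"

lemma herm_euler_step: "herm a \<Longrightarrow> herm (euler_step h n a)"
  using herm_NL[of a] by (simp add: herm_def euler_step_def)

lemma euler_step_0: "a 0 = 0 \<Longrightarrow> euler_step h n a 0 = 0"
  by (simp add: euler_step_def NL_def)

lemma NL_integrable: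
  fixes a :: "int ^ 'n::finite \<Rightarrow> complex"
  assumes w: "submult w" and a: "fin_mom w a" and z: "mom w 0 a \<le> z" "z < 1"
  shows "integrable (count_space UNIV) (\<lambda>k. w k * norm (NL a k))"
    and "(\<integral>k. w k * norm (NL a k) \<partial>count_space UNIV) \<le> (real CARD('n))\<^sup>2 * P1 z * mom w 4 a"
proof -
  have 0: "0 \<le> w k * norm (NL a k)" for k
    using submultD(3)[OF w] by simp
  note le = NL_estimate[OF w a z]
  have P: "0 \<le> P1 z * mom w 4 a"
    using Bc_bd(2)[OF w a z] by (simp add: bd_def)
  show *: "integrable (count_space UNIV) (\<lambda>k. w k * norm (NL a k))"
    unfolding integrable_iff_bounded using le by (auto simp: abs_mult submultD(3)[OF w] intro: le_less_trans)
  have "ennreal (\<integral>k. w k * norm (NL a k) \<partial>count_space UNIV) \<le> ennreal ((real CARD('n))\<^sup>2 * P1 z * mom w 4 a)"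
    using le by (subst nn_integral_eq_integral[OF *, symmetric]) (auto simp: 0)
  then show "(\<integral>k. w k * norm (NL a k) \<partial>count_space UNIV) \<le> (real CARD('n))\<^sup>2 * P1 z * mom w 4 a"
    using P by (simp add: mult.assoc)
qed

text \<open>Three effects are balanced. Since h n^4 \<le> 1, the factor 1 - h |k|^4 is nonnegative
  and the linear part gains h |k|^4 |a k|. The additional weight factor costs b h |k| |a k|, which
  is at most b h |k|^4 |a k| because the zero mode vanishes and other frequencies have length at
  least 1. The nonlinear term is amplified by at most 1 + b h n.\<close>

lemma euler_step_mom_le:
  fixes a :: "int ^ 'n::finite \<Rightarrow> complex"
  assumes h: "0 \<le> h" "h * real n ^ 4 \<le> 1" and b: "0 \<le> b"
    and a: "a 0 = 0" "\<And>k. real n < norm (freq k) \<Longrightarrow> a k = 0"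
    and z: "mom (pw (b * h) j) 0 a \<le> z" "z < 1"
  shows "mom (pw (b * h) (Suc j)) 0 (euler_step h n a)
      \<le> mom (pw (b * h) j) 0 a
        - h * (1 - b - (1 + b * h * real n) * ((real CARD('n))\<^sup>2 * P1 z)) * mom (pw (b * h) j) 4 a"
proof -
  define w :: "int ^ 'n \<Rightarrow> real" where "w = pw (b * h) j"
  define p where "p = (real CARD('n))\<^sup>2 * P1 z"
  have bh: "0 \<le> b * h"
    using b h by simp
  have w: "submult w"
    unfolding w_def by (rule submult_pw[OF bh])
  note fs = fin_mom_finite_support[OF finite_freq_le[where r = "real n"]]
  have fa: "fin_mom w a"
    by (rule fs) (use a(2) in auto)
  have fa': "fin_mom (pw (b * h) (Suc j)) (euler_step h n a)"
    by (rule fs) (auto simp: euler_step_def)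
  note NLi = NL_integrable[OF w fa z[folded w_def]]
  have pt: "pw (b * h) (Suc j) k * norm (euler_step h n a k)
      \<le> mwt w 0 k * norm (a k) - h * (1 - b) * (mwt w 4 k * norm (a k)) + h * (1 + b * h * real n) * (w k * norm (NL a k))" for k
  proof (cases "norm (freq k) \<le> real n")
    case False
    then show ?thesis
      using a(2)[of k] h bh submultD(3)[OF w, of k] by (simp add: euler_step_def)
  next
    case True
    define r where "r = norm (freq k)"
    have r: "0 \<le> r" "r \<le> real n"
      using True by (auto simp: r_def)
    have "h * r ^ 4 \<le> h * real n ^ 4"
      using r h by (intro mult_left_mono power_mono) auto
    then have hr: "h * r ^ 4 \<le> 1"
      using h by linarith
    have "norm (euler_step h n a k) = norm (of_real (1 - h * r ^ 4) * a k + of_real h * NL a k)"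
      using True by (simp add: euler_step_def r_def algebra_simps)
    also have "\<dots> \<le> (1 - h * r ^ 4) * norm (a k) + h * norm (NL a k)"
      using h hr by (intro norm_triangle_le) (simp add: norm_mult del: of_real_diff)
    finally have "(1 + b * h * r) * norm (euler_step h n a k)
        \<le> (1 + b * h * r) * ((1 - h * r ^ 4) * norm (a k) + h * norm (NL a k))"
      using bh r by (intro mult_left_mono) auto
    also have "\<dots> = norm (a k) + h * (b * (r * norm (a k)) - r ^ 4 * norm (a k))
        - b * h * r * (h * r ^ 4) * norm (a k) + (1 + b * h * r) * (h * norm (NL a k))"
      by (simp add: algebra_simps)
    \<comment> \<open>The product of the weight increment with the linear damping has a favourable
      sign and is dropped.\<close>
    also have "\<dots> \<le> norm (a k) + h * (b * (r ^ 4 * norm (a k)) - r ^ 4 * norm (a k))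
        - 0 + (1 + b * h * real n) * (h * norm (NL a k))"
    proof -
      have "r * norm (a k) \<le> r ^ 4 * norm (a k)"
      proof (cases "k = 0")
        case False
        then have "1 \<le> r"
          unfolding r_def by (rule norm_freq_ge_1)
        then have "r ^ 1 \<le> r ^ 4"
          by (intro power_increasing) auto
        then show ?thesis
          by (intro mult_right_mono) auto
      qed (simp add: a(1))
      then have "h * (b * (r * norm (a k)) - r ^ 4 * norm (a k)) \<le> h * (b * (r ^ 4 * norm (a k)) - r ^ 4 * norm (a k))"
        using h b by (intro mult_left_mono diff_mono) auto
      moreover have "0 \<le> b * h * r * (h * r ^ 4) * norm (a k)"
        using h b r by simp
      moreover have "(1 + b * h * r) * (h * norm (NL a k)) \<le> (1 + b * h * real n) * (h * norm (NL a k))"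
        using h bh r by (intro mult_right_mono add_left_mono mult_left_mono) auto
      ultimately show ?thesis
        by linarith
    qed
    also have "\<dots> = norm (a k) - h * (1 - b) * (r ^ 4 * norm (a k)) + h * (1 + b * h * real n) * norm (NL a k)"
      by (simp add: algebra_simps)
    finally have "w k * ((1 + b * h * r) * norm (euler_step h n a k))
        \<le> w k * (norm (a k) - h * (1 - b) * (r ^ 4 * norm (a k)) + h * (1 + b * h * real n) * norm (NL a k))"
      by (intro mult_left_mono submultD(3)[OF w])
    moreover have "pw (b * h) (Suc j) k = w k * (1 + b * h * r)"
      by (simp add: pw_def w_def r_def)
    ultimately show ?thesis
      by (simp add: mwt_def r_def algebra_simps)
  qed
  have i: "integrable (count_space UNIV) (\<lambda>k. mwt w m k * norm (a k))" if "m \<le> 4" for m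
    by (rule fin_momD[OF fa that])
  have "mom (pw (b * h) (Suc j)) 0 (euler_step h n a) \<le> (\<integral>k. mwt w 0 k * norm (a k) - h * (1 - b) * (mwt w 4 k * norm (a k))
      + h * (1 + b * h * real n) * (w k * norm (NL a k)) \<partial>count_space UNIV)"
    unfolding mom_def
  proof (rule integral_mono)
    show "integrable (count_space UNIV) (\<lambda>k. mwt (pw (b * h) (Suc j)) 0 k * norm (euler_step h n a k))"
      by (rule fin_momD[OF fa']) simp
    show "integrable (count_space UNIV) (\<lambda>k. mwt w 0 k * norm (a k) - h * (1 - b) * (mwt w 4 k * norm (a k))
      + h * (1 + b * h * real n) * (w k * norm (NL a k)))"
      using i[of 0] i[of 4] NLi(1) by (intro Bochner_Integration.integrable_add Bochner_Integration.integrable_diff integrable_mult_right) auto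
    show "mwt (pw (b * h) (Suc j)) 0 k * norm (euler_step h n a k) \<le> mwt w 0 k * norm (a k) - h * (1 - b) * (mwt w 4 k * norm (a k))
      + h * (1 + b * h * real n) * (w k * norm (NL a k))" for k
      using pt[of k] by (simp add: mwt_def)
  qed
  also have "\<dots> = mom w 0 a - h * (1 - b) * mom w 4 a
      + h * (1 + b * h * real n) * (\<integral>k. w k * norm (NL a k) \<partial>count_space UNIV)"
    using i[of 0] i[of 4] NLi(1) by (simp add: mom_def)
  also have "\<dots> \<le> mom w 0 a - h * (1 - b) * mom w 4 a + h * (1 + b * h * real n) * (p * mom w 4 a)"
    using NLi(2) h bh by (intro add_left_mono mult_left_mono) (auto simp: p_def)
  also have "\<dots> = mom w 0 a - h * (1 - b - (1 + b * h * real n) * p) * mom w 4 a"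
    by (simp add: algebra_simps)
  finally show ?thesis
    by (simp add: w_def p_def)
qed

text \<open>For a single mode both derivatives outside the quotient become the factor |k|^2, so that
  the first moment suffices; this weak dependence is what makes the time increments equicontinuous.
  A single coefficient is bounded by the sum of all of them.\<close>

lemma norm_NL_le:
  fixes a :: "int ^ 'n::finite \<Rightarrow> complex"
  assumes w: "submult w" and a: "fin_mom w a" and z: "mom w 0 a \<le> z" "z < 1"
  shows "norm (NL a k) \<le> (real CARD('n))\<^sup>2 * norm (freq k) ^ 2 * ((mom w 1 a)\<^sup>2 / (1 - z))"
proof -
  have B: "norm (Bc i j a k) \<le> (mom w 1 a)\<^sup>2 / (1 - z)" for i j
  proof -
    have "ennreal (norm (Bc i j a k)) = (\<integral>\<^sup>+l. ennreal (norm (Bc i j a l)) * indicator {k} l \<partial>count_space UNIV)"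
      by (subst nn_integral_count_space'[of "{k}"]) auto
    also have "\<dots> \<le> (\<integral>\<^sup>+l. ennreal (mwt w 0 l * norm (Bc i j a l)) \<partial>count_space UNIV)"
    proof (intro nn_integral_mono)
      fix l
      have "ennreal (norm (Bc i j a l)) \<le> ennreal (mwt w 0 l * norm (Bc i j a l))"
        using mult_right_mono[OF submultD(2)[OF w, of l], of "norm (Bc i j a l)"]
        by (intro ennreal_leI) (simp add: mwt_def)
      then show "ennreal (norm (Bc i j a l)) * indicator {k} l \<le> ennreal (mwt w 0 l * norm (Bc i j a l))"
        by (auto simp: indicator_def)
    qed
    also have "\<dots> \<le> ennreal ((mom w 1 a)\<^sup>2 / (1 - z))"
      using Bc_bd(1)[OF w a z] by (simp add: bd_def wnorm_def Bc_def)
    finally show ?thesis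
      using z by simp
  qed
  have "norm (NL a k) \<le> (\<Sum>i\<in>(UNIV::'n set). \<Sum>j\<in>(UNIV::'n set). norm (freq k) ^ 2 * ((mom w 1 a)\<^sup>2 / (1 - z)))"
    unfolding NL_def norm_minus_cancel
  proof (intro sum_norm_le)
    fix i j
    have "\<bar>freq k $ i\<bar> * \<bar>freq k $ j\<bar> \<le> norm (freq k) * norm (freq k)"
      by (intro mult_mono component_le_norm_cart) auto
    then have "norm (of_real (freq k $ i * freq k $ j) :: complex) \<le> norm (freq k) ^ 2"
      by (simp add: norm_mult power2_eq_square)
    then show "norm (of_real (freq k $ i * freq k $ j) * Bc i j a k) \<le> norm (freq k) ^ 2 * ((mom w 1 a)\<^sup>2 / (1 - z))"
      unfolding norm_mult by (intro mult_mono B) auto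
  qed
  then show ?thesis
    by (simp add: power2_eq_square algebra_simps)
qed

text \<open>J ln (1 + y) lies between J y (1 - y) and J y.\<close>

lemma tendsto_exp_power:
  fixes y :: "nat \<Rightarrow> real"
  assumes y: "y \<longlonglongrightarrow> 0" "\<And>n. 0 \<le> y n" and L: "(\<lambda>n. real (J n) * y n) \<longlonglongrightarrow> L"
  shows "(\<lambda>n. (1 + y n) ^ J n) \<longlonglongrightarrow> exp L"
proof -
  have "(\<lambda>n. real (J n) * ln (1 + y n)) \<longlonglongrightarrow> L"
  proof (rule tendsto_sandwich)
    have "(\<lambda>n. real (J n) * y n * (1 - y n)) \<longlonglongrightarrow> L * (1 - 0)"
      by (intro tendsto_mult L tendsto_diff y tendsto_const)
    then show "(\<lambda>n. real (J n) * y n * (1 - y n)) \<longlonglongrightarrow> L"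
      by simp
    have "\<forall>\<^sub>F n in sequentially. y n < 1"
      using y(1) by (rule order_tendstoD) simp
    then show "\<forall>\<^sub>F n in sequentially. real (J n) * y n * (1 - y n) \<le> real (J n) * ln (1 + y n)"
    proof eventually_elim
      case (elim n)
      then have "y n - (y n)\<^sup>2 \<le> ln (1 + y n)"
        using y(2)[of n] by (intro ln_one_plus_pos_lower_bound) auto
      then have "real (J n) * (y n - (y n)\<^sup>2) \<le> real (J n) * ln (1 + y n)"
        by (intro mult_left_mono) auto
      then show ?case
        by (simp add: power2_eq_square algebra_simps)
    qed
    show "\<forall>\<^sub>F n in sequentially. real (J n) * ln (1 + y n) \<le> real (J n) * y n"
      by (intro always_eventually allI mult_left_mono ln_add_one_self_le_self y) simp
  qed (rule L)
  then have "(\<lambda>n. exp (real (J n) * ln (1 + y n))) \<longlonglongrightarrow> exp L"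
    by (rule tendsto_exp)
  moreover have "exp (real (J n) * ln (1 + y n)) = (1 + y n) ^ J n" for n
    using y(2)[of n] by (simp add: exp_of_nat_mult)
  ultimately show ?thesis
    by simp
qed

text \<open>Stated over a semiring, to serve \<open>ennreal\<close>-valued and complex step
  functions alike. The intervals are half-open, so that each t \<ge> 0 lies in exactly one.\<close>

lemma step_function_decomp:
  fixes F :: "nat \<Rightarrow> 'a::semiring_1"
  assumes h: "0 < h"
  shows "F (nat \<lfloor>t / h\<rfloor>) * indicator {0..<real J * h} t = (\<Sum>j<J. F j * indicator {real j * h..<real (Suc j) * h} t)"
proof (cases "0 \<le> t")
  case False
  then have "t \<notin> {real j * h..<real (Suc j) * h}" for j
    using h by (auto simp: not_le intro: less_le_trans)
  with False show ?thesis
    by simp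
next
  case True
  define m where "m = nat \<lfloor>t / h\<rfloor>"
  have m: "real m = of_int \<lfloor>t / h\<rfloor>"
    using True h by (simp add: m_def)
  have "real m \<le> t / h" "t / h < real m + 1"
    unfolding m by linarith+
  then have mt: "real m * h \<le> t" "t < (real m + 1) * h"
    using h by (simp_all add: field_simps)
  have iff: "t \<in> {real j * h..<real (Suc j) * h} \<longleftrightarrow> j = m" for j
  proof
    assume "t \<in> {real j * h..<real (Suc j) * h}"
    then have "real j * h < (real m + 1) * h" "real m * h < (real j + 1) * h"
      using mt by (auto simp: add.commute)
    then have "real j < real m + 1" "real m < real j + 1"
      using h by (auto simp: mult_less_cancel_right)
    then show "j = m"
      by linarith
  qed (use mt in \<open>auto simp: add.commute\<close>)
  have "t < real J * h \<longleftrightarrow> m < J"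
  proof
    assume "t < real J * h"
    then have "real m * h < real J * h"
      using mt by linarith
    then show "m < J"
      using h by (simp add: mult_less_cancel_right)
  next
    assume "m < J"
    then have "(real m + 1) * h \<le> real J * h"
      using h by (intro mult_right_mono) auto
    then show "t < real J * h"
      using mt by linarith
  qed
  then have "F m * indicator {0..<real J * h} t = (\<Sum>j<J. if j = m then F j else 0)"
    using True by (simp add: indicator_def)
  also have "\<dots> = (\<Sum>j<J. F j * indicator {real j * h..<real (Suc j) * h} t)"
    unfolding indicator_def iff by (intro sum.cong refl) simp
  finally show ?thesis
    by (simp add: m_def)
qed

lemma nn_integral_step:
  fixes F :: "nat \<Rightarrow> ennreal"
  assumes h: "0 < h"
  shows "(\<integral>\<^sup>+t. F (nat \<lfloor>t / h\<rfloor>) * indicator {0..<real J * h} t \<partial>lborel) = (\<Sum>j<J. ennreal h * F j)"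
proof -
  have "(\<integral>\<^sup>+t. F (nat \<lfloor>t / h\<rfloor>) * indicator {0..<real J * h} t \<partial>lborel)
      = (\<integral>\<^sup>+t. (\<Sum>j<J. F j * indicator {real j * h..<real (Suc j) * h} t) \<partial>lborel)"
    by (simp only: step_function_decomp[OF h])
  also have "\<dots> = (\<Sum>j<J. \<integral>\<^sup>+t. F j * indicator {real j * h..<real (Suc j) * h} t \<partial>lborel)"
    by (rule nn_integral_sum) simp
  also have "\<dots> = (\<Sum>j<J. ennreal h * F j)"
    by (intro sum.cong refl) (use h in \<open>simp add: nn_integral_cmult_indicator algebra_simps mult.commute\<close>)
  finally show ?thesis .
qed

lemma P1_nonneg: "0 \<le> z \<Longrightarrow> z < 1 \<Longrightarrow> 0 \<le> P1 z"
  by (simp add: P1_def)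

section \<open>The scheme for a small datum and its bounds uniform in the step size\<close>

locale wiener_datum =
  fixes v :: "int ^ 'n::finite \<Rightarrow> complex"
  assumes v_l1: "l1 v" and v_0: "v 0 = 0" and v_herm: "herm v"
    and z_less: "(\<integral>k. norm (v k) \<partial>count_space UNIV) < 1"
    and small: "(real CARD('n))\<^sup>2 * P1 (\<integral>k. norm (v k) \<partial>count_space UNIV) < 1"
begin

definition z :: real where "z = (\<integral>k. norm (v k) \<partial>count_space UNIV)"
definition \<delta> :: real where "\<delta> = 1 - (real CARD('n))\<^sup>2 * P1 z"

text \<open>
  The step satisfies \<open>h n\<^sup>4 \<le> 1\<close> and \<open>h n \<rightarrow> 0\<close>; the reduced rate \<open>rt n\<close> compensates for the factor
  \<open>1 + b h n\<close> that the growing weight produces in the nonlinear term.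
\<close>

definition hs :: "nat \<Rightarrow> real" where "hs n = 1 / (real n + 1) ^ 5"
definition rt :: "nat \<Rightarrow> real" where "rt n = \<delta> / (1 + hs n * real n)"

primrec euler :: "nat \<Rightarrow> nat \<Rightarrow> int ^ 'n \<Rightarrow> complex" where
  "euler n 0 = (\<lambda>k. if norm (freq k) \<le> real n then v k else 0)"
| "euler n (Suc j) = euler_step (hs n) n (euler n j)"

lemma z: "0 \<le> z" "z < 1"
  using z_less by (simp_all add: z_def)

lemma \<delta>: "0 < \<delta>" "\<delta> \<le> 1" "(real CARD('n))\<^sup>2 * P1 z = 1 - \<delta>"
  using small P1_nonneg[OF z] by (simp_all add: \<delta>_def z_def)

lemma hs: "0 < hs n" "hs n * real n ^ 4 \<le> 1" "hs n \<le> 1" "hs n * real n \<le> 1 / (real n + 1)"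
    "hs n \<le> 1 / (real n + 1)"
proof -
  have p: "(real n + 1) ^ 5 = (real n + 1) ^ 4 * (real n + 1)"
    by (simp add: eval_nat_numeral)
  have n1: "1 \<le> (real n + 1) ^ m" for m
    by (intro one_le_power) simp
  show "0 < hs n"
    by (simp add: hs_def)
  have "real n ^ 4 \<le> (real n + 1) ^ 4 * 1"
    by (simp add: power_mono)
  also have "\<dots> \<le> (real n + 1) ^ 5"
    unfolding p by (intro mult_left_mono) auto
  finally show "hs n * real n ^ 4 \<le> 1"
    by (simp add: hs_def)
  show "hs n \<le> 1"
    using n1[of 5] by (simp add: hs_def)
  have "real n * (real n + 1) \<le> (real n + 1) ^ 2"
    by (simp add: power2_eq_square algebra_simps)
  also have "\<dots> \<le> (real n + 1) ^ 5"
    by (intro power_increasing) auto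
  finally show "hs n * real n \<le> 1 / (real n + 1)"
    by (simp add: hs_def field_simps)
  have "(real n + 1) ^ 1 \<le> (real n + 1) ^ 5"
    by (intro power_increasing) auto
  then show "hs n \<le> 1 / (real n + 1)"
    unfolding hs_def by (intro divide_left_mono) auto
qed

lemma hs_tendsto: "hs \<longlonglongrightarrow> 0"
proof (rule tendsto_sandwich[of "\<lambda>_. 0"])
  show "(\<lambda>n. 1 / (real n + 1)) \<longlonglongrightarrow> 0"
    using LIMSEQ_inverse_real_of_nat by (simp add: inverse_eq_divide add.commute)
qed (auto intro!: always_eventually hs less_imp_le)

lemma rt: "0 \<le> rt n" "rt n \<le> \<delta>"
proof -
  have "1 \<le> 1 + hs n * real n"
    using hs(1)[of n] by simp
  then show "0 \<le> rt n" "rt n \<le> \<delta>"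
    using \<delta> by (auto simp: rt_def divide_le_eq mult_le_cancel_left1)
qed

lemma rt_tendsto: "rt \<longlonglongrightarrow> \<delta>"
proof -
  have "(\<lambda>n. hs n * real n) \<longlonglongrightarrow> 0"
  proof (rule tendsto_sandwich[of "\<lambda>_. 0"])
    show "(\<lambda>n. 1 / (real n + 1)) \<longlonglongrightarrow> 0"
      using LIMSEQ_inverse_real_of_nat by (simp add: inverse_eq_divide add.commute)
  qed (auto intro!: always_eventually hs(4) mult_nonneg_nonneg less_imp_le[OF hs(1)])
  then have "(\<lambda>n. \<delta> / (1 + hs n * real n)) \<longlonglongrightarrow> \<delta> / (1 + 0)"
    by (intro tendsto_intros) auto
  then show ?thesis
    by (simp add: rt_def[abs_def])
qed

lemma euler_zero: "euler n j 0 = 0"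
  by (induction j) (simp_all add: v_0 euler_step_0)

lemma euler_outside: "real n < norm (freq k) \<Longrightarrow> euler n j k = 0"
  by (cases j) (simp_all add: euler_step_def)

lemma euler_herm: "herm (euler n j)"
proof (induction j)
  case 0
  then show ?case
    using v_herm by (simp add: herm_def)
next
  case (Suc j)
  then show ?case
    by (simp add: herm_euler_step)
qed

lemma euler_fin_mom: "fin_mom w (euler n j)"
  by (rule fin_mom_finite_support[OF finite_freq_le[where r = "real n"]]) (auto intro: euler_outside)

lemma euler_start: "mom (pw b 0) 0 (euler n 0) \<le> z"
  unfolding mom_def z_def
proof (rule integral_mono)
  show "integrable (count_space UNIV) (\<lambda>k. mwt (pw b 0) 0 k * norm (euler n 0 k))"
    by (rule fin_momD[OF euler_fin_mom]) simp
qed (auto simp: mwt_def pw_def v_l1)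

text \<open>The hypothesis on b says that the fourth moment enters the one-step estimate with a
  favourable sign. The bound z for one step is what makes the nonlinear estimate available at the
  next, so smallness persists while the weight gains a factor.\<close>

lemma euler_mom_bound:
  assumes b: "0 \<le> b" "b + (1 + b * hs n * real n) * (1 - \<delta>) \<le> 1"
  shows "mom (pw (b * hs n) j) 0 (euler n j) \<le> z"
proof (induction j)
  case 0
  show ?case
    by (rule euler_start)
next
  case (Suc j)
  have "mom (pw (b * hs n) (Suc j)) 0 (euler_step (hs n) n (euler n j))
      \<le> mom (pw (b * hs n) j) 0 (euler n j)
        - hs n * (1 - b - (1 + b * hs n * real n) * ((real CARD('n))\<^sup>2 * P1 z)) * mom (pw (b * hs n) j) 4 (euler n j)"
    using hs(1)[of n] hs(2)[of n] b(1) euler_zero euler_outside Suc z(2)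
    by (intro euler_step_mom_le) auto
  also have "\<dots> \<le> mom (pw (b * hs n) j) 0 (euler n j)"
    unfolding \<delta>(3) using b hs(1)[of n]
    by (intro iffD2[OF diff_le_eq] iffD2[OF le_add_same_cancel1] mult_nonneg_nonneg mom_nonneg submult_pw) auto
  finally show ?case
    using Suc by simp
qed

lemma euler_rt_bound: "mom (pw (rt n * hs n) j) 0 (euler n j) \<le> z"
proof (rule euler_mom_bound[OF rt(1)])
  define x where "x = hs n * real n"
  have x: "0 \<le> x"
    using hs(1)[of n] by (simp add: x_def)
  \<comment> \<open>\<open>rt n\<close> is defined so that
    \<open>rt n * (1 + x) = \<delta>\<close>.\<close>
  have "rt n * (1 + x * (1 - \<delta>)) \<le> rt n * (1 + x * 1)"
    using x \<delta> by (intro mult_left_mono add_left_mono rt) auto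
  also have "\<dots> = \<delta>"
    using x by (simp add: rt_def x_def[symmetric])
  finally show "rt n + (1 + rt n * hs n * real n) * (1 - \<delta>) \<le> 1"
    by (simp add: x_def algebra_simps)
qed

abbreviation mom1 :: "nat \<Rightarrow> (int ^ 'n \<Rightarrow> complex) \<Rightarrow> real" where
  "mom1 \<equiv> mom (\<lambda>_. 1)"

lemma pw_0: "pw 0 j = (\<lambda>_ :: int ^ 'n. 1)"
  by (simp add: pw_def fun_eq_iff)

lemma euler_mom1_bound: "mom1 0 (euler n j) \<le> z"
  using euler_mom_bound[of 0 n j] \<delta> by (simp add: pw_0)

text \<open>With b = 0 the full margin \<delta> is left for the fourth moment, and the one-step
  estimates telescope.\<close>

lemma euler_dissipation: "mom1 0 (euler n J) + hs n * \<delta> * (\<Sum>j<J. mom1 4 (euler n j)) \<le> z"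
proof (induction J)
  case 0
  show ?case
    using euler_mom1_bound[of n 0] by simp
next
  case (Suc J)
  have "mom (pw (0 * hs n) (Suc J)) 0 (euler_step (hs n) n (euler n J))
      \<le> mom (pw (0 * hs n) J) 0 (euler n J)
        - hs n * (1 - 0 - (1 + 0 * hs n * real n) * ((real CARD('n))\<^sup>2 * P1 z)) * mom (pw (0 * hs n) J) 4 (euler n J)"
    using hs(1)[of n] hs(2)[of n] euler_zero euler_outside z(2) euler_mom1_bound[of n J]
    by (intro euler_step_mom_le) (auto simp: pw_0)
  then have "mom1 0 (euler n (Suc J)) \<le> mom1 0 (euler n J) - hs n * \<delta> * mom1 4 (euler n J)"
    unfolding \<delta>(3) by (simp add: pw_0)
  with Suc show ?case
    by (simp add: algebra_simps)
qed

lemma euler_sum_mom4: "(\<Sum>j<J. hs n * mom1 4 (euler n j)) \<le> z / \<delta>"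
proof -
  have "\<delta> * (\<Sum>j<J. hs n * mom1 4 (euler n j)) \<le> z"
    using euler_dissipation[of n J] mom_nonneg[OF submult_1, of 0 "euler n J"]
    by (simp add: sum_distrib_left[symmetric] mult_ac)
  then show ?thesis
    using \<delta>(1) by (simp add: field_simps)
qed

section \<open>Equicontinuity in time of the single modes\<close>

lemma norm_le_mom:
  assumes "submult w" "fin_mom w a"
  shows "w k * norm (a k) \<le> mom w 0 a"
proof -
  have "w k * norm (a k) = (\<integral>l. (w k * norm (a k)) * indicator {k} l \<partial>count_space UNIV)"
    by simp
  also have "\<dots> \<le> (\<integral>l. mwt w 0 l * norm (a l) \<partial>count_space UNIV)"
    by (intro integral_mono fin_momD[OF assms(2)] integrable_count_space_finite_support[of "{k}"])
       (auto simp: indicator_def mwt_def submultD(3)[OF assms(1)])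
  finally show ?thesis
    by (simp add: mom_def)
qed

lemma norm_eul_le: "norm (euler n j k) \<le> z"
  using norm_le_mom[OF submult_1 euler_fin_mom[where n = n and j = j], of k] euler_mom1_bound[of n j] by simp

text \<open>Free to grow with k, since compactness is required only mode by mode.\<close>

definition K :: "int ^ 'n \<Rightarrow> real" where
  "K k = norm (freq k) ^ 4 + (real CARD('n))\<^sup>2 * norm (freq k) ^ 2 / (1 - z)"

lemma K_nonneg: "0 \<le> K k"
  using z by (simp add: K_def)

definition rhs :: "(int ^ 'n \<Rightarrow> complex) \<Rightarrow> int ^ 'n \<Rightarrow> complex" where
  "rhs a k = - of_real (norm (freq k) ^ 4) * a k + NL a k"

text \<open>A_1^2 \<le> A_0 A_2 and A_0 < 1 leave the second moment as the only quantity that is not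
  bounded uniformly in time.\<close>

lemma norm_rhs_eul_le: "norm (rhs (euler n j) k) \<le> K k * (1 + mom1 2 (euler n j))"
proof -
  define a where "a = euler n j"
  have fa: "fin_mom (\<lambda>_. 1) a"
    by (simp add: a_def euler_fin_mom)
  have "(mom1 1 a)\<^sup>2 \<le> mom1 0 a * mom1 2 a"
    by (rule mom_interpolation(2)[OF submult_1 fa])
  also have "\<dots> \<le> 1 * mom1 2 a"
    using euler_mom1_bound[of n j] z by (intro mult_right_mono mom_nonneg submult_1) (auto simp: a_def)
  finally have 1: "(mom1 1 a)\<^sup>2 \<le> mom1 2 a"
    by simp
  have "norm (NL a k) \<le> (real CARD('n))\<^sup>2 * norm (freq k) ^ 2 * ((mom1 1 a)\<^sup>2 / (1 - z))"
    using euler_mom1_bound[of n j] z(2) by (intro norm_NL_le[OF submult_1 fa]) (auto simp: a_def)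
  also have "\<dots> \<le> (real CARD('n))\<^sup>2 * norm (freq k) ^ 2 * (mom1 2 a / (1 - z))"
    using 1 z by (intro mult_left_mono divide_right_mono) auto
  finally have 2: "norm (NL a k) \<le> (real CARD('n))\<^sup>2 * norm (freq k) ^ 2 / (1 - z) * mom1 2 a"
    by simp
  have "norm (rhs a k) \<le> norm (freq k) ^ 4 * norm (a k) + norm (NL a k)"
    unfolding rhs_def by (intro norm_triangle_le) (simp add: norm_mult norm_power)
  also have "\<dots> \<le> norm (freq k) ^ 4 * 1 + (real CARD('n))\<^sup>2 * norm (freq k) ^ 2 / (1 - z) * mom1 2 a"
    using norm_eul_le[of n j k] z 2 by (intro add_mono mult_left_mono) (auto simp: a_def)
  also have "\<dots> \<le> K k * (1 + mom1 2 a)"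
  proof -
    define c where "c = (real CARD('n))\<^sup>2 * norm (freq k) ^ 2 / (1 - z)"
    have "0 \<le> c" "0 \<le> norm (freq k) ^ 4 * mom1 2 a"
      using z mom_nonneg[OF submult_1, of 2 a] by (auto simp: c_def)
    then show ?thesis
      unfolding K_def c_def[symmetric] by (simp add: algebra_simps)
  qed
  finally show ?thesis
    by (simp add: a_def)
qed

lemma euler_Suc: "norm (freq k) \<le> real n \<Longrightarrow> euler n (Suc j) k = euler n j k + of_real (hs n) * rhs (euler n j) k"
  by (simp add: euler_step_def rhs_def)

text \<open>The dissipation bounds only the sum over time of the fourth moments, which alone would
  permit jumps. With \<epsilon> at disposal its contribution to an increment becomes small, and the
  remainder is proportional to the elapsed time.\<close>

lemma euler_mom2_le:
  assumes "0 < \<epsilon>"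
  shows "mom1 2 (euler n j) \<le> \<epsilon> * mom1 4 (euler n j) + 1 / \<epsilon>"
proof -
  have i: "integrable (count_space UNIV) (\<lambda>k. mwt (\<lambda>_. 1) m k * norm (euler n j k))" if "m \<le> 4" for m
    using fin_momD[OF euler_fin_mom that] .
  have "mom1 2 (euler n j) \<le> (\<integral>k. \<epsilon> * (mwt (\<lambda>_. 1) 4 k * norm (euler n j k)) + 1 / \<epsilon> * (mwt (\<lambda>_. 1) 0 k * norm (euler n j k)) \<partial>count_space UNIV)"
    unfolding mom_def
  proof (rule integral_mono)
    fix k :: "int ^ 'n"
    define x where "x = (norm (freq k))\<^sup>2"
    have "0 \<le> (\<epsilon> * x - 1)\<^sup>2 + \<epsilon> * x"
      using assms by (simp add: x_def)
    then have "\<epsilon> * x \<le> \<epsilon> * (\<epsilon> * x\<^sup>2 + 1 / \<epsilon>)"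
      using assms by (simp add: power2_eq_square algebra_simps)
    then have "x \<le> \<epsilon> * x\<^sup>2 + 1 / \<epsilon>"
      using assms by (simp add: mult_le_cancel_left)
    then have "x * norm (euler n j k) \<le> (\<epsilon> * x\<^sup>2 + 1 / \<epsilon>) * norm (euler n j k)"
      by (intro mult_right_mono) auto
    moreover have "x\<^sup>2 = norm (freq k) ^ 4"
      by (simp add: x_def flip: power_mult)
    ultimately show "mwt (\<lambda>_. 1) 2 k * norm (euler n j k)
        \<le> \<epsilon> * (mwt (\<lambda>_. 1) 4 k * norm (euler n j k)) + 1 / \<epsilon> * (mwt (\<lambda>_. 1) 0 k * norm (euler n j k))"
      by (simp add: mwt_def x_def[symmetric] algebra_simps)
  qed (use i[of 0] i[of 2] i[of 4] in \<open>auto intro!: Bochner_Integration.integrable_add integrable_mult_right\<close>)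
  also have "\<dots> = \<epsilon> * mom1 4 (euler n j) + 1 / \<epsilon> * mom1 0 (euler n j)"
    using i[of 0] i[of 4] by (simp add: mom_def)
  also have "\<dots> \<le> \<epsilon> * mom1 4 (euler n j) + 1 / \<epsilon> * 1"
    using euler_mom1_bound[of n j] z assms by (intro add_left_mono mult_left_mono) auto
  finally show ?thesis
    by simp
qed

text \<open>The first term measures the elapsed time \<open>real m * hs n\<close>; in the second the
  total dissipation z / \<delta> is spent regardless of the length of the interval, but with the
  small factor \<epsilon>.\<close>

lemma euler_increment:
  assumes k: "norm (freq k) \<le> real n" and \<epsilon>: "0 < \<epsilon>"
  shows "norm (euler n (J + m) k - euler n J k) \<le> K k * (real m * hs n * (1 + 1 / \<epsilon>) + \<epsilon> * (z / \<delta>))"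
proof -
  have step: "norm (euler n (Suc j) k - euler n j k) \<le> K k * (hs n * (1 + 1 / \<epsilon>) + \<epsilon> * (hs n * mom1 4 (euler n j)))" for j
  proof -
    have "norm (euler n (Suc j) k - euler n j k) = hs n * norm (rhs (euler n j) k)"
      unfolding euler_Suc[OF k] using hs(1)[of n] by (simp add: norm_mult)
    also have "\<dots> \<le> hs n * (K k * (1 + mom1 2 (euler n j)))"
      using hs(1)[of n] by (intro mult_left_mono norm_rhs_eul_le) auto
    also have "\<dots> \<le> hs n * (K k * (1 + (\<epsilon> * mom1 4 (euler n j) + 1 / \<epsilon>)))"
      using hs(1)[of n] by (intro mult_left_mono add_left_mono euler_mom2_le \<epsilon> K_nonneg) auto
    finally show ?thesis
      by (simp add: algebra_simps)
  qed
  have "norm (euler n (J + m) k - euler n J k)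
      \<le> K k * (real m * hs n * (1 + 1 / \<epsilon>) + \<epsilon> * (\<Sum>j\<in>{J..<J + m}. hs n * mom1 4 (euler n j)))"
  proof (induction m)
    case (Suc m)
    have "norm (euler n (J + Suc m) k - euler n J k)
        \<le> norm (euler n (J + m) k - euler n J k) + norm (euler n (Suc (J + m)) k - euler n (J + m) k)"
      using norm_triangle_ineq[of "euler n (J + m) k - euler n J k" "euler n (Suc (J + m)) k - euler n (J + m) k"]
      by (simp del: euler.simps)
    also have "\<dots> \<le> K k * (real m * hs n * (1 + 1 / \<epsilon>) + \<epsilon> * (\<Sum>j\<in>{J..<J + m}. hs n * mom1 4 (euler n j)))
        + K k * (hs n * (1 + 1 / \<epsilon>) + \<epsilon> * (hs n * mom1 4 (euler n (J + m))))"
      by (intro add_mono Suc step)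
    also have "\<dots> = K k * (real (Suc m) * hs n * (1 + 1 / \<epsilon>) + \<epsilon> * (\<Sum>j\<in>{J..<J + Suc m}. hs n * mom1 4 (euler n j)))"
      by (simp add: algebra_simps)
    finally show ?case .
  qed simp
  also have "\<dots> \<le> K k * (real m * hs n * (1 + 1 / \<epsilon>) + \<epsilon> * (\<Sum>j<J + m. hs n * mom1 4 (euler n j)))"
    using hs(1)[of n] \<epsilon>
    by (intro mult_left_mono add_left_mono sum_mono2 K_nonneg)
       (auto intro!: mult_nonneg_nonneg mom_nonneg submult_1)
  also have "\<dots> \<le> K k * (real m * hs n * (1 + 1 / \<epsilon>) + \<epsilon> * (z / \<delta>))"
    using \<epsilon> by (intro mult_left_mono add_left_mono euler_sum_mom4 K_nonneg) auto
  finally show ?thesis .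
qed

definition approx :: "nat \<Rightarrow> real \<Rightarrow> int ^ 'n \<Rightarrow> complex" where
  "approx n t = euler n (nat \<lfloor>t / hs n\<rfloor>)"

lemma step_index:
  assumes "0 \<le> t"
  shows "real (nat \<lfloor>t / hs n\<rfloor>) * hs n \<le> t" "t - hs n < real (nat \<lfloor>t / hs n\<rfloor>) * hs n"
proof -
  have m: "real (nat \<lfloor>t / hs n\<rfloor>) = of_int \<lfloor>t / hs n\<rfloor>"
    using assms hs(1)[of n] by (simp add: less_imp_le)
  have "of_int \<lfloor>t / hs n\<rfloor> \<le> t / hs n" "t / hs n < of_int \<lfloor>t / hs n\<rfloor> + 1"
    by linarith+
  then have "of_int \<lfloor>t / hs n\<rfloor> * hs n \<le> t" "t < (of_int \<lfloor>t / hs n\<rfloor> + 1) * hs n"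
    by (simp_all only: pos_le_divide_eq[OF hs(1)] pos_divide_less_eq[OF hs(1)])
  then show "real (nat \<lfloor>t / hs n\<rfloor>) * hs n \<le> t" "t - hs n < real (nat \<lfloor>t / hs n\<rfloor>) * hs n"
    unfolding m by (simp_all add: algebra_simps)
qed

text \<open>The additional \<open>hs n\<close> pays for rounding the times down to the grid.\<close>

lemma approx_increment:
  assumes k: "norm (freq k) \<le> real n" and \<epsilon>: "0 < \<epsilon>" and st: "0 \<le> s" "s \<le> t"
  shows "norm (approx n t k - approx n s k) \<le> K k * ((t - s + hs n) * (1 + 1 / \<epsilon>) + \<epsilon> * (z / \<delta>))"
proof -
  define J where "J = nat \<lfloor>s / hs n\<rfloor>"
  define m where "m = nat \<lfloor>t / hs n\<rfloor> - J"
  have "\<lfloor>s / hs n\<rfloor> \<le> \<lfloor>t / hs n\<rfloor>"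
    using st hs(1)[of n] by (intro floor_mono divide_right_mono) auto
  then have Jm: "nat \<lfloor>t / hs n\<rfloor> = J + m"
    by (simp add: J_def m_def)
  have "real m * hs n = real (J + m) * hs n - real J * hs n"
    by (simp add: algebra_simps)
  also have "\<dots> \<le> t - s + hs n"
  proof -
    have "s - hs n < real J * hs n" "real (J + m) * hs n \<le> t"
      using step_index(2)[of s n] step_index(1)[of t n] st Jm J_def by simp_all
    then show ?thesis
      by linarith
  qed
  finally have "real m * hs n * (1 + 1 / \<epsilon>) \<le> (t - s + hs n) * (1 + 1 / \<epsilon>)"
    using \<epsilon> by (intro mult_right_mono) auto
  then have "K k * (real m * hs n * (1 + 1 / \<epsilon>) + \<epsilon> * (z / \<delta>)) \<le> K k * ((t - s + hs n) * (1 + 1 / \<epsilon>) + \<epsilon> * (z / \<delta>))"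
    by (intro mult_left_mono add_right_mono K_nonneg)
  with euler_increment[OF k \<epsilon>, of J m] show ?thesis
    unfolding approx_def Jm J_def[symmetric] by linarith
qed

end

section \<open>Passage to the limit\<close>

definition gam :: "int ^ 'n::finite \<Rightarrow> real" where
  "gam k = (\<Prod>i\<in>UNIV. 1 / (1 + (real_of_int (k $ i))\<^sup>2))"

lemma gam_pos: "0 < gam k"
proof -
  have "0 < 1 / (1 + (real_of_int (k $ i))\<^sup>2)" for i
    by (simp add: add_pos_nonneg)
  then show ?thesis
    unfolding gam_def by (intro prod_pos) auto
qed

lemma abs_summable_int_inverse_square: "Infinite_Set_Sum.abs_summable_on (\<lambda>m::int. 1 / (1 + (real_of_int m)\<^sup>2)) UNIV"
proof -
  have "summable (\<lambda>n::nat. inverse (real n ^ 2))"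
    by (intro inverse_power_summable) simp
  then have "summable (\<lambda>n::nat. 1 / (1 + (real n)\<^sup>2))"
  proof (rule summable_comparison_test[rotated])
    have "norm (1 / (1 + (real n)\<^sup>2)) \<le> inverse (real n ^ 2)" if "n \<ge> 1" for n
      using that by (simp add: inverse_eq_divide frac_le)
    then show "\<exists>N. \<forall>n\<ge>N. norm (1 / (1 + (real n)\<^sup>2)) \<le> inverse (real n ^ 2)"
      by blast
  qed
  then have nat: "Infinite_Set_Sum.abs_summable_on (\<lambda>n::nat. 1 / (1 + (real n)\<^sup>2)) UNIV"
    by (simp add: abs_summable_on_nat_iff')
  have "bij_betw int UNIV {0..}" "bij_betw (\<lambda>n. - int n) UNIV {..0}"
    by (rule bij_betwI[where g = nat]; auto) (rule bij_betwI[where g = "\<lambda>m. nat (- m)"]; auto)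
  from this[THEN abs_summable_on_reindex_bij_betw, where f = "\<lambda>m. 1 / (1 + (real_of_int m)\<^sup>2)"]
  have "Infinite_Set_Sum.abs_summable_on (\<lambda>m::int. 1 / (1 + (real_of_int m)\<^sup>2)) {0..}"
    "Infinite_Set_Sum.abs_summable_on (\<lambda>m::int. 1 / (1 + (real_of_int m)\<^sup>2)) {..0}"
    using nat by simp_all
  then have "Infinite_Set_Sum.abs_summable_on (\<lambda>m::int. 1 / (1 + (real_of_int m)\<^sup>2)) ({0..} \<union> {..0})"
    by (rule abs_summable_on_union)
  moreover have "{0..} \<union> {..0} = (UNIV :: int set)"
    by auto
  ultimately show ?thesis
    by simp
qed

text \<open>The product form of \<open>gam\<close> reduces summability over the lattice to one
  dimension.\<close>

lemma integrable_gam: "integrable (count_space UNIV) (gam :: int ^ 'n::finite \<Rightarrow> real)"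
proof -
  have "Infinite_Set_Sum.abs_summable_on (\<lambda>g. \<Prod>i\<in>(UNIV::'n set). 1 / (1 + (real_of_int (g i))\<^sup>2)) (PiE UNIV (\<lambda>_. UNIV))"
    by (intro abs_summable_on_prod_PiE abs_summable_int_inverse_square) auto
  moreover have "bij_betw vec_nth (UNIV :: (int ^ 'n) set) (PiE UNIV (\<lambda>_. UNIV))"
    by (rule bij_betwI[where g = vec_lambda]) auto
  ultimately have "Infinite_Set_Sum.abs_summable_on (\<lambda>k :: int ^ 'n. \<Prod>i\<in>(UNIV::'n set). 1 / (1 + (real_of_int (k $ i))\<^sup>2)) UNIV"
    using abs_summable_on_reindex_bij_betw[of vec_nth "UNIV :: (int ^ 'n) set" "PiE UNIV (\<lambda>_. UNIV)"
        "\<lambda>g. \<Prod>i\<in>(UNIV::'n set). 1 / (1 + (real_of_int (g i))\<^sup>2)"] by simp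
  then show ?thesis
    by (simp add: abs_summable_on_def gam_def[abs_def])
qed

text \<open>1 + k_i^2 \<le> 2 |k|^2 in each coordinate, so \<open>gam\<close> decays no faster than
  |k|^(-2 d).\<close>

lemma gam_lower: "k \<noteq> 0 \<Longrightarrow> 1 \<le> 2 ^ CARD('n) * norm (freq k) ^ (2 * CARD('n)) * gam (k :: int ^ 'n::finite)"
proof -
  assume k: "k \<noteq> 0"
  have n1: "1 \<le> norm (freq k)"
    using k by (rule norm_freq_ge_1)
  have "1 / (2 * (norm (freq k))\<^sup>2) \<le> 1 / (1 + (real_of_int (k $ i))\<^sup>2)" for i
  proof (intro divide_left_mono)
    have "\<bar>real_of_int (k $ i)\<bar> \<le> norm (freq k)"
      using component_le_norm_cart[of "freq k" i] by (simp add: freq_def)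
    then have "(real_of_int (k $ i))\<^sup>2 \<le> (norm (freq k))\<^sup>2"
      by (metis abs_ge_zero power2_abs power_mono)
    moreover have "1 \<le> (norm (freq k))\<^sup>2"
      using n1 by simp
    ultimately show "1 + (real_of_int (k $ i))\<^sup>2 \<le> 2 * (norm (freq k))\<^sup>2"
      by linarith
    show "0 < 2 * (norm (freq k))\<^sup>2 * (1 + (real_of_int (k $ i))\<^sup>2)"
      using n1 by (intro mult_pos_pos zero_less_power add_pos_nonneg) auto
  qed simp
  then have "(\<Prod>i\<in>(UNIV :: 'n set). 1 / (2 * (norm (freq k))\<^sup>2)) \<le> gam k"
    unfolding gam_def by (intro prod_mono) auto
  then have "1 / (2 ^ CARD('n) * norm (freq k) ^ (2 * CARD('n))) \<le> gam k"
    by (simp add: power_divide power_mult_distrib flip: power_mult)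
  moreover have "0 < 2 ^ CARD('n) * norm (freq k) ^ (2 * CARD('n))"
    using n1 by (intro mult_pos_pos zero_less_power) auto
  ultimately show ?thesis
    by (simp add: pos_divide_le_eq mult.commute)
qed

text \<open>2 d additional powers of |k| are traded for summability; at k = 0, where powers give no
  information, the coefficient vanishes by hypothesis.\<close>

lemma moment_le_gam:
  fixes a :: "int ^ 'n::finite \<Rightarrow> complex"
  assumes "a 0 = 0" and C: "norm (freq k) ^ (2 * CARD('n) + j) * norm (a k) \<le> C"
  shows "norm (freq k) ^ j * norm (a k) \<le> C * 2 ^ CARD('n) * gam k"
proof (cases "k = 0")
  case True
  have "0 \<le> norm (freq k) ^ (2 * CARD('n) + j) * norm (a k)"
    by simp
  then have "0 \<le> C"
    using C by linarith
  then show ?thesis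
    using True assms(1) gam_pos[of k] by simp
next
  case False
  have "norm (freq k) ^ j * norm (a k) * 1
      \<le> norm (freq k) ^ j * norm (a k) * (2 ^ CARD('n) * norm (freq k) ^ (2 * CARD('n)) * gam k)"
    using gam_lower[OF False] by (intro mult_left_mono) auto
  also have "\<dots> = (norm (freq k) ^ (2 * CARD('n) + j) * norm (a k)) * (2 ^ CARD('n) * gam k)"
    by (simp add: power_add)
  also have "\<dots> \<le> C * (2 ^ CARD('n) * gam k)"
    using C gam_pos[of k] by (intro mult_right_mono) auto
  finally show ?thesis
    by simp
qed

text \<open>Bernoulli's inequality in each of m blocks of \<open>J div m\<close> factors. This is
  the discrete form of (x / m)^m \<le> exp x and extracts any power of |k| from the weight
  \<open>pw\<close>.\<close>

lemma one_plus_power_ge: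
  fixes x :: real
  assumes "0 \<le> x" "0 < m"
  shows "(real (J div m) * x) ^ m \<le> (1 + x) ^ J"
proof -
  have "(real (J div m) * x) ^ m \<le> (1 + real (J div m) * x) ^ m"
    using assms by (intro power_mono) auto
  also have "\<dots> \<le> ((1 + x) ^ (J div m)) ^ m"
    using assms by (intro power_mono Bernoulli_inequality) (auto intro: add_nonneg_nonneg)
  also have "\<dots> = (1 + x) ^ (J div m * m)"
    by (simp add: power_mult)
  also have "\<dots> \<le> (1 + x) ^ J"
    using assms by (intro power_increasing) (auto simp: div_times_less_eq_dividend)
  finally show ?thesis .
qed

lemma tendsto_ser:
  assumes "\<And>n. \<forall>k. norm (a n k) \<le> g k" "integrable (count_space UNIV) g" "\<And>k. (\<lambda>n. a n k) \<longlonglongrightarrow> b k"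
  shows "(\<lambda>n. ser (a n) x) \<longlonglongrightarrow> ser b x"
  unfolding ser_def
proof (rule integral_dominated_convergence[where w = g])
  show "AE k in count_space UNIV. (\<lambda>n. a n k * wave k x) \<longlonglongrightarrow> b k * wave k x"
    by (intro AE_I2 tendsto_mult tendsto_const assms(3))
  show "AE k in count_space UNIV. norm (a n k * wave k x) \<le> g k" for n
    using assms(1)[of n] by (intro AE_I2) (simp add: norm_mult)
qed (use assms(2) in auto)

text \<open>Dominated convergence twice: over frequencies for the series, where \<open>g\<close>
  controls the coefficients and those of the gradient, and over the torus for the integral. The
  common bound q < 1 keeps the denominators away from 0.\<close>

lemma Bc_tendsto:
  fixes a :: "nat \<Rightarrow> int ^ 'n::finite \<Rightarrow> complex"
  assumes dom: "\<And>n k. norm (a n k) \<le> g k" "\<And>n k. norm (freq k) * norm (a n k) \<le> g k"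
    and g: "integrable (count_space UNIV) g" and lim: "\<And>k. (\<lambda>n. a n k) \<longlonglongrightarrow> b k"
    and q: "\<And>n x. norm (ser (a n) x) \<le> q" "q < 1"
  shows "(\<lambda>n. Bc i j (a n) m) \<longlonglongrightarrow> Bc i j b m"
proof -
  define G where "G = (\<integral>k. g k \<partial>count_space UNIV)"
  have domD: "norm (Dc i (a n) k) \<le> g k" for i n k
    using norm_Dc_le[of i "a n" k] dom(2)[of k n] by linarith
  have limD: "(\<lambda>n. Dc i (a n) k) \<longlonglongrightarrow> Dc i b k" for i k
    unfolding Dc_def by (intro tendsto_intros lim)
  have l1: "l1 (a n)" "l1 (Dc i (a n))" for i n
    by (rule Bochner_Integration.integrable_bound[OF g];
        use dom(1)[of n] domD[of i n] in \<open>force intro!: AE_I2 intro: order_trans[OF _ abs_ge_self]\<close>)+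
  have limb: "norm (b k) \<le> g k" "norm (Dc i b k) \<le> g k" for i k
    by (rule LIMSEQ_le_const2[OF tendsto_norm[OF lim]]; use dom in blast)
       (rule LIMSEQ_le_const2[OF tendsto_norm[OF limD]]; use domD in blast)
  have l1b: "l1 b" "l1 (Dc i b)" for i
    by (rule Bochner_Integration.integrable_bound[OF g];
        use limb in \<open>force intro!: AE_I2 intro: order_trans[OF _ abs_ge_self]\<close>)+
  have sl: "(\<lambda>n. ser (a n) x) \<longlonglongrightarrow> ser b x" "(\<lambda>n. ser (Dc i (a n)) x) \<longlonglongrightarrow> ser (Dc i b) x" for i x
    by (rule tendsto_ser[OF _ g lim]; use dom in blast) (rule tendsto_ser[OF _ g limD]; use domD in blast)
  have sB: "norm (ser (Dc i (a n)) x) \<le> G" for i n x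
  proof -
    have "norm (ser (Dc i (a n)) x) \<le> (\<integral>k. norm (Dc i (a n) k) \<partial>count_space UNIV)"
      by (rule norm_ser_le)
    also have "\<dots> \<le> G"
      unfolding G_def using l1 g domD by (intro integral_mono) auto
    finally show ?thesis .
  qed
  have low: "1 - q \<le> norm (1 + ser (a n) x)" for n x
    using norm_triangle_ineq2[of 1 "- ser (a n) x"] q(1)[of n x] by simp
  have qb: "norm (ser b x) \<le> q" for x
    by (rule LIMSEQ_le_const2[OF tendsto_norm[OF sl(1)]]) (use q in blast)
  have nzb: "1 + ser b x \<noteq> 0" for x
  proof
    assume "1 + ser b x = 0"
    then have "ser b x = - 1"
      by (simp add: add_eq_0_iff)
    then show False
      using qb[of x] q(2) by simp
  qed
  have nz: "1 + ser (a n) x \<noteq> 0" for n x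
    using low[of n x] q(2) by auto
  have cont: "continuous_on UNIV (\<lambda>x. ser (Dc i (a n)) x * ser (Dc j (a n)) x * (1 / (1 + ser (a n) x)) * wave (- m) x)" for n
    using nz by (intro continuous_intros continuous_on_ser l1) auto
  have contb: "continuous_on UNIV (\<lambda>x. ser (Dc i b) x * ser (Dc j b) x * (1 / (1 + ser b x)) * wave (- m) x)"
    using nzb by (intro continuous_intros continuous_on_ser l1b) auto
  have "(\<lambda>n. LINT x|torus. ser (Dc i (a n)) x * ser (Dc j (a n)) x * (1 / (1 + ser (a n) x)) * wave (- m) x)
      \<longlonglongrightarrow> (LINT x|torus. ser (Dc i b) x * ser (Dc j b) x * (1 / (1 + ser b x)) * wave (- m) x)"
  proof (rule integral_dominated_convergence[where w = "\<lambda>_. G * G * (1 / (1 - q))"])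
    show "integrable torus (\<lambda>_::real ^ 'n. G * G * (1 / (1 - q)))"
      by (rule integrable_torus_continuous) simp
    show "AE x in torus. (\<lambda>n. ser (Dc i (a n)) x * ser (Dc j (a n)) x * (1 / (1 + ser (a n) x)) * wave (- m) x)
        \<longlonglongrightarrow> ser (Dc i b) x * ser (Dc j b) x * (1 / (1 + ser b x)) * wave (- m) x"
      by (intro AE_I2 tendsto_mult tendsto_divide tendsto_add tendsto_const sl nzb)
    show "AE x in torus. norm (ser (Dc i (a n)) x * ser (Dc j (a n)) x * (1 / (1 + ser (a n) x)) * wave (- m) x)
        \<le> G * G * (1 / (1 - q))" for n
    proof (rule AE_I2)
      fix x
      have "norm (1 / (1 + ser (a n) x)) \<le> 1 / (1 - q)"
        unfolding norm_divide using low[of n x] q(2) by (simp add: frac_le)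
      moreover have "0 \<le> G"
        using sB[of i n x] norm_ge_zero order_trans by blast
      ultimately show "norm (ser (Dc i (a n)) x * ser (Dc j (a n)) x * (1 / (1 + ser (a n) x)) * wave (- m) x)
          \<le> G * G * (1 / (1 - q))"
        unfolding norm_mult norm_wave mult_1_right by (intro mult_mono sB mult_nonneg_nonneg) auto
    qed
  qed (rule borel_measurable_torus[OF contb] borel_measurable_torus[OF cont])+
  then show ?thesis
    unfolding Bc_def fc_def by (intro tendsto_divide tendsto_const) auto
qed

lemma NL_tendsto:
  assumes "\<And>n k. norm (a n k) \<le> g k" "\<And>n k. norm (freq k) * norm (a n k) \<le> g k"
    and "integrable (count_space UNIV) g" and "\<And>k. (\<lambda>n. a n k) \<longlonglongrightarrow> b k"
    and "\<And>n x. norm (ser (a n) x) \<le> q" "q < 1"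
  shows "(\<lambda>n. NL (a n) k) \<longlonglongrightarrow> NL b k"
  unfolding NL_def by (intro tendsto_minus tendsto_sum tendsto_mult tendsto_const Bc_tendsto[OF assms])

section \<open>Compactness and the limiting coefficients\<close>

context wiener_datum
begin

lemma norm_app_le: "norm (approx n t k) \<le> z"
  by (simp add: approx_def norm_eul_le)

text \<open>It holds only from some index on: the approximations jump at grid points, so the step
  has to be below \<eta>, and the cutoff has to include k.\<close>

lemma approx_equicontinuous:
  assumes "0 < e"
  obtains \<eta> N where "0 < \<eta>" "\<And>n s t. N \<le> n \<Longrightarrow> 0 \<le> s \<Longrightarrow> s \<le> t \<Longrightarrow> t - s < \<eta> \<Longrightarrow> norm (approx n t k - approx n s k) < e"
proof -
  define M where "M = K k + 1"
  have M: "0 < M" "K k \<le> M"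
    using K_nonneg[of k] by (auto simp: M_def)
  define Z where "Z = z / \<delta> + 1"
  have Z: "0 < Z" "z / \<delta> \<le> Z"
    using z \<delta> by (auto simp: Z_def add_nonneg_pos)
  \<comment> \<open>With this choice the dissipation part is at most e / 4, and \<eta> then makes
    the part proportional to time at most e / 2. The summands 1 in \<open>M\<close> and
    \<open>Z\<close> avoid a division by 0.\<close>
  define \<epsilon> where "\<epsilon> = e / (4 * M * Z)"
  have \<epsilon>: "0 < \<epsilon>"
    using assms M Z by (simp add: \<epsilon>_def)
  define \<eta> where "\<eta> = e / (4 * M * (1 + 1 / \<epsilon>))"
  have \<eta>: "0 < \<eta>"
    using assms M \<epsilon> by (simp add: \<eta>_def add_pos_pos)
  have "\<forall>\<^sub>F n in sequentially. hs n < \<eta> \<and> norm (freq k) \<le> real n"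
    using order_tendstoD(2)[OF hs_tendsto \<eta>] eventually_ge_at_top[of "nat \<lceil>norm (freq k)\<rceil>"]
    by eventually_elim linarith
  then obtain N where N: "\<And>n. N \<le> n \<Longrightarrow> hs n < \<eta> \<and> norm (freq k) \<le> real n"
    by (auto simp: eventually_sequentially)
  show ?thesis
  proof (rule that[OF \<eta>])
    fix n s t assume n: "N \<le> n" and st: "0 \<le> s" "s \<le> t" "t - s < \<eta>"
    have "norm (approx n t k - approx n s k) \<le> K k * ((t - s + hs n) * (1 + 1 / \<epsilon>) + \<epsilon> * (z / \<delta>))"
      using N[OF n] by (intro approx_increment \<epsilon> st) auto
    \<comment> \<open>One \<eta> bounds t - s, the other the step size.\<close>
    also have "\<dots> \<le> M * ((\<eta> + \<eta>) * (1 + 1 / \<epsilon>) + \<epsilon> * Z)"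
      using N[OF n] st \<epsilon> M Z z \<delta> hs(1)[of n]
      by (intro mult_mono add_mono mult_right_mono mult_left_mono order_refl add_nonneg_nonneg mult_nonneg_nonneg) auto
    also have "\<dots> = 3 / 4 * e"
    proof -
      define y where "y = 1 + 1 / \<epsilon>"
      have "y \<noteq> 0"
        using \<epsilon> by (simp add: y_def add_pos_pos order.strict_implies_not_eq[symmetric] less_imp_neq[symmetric])
      have "\<eta> = e / (4 * M * y)"
        by (simp add: \<eta>_def y_def)
      then have "M * ((\<eta> + \<eta>) * y) = e / 2"
        using M \<open>y \<noteq> 0\<close> by simp
      moreover have "M * (\<epsilon> * Z) = e / 4"
        using M Z by (simp add: \<epsilon>_def)
      moreover note \<open>y \<noteq> 0\<close>
      ultimately show ?thesis
        by (simp add: y_def[symmetric] distrib_left)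
    qed
    also have "\<dots> < e"
      using assms by simp
    finally show "norm (approx n t k - approx n s k) < e" .
  qed
qed

text \<open>The Arzela-Ascoli argument: a diagonal subsequence converges at all nonnegative rational
  times and all frequencies, and asymptotic equicontinuity extends the convergence to every real
  time.\<close>

lemma ex_subsequence: "\<exists>r :: nat \<Rightarrow> nat. strict_mono r \<and> (\<forall>t\<ge>0. \<forall>k. convergent (\<lambda>n. approx (r n) t k))"
proof -
  define S where "S = ({q \<in> \<rat>. 0 \<le> q} :: real set) \<times> (UNIV :: (int ^ 'n) set)"
  have "countable S"
    unfolding S_def by (intro countable_SIGMA countable_subset[OF _ countable_rat]) auto
  moreover have "norm ((\<lambda>(q, k). approx n q k) x) \<le> z" for n x
    by (cases x) (simp add: norm_app_le)
  ultimately obtain r where r: "strict_mono (r :: nat \<Rightarrow> nat)"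
    and conv: "\<And>x. x \<in> S \<Longrightarrow> \<exists>l. (\<lambda>n. (\<lambda>(q, k). approx (r n) q k) x) \<longlonglongrightarrow> l"
    using function_convergent_subsequence[of S "\<lambda>n (q, k). approx n q k" z] by metis
  have "convergent (\<lambda>n. approx (r n) t k)" if t: "0 \<le> t" for t k
    unfolding Cauchy_convergent_iff[symmetric]
  proof (rule metric_CauchyI)
    fix e :: real assume "0 < e"
    then have e3: "0 < e / 3"
      by simp
    obtain \<eta> N where \<eta>: "0 < \<eta>" and N: "\<And>n s t. N \<le> n \<Longrightarrow> 0 \<le> s \<Longrightarrow> s \<le> t \<Longrightarrow> t - s < \<eta> \<Longrightarrow> norm (approx n t k - approx n s k) < e / 3"
      using approx_equicontinuous[OF e3, of k] by metis
    obtain q where q: "q \<in> \<rat>" "t < q" "q < t + \<eta>"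
      using Rats_dense_in_real[of t "t + \<eta>"] \<eta> by auto
    have "(q, k) \<in> S"
      using q t by (auto simp: S_def)
    then have "convergent (\<lambda>n. approx (r n) q k)"
      using conv[of "(q, k)"] by (auto simp: convergent_def)
    then have "Cauchy (\<lambda>n. approx (r n) q k)"
      by (simp add: Cauchy_convergent_iff)
    then obtain N' where N': "\<And>m n. N' \<le> m \<Longrightarrow> N' \<le> n \<Longrightarrow> dist (approx (r m) q k) (approx (r n) q k) < e / 3"
      using metric_CauchyD[OF _ e3] by blast
    show "\<exists>M. \<forall>m\<ge>M. \<forall>n\<ge>M. dist (approx (r m) t k) (approx (r n) t k) < e"
    proof (intro exI allI impI)
      fix m n assume mn: "max N N' \<le> m" "max N N' \<le> n"
      then have rm: "N \<le> r m" "N \<le> r n"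
        using seq_suble[OF r, of m] seq_suble[OF r, of n] by linarith+
      have "dist (approx (r m) q k) (approx (r m) t k) < e / 3" "dist (approx (r n) q k) (approx (r n) t k) < e / 3"
        using N[OF rm(1) t, of q] N[OF rm(2) t, of q] q by (auto simp: dist_norm)
      moreover have "dist (approx (r m) q k) (approx (r n) q k) < e / 3"
        using mn by (intro N') auto
      ultimately show "dist (approx (r m) t k) (approx (r n) t k) < e"
        by (metis dist_commute dist_triangle_third)
    qed
  qed
  with r show ?thesis
    by blast
qed

definition sub :: "nat \<Rightarrow> nat" where
  "sub = (SOME r. strict_mono r \<and> (\<forall>t\<ge>0. \<forall>k. convergent (\<lambda>n. approx (r n) t k)))"

definition c :: "real \<Rightarrow> int ^ 'n \<Rightarrow> complex" where
  "c t k = lim (\<lambda>n. approx (sub n) t k)"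

lemma sub: "strict_mono sub" "0 \<le> t \<Longrightarrow> convergent (\<lambda>n. approx (sub n) t k)"
  using someI_ex[OF ex_subsequence] unfolding sub_def[symmetric] by blast+

lemma c_lim: "0 \<le> t \<Longrightarrow> (\<lambda>n. approx (sub n) t k) \<longlonglongrightarrow> c t k"
  using sub(2) by (simp add: c_def convergent_LIMSEQ_iff)

lemma sub_at_top: "filterlim sub at_top sequentially"
  by (rule filterlim_subseq[OF sub(1)])

text \<open>Continuity up to t = 0 is what connects the limit with the datum, since the differential
  equation is obtained for t > 0 only.\<close>

lemma c_continuous: "continuous_on {0..} (\<lambda>t. c t k)"
  unfolding continuous_on_iff
proof (intro ballI allI impI)
  fix t e :: real assume t: "t \<in> {0..}" and "0 < e"
  then have e2: "0 < e / 2"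
    by simp
  obtain \<eta> N where \<eta>: "0 < \<eta>" and N: "\<And>n s t. N \<le> n \<Longrightarrow> 0 \<le> s \<Longrightarrow> s \<le> t \<Longrightarrow> t - s < \<eta> \<Longrightarrow> norm (approx n t k - approx n s k) < e / 2"
    using approx_equicontinuous[OF e2, of k] by metis
  have *: "dist (c s k) (c t k) < e" if "0 \<le> s" "s \<le> t" "t - s < \<eta>" for s t
  proof -
    have "dist (c s k) (c t k) \<le> e / 2"
    proof (rule LIMSEQ_le_const2[OF tendsto_dist[OF c_lim c_lim]])
      show "\<exists>N. \<forall>n\<ge>N. dist (approx (sub n) s k) (approx (sub n) t k) \<le> e / 2"
      proof (intro exI allI impI)
        fix n assume "N \<le> n"
        then have "N \<le> sub n"
          using seq_suble[OF sub(1), of n] by linarith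
        then show "dist (approx (sub n) s k) (approx (sub n) t k) \<le> e / 2"
          using N[of "sub n" s t] that by (simp add: dist_norm norm_minus_commute less_imp_le)
      qed
    qed (use that in auto)
    then show ?thesis
      using e2 by linarith
  qed
  show "\<exists>d>0. \<forall>s\<in>{0..}. dist s t < d \<longrightarrow> dist (c s k) (c t k) < e"
  proof (intro exI conjI ballI impI)
    fix s assume "s \<in> {0..}" "dist s t < \<eta>"
    then show "dist (c s k) (c t k) < e"
      using *[of s t] *[of t s] t by (cases "s \<le> t") (auto simp: dist_real_def dist_commute)
  qed (rule \<eta>)
qed

text \<open>As soon as the cutoff reaches |k|, the mode starts exactly from
  \<open>v k\<close>.\<close>

lemma c_0: "c 0 k = v k"
proof -
  have "\<forall>\<^sub>F n in sequentially. approx (sub n) 0 k = v k"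
    using filterlim_at_top[THEN iffD1, OF sub_at_top, rule_format, of "nat \<lceil>norm (freq k)\<rceil>"]
  proof eventually_elim
    case (elim n)
    then have "norm (freq k) \<le> real (sub n)"
      by linarith
    then show ?case
      by (simp add: approx_def)
  qed
  then have "(\<lambda>n. approx (sub n) 0 k) \<longlonglongrightarrow> v k"
    by (rule tendsto_eventually)
  then show ?thesis
    using c_lim[of 0 k] LIMSEQ_unique by blast
qed

lemma c_zero: "0 \<le> t \<Longrightarrow> c t 0 = 0"
  using c_lim[of t 0] by (simp add: approx_def euler_zero LIMSEQ_const_iff)

lemma c_herm: "0 \<le> t \<Longrightarrow> herm (c t)"
  unfolding herm_def
proof
  fix k assume t: "0 \<le> t"
  have "approx n t (- k) = cnj (approx n t k)" for n
    using euler_herm by (simp add: approx_def herm_def)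
  then have "(\<lambda>n. approx (sub n) t (- k)) \<longlonglongrightarrow> cnj (c t k)"
    using tendsto_cnj[OF c_lim[OF t, of k]] by simp
  then show "c t (- k) = cnj (c t k)"
    using c_lim[OF t, of "- k"] LIMSEQ_unique by blast
qed

section \<open>Bounds inherited by the limit, and uniform decay for positive times\<close>

lemma approx_nn_mom:
  assumes "submult w" "j \<le> 4"
  shows "(\<integral>\<^sup>+k. ennreal (mwt w j k * norm (approx n t k)) \<partial>count_space UNIV) = ennreal (mom w j (approx n t))"
  unfolding mom_def approx_def
  by (rule nn_integral_eq_integral[OF fin_momD[OF euler_fin_mom assms(2)]]) (simp add: mwt_nonneg[OF assms(1)])

lemma submult_rt: "submult (pw (rt n * hs n) j :: int ^ 'n \<Rightarrow> real)"
  by (intro submult_pw mult_nonneg_nonneg rt less_imp_le[OF hs(1)])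

text \<open>The number of steps times \<open>hs n\<close> tends to t and \<open>rt n\<close> tends
  to \<delta>, so the discrete weights converge to the exponential; Fatou does the rest.\<close>

lemma c_exp_bound:
  assumes t: "0 \<le> t"
  shows "(\<integral>\<^sup>+k. ennreal (exp (\<delta> * t * norm (freq k)) * norm (c t k)) \<partial>count_space UNIV) \<le> ennreal z"
proof -
  define J where "J n = nat \<lfloor>t / hs n\<rfloor>" for n
  have J: "(\<lambda>n. real (J n) * hs n) \<longlonglongrightarrow> t"
  proof (rule tendsto_sandwich[of "\<lambda>n. t - hs n" _ _ "\<lambda>_. t"])
    show "(\<lambda>n. t - hs n) \<longlonglongrightarrow> t"
      using tendsto_diff[OF tendsto_const[of t] hs_tendsto] by simp
  qed (use step_index[OF t] in \<open>auto intro!: always_eventually less_imp_le simp: J_def\<close>)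
  have pw: "(\<lambda>n. pw (rt n * hs n) (J n) k) \<longlonglongrightarrow> exp (\<delta> * t * norm (freq k))" for k :: "int ^ 'n"
    unfolding pw_def
  proof (rule tendsto_exp_power)
    have "(\<lambda>n. rt n * hs n * norm (freq k)) \<longlonglongrightarrow> \<delta> * 0 * norm (freq k)"
      by (intro tendsto_mult rt_tendsto hs_tendsto tendsto_const)
    then show "(\<lambda>n. rt n * hs n * norm (freq k)) \<longlonglongrightarrow> 0"
      by simp
    show "0 \<le> rt n * hs n * norm (freq k)" for n
      using rt(1)[of n] hs(1)[of n] by simp
    have "(\<lambda>n. rt n * (real (J n) * hs n) * norm (freq k)) \<longlonglongrightarrow> \<delta> * t * norm (freq k)"
      by (intro tendsto_mult rt_tendsto J tendsto_const)
    then show "(\<lambda>n. real (J n) * (rt n * hs n * norm (freq k))) \<longlonglongrightarrow> \<delta> * t * norm (freq k)"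
      by (simp add: mult_ac)
  qed
  show ?thesis
  proof (rule nn_integral_limit_le)
    show "AE k in count_space UNIV. (\<lambda>n. pw (rt (sub n) * hs (sub n)) (J (sub n)) k * norm (approx (sub n) t k))
        \<longlonglongrightarrow> exp (\<delta> * t * norm (freq k)) * norm (c t k)"
      by (intro AE_I2 tendsto_mult tendsto_norm c_lim t filterlim_compose[OF pw sub_at_top])
    show "(\<integral>\<^sup>+k. ennreal (pw (rt (sub n) * hs (sub n)) (J (sub n)) k * norm (approx (sub n) t k)) \<partial>count_space UNIV) \<le> ennreal z" for n
      using approx_nn_mom[OF submult_rt[of "sub n" "J (sub n)"], of 0 "sub n" t] euler_rt_bound[of "sub n" "J (sub n)"]
      by (simp add: mwt_def approx_def J_def ennreal_leI)
  qed simp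
qed

end

lemma exp_ge_power:
  fixes x :: real
  assumes "0 \<le> x" "0 < m"
  shows "(x / real m) ^ m \<le> exp x"
proof -
  have "x / real m \<le> exp (x / real m)"
    using exp_ge_add_one_self[of "x / real m"] by linarith
  then have "(x / real m) ^ m \<le> exp (x / real m) ^ m"
    using assms by (intro power_mono) auto
  also have "\<dots> = exp x"
    using assms by (simp flip: exp_of_nat_mult)
  finally show ?thesis .
qed

context wiener_datum
begin

lemma c_exp_pointwise: "0 \<le> t \<Longrightarrow> exp (\<delta> * t * norm (freq k)) * norm (c t k) \<le> z"
proof -
  assume t: "0 \<le> t"
  have "ennreal (exp (\<delta> * t * norm (freq k)) * norm (c t k))
      = (\<integral>\<^sup>+l. ennreal (exp (\<delta> * t * norm (freq l)) * norm (c t l)) * indicator {k} l \<partial>count_space UNIV)"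
    by (subst nn_integral_count_space'[of "{k}"]) auto
  also have "\<dots> \<le> (\<integral>\<^sup>+l. ennreal (exp (\<delta> * t * norm (freq l)) * norm (c t l)) \<partial>count_space UNIV)"
    by (intro nn_integral_mono) (auto simp: indicator_def)
  also have "\<dots> \<le> ennreal z"
    by (rule c_exp_bound[OF t])
  finally show ?thesis
    using z by simp
qed

text \<open>The exponential weight dominates every power of |k|; the lower bound \<tau> makes the
  constant uniform in t.\<close>

lemma c_decay:
  assumes \<tau>: "0 < \<tau>" "\<tau> \<le> t" and m: "0 < m"
  shows "norm (freq k) ^ m * norm (c t k) \<le> z * (real m / (\<delta> * \<tau>)) ^ m"
proof -
  have "(\<delta> * \<tau> * norm (freq k) / real m) ^ m \<le> (\<delta> * t * norm (freq k) / real m) ^ m"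
    using \<tau> \<delta> by (intro power_mono divide_right_mono mult_right_mono mult_left_mono) auto
  also have "\<dots> \<le> exp (\<delta> * t * norm (freq k))"
    using \<tau> \<delta> m by (intro exp_ge_power) auto
  finally have "(\<delta> * \<tau> * norm (freq k) / real m) ^ m * norm (c t k) \<le> exp (\<delta> * t * norm (freq k)) * norm (c t k)"
    by (intro mult_right_mono) auto
  also have "\<dots> \<le> z"
    using \<tau> by (intro c_exp_pointwise) auto
  finally have "(\<delta> * \<tau> / real m) ^ m * (norm (freq k) ^ m * norm (c t k)) \<le> z"
    by (simp add: power_divide power_mult_distrib mult_ac)
  then have "(real m / (\<delta> * \<tau>)) ^ m * ((\<delta> * \<tau> / real m) ^ m * (norm (freq k) ^ m * norm (c t k)))
      \<le> (real m / (\<delta> * \<tau>)) ^ m * z"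
    using \<tau> \<delta> by (intro mult_left_mono) auto
  moreover have "(real m / (\<delta> * \<tau>)) ^ m * (\<delta> * \<tau> / real m) ^ m = 1"
    using \<tau> \<delta> m by (simp flip: power_mult_distrib)
  ultimately show ?thesis
    unfolding mult.assoc[symmetric] by (simp only: mult_1 mult.commute[of z])
qed

text \<open>The scheme itself decays, uniformly in n, once the step is so small compared with \<tau>
  / m that each of the m Bernoulli blocks contains enough factors. The constant 4 is a factor 2 from
  \<open>rt n \<ge> \<delta> / 2\<close> times a factor 2 from rounding.\<close>

lemma approx_decay:
  assumes \<tau>: "0 < \<tau>" "\<tau> \<le> s" and m: "0 < m" and n: "hs n \<le> \<tau> / (4 * real m)"
  shows "norm (freq k) ^ m * norm (approx n s k) \<le> z * (4 * real m / (\<tau> * \<delta>)) ^ m"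
proof -
  define J where "J = nat \<lfloor>s / hs n\<rfloor>"
  define b where "b = rt n * hs n"
  have b: "0 \<le> b"
    using rt(1)[of n] hs(1)[of n] by (simp add: b_def)
  have rt_ge: "\<delta> / 2 \<le> rt n"
  proof -
    have "hs n * real n \<le> 1"
      using hs(4)[of n] by (rule order_trans) simp
    then show ?thesis
      unfolding rt_def using \<delta> hs(1)[of n] by (intro divide_left_mono) (auto intro!: mult_pos_pos add_pos_nonneg)
  qed
  have "real J < real m * (real (J div m) + 1)"
  proof -
    have "J < m + m * (J div m)"
      using m by (rule dividend_less_times_div)
    then have "real J < real (m + m * (J div m))"
      by (rule iffD2[OF of_nat_less_iff])
    then show ?thesis
      by (simp add: algebra_simps)
  qed
  then have "real J * hs n < real m * (real (J div m) + 1) * hs n"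
    using hs(1)[of n] by (intro mult_strict_right_mono)
  moreover have "s - hs n < real J * hs n"
    using step_index(2)[of s n] \<tau> by (simp add: J_def)
  ultimately have 1: "\<tau> - hs n < real m * (real (J div m) * hs n) + real m * hs n"
    using \<tau>(2) by (simp add: algebra_simps)
  have 2: "real m * hs n \<le> \<tau> / 4"
    using n m by (simp add: field_simps)
  have "1 * hs n \<le> real m * hs n"
    using m hs(1)[of n] by (intro mult_right_mono) auto
  \<comment> \<open>Rounding s to the grid and rounding the number of steps to a multiple of m lose
    at most \<tau> / 4 each.\<close>
  with 1 2 have "\<tau> / 2 \<le> real m * (real (J div m) * hs n)"
    by simp
  then have "\<tau> / (2 * real m) \<le> real (J div m) * hs n"
    using m by (simp add: field_simps)
  then have "\<tau> / (2 * real m) * (\<delta> / 2) \<le> (real (J div m) * hs n) * rt n"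
    using rt_ge \<tau> \<delta> hs(1)[of n] by (intro mult_mono) auto
  then have Jb: "\<tau> * \<delta> / (4 * real m) \<le> real (J div m) * b"
    by (simp add: b_def mult_ac)
  have "(\<tau> * \<delta> / (4 * real m)) ^ m * norm (freq k) ^ m = (\<tau> * \<delta> / (4 * real m) * norm (freq k)) ^ m"
    by (rule power_mult_distrib[symmetric])
  also have "\<dots> \<le> (real (J div m) * (b * norm (freq k))) ^ m"
    using mult_right_mono[OF Jb, of "norm (freq k)"] \<tau> \<delta> by (intro power_mono) (auto simp: mult.assoc)
  also have "\<dots> \<le> pw b J k"
    unfolding pw_def using b m by (intro one_plus_power_ge) auto
  finally have "(\<tau> * \<delta> / (4 * real m)) ^ m * norm (freq k) ^ m * norm (approx n s k) \<le> pw b J k * norm (approx n s k)"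
    by (intro mult_right_mono) auto
  also have "\<dots> \<le> mom (pw b J) 0 (approx n s)"
    unfolding approx_def J_def[symmetric] by (intro norm_le_mom submult_pw b euler_fin_mom)
  also have "\<dots> \<le> z"
    unfolding approx_def J_def[symmetric] b_def by (rule euler_rt_bound)
  finally have "(4 * real m / (\<tau> * \<delta>)) ^ m * ((\<tau> * \<delta> / (4 * real m)) ^ m * (norm (freq k) ^ m * norm (approx n s k)))
      \<le> (4 * real m / (\<tau> * \<delta>)) ^ m * z"
    using \<tau> \<delta> by (intro mult_left_mono) (auto simp: mult_ac)
  moreover have "(4 * real m / (\<tau> * \<delta>)) ^ m * (\<tau> * \<delta> / (4 * real m)) ^ m = 1"
    using \<tau> \<delta> m by (simp flip: power_mult_distrib)
  ultimately show ?thesis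
    unfolding mult.assoc[symmetric] by (simp only: mult_1 mult.commute[of z])
qed

lemma approx_zero: "approx n t 0 = 0"
  by (simp add: approx_def euler_zero)

text \<open>The constant that \<open>moment_le_gam\<close> yields from the decay of order 2 d + j of
  the scheme; it carries a negative power of \<tau>, so the majorant is available only away from the
  initial time.\<close>

definition Gm :: "nat \<Rightarrow> real \<Rightarrow> real" where
  "Gm j \<tau> = z * (4 * real (2 * CARD('n) + j) / (\<tau> * \<delta>)) ^ (2 * CARD('n) + j) * 2 ^ CARD('n)"

lemma Gm_nonneg: "0 < \<tau> \<Longrightarrow> 0 \<le> Gm j \<tau>"
  using z \<delta> by (simp add: Gm_def)

lemma approx_moment_le:
  assumes "0 < \<tau>" "\<tau> \<le> s" "hs n \<le> \<tau> / (4 * real (2 * CARD('n) + j))"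
  shows "norm (freq k) ^ j * norm (approx n s k) \<le> Gm j \<tau> * gam k"
  unfolding Gm_def by (intro moment_le_gam approx_decay approx_zero assms) simp

lemma c_moment_le:
  assumes "0 < \<tau>" "\<tau> \<le> s"
  shows "norm (freq k) ^ j * norm (c s k) \<le> Gm j \<tau> * gam k"
  unfolding Gm_def
proof (rule moment_le_gam)
  show "c s 0 = 0"
    using assms by (intro c_zero) simp
  have "norm (freq k) ^ (2 * CARD('n) + j) * norm (c s k)
      \<le> z * (real (2 * CARD('n) + j) / (\<delta> * \<tau>)) ^ (2 * CARD('n) + j)"
    by (intro c_decay assms) simp
  \<comment> \<open>The constant is enlarged so that scheme and limit share one majorant.\<close>
  also have "\<dots> \<le> z * (4 * real (2 * CARD('n) + j) / (\<tau> * \<delta>)) ^ (2 * CARD('n) + j)"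
    using z \<delta> assms by (intro mult_left_mono power_mono) (auto simp: field_simps)
  finally show "norm (freq k) ^ (2 * CARD('n) + j) * norm (c s k)
      \<le> z * (4 * real (2 * CARD('n) + j) / (\<tau> * \<delta>)) ^ (2 * CARD('n) + j)" .
qed

lemma c_moment_integrable: "0 < t \<Longrightarrow> integrable (count_space UNIV) (\<lambda>k. norm (freq k) ^ j * norm (c t k))"
proof (rule Bochner_Integration.integrable_bound)
  assume t: "0 < t"
  show "integrable (count_space UNIV) (\<lambda>k. Gm j t * gam k)"
    by (intro integrable_mult_right integrable_gam)
  show "AE k in count_space UNIV. norm (norm (freq k) ^ j * norm (c t k)) \<le> norm (Gm j t * gam k)"
    by (intro AE_I2) (use c_moment_le[OF t order_refl, of _ j] in \<open>simp add: order_trans[OF _ abs_ge_self]\<close>)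
qed simp

text \<open>For |k| \<ge> 1 the weight exp (\<delta> t |k|) is at least exp (\<delta> t), and the
  zero mode vanishes.\<close>

lemma c_norm_nn: "0 \<le> t \<Longrightarrow> (\<integral>\<^sup>+k. ennreal (norm (c t k)) \<partial>count_space UNIV) \<le> ennreal (z * exp (- \<delta> * t))"
proof -
  assume t: "0 \<le> t"
  have "(\<integral>\<^sup>+k. ennreal (norm (c t k)) \<partial>count_space UNIV)
      \<le> (\<integral>\<^sup>+k. ennreal (exp (- \<delta> * t)) * ennreal (exp (\<delta> * t * norm (freq k)) * norm (c t k)) \<partial>count_space UNIV)"
  proof (intro nn_integral_mono)
    fix k
    have "norm (c t k) \<le> exp (- \<delta> * t) * (exp (\<delta> * t * norm (freq k)) * norm (c t k))"
    proof (cases "k = 0")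
      case True
      then show ?thesis
        by (simp add: c_zero[OF t])
    next
      case False
      have "\<delta> * t * 1 \<le> \<delta> * t * norm (freq k)"
        using norm_freq_ge_1[OF False] t \<delta> by (intro mult_left_mono) auto
      then have "1 \<le> exp (- \<delta> * t) * exp (\<delta> * t * norm (freq k))"
        by (simp flip: exp_add)
      then have "1 * norm (c t k) \<le> exp (- \<delta> * t) * exp (\<delta> * t * norm (freq k)) * norm (c t k)"
        by (rule mult_right_mono) simp
      then show ?thesis
        by (simp add: mult.assoc)
    qed
    then show "ennreal (norm (c t k)) \<le> ennreal (exp (- \<delta> * t)) * ennreal (exp (\<delta> * t * norm (freq k)) * norm (c t k))"
      by (simp add: ennreal_mult[symmetric] ennreal_leI)
  qed
  also have "\<dots> = ennreal (exp (- \<delta> * t)) * (\<integral>\<^sup>+k. ennreal (exp (\<delta> * t * norm (freq k)) * norm (c t k)) \<partial>count_space UNIV)"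
    by (rule nn_integral_cmult) simp
  also have "\<dots> \<le> ennreal (exp (- \<delta> * t)) * ennreal z"
    by (intro mult_left_mono c_exp_bound t) simp
  finally show ?thesis
    using z by (simp add: ennreal_mult[symmetric] mult.commute)
qed

lemma c_l1: "0 \<le> t \<Longrightarrow> l1 (c t)"
  using c_norm_nn[of t] by (auto simp: integrable_iff_bounded intro: le_less_trans)

lemma c_norm_le: "0 \<le> t \<Longrightarrow> (\<integral>k. norm (c t k) \<partial>count_space UNIV) \<le> z * exp (- \<delta> * t)"
  using c_norm_nn[of t] nn_integral_eq_integral[OF integrable_norm[OF c_l1[of t]]] z by simp

lemma norm_ser_c_le: "0 \<le> t \<Longrightarrow> norm (ser (c t) x) \<le> z * exp (- \<delta> * t)"
  using norm_ser_le[of "c t" x] c_norm_le[of t] by linarith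

lemma norm_ser_c_le_z: "0 \<le> t \<Longrightarrow> norm (ser (c t) x) \<le> z"
proof -
  assume t: "0 \<le> t"
  have "z * exp (- \<delta> * t) \<le> z * 1"
    using z \<delta> t by (intro mult_left_mono) auto
  then show ?thesis
    using norm_ser_c_le[OF t, of x] by linarith
qed

section \<open>The differential equation for each mode\<close>

lemma ser_app_le_z: "norm (ser (approx n t) x) \<le> z"
  using norm_ser_le_mom[OF submult_1 euler_fin_mom, of n "nat \<lfloor>t / hs n\<rfloor>" x] euler_mom1_bound[of n "nat \<lfloor>t / hs n\<rfloor>"]
  by (simp add: approx_def)

text \<open>Without a zero mode, a majorant of the first moment also bounds the coefficients, so one
  function dominates both.\<close>

lemma moment_0_1_le:
  assumes "\<And>k. norm (freq k) ^ 1 * norm (a k) \<le> M * gam k" "a 0 = 0"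
  shows "norm (a k) \<le> M * gam k"
proof (cases "k = 0")
  case True
  then show ?thesis
    using assms(1)[of k] assms(2) by simp
next
  case False
  then have "1 * norm (a k) \<le> norm (freq k) * norm (a k)"
    by (intro mult_right_mono norm_freq_ge_1) auto
  then show ?thesis
    using assms(1)[of k] by simp
qed

text \<open>On every half-line starting at some \<tau> > 0 a single summable majorant allows the
  passage to the limit, and the open half-lines exhaust the positive times.\<close>

lemma rhs_c_continuous: "continuous_on {0<..} (\<lambda>s. rhs (c s) k)"
proof -
  have cont: "continuous_on {\<tau>..} (\<lambda>s. rhs (c s) k)" if \<tau>: "0 < \<tau>" for \<tau>
    unfolding continuous_on_sequentially o_def
  proof (intro allI ballI impI, elim conjE)
    fix x s assume s: "s \<in> {\<tau>..}" and x: "\<forall>n. x n \<in> {\<tau>..}" "x \<longlonglongrightarrow> s"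
    have cl: "(\<lambda>n. c (x n) k) \<longlonglongrightarrow> c s k" for k
    proof (rule continuous_on_tendsto_compose[OF c_continuous x(2)])
      show "s \<in> {0..}"
        using s \<tau> by simp
      show "\<forall>\<^sub>F n in sequentially. x n \<in> {0..}"
        using x(1) \<tau> by (intro always_eventually allI) (meson atLeast_iff less_imp_le order_trans)
    qed
    have xn: "\<tau> \<le> x n" for n
      using x(1) by simp
    have xn0: "0 \<le> x n" for n
      using xn[of n] \<tau> by linarith
    have dom: "norm (freq k) * norm (c (x n) k) \<le> Gm 1 \<tau> * gam k" for n k
      using c_moment_le[OF \<tau> xn, of k 1] by simp
    have "(\<lambda>n. NL (c (x n)) k) \<longlonglongrightarrow> NL (c s) k"
    proof (rule NL_tendsto[where g = "\<lambda>k. Gm 1 \<tau> * gam k" and q = z])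
      show "norm (c (x n) k) \<le> Gm 1 \<tau> * gam k" for n k
        using dom[of _ n] by (intro moment_0_1_le c_zero[OF xn0]) (simp only: power_one_right)
      show "integrable (count_space UNIV) (\<lambda>k. Gm 1 \<tau> * gam k)"
        by (intro integrable_mult_right integrable_gam)
    qed (rule dom cl norm_ser_c_le_z[OF xn0] z(2))+
    then show "(\<lambda>n. rhs (c (x n)) k) \<longlonglongrightarrow> rhs (c s) k"
      unfolding rhs_def by (intro tendsto_add tendsto_mult tendsto_const cl)
  qed
  have "continuous_on (\<Union>\<tau>\<in>{0<..}. {\<tau><..}) (\<lambda>s. rhs (c s) k)"
  proof (intro continuous_on_open_UN open_greaterThan)
    fix \<tau> :: real assume "\<tau> \<in> {0<..}"
    then show "continuous_on {\<tau><..} (\<lambda>s. rhs (c s) k)"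
      by (intro continuous_on_subset[OF cont[of \<tau>]]) auto
  qed
  moreover have "(\<Union>\<tau>\<in>{0::real<..}. {\<tau><..}) = {0<..}"
    using dense by auto
  ultimately show ?thesis
    by simp
qed

lemma rhs_app_tendsto:
  assumes "0 < s"
  shows "(\<lambda>n. rhs (approx (sub n) s) k) \<longlonglongrightarrow> rhs (c s) k"
proof -
  \<comment> \<open>The uniform decay requires a small step, so finitely many terms are
    discarded.\<close>
  have "\<forall>\<^sub>F n in sequentially. hs n < s / (4 * real (2 * CARD('n) + 1))"
    using hs_tendsto assms by (intro order_tendstoD(2)) auto
  then obtain N where N: "\<And>n. N \<le> n \<Longrightarrow> hs n < s / (4 * real (2 * CARD('n) + 1))"
    by (auto simp: eventually_sequentially)
  have N': "hs (sub (n + N)) \<le> s / (4 * real (2 * CARD('n) + 1))" for n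
    using N[of "sub (n + N)"] seq_suble[OF sub(1), of "n + N"] by (simp add: less_imp_le)
  have dom: "norm (freq k) * norm (approx (sub (n + N)) s k) \<le> Gm 1 s * gam k" for n k
    using approx_moment_le[OF assms order_refl N', of k n] by simp
  have cl: "(\<lambda>n. approx (sub (n + N)) s k) \<longlonglongrightarrow> c s k" for k
    using LIMSEQ_ignore_initial_segment[OF c_lim[of s k], of N] assms by simp
  have "(\<lambda>n. NL (approx (sub (n + N)) s) k) \<longlonglongrightarrow> NL (c s) k"
  proof (rule NL_tendsto[where g = "\<lambda>k. Gm 1 s * gam k" and q = z])
    show "norm (approx (sub (n + N)) s k) \<le> Gm 1 s * gam k" for n k
      using dom[of _ n] by (intro moment_0_1_le approx_zero) (simp only: power_one_right)
    show "integrable (count_space UNIV) (\<lambda>k. Gm 1 s * gam k)"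
      by (intro integrable_mult_right integrable_gam)
  qed (rule dom cl ser_app_le_z z(2))+
  then have "(\<lambda>n. rhs (approx (sub (n + N)) s) k) \<longlonglongrightarrow> rhs (c s) k"
    unfolding rhs_def by (intro tendsto_add tendsto_mult tendsto_const cl)
  then show ?thesis
    by (rule LIMSEQ_offset)
qed

text \<open>A majorant constant in time, for dominated convergence in the integral equation.\<close>

lemma norm_rhs_app_le:
  assumes "0 < \<tau>" "\<tau> \<le> s" "hs n \<le> \<tau> / (4 * real (2 * CARD('n) + 2))"
  shows "norm (rhs (approx n s) k) \<le> K k * (1 + Gm 2 \<tau> * (\<integral>l. gam l \<partial>count_space (UNIV :: (int ^ 'n) set)))"
proof -
  have "mom1 2 (approx n s) \<le> (\<integral>l. Gm 2 \<tau> * gam l \<partial>count_space (UNIV :: (int ^ 'n) set))"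
    unfolding mom_def
  proof (rule integral_mono)
    show "integrable (count_space UNIV) (\<lambda>k. mwt (\<lambda>_. 1) 2 k * norm (approx n s k))"
      unfolding approx_def using fin_momD[OF euler_fin_mom, of 2] by simp
    show "mwt (\<lambda>_. 1) 2 k * norm (approx n s k) \<le> Gm 2 \<tau> * gam k" for k
      using approx_moment_le[OF assms, of k] by (simp add: mwt_def)
  qed (intro integrable_mult_right integrable_gam)
  also have "\<dots> = Gm 2 \<tau> * (\<integral>l. gam l \<partial>count_space (UNIV :: (int ^ 'n) set))"
    by simp
  finally have "K k * (1 + mom1 2 (approx n s)) \<le> K k * (1 + Gm 2 \<tau> * (\<integral>l. gam l \<partial>count_space (UNIV :: (int ^ 'n) set)))"
    by (intro mult_left_mono add_left_mono K_nonneg)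
  with norm_rhs_eul_le[of n "nat \<lfloor>s / hs n\<rfloor>" k] show ?thesis
    by (simp add: approx_def)
qed

text \<open>A sum of Euler increments is the integral of the step function formed from the
  right-hand sides, to which limit theorems in time apply.\<close>

lemma euler_integral:
  assumes k: "norm (freq k) \<le> real n"
  shows "integrable lborel (\<lambda>s. indicator {0..<real J * hs n} s *\<^sub>R rhs (approx n s) k)"
    and "euler n J k - euler n 0 k = (\<integral>s. indicator {0..<real J * hs n} s *\<^sub>R rhs (approx n s) k \<partial>lborel)"
proof -
  have ind: "indicator A s *\<^sub>R x = x * indicator A s" for A and s :: real and x :: complex
    by (simp add: indicator_def)
  have eq: "indicator {0..<real J * hs n} s *\<^sub>R rhs (approx n s) k
      = (\<Sum>j<J. indicator {real j * hs n..<real (Suc j) * hs n} s *\<^sub>R rhs (euler n j) k)" for s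
    unfolding ind approx_def by (rule step_function_decomp[OF hs(1), of "\<lambda>j. rhs (euler n j) k"])
  have int: "integrable lborel (\<lambda>s. indicator {real j * hs n..<real (Suc j) * hs n} s *\<^sub>R rhs (euler n j) k)" for j
  proof (intro integrable_scaleR_left integrable_real_indicator)
    have "real j * hs n \<le> real (Suc j) * hs n"
      using hs(1)[of n] by (intro mult_right_mono) auto
    then show "emeasure lborel {real j * hs n..<real (Suc j) * hs n} < \<infinity>"
      by (simp only: emeasure_lborel_Ico) simp
  qed simp
  show "integrable lborel (\<lambda>s. indicator {0..<real J * hs n} s *\<^sub>R rhs (approx n s) k)"
    unfolding eq by (intro Bochner_Integration.integrable_sum int)
  have "euler n J k - euler n 0 k = (\<Sum>j<J. of_real (hs n) * rhs (euler n j) k)"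
    using euler_Suc[OF k] by (induction J) (auto simp del: euler.simps simp: algebra_simps)
  also have "\<dots> = (\<Sum>j<J. \<integral>s. indicator {real j * hs n..<real (Suc j) * hs n} s *\<^sub>R rhs (euler n j) k \<partial>lborel)"
    using hs(1)[of n] by (intro sum.cong refl) (simp add: scaleR_conv_of_real algebra_simps)
  also have "\<dots> = (\<integral>s. indicator {0..<real J * hs n} s *\<^sub>R rhs (approx n s) k \<partial>lborel)"
    unfolding eq by (rule Bochner_Integration.integral_sum[symmetric]) (rule int)
  finally show "euler n J k - euler n 0 k = (\<integral>s. indicator {0..<real J * hs n} s *\<^sub>R rhs (approx n s) k \<partial>lborel)" .
qed

text \<open>The integral runs between the grid points representing s and t, so the identity is exact
  and rounding appears only in the limits of integration.\<close>

lemma approx_integral: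
  assumes k: "norm (freq k) \<le> real n" and st: "0 \<le> s" "s \<le> t"
  defines "J \<equiv> \<lambda>t. nat \<lfloor>t / hs n\<rfloor>"
  shows "approx n t k - approx n s k = (\<integral>u. indicator {real (J s) * hs n..<real (J t) * hs n} u *\<^sub>R rhs (approx n u) k \<partial>lborel)"
    and "integrable lborel (\<lambda>u. indicator {real (J s) * hs n..<real (J t) * hs n} u *\<^sub>R rhs (approx n u) k)"
proof -
  have "\<lfloor>s / hs n\<rfloor> \<le> \<lfloor>t / hs n\<rfloor>"
    using st hs(1)[of n] by (intro floor_mono divide_right_mono) auto
  then have le: "real (J s) * hs n \<le> real (J t) * hs n"
    using hs(1)[of n] by (intro mult_right_mono) (auto simp: J_def)
  have ind: "indicator {a..<b} u *\<^sub>R x = indicator {0..<b} u *\<^sub>R x - indicator {0..<a} u *\<^sub>R x"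
    if "0 \<le> a" "a \<le> b" for a b u :: real and x :: complex
    using that by (auto simp: indicator_def)
  have eq: "indicator {real (J s) * hs n..<real (J t) * hs n} u *\<^sub>R rhs (approx n u) k
      = indicator {0..<real (J t) * hs n} u *\<^sub>R rhs (approx n u) k - indicator {0..<real (J s) * hs n} u *\<^sub>R rhs (approx n u) k" for u
    using ind[OF _ le] hs(1)[of n] by (simp add: less_imp_le)
  show "integrable lborel (\<lambda>u. indicator {real (J s) * hs n..<real (J t) * hs n} u *\<^sub>R rhs (approx n u) k)"
    unfolding eq by (intro Bochner_Integration.integrable_diff euler_integral[OF k])
  have "approx n t k - approx n s k = (euler n (J t) k - euler n 0 k) - (euler n (J s) k - euler n 0 k)"
    by (simp add: approx_def J_def)
  also have "\<dots> = (\<integral>u. indicator {real (J s) * hs n..<real (J t) * hs n} u *\<^sub>R rhs (approx n u) k \<partial>lborel)"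
    unfolding eq euler_integral(2)[OF k] by (rule Bochner_Integration.integral_diff[symmetric]) (rule euler_integral[OF k])+
  finally show "approx n t k - approx n s k = (\<integral>u. indicator {real (J s) * hs n..<real (J t) * hs n} u *\<^sub>R rhs (approx n u) k \<partial>lborel)" .
qed

text \<open>From a positive time on, the right-hand sides of the scheme are bounded uniformly in the
  step, so the integral equation passes to the limit by dominated convergence.\<close>

lemma c_integral:
  assumes \<tau>: "0 < \<tau>" "\<tau> \<le> t"
  shows "c t k - c \<tau> k = (\<integral>u. indicator {\<tau>..t} u *\<^sub>R rhs (c u) k \<partial>lborel)"
proof -
  \<comment> \<open>The grid point representing \<tau> may lie below it; for small steps it stays
    above \<tau> / 2, and the majorant is taken from there on.\<close>
  define M where "M = K k * (1 + Gm 2 (\<tau> / 2) * (\<integral>l. gam l \<partial>count_space (UNIV :: (int ^ 'n) set)))"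
  define J where "J n t = real (nat \<lfloor>t / hs n\<rfloor>) * hs n" for n t
  have "0 < \<tau> / 2 / (4 * real (2 * CARD('n) + 2))"
    using \<tau> by (intro divide_pos_pos) auto
  then have "\<forall>\<^sub>F n in sequentially. hs n < \<tau> / 2 / (4 * real (2 * CARD('n) + 2))"
    by (rule order_tendstoD(2)[OF hs_tendsto])
  moreover have "\<forall>\<^sub>F n in sequentially. norm (freq k) \<le> real n"
    by (rule eventually_sequentiallyI[of "nat \<lceil>norm (freq k)\<rceil>"]) linarith
  ultimately have "\<forall>\<^sub>F n in sequentially. hs n < \<tau> / 2 / (4 * real (2 * CARD('n) + 2)) \<and> norm (freq k) \<le> real n"
    by (rule eventually_conj)
  then obtain N where N: "\<And>n. N \<le> n \<Longrightarrow> hs n < \<tau> / 2 / (4 * real (2 * CARD('n) + 2)) \<and> norm (freq k) \<le> real n"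
    by (auto simp: eventually_sequentially)
  define \<sigma> where "\<sigma> n = sub (n + N)" for n
  have \<sigma>N: "N \<le> \<sigma> n" for n
    using seq_suble[OF sub(1), of "n + N"] by (simp add: \<sigma>_def)
  have hsm: "hs (\<sigma> n) \<le> \<tau> / 2 / (4 * real (2 * CARD('n) + 2))" and fk: "norm (freq k) \<le> real (\<sigma> n)" for n
    using N[OF \<sigma>N[of n]] by auto
  have hs2: "hs (\<sigma> n) \<le> \<tau> / 2" for n
  proof -
    have "\<tau> / 2 / (4 * real (2 * CARD('n) + 2)) \<le> \<tau> / 2 / 1"
      using \<tau> by (intro divide_left_mono) auto
    from order_trans[OF hsm[of n] this] show ?thesis
      by (simp only: div_by_1)
  qed
  have hs\<sigma>: "(\<lambda>n. hs (\<sigma> n)) \<longlonglongrightarrow> 0"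
    unfolding \<sigma>_def
    using LIMSEQ_ignore_initial_segment[OF filterlim_compose[OF hs_tendsto sub_at_top], of N] by simp
  have Jlim: "(\<lambda>n. J (\<sigma> n) s) \<longlonglongrightarrow> s" if "0 \<le> s" for s
  proof (rule tendsto_sandwich[of "\<lambda>n. s - hs (\<sigma> n)" _ _ "\<lambda>_. s"])
    show "(\<lambda>n. s - hs (\<sigma> n)) \<longlonglongrightarrow> s"
      using tendsto_diff[OF tendsto_const[of s] hs\<sigma>] by simp
  qed (use step_index[OF that] in \<open>auto intro!: always_eventually less_imp_le simp: J_def\<close>)
  have J\<tau>: "\<tau> / 2 \<le> J (\<sigma> n) \<tau>" for n
    using step_index(2)[of \<tau> "\<sigma> n"] hs2[of n] \<tau> by (simp add: J_def)
  have Jt: "J (\<sigma> n) t \<le> t" for n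
    using step_index(1)[of t "\<sigma> n"] \<tau> by (simp add: J_def)
  have t0: "0 \<le> t" "0 \<le> \<tau>"
    using \<tau> by auto
  have "(\<lambda>n. \<integral>u. indicator {J (\<sigma> n) \<tau>..<J (\<sigma> n) t} u *\<^sub>R rhs (approx (\<sigma> n) u) k \<partial>lborel)
      \<longlonglongrightarrow> (\<integral>u. indicator {\<tau>..t} u *\<^sub>R rhs (c u) k \<partial>lborel)"
  proof (rule integral_dominated_convergence[where w = "\<lambda>u. indicator {\<tau> / 2..t} u *\<^sub>R M"])
    have "(\<lambda>u. indicator {\<tau>..t} u *\<^sub>R rhs (c u) k) \<in> borel_measurable borel"
      using \<tau> by (intro borel_measurable_continuous_on_indicator continuous_on_subset[OF rhs_c_continuous]) auto
    then show "(\<lambda>u. indicator {\<tau>..t} u *\<^sub>R rhs (c u) k) \<in> borel_measurable lborel"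
      by simp
    show "(\<lambda>u. indicator {J (\<sigma> n) \<tau>..<J (\<sigma> n) t} u *\<^sub>R rhs (approx (\<sigma> n) u) k) \<in> borel_measurable lborel" for n
      using approx_integral(2)[OF fk t0(2) \<tau>(2), of n] unfolding J_def by (rule borel_measurable_integrable)
    show "integrable lborel (\<lambda>u. indicator {\<tau> / 2..t} u *\<^sub>R M)"
      using \<tau> by (intro integrable_scaleR_left integrable_real_indicator) (auto simp: emeasure_lborel_Icc)
    show "AE u in lborel. norm (indicator {J (\<sigma> n) \<tau>..<J (\<sigma> n) t} u *\<^sub>R rhs (approx (\<sigma> n) u) k)
        \<le> indicator {\<tau> / 2..t} u *\<^sub>R M" for n
    proof (rule AE_I2)
      fix u
      have M0: "0 \<le> M"
        unfolding M_def using \<tau> gam_pos by (intro mult_nonneg_nonneg K_nonneg add_nonneg_nonneg Gm_nonneg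
            Bochner_Integration.integral_nonneg) (auto intro: less_imp_le)
      show "norm (indicator {J (\<sigma> n) \<tau>..<J (\<sigma> n) t} u *\<^sub>R rhs (approx (\<sigma> n) u) k) \<le> indicator {\<tau> / 2..t} u *\<^sub>R M"
      proof (cases "u \<in> {J (\<sigma> n) \<tau>..<J (\<sigma> n) t}")
        case True
        then have u: "\<tau> / 2 \<le> u" "u \<le> t"
          using J\<tau>[of n] Jt[of n] by auto
        have "norm (rhs (approx (\<sigma> n) u) k) \<le> M"
          unfolding M_def using \<tau> u hsm[of n] by (intro norm_rhs_app_le) auto
        then show ?thesis
          using True u by simp
      next
        case False
        then have "indicator {J (\<sigma> n) \<tau>..<J (\<sigma> n) t} u = (0 :: real)"
          by (rule indicator_simps)
        then show ?thesis
          using M0 by simp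
      qed
    qed
    \<comment> \<open>Only at the two end points may the indicators fail to converge.\<close>
    have "AE u in lborel. u \<noteq> \<tau> \<and> u \<noteq> t"
      using AE_lborel_singleton[of \<tau>] AE_lborel_singleton[of t] by eventually_elim simp
    then show "AE u in lborel. (\<lambda>n. indicator {J (\<sigma> n) \<tau>..<J (\<sigma> n) t} u *\<^sub>R rhs (approx (\<sigma> n) u) k)
        \<longlonglongrightarrow> indicator {\<tau>..t} u *\<^sub>R rhs (c u) k"
    proof eventually_elim
      case (elim u)
      consider "u < \<tau>" | "\<tau> < u" "u < t" | "t < u"
        using elim by linarith
      then show ?case
      proof cases
        case 1
        have "\<forall>\<^sub>F n in sequentially. u < J (\<sigma> n) \<tau>"
          by (rule order_tendstoD(1)[OF Jlim[OF t0(2)] 1])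
        then have "\<forall>\<^sub>F n in sequentially. indicator {J (\<sigma> n) \<tau>..<J (\<sigma> n) t} u *\<^sub>R rhs (approx (\<sigma> n) u) k
            = indicator {\<tau>..t} u *\<^sub>R rhs (c u) k"
          by eventually_elim (use 1 in auto)
        then show ?thesis
          by (rule tendsto_eventually)
      next
        case 2
        have "\<forall>\<^sub>F n in sequentially. J (\<sigma> n) \<tau> < u" "\<forall>\<^sub>F n in sequentially. u < J (\<sigma> n) t"
          by (rule order_tendstoD(2)[OF Jlim[OF t0(2)] 2(1)] order_tendstoD(1)[OF Jlim[OF t0(1)] 2(2)])+
        then have "\<forall>\<^sub>F n in sequentially. rhs (approx (\<sigma> n) u) k
            = indicator {J (\<sigma> n) \<tau>..<J (\<sigma> n) t} u *\<^sub>R rhs (approx (\<sigma> n) u) k"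
          by eventually_elim simp
        moreover have "(\<lambda>n. rhs (approx (\<sigma> n) u) k) \<longlonglongrightarrow> rhs (c u) k"
          unfolding \<sigma>_def using LIMSEQ_ignore_initial_segment[OF rhs_app_tendsto[of u k], of N] 2 \<tau> by simp
        ultimately have "(\<lambda>n. indicator {J (\<sigma> n) \<tau>..<J (\<sigma> n) t} u *\<^sub>R rhs (approx (\<sigma> n) u) k) \<longlonglongrightarrow> rhs (c u) k"
          by (rule Lim_transform_eventually[rotated])
        then show ?thesis
          using 2 by simp
      next
        case 3
        then have "indicator {J (\<sigma> n) \<tau>..<J (\<sigma> n) t} u *\<^sub>R rhs (approx (\<sigma> n) u) k
            = indicator {\<tau>..t} u *\<^sub>R rhs (c u) k" for n
          using Jt[of n] by auto
        then show ?thesis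
          by simp
      qed
    qed
  qed
  moreover have "(\<integral>u. indicator {J (\<sigma> n) \<tau>..<J (\<sigma> n) t} u *\<^sub>R rhs (approx (\<sigma> n) u) k \<partial>lborel)
      = approx (\<sigma> n) t k - approx (\<sigma> n) \<tau> k" for n
    using approx_integral(1)[OF fk t0(2) \<tau>(2), of n] by (simp add: J_def)
  moreover have "(\<lambda>n. approx (\<sigma> n) t k - approx (\<sigma> n) \<tau> k) \<longlonglongrightarrow> c t k - c \<tau> k"
    unfolding \<sigma>_def
    using tendsto_diff[OF LIMSEQ_ignore_initial_segment[OF c_lim[OF t0(1), of k], of N] LIMSEQ_ignore_initial_segment[OF c_lim[OF t0(2), of k], of N]] .
  ultimately show ?thesis
    using LIMSEQ_unique by simp
qed

text \<open>The right-hand side is continuous for positive times, so the integral equation can be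
  differentiated; the base point t / 2 is one of many possible earlier positive times.\<close>

lemma c_deriv:
  assumes t: "0 < t"
  shows "((\<lambda>s. c s k) has_vector_derivative rhs (c t) k) (at t)"
proof -
  define \<tau> where "\<tau> = t / 2"
  have \<tau>: "0 < \<tau>" "\<tau> < t"
    using t by (auto simp: \<tau>_def)
  have cont: "continuous_on {\<tau>..b} (\<lambda>s. rhs (c s) k)" for b
    using \<tau> by (intro continuous_on_subset[OF rhs_c_continuous]) auto
  have eq: "c s k = c \<tau> k + integral {\<tau>..s} (\<lambda>u. rhs (c u) k)" if "\<tau> \<le> s" for s
  proof -
    have "set_integrable lborel {\<tau>..s} (\<lambda>u. rhs (c u) k)"
      by (rule borel_integrable_atLeastAtMost') (rule cont)
    then have "(LINT u:{\<tau>..s}|lborel. rhs (c u) k) = integral {\<tau>..s} (\<lambda>u. rhs (c u) k)"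
      by (rule set_borel_integral_eq_integral)
    then show ?thesis
      using c_integral[OF \<tau>(1) that, of k] by (simp add: set_lebesgue_integral_def algebra_simps)
  qed
  have "((\<lambda>s. integral {\<tau>..s} (\<lambda>u. rhs (c u) k)) has_vector_derivative rhs (c t) k) (at t within {\<tau>..t + 1})"
    using \<tau> by (intro integral_has_vector_derivative cont) auto
  then have "((\<lambda>s. c \<tau> k + integral {\<tau>..s} (\<lambda>u. rhs (c u) k)) has_vector_derivative rhs (c t) k) (at t within {\<tau>..t + 1})"
    using has_vector_derivative_add[OF has_vector_derivative_const] by fastforce
  then have "((\<lambda>s. c s k) has_vector_derivative rhs (c t) k) (at t within {\<tau>..t + 1})"
  proof (rule has_vector_derivative_transform[rotated 2])
    show "t \<in> {\<tau>..t + 1}"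
      using \<tau> by simp
    show "c s k = c \<tau> k + integral {\<tau>..s} (\<lambda>u. rhs (c u) k)" if "s \<in> {\<tau>..t + 1}" for s
      using that by (intro eq) simp
  qed
  then show ?thesis
    using \<tau> by (subst (asm) at_within_interior) (auto simp: interior_atLeastAtMost_real)
qed

text \<open>Fatou over frequencies and then over time. In contrast to the moment bounds for positive
  times, this one reaches down to t = 0, and integrability near 0 rests on it.\<close>

lemma c_dissipation:
  assumes T: "0 < T"
  shows "(\<integral>\<^sup>+t. (\<integral>\<^sup>+k. ennreal (norm (freq k) ^ 4 * norm (c t k)) \<partial>count_space UNIV) * indicator {0..T} t \<partial>lborel) \<le> ennreal (z / \<delta>)"
proof -
  define F where "F n t = (\<integral>\<^sup>+k. ennreal (norm (freq k) ^ 4 * norm (approx (sub n) t k)) \<partial>count_space UNIV)" for n t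
  have F: "F n t = ennreal (mom1 4 (euler (sub n) (nat \<lfloor>t / hs (sub n)\<rfloor>)))" for n t
    using approx_nn_mom[OF submult_1, of 4 "sub n" t] by (simp add: F_def mwt_def approx_def)
  have Fmeas: "F n \<in> borel_measurable lborel" for n
  proof -
    have "(\<lambda>t. nat \<lfloor>t / hs (sub n)\<rfloor>) \<in> measurable lborel (count_space UNIV)"
      by measurable
    then show ?thesis
      unfolding F by (rule measurable_compose) simp
  qed
  have "(\<integral>\<^sup>+t. (\<integral>\<^sup>+k. ennreal (norm (freq k) ^ 4 * norm (c t k)) \<partial>count_space UNIV) * indicator {0..T} t \<partial>lborel)
      \<le> (\<integral>\<^sup>+t. liminf (\<lambda>n. F n t * indicator {0..T} t) \<partial>lborel)"
  proof (rule nn_integral_mono)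
    fix t
    show "(\<integral>\<^sup>+k. ennreal (norm (freq k) ^ 4 * norm (c t k)) \<partial>count_space UNIV) * indicator {0..T} t
        \<le> liminf (\<lambda>n. F n t * indicator {0..T} t)"
    proof (cases "t \<in> {0..T}")
      case True
      have "(\<integral>\<^sup>+k. ennreal (norm (freq k) ^ 4 * norm (c t k)) \<partial>count_space UNIV)
          = (\<integral>\<^sup>+k. liminf (\<lambda>n. ennreal (norm (freq k) ^ 4 * norm (approx (sub n) t k))) \<partial>count_space UNIV)"
      proof (rule nn_integral_cong)
        fix k
        have "(\<lambda>n. ennreal (norm (freq k) ^ 4 * norm (approx (sub n) t k))) \<longlonglongrightarrow> ennreal (norm (freq k) ^ 4 * norm (c t k))"
          using True by (intro tendsto_ennrealI tendsto_mult tendsto_const tendsto_norm c_lim) auto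
        then show "ennreal (norm (freq k) ^ 4 * norm (c t k)) = liminf (\<lambda>n. ennreal (norm (freq k) ^ 4 * norm (approx (sub n) t k)))"
          using lim_imp_Liminf trivial_limit_sequentially by fastforce
      qed
      also have "\<dots> \<le> liminf (\<lambda>n. F n t)"
        unfolding F_def by (rule nn_integral_liminf) simp
      finally show ?thesis
        using True by simp
    qed simp
  qed
  also have "\<dots> \<le> liminf (\<lambda>n. \<integral>\<^sup>+t. F n t * indicator {0..T} t \<partial>lborel)"
    using Fmeas by (intro nn_integral_liminf) simp
  also have "\<dots> \<le> ennreal (z / \<delta>)"
  proof (rule Liminf_le)
    show "\<forall>\<^sub>F n in sequentially. (\<integral>\<^sup>+t. F n t * indicator {0..T} t \<partial>lborel) \<le> ennreal (z / \<delta>)"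
    proof (intro always_eventually allI)
      fix n
      define h where "h = hs (sub n)"
      \<comment> \<open>One step more than fits into [0, T], so that the grid covers T.\<close>
      define J where "J = Suc (nat \<lfloor>T / h\<rfloor>)"
      have h: "0 < h"
        using hs(1) by (simp add: h_def)
      have "T < real J * h"
        using step_index(2)[of T "sub n"] T by (simp add: J_def h_def algebra_simps)
      then have "(\<integral>\<^sup>+t. F n t * indicator {0..T} t \<partial>lborel)
          \<le> (\<integral>\<^sup>+t. F n t * indicator {0..<real J * h} t \<partial>lborel)"
        by (intro nn_integral_mono mult_left_mono) (auto simp: indicator_def)
      also have "\<dots> = (\<Sum>j<J. ennreal h * ennreal (mom1 4 (euler (sub n) j)))"
        unfolding F h_def[symmetric] by (rule nn_integral_step[OF h])
      also have "\<dots> = ennreal (\<Sum>j<J. h * mom1 4 (euler (sub n) j))"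
      proof -
        have "0 \<le> mom1 4 (euler (sub n) j)" for j
          by (rule mom_nonneg[OF submult_1])
        then show ?thesis
          using h by (subst sum_ennreal[symmetric]) (auto simp: ennreal_mult)
      qed
      also have "\<dots> \<le> ennreal (z / \<delta>)"
        unfolding h_def by (intro ennreal_leI euler_sum_mom4)
      finally show "(\<integral>\<^sup>+t. F n t * indicator {0..T} t \<partial>lborel) \<le> ennreal (z / \<delta>)" .
    qed
  qed simp
  finally show ?thesis .
qed

end

section \<open>Weak derivatives of Fourier series\<close>

text \<open>The real part yields a real function for every sequence; for \<open>herm\<close>
  sequences nothing is lost.\<close>

definition U :: "(int ^ 'n::finite \<Rightarrow> complex) \<Rightarrow> real ^ 'n \<Rightarrow> real" where
  "U a x = Re (ser a x)"

lemma U_ser: "herm a \<Longrightarrow> complex_of_real (U a x) = ser a x"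
  using ser_real[of a x] by (simp add: U_def complex_eq_iff)

lemma continuous_on_U: "l1 a \<Longrightarrow> continuous_on S (U a)"
  unfolding U_def by (intro continuous_intros continuous_on_ser)

lemma periodic_U: "periodic (U a)"
  using periodic_ser[of a] by (simp add: periodic_def U_def)

lemma U_diff: "l1 a \<Longrightarrow> l1 b \<Longrightarrow> U a - U b = U (\<lambda>k. a k - b k)"
  by (rule ext) (simp add: U_def ser_diff)

lemma abs_U_le: "\<bar>U a x\<bar> \<le> (\<integral>k. norm (a k) \<partial>count_space UNIV)"
  unfolding U_def using abs_Re_le_cmod norm_ser_le order_trans by blast

lemma U_measurable: "l1 a \<Longrightarrow> U a \<in> borel_measurable torus"
  by (intro borel_measurable_torus continuous_on_U)

lemma L1_measurable: "f \<in> L1 \<Longrightarrow> f \<in> borel_measurable torus"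
  by (simp add: L1_def borel_measurable_integrable)

lemma U_L1: "l1 a \<Longrightarrow> U a \<in> L1"
  by (simp add: L1_def periodic_U integrable_torus_continuous continuous_on_U)

lemma U_L2: "l1 a \<Longrightarrow> U a \<in> L2"
  unfolding L2_def by (auto intro!: periodic_U borel_measurable_torus integrable_torus_continuous continuous_on_U continuous_intros)

lemma U_Linf: "l1 a \<Longrightarrow> U a \<in> Linf"
  unfolding Linf_def using abs_U_le[of a] by (auto intro!: periodic_U borel_measurable_torus continuous_on_U)

lemma fourier_coeff_U: "herm a \<Longrightarrow> l1 a \<Longrightarrow> fourier_coeff (U a) = a"
  by (simp add: fourier_coeff_eq_fc U_ser fc_ser_eq)

lemma Linf_norm_le:
  assumes "f \<in> borel_measurable torus" "AE x in torus. \<bar>f x\<bar> \<le> C" "0 \<le> C"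
  shows "Linf_norm f \<le> C"
proof -
  have "esssup torus (\<lambda>x. ereal \<bar>f x\<bar>) \<le> ereal C"
    by (rule esssup_I) (use assms in auto)
  \<comment> \<open>An essential supremum of -\<infinity> would be sent to 0 by
    \<open>real_of_ereal\<close>; that case uses \<open>0 \<le> C\<close>.\<close>
  then show ?thesis
    unfolding Linf_norm_def using assms(3) by (cases "esssup torus (\<lambda>x. ereal \<bar>f x\<bar>)") auto
qed

text \<open>The torus has positive measure, so the essential supremum of the zero function is 0 and
  a lower bound for that of |f|.\<close>

lemma Linf_norm_nonneg:
  fixes f :: "real ^ 'n::finite \<Rightarrow> real"
  assumes "f \<in> borel_measurable torus"
  shows "0 \<le> Linf_norm f"
proof -
  have "measure (torus :: (real ^ 'n) measure) (space torus) \<noteq> 0"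
    by (simp add: measure_torus)
  then have "emeasure (torus :: (real ^ 'n) measure) (space torus) \<noteq> 0"
    by (auto simp: measure_def)
  then have "esssup (torus :: (real ^ 'n) measure) (\<lambda>_. 0 :: ereal) = 0"
    by (rule esssup_const)
  moreover have "esssup (torus :: (real ^ 'n) measure) (\<lambda>_. 0) \<le> esssup torus (\<lambda>x. ereal \<bar>f x\<bar>)"
    by (rule esssup_mono) (use assms in auto)
  ultimately show ?thesis
    unfolding Linf_norm_def by (intro real_of_ereal_pos) simp
qed

text \<open>Uniqueness of coefficients for real functions. It identifies functions known only
  through an abstract property, such as weak derivatives.\<close>

lemma real_AE_eq_U:
  fixes g :: "real ^ 'n::finite \<Rightarrow> real"
  assumes g: "integrable torus g" and fc: "fourier_coeff g = a" and a: "herm a" "l1 a"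
  shows "AE x in torus. g x = U a x"
proof -
  have gi: "integrable torus (\<lambda>x. complex_of_real (g x))"
    using g by simp
  have "wien (\<lambda>x. complex_of_real (g x))"
    using a gi fc by (simp add: wien_def fourier_coeff_eq_fc)
  then have "AE x in torus. complex_of_real (g x) = ser (fc (\<lambda>x. complex_of_real (g x))) x"
    by (rule wien_AE_eq_ser)
  then have "AE x in torus. complex_of_real (g x) = ser a x"
    using fc by (simp add: fourier_coeff_eq_fc)
  then show ?thesis
    by eventually_elim (simp add: U_ser[OF a(1), symmetric])
qed

section \<open>Integration by parts against exponentials and trigonometric test functions\<close>

lemma line_derivative:
  fixes f :: "'a::euclidean_space \<Rightarrow> real"
  assumes f: "f differentiable (at x within S)" and b: "b \<in> Basis" and S: "\<And>s. s \<in> T \<Longrightarrow> x + (s - t) *\<^sub>R b \<in> S"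
  shows "((\<lambda>s. f (x + (s - t) *\<^sub>R b)) has_vector_derivative partial_on S b f x) (at t within T)"
proof -
  have "(f has_derivative frechet_derivative f (at x within S)) (at x within S)"
    using f by (simp add: frechet_derivative_works)
  then have "(f has_derivative frechet_derivative f (at x within S)) (at (x + (t - t) *\<^sub>R b) within (\<lambda>s. x + (s - t) *\<^sub>R b) ` T)"
    using S by (auto intro: has_derivative_subset)
  moreover have "((\<lambda>s. x + (s - t) *\<^sub>R b) has_derivative (\<lambda>h. h *\<^sub>R b)) (at t within T)"
    by (auto intro!: derivative_eq_intros)
  ultimately have "((\<lambda>s. f (x + (s - t) *\<^sub>R b)) has_derivative (\<lambda>h. frechet_derivative f (at x within S) (h *\<^sub>R b))) (at t within T)"
    using has_derivative_in_compose[of "\<lambda>s. x + (s - t) *\<^sub>R b" "\<lambda>h. h *\<^sub>R b" t T f "frechet_derivative f (at x within S)"] by simp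
  moreover have "linear (frechet_derivative f (at x within S))"
    using f by (simp add: linear_frechet_derivative)
  ultimately show ?thesis
    by (simp add: has_vector_derivative_def partial_on_def linear_scale)
qed

lemma axis_eq_scaleR: "axis i s = s *\<^sub>R (axis i 1 :: real ^ 'n::finite)"
  by (simp add: vec_eq_iff axis_def)

lemma wave_line_derivative:
  "((\<lambda>s. wave k (x + axis i s)) has_vector_derivative \<i> * of_real (freq k $ i) * wave k x) (at 0)"
proof -
  have eq: "wave k (x + axis i s) = wave k x * exp (\<i> * of_real (freq k $ i) * of_real s)" for s
    by (simp add: wave_plus wave_axis cis_conv_exp freq_def mult_ac)
  have "((\<lambda>s. wave k x * exp (\<i> * of_real (freq k $ i) * of_real s)) has_vector_derivative
      wave k x * (\<i> * of_real (freq k $ i) * exp (\<i> * of_real (freq k $ i) * of_real 0))) (at 0)"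
    by (auto intro!: derivative_eq_intros has_vector_derivative_real_field)
  then show ?thesis
    unfolding eq by (simp add: mult_ac)
qed

text \<open>The product with the exponential is periodic, so its derivative integrates to 0.\<close>

lemma integral_torus_wave_derivative:
  fixes f f' :: "real ^ 'n::finite \<Rightarrow> real"
  assumes f: "continuous_on UNIV f" "periodic f" "continuous_on UNIV f'"
    and D: "\<And>x. ((\<lambda>s. f (x + axis i s)) has_vector_derivative f' x) (at 0)"
  shows "(LINT x|torus. wave k x * of_real (f' x)) = - (\<i> * of_real (freq k $ i) * (LINT x|torus. wave k x * of_real (f x)))"
proof -
  have c: "continuous_on UNIV (\<lambda>x. wave k x * of_real (f' x))"
    "continuous_on UNIV (\<lambda>x. \<i> * of_real (freq k $ i) * (wave k x * of_real (f x)))"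
    by (intro continuous_intros f)+
  have "(LINT x|torus. wave k x * of_real (f' x) + \<i> * of_real (freq k $ i) * (wave k x * of_real (f x))) = 0"
  proof (rule integral_torus_derivative[where f = "\<lambda>x. wave k x * of_real (f x)" and i = i])
    show "continuous_on UNIV (\<lambda>x. wave k x * complex_of_real (f x))"
      by (intro continuous_intros f)
    show "periodic (\<lambda>x. wave k x * complex_of_real (f x))"
      using periodic_wave[of k] f(2) by (simp add: periodic_def)
    show "continuous_on UNIV (\<lambda>x. wave k x * of_real (f' x) + \<i> * of_real (freq k $ i) * (wave k x * of_real (f x)))"
      by (intro continuous_intros f)
    show "((\<lambda>s. wave k (x + axis i s) * complex_of_real (f (x + axis i s))) has_vector_derivative
        wave k x * of_real (f' x) + \<i> * of_real (freq k $ i) * (wave k x * of_real (f x))) (at 0)" for x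
    proof -
      have 0: "x + axis i 0 = x"
        by (simp add: vec_eq_iff axis_def)
      have "((\<lambda>s. complex_of_real (f (x + axis i s))) has_vector_derivative of_real (f' x)) (at 0)"
        by (rule bounded_linear.has_vector_derivative[OF bounded_linear_of_real D])
      from has_vector_derivative_mult[OF wave_line_derivative[of k x i] this] show ?thesis
        by (simp add: 0 mult_ac)
    qed
  qed
  then show ?thesis
    using c by (simp add: integrable_torus_continuous add_eq_0_iff)
qed

lemma smooth_on_continuous:
  assumes "smooth_on S f"
  shows "continuous_on S f" "f differentiable_on S"
    and "b \<in> Basis \<Longrightarrow> smooth_on S (partial_on S b f)"
proof -
  have C: "Ck_on k S f" for k
    using assms by (simp add: smooth_on_def)
  show "continuous_on S f" "f differentiable_on S"
    using C[of 0] C[of 1] by simp_all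
  show "smooth_on S (partial_on S b f)" if "b \<in> Basis"
    unfolding smooth_on_def using C[of "Suc k" for k] that by simp
qed

lemma smooth_line_derivative:
  fixes f :: "real ^ 'n::finite \<Rightarrow> real"
  assumes "smooth_on UNIV f"
  shows "((\<lambda>s. f (x + axis i s)) has_vector_derivative partial_on UNIV (axis i 1) f x) (at 0)"
proof -
  have "f differentiable (at x within UNIV)"
    using smooth_on_continuous(2)[OF assms] by (simp add: differentiable_on_def)
  from line_derivative[OF this, of "axis i 1" UNIV 0] show ?thesis
    by (simp flip: axis_eq_scaleR)
qed

text \<open>Differentiation shifts the phase by pi / 2 and changes the amplitude, so the family is
  closed under partial derivatives and the induction runs over all amplitudes and phases.\<close>

lemma smooth_cos: "smooth_on UNIV (\<lambda>x :: real ^ 'n::finite. r * cos (\<kappa> \<bullet> x + \<theta>))"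
proof -
  have D: "((\<lambda>x. r * cos (\<kappa> \<bullet> x + \<theta>)) has_derivative (\<lambda>h. r * (- sin (\<kappa> \<bullet> x + \<theta>) * (\<kappa> \<bullet> h)))) (at x)" for r \<theta> and x :: "real ^ 'n"
    by (auto intro!: derivative_eq_intros)
  have P: "partial_on UNIV b (\<lambda>x. r * cos (\<kappa> \<bullet> x + \<theta>)) = (\<lambda>x. (r * (\<kappa> \<bullet> b)) * cos (\<kappa> \<bullet> x + (\<theta> + pi / 2)))" for r \<theta> and b :: "real ^ 'n"
  proof
    fix x
    have "frechet_derivative (\<lambda>x. r * cos (\<kappa> \<bullet> x + \<theta>)) (at x) = (\<lambda>h. r * (- sin (\<kappa> \<bullet> x + \<theta>) * (\<kappa> \<bullet> h)))"
      by (rule frechet_derivative_at[OF D, symmetric])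
    moreover have "cos (\<kappa> \<bullet> x + (\<theta> + pi / 2)) = - sin (\<kappa> \<bullet> x + \<theta>)"
      by (simp add: cos_add sin_add flip: add.assoc)
    ultimately show "partial_on UNIV b (\<lambda>x. r * cos (\<kappa> \<bullet> x + \<theta>)) x = (r * (\<kappa> \<bullet> b)) * cos (\<kappa> \<bullet> x + (\<theta> + pi / 2))"
      by (simp add: partial_on_def)
  qed
  have "Ck_on k UNIV (\<lambda>x :: real ^ 'n. r * cos (\<kappa> \<bullet> x + \<theta>))" for k r \<theta>
  proof (induction k arbitrary: r \<theta>)
    case 0
    show ?case
      by (auto intro!: continuous_intros)
  next
    case (Suc k)
    have "(\<lambda>x. r * cos (\<kappa> \<bullet> x + \<theta>)) differentiable_on UNIV"
      using D[of r \<theta>] by (auto simp: differentiable_on_def differentiable_def)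
    then show ?case
      using Suc by (simp add: P)
  qed
  then show ?thesis
    by (simp add: smooth_on_def)
qed

lemma periodic_cos_freq: "periodic (\<lambda>x. r * cos (freq k \<bullet> x + \<theta>))"
proof -
  have "cos (freq k \<bullet> (x + axis i (2 * pi)) + \<theta>) = cos (freq k \<bullet> x + \<theta>)" for x i
  proof -
    have "wave k (x + axis i (2 * pi)) = wave k x"
      using periodic_wave[of k] by (simp add: periodic_def)
    then have "cis (freq k \<bullet> (x + axis i (2 * pi)) + \<theta>) = cis (freq k \<bullet> x + \<theta>)"
      by (simp add: wave_def flip: cis_mult)
    then show ?thesis
      by (simp add: complex_eq_iff)
  qed
  then show ?thesis
    by (simp add: periodic_def)
qed

text \<open>Stated for any f that agrees with the series almost everywhere, since in second
  derivatives \<open>weak_deriv\<close> is applied to a function known only up to null sets.\<close>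

lemma has_weak_deriv_U:
  assumes a: "herm a" "l1 a" "l1 (Dc i a)" and f: "f \<in> L1" "AE x in torus. f x = U a x"
  shows "has_weak_deriv i f (U (Dc i a))"
  unfolding has_weak_deriv_def
proof (intro conjI allI impI)
  show "f \<in> L1" "U (Dc i a) \<in> L1"
    by (rule f U_L1 a)+
  fix \<psi> :: "real ^ 'a \<Rightarrow> real"
  assume "smooth_on UNIV \<psi> \<and> periodic \<psi>"
  then have \<psi>: "smooth_on UNIV \<psi>" "periodic \<psi>"
    by auto
  define d where "d = partial_on UNIV (axis i 1) \<psi>"
  have c\<psi>: "continuous_on UNIV \<psi>" "continuous_on UNIV d"
    unfolding d_def by (intro smooth_on_continuous \<psi>; simp)+
  have ci: "integrable torus (\<lambda>x. complex_of_real (\<psi> x))" "integrable torus (\<lambda>x. complex_of_real (d x))"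
    by (intro integrable_torus_continuous continuous_intros c\<psi>)+
  have "(LINT x|torus. f x * d x) = (LINT x|torus. U a x * d x)"
  proof (rule integral_cong_AE)
    show "AE x in torus. f x * d x = U a x * d x"
      using f(2) by eventually_elim simp
  qed (rule borel_measurable_times L1_measurable[OF f(1)] U_measurable[OF a(2)] borel_measurable_torus[OF c\<psi>(2)])+
  then have "complex_of_real (LINT x|torus. f x * d x) = (LINT x|torus. ser a x * of_real (d x))"
    by (simp flip: U_ser[OF a(1)] of_real_mult)
  also have "\<dots> = (\<integral>k. a k * (LINT x|torus. wave k x * of_real (d x)) \<partial>count_space UNIV)"
    by (rule ser_swap[OF a(2) ci(2)])
  also have "\<dots> = (\<integral>k. - (Dc i a k * (LINT x|torus. wave k x * of_real (\<psi> x))) \<partial>count_space UNIV)"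
  proof (intro Bochner_Integration.integral_cong refl)
    fix k
    have "(LINT x|torus. wave k x * of_real (d x)) = - (\<i> * of_real (freq k $ i) * (LINT x|torus. wave k x * of_real (\<psi> x)))"
      by (rule integral_torus_wave_derivative[OF c\<psi>(1) \<psi>(2) c\<psi>(2)]) (unfold d_def, rule smooth_line_derivative[OF \<psi>(1)])
    then show "a k * (LINT x|torus. wave k x * of_real (d x)) = - (Dc i a k * (LINT x|torus. wave k x * of_real (\<psi> x)))"
      by (simp add: Dc_def mult_ac)
  qed
  also have "\<dots> = - (LINT x|torus. ser (Dc i a) x * of_real (\<psi> x))"
    by (simp add: ser_swap[OF a(3) ci(1)])
  also have "\<dots> = complex_of_real (- (LINT x|torus. U (Dc i a) x * \<psi> x))"
    by (simp flip: U_ser[OF herm_Dc[OF a(1)]] of_real_mult)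
  finally show "(LINT x|torus. f x * partial_on UNIV (axis i 1) \<psi> x) = - (LINT x|torus. U (Dc i a) x * \<psi> x)"
    unfolding d_def[symmetric] of_real_eq_iff .
qed

text \<open>Test functions are real, so the exponential is split into cosines of phase 0 and pi / 2.
  A derivative turns phase 0 into pi / 2 and pi / 2 into pi, which is minus phase 0; together this
  is multiplication by i k_i.\<close>

lemma fourier_coeff_weak_deriv:
  fixes f g :: "real ^ 'n::finite \<Rightarrow> real"
  assumes "has_weak_deriv i f g"
  shows "fourier_coeff g = Dc i (fourier_coeff f)"
proof
  fix k
  have gi: "integrable torus g" and fi: "integrable torus f"
    using assms by (auto simp: has_weak_deriv_def L1_def)
  define C where "C \<theta> x = 1 * cos (freq k \<bullet> x + \<theta>)" for \<theta> and x :: "real ^ 'n"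
  have C: "smooth_on UNIV (C \<theta>)" "periodic (C \<theta>)" for \<theta>
    unfolding C_def by (rule smooth_cos periodic_cos_freq)+
  have cC: "continuous_on UNIV (C \<theta>)" for \<theta>
    by (rule smooth_on_continuous[OF C(1)])
  have pC: "partial_on UNIV (axis i 1) (C \<theta>) x = freq k $ i * C (\<theta> + pi / 2) x" for \<theta> x
  proof -
    have D: "(C \<theta> has_derivative (\<lambda>h. - sin (freq k \<bullet> x + \<theta>) * (freq k \<bullet> h))) (at x)"
      unfolding C_def by (auto intro!: derivative_eq_intros)
    have "cos (freq k \<bullet> x + (\<theta> + pi / 2)) = - sin (freq k \<bullet> x + \<theta>)"
      by (simp add: cos_add sin_add flip: add.assoc)
    then show ?thesis
      by (simp add: partial_on_def frechet_derivative_at[OF D, symmetric] C_def inner_axis)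
  qed
  have parts: "(LINT x|torus. g x * C \<theta> x) = - (freq k $ i * (LINT x|torus. f x * C (\<theta> + pi / 2) x))" for \<theta>
  proof -
    have "(LINT x|torus. f x * partial_on UNIV (axis i 1) (C \<theta>) x) = - (LINT x|torus. g x * C \<theta> x)"
      using assms C by (auto simp: has_weak_deriv_def)
    moreover have "(LINT x|torus. f x * partial_on UNIV (axis i 1) (C \<theta>) x) = freq k $ i * (LINT x|torus. f x * C (\<theta> + pi / 2) x)"
    proof -
      have "f x * partial_on UNIV (axis i 1) (C \<theta>) x = freq k $ i * (f x * C (\<theta> + pi / 2) x)" for x
        by (simp add: pC)
      then show ?thesis
        by (simp only: integral_mult_right_zero)
    qed
    ultimately show ?thesis
      by simp
  qed
  have int: "integrable torus (\<lambda>x. h x * C \<theta> x)" if "integrable torus h" for h :: "real ^ 'n \<Rightarrow> real" and \<theta>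
  proof (rule Bochner_Integration.integrable_bound[OF that])
    show "(\<lambda>x. h x * C \<theta> x) \<in> borel_measurable torus"
      by (rule borel_measurable_times[OF borel_measurable_integrable[OF that] borel_measurable_torus[OF cC]])
    show "AE x in torus. norm (h x * C \<theta> x) \<le> norm (h x)"
      by (intro AE_I2) (simp add: C_def abs_mult mult_left_le)
  qed
  have wC: "wave (- k) x = of_real (C 0 x) + \<i> * of_real (C (pi / 2) x)" for x
    by (simp add: wave_def freq_uminus complex_eq_iff C_def cos_add)
  have fcC: "(LINT x|torus. of_real (h x) * wave (- k) x)
      = of_real (LINT x|torus. h x * C 0 x) + \<i> * of_real (LINT x|torus. h x * C (pi / 2) x)" if "integrable torus h" for h :: "real ^ 'n \<Rightarrow> real"
  proof -
    have "(LINT x|torus. of_real (h x) * wave (- k) x)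
        = (LINT x|torus. of_real (h x * C 0 x) + \<i> * of_real (h x * C (pi / 2) x))"
      unfolding wC by (simp add: algebra_simps)
    also have "\<dots> = (LINT x|torus. of_real (h x * C 0 x)) + (LINT x|torus. \<i> * of_real (h x * C (pi / 2) x))"
      using int[OF that, of 0] int[OF that, of "pi / 2"]
      by (intro Bochner_Integration.integral_add integrable_mult_right integrable_of_real)
    also have "\<dots> = of_real (LINT x|torus. h x * C 0 x) + \<i> * of_real (LINT x|torus. h x * C (pi / 2) x)"
      by (simp only: integral_mult_right_zero integral_complex_of_real)
    finally show ?thesis .
  qed
  have Cpi: "C pi x = - C 0 x" for x
    by (simp add: C_def cos_add)
  have "(LINT x|torus. of_real (g x) * wave (- k) x) = \<i> * of_real (freq k $ i) * (LINT x|torus. of_real (f x) * wave (- k) x)"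
    unfolding fcC[OF gi] fcC[OF fi] parts by (simp add: Cpi complex_eq_iff)
  then show "fourier_coeff g k = Dc i (fourier_coeff f) k"
    by (simp add: fourier_coeff_eq_fc fc_def Dc_def)
qed

lemma fourier_coeff_cong_AE:
  assumes "AE x in torus. f x = g x" "f \<in> borel_measurable torus" "g \<in> borel_measurable torus"
  shows "fourier_coeff f = fourier_coeff g"
  unfolding fourier_coeff_eq_fc
  by (rule ext, rule fc_cong_AE) (use assms in \<open>auto elim: eventually_mono\<close>)

text \<open>\<open>weak_deriv\<close> is an arbitrary choice, but its coefficients are forced, and
  these determine it almost everywhere.\<close>

lemma weak_deriv_U:
  fixes a :: "int ^ 'n::finite \<Rightarrow> complex"
  assumes a: "herm a" "l1 a" "l1 (Dc i a)" and f: "f \<in> L1" "AE x in torus. f x = U a x"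
  shows "has_weak_deriv i f (weak_deriv i f)" "weak_deriv i f \<in> L1" "AE x in torus. weak_deriv i f x = U (Dc i a) x"
proof -
  show w: "has_weak_deriv i f (weak_deriv i f)"
    unfolding weak_deriv_def
    by (rule someI[where P = "has_weak_deriv i f", OF has_weak_deriv_U[OF assms]])
  then show L: "weak_deriv i f \<in> L1"
    by (simp add: has_weak_deriv_def)
  have "fourier_coeff (weak_deriv i f) = Dc i (fourier_coeff f)"
    by (rule fourier_coeff_weak_deriv[OF w])
  also have "fourier_coeff f = a"
    using fourier_coeff_cong_AE[OF f(2) L1_measurable[OF f(1)] U_measurable[OF a(2)]] fourier_coeff_U[OF a(1,2)]
    by simp
  finally show "AE x in torus. weak_deriv i f x = U (Dc i a) x"
    using L by (intro real_AE_eq_U herm_Dc a) (auto simp: L1_def)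
qed

section \<open>Sobolev norms and fluxes of regular series\<close>

definition reg :: "(int ^ 'n::finite \<Rightarrow> complex) \<Rightarrow> bool" where
  "reg a \<longleftrightarrow> herm a \<and> fin_mom (\<lambda>_. 1) a"

lemma reg_moment: "reg a \<Longrightarrow> j \<le> 4 \<Longrightarrow> integrable (count_space UNIV) (\<lambda>k. norm (freq k) ^ j * norm (a k))"
  using fin_momD[of "\<lambda>_. 1" a j] by (simp add: reg_def mwt_def)

lemma norm_Dc_Dc_le: "norm (Dc i (Dc j a) k) \<le> norm (freq k) ^ 2 * norm (a k)"
proof -
  have "norm (Dc i (Dc j a) k) \<le> norm (freq k) * norm (Dc j a k)"
    by (rule norm_Dc_le)
  also have "\<dots> \<le> norm (freq k) * (norm (freq k) * norm (a k))"
    by (intro mult_left_mono norm_Dc_le) simp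
  finally show ?thesis
    by (simp add: power2_eq_square mult.assoc)
qed

lemma regD:
  assumes a: "reg a"
  shows "herm a" "l1 a" "l1 (Dc i a)" "l1 (Dc i (Dc j a))"
proof -
  have f: "fin_mom (\<lambda>_. 1) a"
    using a by (simp add: reg_def)
  show "herm a"
    using a by (simp add: reg_def)
  show "l1 a" "l1 (Dc i a)"
    by (rule fin_mom_l1[OF submult_1 f])+
  show "l1 (Dc i (Dc j a))"
  proof (rule Bochner_Integration.integrable_bound)
    show "integrable (count_space UNIV) (\<lambda>k. norm (freq k) ^ 2 * norm (a k))"
      by (rule reg_moment[OF a]) simp
    show "AE k in count_space UNIV. norm (Dc i (Dc j a) k) \<le> norm (norm (freq k) ^ 2 * norm (a k))"
      by (rule AE_I2) (simp add: norm_Dc_Dc_le)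
  qed simp
qed

lemma Dc_diff: "Dc i (\<lambda>k. a k - b k) = (\<lambda>k. Dc i a k - Dc i b k)"
  by (simp add: Dc_def fun_eq_iff right_diff_distrib)

lemma reg_diff:
  assumes "reg a" "reg b"
  shows "reg (\<lambda>k. a k - b k)"
  unfolding reg_def fin_mom_def
proof (intro conjI allI impI)
  show "herm (\<lambda>k. a k - b k)"
    using assms by (simp add: reg_def herm_def)
  fix j :: nat assume j: "j \<le> 4"
  show "integrable (count_space UNIV) (\<lambda>k. mwt (\<lambda>_. 1) j k * norm (a k - b k))"
  proof (rule Bochner_Integration.integrable_bound)
    show "integrable (count_space UNIV) (\<lambda>k. norm (freq k) ^ j * norm (a k) + norm (freq k) ^ j * norm (b k))"
      by (intro Bochner_Integration.integrable_add reg_moment assms j)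
    show "AE k in count_space UNIV. norm (mwt (\<lambda>_. 1) j k * norm (a k - b k))
        \<le> norm (norm (freq k) ^ j * norm (a k) + norm (freq k) ^ j * norm (b k))"
    proof (rule AE_I2)
      fix k
      have "norm (freq k) ^ j * norm (a k - b k) \<le> norm (freq k) ^ j * (norm (a k) + norm (b k))"
        by (intro mult_left_mono norm_triangle_ineq4) simp
      then show "norm (mwt (\<lambda>_. 1) j k * norm (a k - b k)) \<le> norm (norm (freq k) ^ j * norm (a k) + norm (freq k) ^ j * norm (b k))"
        by (simp add: mwt_def distrib_left)
    qed
  qed simp
qed

lemma reg_0: "reg (\<lambda>_. 0)"
  by (simp add: reg_def herm_def fin_mom_def)

lemma weak_deriv_reg:
  assumes a: "reg a"
  shows "has_weak_deriv i (U a) (weak_deriv i (U a))" "AE x in torus. weak_deriv i (U a) x = U (Dc i a) x"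
    "weak_deriv i (U a) \<in> L1"
    "has_weak_deriv i (weak_deriv j (U a)) (weak_deriv i (weak_deriv j (U a)))"
    "AE x in torus. weak_deriv i (weak_deriv j (U a)) x = U (Dc i (Dc j a)) x"
    "weak_deriv i (weak_deriv j (U a)) \<in> L1"
proof -
  note 1 = weak_deriv_U[OF regD(1,2,3)[OF a] U_L1[OF regD(2)[OF a]] AE_I2[OF refl]]
  show "has_weak_deriv i (U a) (weak_deriv i (U a))" "AE x in torus. weak_deriv i (U a) x = U (Dc i a) x"
    "weak_deriv i (U a) \<in> L1"
    by (rule 1)+
  note 2 = weak_deriv_U[OF herm_Dc[OF regD(1)[OF a]] regD(3,4)[OF a] 1(2,3)]
  show "has_weak_deriv i (weak_deriv j (U a)) (weak_deriv i (weak_deriv j (U a)))"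
    "AE x in torus. weak_deriv i (weak_deriv j (U a)) x = U (Dc i (Dc j a)) x"
    "weak_deriv i (weak_deriv j (U a)) \<in> L1"
    by (rule 2)+
qed

lemma U_H1: "reg a \<Longrightarrow> U a \<in> H1"
  unfolding H1_def by (auto intro!: U_L2 regD exI[of _ "U (Dc _ a)"] bexI[of _ "U (Dc _ a)"] has_weak_deriv_U U_L1)

lemma U_W21:
  assumes "reg a"
  shows "U a \<in> W21"
  unfolding W21_def using weak_deriv_reg[OF assms] U_L1[OF regD(2)[OF assms]] by blast

lemma L2_norm_cong: "f \<in> L1 \<Longrightarrow> AE x in torus. f x = U a x \<Longrightarrow> l1 a \<Longrightarrow> (L2_norm f)\<^sup>2 = (LINT x|torus. (U a x)\<^sup>2)"
proof -
  assume f: "f \<in> L1" "AE x in torus. f x = U a x" "l1 a"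
  have "(LINT x|torus. (f x)\<^sup>2) = (LINT x|torus. (U a x)\<^sup>2)"
  proof (rule integral_cong_AE)
    show "AE x in torus. (f x)\<^sup>2 = (U a x)\<^sup>2"
      using f(2) by eventually_elim simp
  qed (rule borel_measurable_power L1_measurable[OF f(1)] U_measurable[OF f(3)])+
  then show ?thesis
    by (simp add: L2_norm_def)
qed

lemma L1_norm_cong: "f \<in> borel_measurable torus \<Longrightarrow> AE x in torus. f x = g x \<Longrightarrow> g \<in> borel_measurable torus \<Longrightarrow> L1_norm f = L1_norm g"
  unfolding L1_norm_def by (rule integral_cong_AE) (auto elim: eventually_mono)

lemma H1_norm_U:
  assumes "reg a"
  shows "H1_norm (U a) = sqrt ((LINT x|torus. (U a x)\<^sup>2) + (\<Sum>i\<in>UNIV. LINT x|torus. (U (Dc i a) x)\<^sup>2))"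
proof -
  have "(L2_norm (weak_deriv i (U a)))\<^sup>2 = (LINT x|torus. (U (Dc i a) x)\<^sup>2)" for i
    by (intro L2_norm_cong weak_deriv_reg regD assms)
  moreover have "(L2_norm (U a))\<^sup>2 = (LINT x|torus. (U a x)\<^sup>2)"
    by (intro L2_norm_cong U_L1 regD[OF assms]) simp
  ultimately show ?thesis
    by (simp add: H1_norm_def)
qed

lemma W21_norm_U:
  assumes "reg a"
  shows "W21_norm (U a) = (LINT x|torus. \<bar>U a x\<bar>) + (\<Sum>j\<in>UNIV. LINT x|torus. \<bar>U (Dc j a) x\<bar>)
     + (\<Sum>i\<in>UNIV. \<Sum>j\<in>UNIV. LINT x|torus. \<bar>U (Dc i (Dc j a)) x\<bar>)"
proof -
  have "L1_norm (weak_deriv i (U a)) = L1_norm (U (Dc i a))" for i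
    by (intro L1_norm_cong L1_measurable U_measurable weak_deriv_reg regD(3) assms)
  moreover have "L1_norm (weak_deriv i (weak_deriv j (U a))) = L1_norm (U (Dc i (Dc j a)))" for i j
    by (intro L1_norm_cong L1_measurable U_measurable weak_deriv_reg regD(4) assms)
  ultimately show ?thesis
    by (simp add: W21_norm_def L1_norm_def)
qed

text \<open>The explicit counterpart of \<open>flux\<close>, whose weak derivatives are fixed only
  up to null sets.\<close>

definition fluxU :: "'n::finite \<Rightarrow> 'n \<Rightarrow> (int ^ 'n \<Rightarrow> complex) \<Rightarrow> real ^ 'n \<Rightarrow> real" where
  "fluxU i j a x = U (Dc i (Dc j a)) x - U (Dc i a) x * U (Dc j a) x / (1 + U a x)"

lemma flux_U:
  assumes a: "reg a"
  shows "AE x in torus. flux i j (U a) x = fluxU i j a x" "periodic (flux i j (U a))"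
    "flux i j (U a) \<in> borel_measurable torus"
proof -
  note w = weak_deriv_reg[OF a]
  show "AE x in torus. flux i j (U a) x = fluxU i j a x"
    using w(5)[of i j] w(2)[of i] w(2)[of j] by eventually_elim (simp add: flux_def fluxU_def)
  have "periodic (weak_deriv i (weak_deriv j (U a)))" "periodic (weak_deriv i (U a))" "periodic (weak_deriv j (U a))" "periodic (U a)"
    using w(6)[where i = i and j = j] w(3)[where i = i] w(3)[where i = j] periodic_U by (auto simp: L1_def)
  then show "periodic (flux i j (U a))"
    by (simp add: periodic_def flux_def)
  have "weak_deriv i (weak_deriv j (U a)) \<in> borel_measurable torus" "weak_deriv i (U a) \<in> borel_measurable torus"
    "weak_deriv j (U a) \<in> borel_measurable torus" "U a \<in> borel_measurable torus"
    by (intro L1_measurable U_measurable w regD(2)[OF a])+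
  then show "flux i j (U a) \<in> borel_measurable torus"
    unfolding flux_def by measurable
qed

section \<open>Strong measurability and Bochner spaces\<close>

text \<open>Continuity on the open interval suffices: u is sampled on ever finer grids, with t
  rounded down. Sample times stay strictly inside (0, T), because norms may be unbounded near
  0.\<close>

lemma strongly_measurableI:
  fixes u :: "real \<Rightarrow> 'v::minus"
  assumes T: "0 < T" and X: "\<And>t. 0 < t \<Longrightarrow> t < T \<Longrightarrow> u t \<in> X"
    and lim: "\<And>t x. 0 < t \<Longrightarrow> t < T \<Longrightarrow> (\<And>n. x n \<in> {0<..<T}) \<Longrightarrow> x \<longlonglongrightarrow> t \<Longrightarrow> (\<lambda>n. N (u (x n) - u t)) \<longlonglongrightarrow> 0"
  shows "strongly_measurable T X N u"
proof -
  let ?M = "lebesgue_on {0<..<T}"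
  \<comment> \<open>The grid points are T j / (n + 2) with j between 1 and n + 1; the clamping keeps
    them inside the open interval for every real t.\<close>
  define \<tau> where "\<tau> n t = T * of_int (min (int n + 1) (max 1 \<lfloor>t * (real n + 2) / T\<rfloor>)) / (real n + 2)" for n t
  have \<tau>: "\<tau> n t \<in> {0<..<T}" for n t
  proof -
    define j where "j = min (int n + 1) (max 1 \<lfloor>t * (real n + 2) / T\<rfloor>)"
    have "1 \<le> j" "j \<le> int n + 1"
      by (auto simp: j_def)
    then have "0 < real_of_int j" "real_of_int j < real n + 2"
      by linarith+
    then have "0 < T * real_of_int j" "T * real_of_int j < T * (real n + 2)"
      using T by auto
    then show ?thesis
      unfolding \<tau>_def j_def[symmetric] by (auto simp: pos_divide_less_eq)
  qed
  have simple: "simple_function ?M (\<tau> n)" for n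
  proof (rule simple_function_borel_measurable)
    have "\<tau> n \<in> borel_measurable borel"
      unfolding \<tau>_def by measurable
    then show "\<tau> n \<in> borel_measurable ?M"
      by (intro measurable_restrict_space1 measurable_completion) simp
    have "\<tau> n ` space ?M \<subseteq> (\<lambda>j. T * of_int j / (real n + 2)) ` {1..int n + 1}"
      unfolding \<tau>_def by (rule image_subsetI, rule imageI) auto
    then show "finite (\<tau> n ` space ?M)"
      by (rule finite_subset) simp
  qed
  have \<tau>_lim: "(\<lambda>n. \<tau> n t) \<longlonglongrightarrow> t" if t: "0 < t" "t < T" for t
  proof (rule tendsto_sandwich[of "\<lambda>n. t - T / (real n + 2)" _ _ "\<lambda>_. t"])
    have "(\<lambda>n. T * inverse (real (n + 2))) \<longlonglongrightarrow> T * 0"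
      by (intro tendsto_mult tendsto_const LIMSEQ_ignore_initial_segment[OF lim_inverse_n])
    then have "(\<lambda>n. T / (real n + 2)) \<longlonglongrightarrow> 0"
      by (simp add: divide_inverse add.commute)
    then show "(\<lambda>n. t - T / (real n + 2)) \<longlonglongrightarrow> t"
      using tendsto_diff[OF tendsto_const[of t]] by force
    \<comment> \<open>From \<open>N\<close> on, t lies beyond the first grid point and the lower
      clamp is inactive.\<close>
    obtain N :: nat where N: "T / t < real N"
      using reals_Archimedean2 by blast
    have ev: "t - T / (real n + 2) \<le> \<tau> n t \<and> \<tau> n t \<le> t" if n: "N \<le> n" for n
    proof -
      define y where "y = t * (real n + 2) / T"
      have "T / t < real n + 2"
        using N n by linarith
      then have y1: "1 < y"
        using t T by (simp add: y_def field_simps)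
      have "t * (real n + 2) < T * (real n + 2)"
        using t by (intro mult_strict_right_mono) auto
      then have y2: "y < real n + 2"
        using T by (simp add: y_def pos_divide_less_eq mult.commute)
      have fl: "min (int n + 1) (max 1 \<lfloor>y\<rfloor>) = \<lfloor>y\<rfloor>"
        using y1 y2 by linarith
      have t_eq: "t = T * y / (real n + 2)"
        using T by (simp add: y_def)
      have "T * of_int \<lfloor>y\<rfloor> / (real n + 2) \<le> T * y / (real n + 2)"
        using T by (intro divide_right_mono mult_left_mono) auto
      moreover have "T * (y - 1) / (real n + 2) \<le> T * of_int \<lfloor>y\<rfloor> / (real n + 2)"
        using T by (intro divide_right_mono mult_left_mono) linarith+
      moreover have "T * (y - 1) / (real n + 2) = T * y / (real n + 2) - T / (real n + 2)"
        by (simp add: right_diff_distrib diff_divide_distrib)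
      moreover have "\<tau> n t = T * of_int \<lfloor>y\<rfloor> / (real n + 2)"
        unfolding \<tau>_def y_def[symmetric] fl ..
      ultimately show ?thesis
        unfolding t_eq[symmetric] by linarith
    qed
    show "\<forall>\<^sub>F n in sequentially. t - T / (real n + 2) \<le> \<tau> n t"
      by (rule eventually_sequentiallyI[of N]) (use ev in blast)
    show "\<forall>\<^sub>F n in sequentially. \<tau> n t \<le> t"
      by (rule eventually_sequentiallyI[of N]) (use ev in blast)
  qed simp
  show ?thesis
    unfolding strongly_measurable_def
  proof (intro exI[of _ "\<lambda>n t. u (\<tau> n t)"] conjI allI)
    show "simple_function ?M (\<lambda>t. u (\<tau> n t))" for n
      using simple_function_compose[OF simple, of u n] by (simp add: o_def)
    show "(\<lambda>t. u (\<tau> n t)) ` {0<..<T} \<subseteq> X" for n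
    proof (rule image_subsetI)
      fix t
      show "u (\<tau> n t) \<in> X"
        using \<tau>[of n t] by (intro X) auto
    qed
    show "AE t in ?M. (\<lambda>n. N (u (\<tau> n t) - u t)) \<longlonglongrightarrow> 0"
    proof (rule AE_I2)
      fix t assume "t \<in> space ?M"
      then have "0 < t" "t < T"
        by auto
      then show "(\<lambda>n. N (u (\<tau> n t) - u t)) \<longlonglongrightarrow> 0"
        by (intro lim \<tau> \<tau>_lim)
    qed
  qed
qed

lemma continuous_zero_imp_seq:
  fixes f :: "real \<Rightarrow> real"
  assumes "continuous_on {0<..} f" "f t = 0" "0 < t" "\<And>n. x n \<in> {0<..<T}" "x \<longlonglongrightarrow> t"
  shows "(\<lambda>n. f (x n)) \<longlonglongrightarrow> 0"
proof -
  have "(\<lambda>n. f (x n)) \<longlonglongrightarrow> f t"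
    by (rule continuous_on_tendsto_compose[OF assms(1,5)]) (use assms(3,4) in auto)
  then show ?thesis
    by (simp add: assms(2))
qed

lemma infsum_eq_integral:
  fixes f :: "'k \<Rightarrow> real"
  assumes "integrable (count_space UNIV) f"
  shows "f summable_on UNIV" "(\<Sum>\<^sub>\<infinity>k. f k) = (\<integral>k. f k \<partial>count_space UNIV)"
proof -
  have a: "Infinite_Set_Sum.abs_summable_on f UNIV"
    using assms by (simp add: abs_summable_on_def)
  then show "f summable_on UNIV"
    using abs_summable_equivalent abs_summable_summable by blast
  show "(\<Sum>\<^sub>\<infinity>k. f k) = (\<integral>k. f k \<partial>count_space UNIV)"
    using infsetsum_infsum[OF a] by (simp add: infsetsum_def)
qed

lemma torus_integral_continuous:
  fixes q :: "real \<Rightarrow> real ^ 'n::finite \<Rightarrow> 'b::euclidean_space"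
  assumes q: "continuous_on (S \<times> UNIV) (\<lambda>(t, x). q t x)"
  shows "continuous_on S (\<lambda>t. LINT x|torus. q t x)"
proof -
  have "continuous_on S (\<lambda>t. integral (cbox (\<chi> i. - pi) (\<chi> i. pi)) (q t))"
    by (rule integral_continuous_on_param) (rule continuous_on_subset[OF q], auto)
  moreover have "(LINT x|torus. q t x) = integral (cbox (\<chi> i. - pi) (\<chi> i. pi)) (q t)" if "t \<in> S" for t
  proof (rule integral_torus)
    have "continuous_on UNIV (\<lambda>x. (\<lambda>(t, x). q t x) (t, x))"
      by (rule continuous_on_compose2[OF q]) (use that in \<open>auto intro!: continuous_intros\<close>)
    then show "integrable torus (q t)"
      by (intro integrable_torus_continuous) simp
  qed
  ultimately show ?thesis
    by (simp cong: continuous_on_cong)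
qed

lemma torus_integral_le:
  fixes f :: "real ^ 'n::finite \<Rightarrow> real"
  assumes "continuous_on UNIV f" "\<And>x. f x \<le> B"
  shows "(LINT x|torus. f x) \<le> (2 * pi) ^ CARD('n) * B"
proof -
  have "(LINT x|torus. f x) \<le> (LINT x|(torus :: (real ^ 'n) measure). B)"
    by (intro integral_mono integrable_torus_continuous assms) auto
  also have "\<dots> = (2 * pi) ^ CARD('n) * B"
    by (simp add: measure_torus)
  finally show ?thesis .
qed

section \<open>Continuity in time and the integrable majorant\<close>

context wiener_datum
begin

lemma c_reg: "0 < t \<Longrightarrow> reg (c t)"
  unfolding reg_def fin_mom_def using c_herm[of t] c_moment_integrable[of t] by (simp add: mwt_def)

definition A :: "nat \<Rightarrow> real \<Rightarrow> real" where
  "A j t = mom1 j (c t)"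

lemma A_eq: "A j t = (\<integral>k. norm (freq k) ^ j * norm (c t k) \<partial>count_space UNIV)"
  by (simp add: A_def mom_def mwt_def)

lemma A_nonneg: "0 \<le> A j t"
  unfolding A_def by (rule mom_nonneg[OF submult_1])

lemma A_le_4: "0 < t \<Longrightarrow> j \<le> 4 \<Longrightarrow> A j t \<le> A 4 t"
  unfolding A_eq
proof (rule integral_mono)
  assume t: "0 < t" and j: "j \<le> 4"
  show "norm (freq k) ^ j * norm (c t k) \<le> norm (freq k) ^ 4 * norm (c t k)" for k
  proof (cases "k = 0")
    case True
    then show ?thesis
      using c_zero[of t] t by simp
  next
    case False
    then show ?thesis
      using j norm_freq_ge_1[OF False] by (intro mult_right_mono power_increasing) auto
  qed
qed (rule c_moment_integrable, assumption)+

lemma A_0_le: "0 < t \<Longrightarrow> A 0 t \<le> z * exp (- \<delta> * t)" "0 < t \<Longrightarrow> A 0 t \<le> z"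
proof -
  assume t: "0 < t"
  show 1: "A 0 t \<le> z * exp (- \<delta> * t)"
    using c_norm_le[of t] t by (simp add: A_eq)
  have "z * exp (- \<delta> * t) \<le> z * 1"
    using z \<delta> t by (intro mult_left_mono) auto
  with 1 show "A 0 t \<le> z"
    by linarith
qed

text \<open>Since A_0 \<le> 1, these squares are still controlled by the first power of A_4; this is
  how the dissipation yields square integrability in time.\<close>

lemma A_squares: "0 < t \<Longrightarrow> (A 0 t)\<^sup>2 \<le> A 4 t" "0 < t \<Longrightarrow> (A 1 t)\<^sup>2 \<le> A 4 t"
proof -
  assume t: "0 < t"
  have A0: "A 0 t \<le> 1"
    using A_0_le(2)[OF t] z by simp
  have "(A 0 t)\<^sup>2 \<le> 1 * A 4 t"
    unfolding power2_eq_square using A0 by (intro mult_mono A_le_4 t A_nonneg) auto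
  then show "(A 0 t)\<^sup>2 \<le> A 4 t"
    by simp
  have "(A 1 t)\<^sup>2 \<le> A 0 t * A 2 t"
    using mom_interpolation(2)[OF submult_1, of "c t"] c_reg[OF t] by (simp add: A_def reg_def)
  also have "\<dots> \<le> 1 * A 4 t"
    using A0 by (intro mult_mono A_le_4 t A_nonneg) auto
  finally show "(A 1 t)\<^sup>2 \<le> A 4 t"
    by simp
qed

lemma continuous_on_positive:
  assumes "\<And>\<tau>::real. 0 < \<tau> \<Longrightarrow> continuous_on {\<tau><..} f"
  shows "continuous_on {0<..} f"
proof -
  have "continuous_on (\<Union>\<tau>\<in>{0<..}. {\<tau><..}) f"
    using assms by (intro continuous_on_open_UN open_greaterThan) auto
  moreover have "(\<Union>\<tau>\<in>{0::real<..}. {\<tau><..}) = {0<..}"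
    using dense by auto
  ultimately show ?thesis
    by simp
qed

lemma c_continuous_pos: "0 \<le> \<tau> \<Longrightarrow> continuous_on {\<tau><..} (\<lambda>t. c t k)"
  by (rule continuous_on_subset[OF c_continuous]) auto

lemma A_continuous: "continuous_on {0<..} (A j)"
proof (rule continuous_on_positive)
  fix \<tau> :: real assume \<tau>: "0 < \<tau>"
  show "continuous_on {\<tau><..} (A j)"
    unfolding A_eq
  proof (rule continuous_on_integral_dominated[where g = "\<lambda>k. Gm j \<tau> * gam k"])
    show "continuous_on {\<tau><..} (\<lambda>s. norm (freq k) ^ j * norm (c s k))" for k
      using \<tau> by (intro continuous_intros c_continuous_pos) simp
    show "norm (norm (freq k) ^ j * norm (c s k)) \<le> Gm j \<tau> * gam k" if "s \<in> {\<tau><..}" for s k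
      using c_moment_le[OF \<tau>, of s k j] that by simp
  qed (auto intro!: integrable_gam)
qed

text \<open>The dissipation bound as an integrability statement. The norms to be integrated over
  time are dominated by multiples of this one function.\<close>

lemma A4_integrable:
  assumes "0 < T"
  shows "integrable (lebesgue_on {0<..<T}) (A 4)"
proof -
  have "integrable lborel (\<lambda>t. indicator {0<..<T} t *\<^sub>R A 4 t)"
    unfolding integrable_iff_bounded
  proof
    have "(\<lambda>t. indicator {0<..<T} t *\<^sub>R A 4 t) \<in> borel_measurable borel"
      by (intro borel_measurable_continuous_on_indicator continuous_on_subset[OF A_continuous]) auto
    then show "(\<lambda>t. indicator {0<..<T} t *\<^sub>R A 4 t) \<in> borel_measurable lborel"
      by simp
    have "(\<integral>\<^sup>+t. ennreal (norm (indicator {0<..<T} t *\<^sub>R A 4 t)) \<partial>lborel)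
        \<le> (\<integral>\<^sup>+t. (\<integral>\<^sup>+k. ennreal (norm (freq k) ^ 4 * norm (c t k)) \<partial>count_space UNIV) * indicator {0..T} t \<partial>lborel)"
    proof (rule nn_integral_mono)
      fix t
      show "ennreal (norm (indicator {0<..<T} t *\<^sub>R A 4 t))
          \<le> (\<integral>\<^sup>+k. ennreal (norm (freq k) ^ 4 * norm (c t k)) \<partial>count_space UNIV) * indicator {0..T} t"
      proof (cases "t \<in> {0<..<T}")
        case True
        then have "(\<integral>\<^sup>+k. ennreal (norm (freq k) ^ 4 * norm (c t k)) \<partial>count_space UNIV) = ennreal (A 4 t)"
          unfolding A_eq by (intro nn_integral_eq_integral c_moment_integrable) auto
        then show ?thesis
          using True A_nonneg[of 4 t] by simp
      qed simp
    qed
    also have "\<dots> \<le> ennreal (z / \<delta>)"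
      by (rule c_dissipation[OF assms])
    also have "\<dots> < \<infinity>"
      by simp
    finally show "(\<integral>\<^sup>+t. ennreal (norm (indicator {0<..<T} t *\<^sub>R A 4 t)) \<partial>lborel) < \<infinity>" .
  qed
  then have "integrable lebesgue (\<lambda>t. indicator {0<..<T} t *\<^sub>R A 4 t)"
    by (subst integrable_completion) (auto intro: borel_measurable_integrable)
  then show ?thesis
    by (subst integrable_restrict_space) (auto simp: sets_completionI_sets)
qed

text \<open>\<open>q\<close> stands for the symbol of a differential operator of order at most j;
  for times beyond \<tau> the summable majorant is independent of time and space.\<close>

lemma ser_joint_continuous:
  assumes q: "\<And>k. norm (q k) \<le> norm (freq k) ^ j"
  shows "continuous_on ({0<..} \<times> UNIV) (\<lambda>(t, x). ser (\<lambda>k. q k * c t k) x)"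
proof -
  have "continuous_on ({\<tau><..} \<times> UNIV) (\<lambda>p. ser (\<lambda>k. q k * c (fst p) k) (snd p))" if \<tau>: "0 < \<tau>" for \<tau>
    unfolding ser_def
  proof (rule continuous_on_integral_dominated[where g = "\<lambda>k. Gm j \<tau> * gam k"])
    show "continuous_on ({\<tau><..} \<times> UNIV) (\<lambda>p. q k * c (fst p) k * wave k (snd p))" for k
      using \<tau> by (intro continuous_intros continuous_on_compose2[OF c_continuous_pos[of \<tau>]]) auto
    show "norm (q k * c (fst p) k * wave k (snd p)) \<le> Gm j \<tau> * gam k" if "p \<in> {\<tau><..} \<times> UNIV" for p k
    proof -
      have "norm (q k * c (fst p) k * wave k (snd p)) \<le> norm (freq k) ^ j * norm (c (fst p) k)"
        using q[of k] by (simp add: norm_mult mult_right_mono)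
      also have "\<dots> \<le> Gm j \<tau> * gam k"
        using that by (intro c_moment_le \<tau>) auto
      finally show ?thesis .
    qed
  qed (auto intro!: integrable_gam)
  then have "continuous_on (\<Union>\<tau>\<in>{0<..}. {\<tau><..} \<times> UNIV) (\<lambda>p. ser (\<lambda>k. q k * c (fst p) k) (snd p))"
    by (intro continuous_on_open_UN open_Times open_greaterThan open_UNIV) auto
  moreover have "(\<Union>\<tau>\<in>{0::real<..}. {\<tau><..} \<times> UNIV) = {0<..} \<times> (UNIV :: (real ^ 'n) set)"
    using dense by fastforce
  ultimately show ?thesis
    by (simp add: case_prod_unfold)
qed

lemma U_joint_continuous:
  "continuous_on ({0<..} \<times> UNIV) (\<lambda>(t, x). U (c t) x)"
  "continuous_on ({0<..} \<times> UNIV) (\<lambda>(t, x). U (Dc i (c t)) x)"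
  "continuous_on ({0<..} \<times> UNIV) (\<lambda>(t, x). U (Dc i (Dc j (c t))) x)"
proof -
  have "continuous_on ({0<..} \<times> UNIV) (\<lambda>(t, x). Re (ser (\<lambda>k. q k * c t k) x))"
    if "\<And>k. norm (q k) \<le> norm (freq k) ^ m" for q m
    using continuous_on_Re[OF ser_joint_continuous[OF that]] by (simp add: case_prod_unfold)
  note * = this
  show "continuous_on ({0<..} \<times> UNIV) (\<lambda>(t, x). U (c t) x)"
    using *[of "\<lambda>_. 1" 0] by (simp add: U_def)
  have "norm (\<i> * of_real (freq k $ i)) \<le> norm (freq k) ^ 1" for k :: "int ^ 'n"
    using component_le_norm_cart[of "freq k" i] by (simp add: norm_mult)
  from *[OF this] show "continuous_on ({0<..} \<times> UNIV) (\<lambda>(t, x). U (Dc i (c t)) x)"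
    by (simp add: U_def Dc_def[abs_def])
  have "norm (\<i> * of_real (freq k $ i) * (\<i> * of_real (freq k $ j))) \<le> norm (freq k) ^ 2" for k :: "int ^ 'n"
    using norm_Dc_Dc_le[of i j "\<lambda>_. 1" k] by (simp add: Dc_def)
  from *[OF this] show "continuous_on ({0<..} \<times> UNIV) (\<lambda>(t, x). U (Dc i (Dc j (c t))) x)"
    by (simp add: U_def Dc_def[abs_def] mult.assoc)
qed

text \<open>Differences with a fixed \<open>b\<close> prepare strong measurability, where
  \<open>b\<close> is the sequence at a fixed time.\<close>

lemma U_joint_diff_continuous:
  assumes b: "reg b"
  shows "continuous_on ({0<..} \<times> UNIV) (\<lambda>(t, x). U (\<lambda>k. c t k - b k) x)"
    "continuous_on ({0<..} \<times> UNIV) (\<lambda>(t, x). U (Dc i (\<lambda>k. c t k - b k)) x)"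
    "continuous_on ({0<..} \<times> UNIV) (\<lambda>(t, x). U (Dc i (Dc j (\<lambda>k. c t k - b k))) x)"
proof -
  have S: "continuous_on ({0<..} \<times> UNIV) (\<lambda>p :: real \<times> (real ^ 'n). U a (snd p))" if "l1 a" for a
    by (intro continuous_on_compose2[OF continuous_on_U[OF that]] continuous_intros) auto
  have 1: "continuous_on ({0<..} \<times> UNIV) (\<lambda>p. U (f (fst p)) (snd p) - U a (snd p))"
    if "continuous_on ({0<..} \<times> UNIV) (\<lambda>(t, x). U (f t) x)" "l1 a"
    for f :: "real \<Rightarrow> int ^ 'n \<Rightarrow> complex" and a
    using continuous_on_diff[OF that(1) S[OF that(2)]] by (simp add: case_prod_unfold)
  have e: "U (\<lambda>k. a k - a' k) x = U a x - U a' x" if "l1 a" "l1 a'" for a a' x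
    using fun_cong[OF U_diff[OF that], of x] by simp
  note r = regD[OF c_reg]
  show "continuous_on ({0<..} \<times> UNIV) (\<lambda>(t, x). U (\<lambda>k. c t k - b k) x)"
    by (rule continuous_on_eq[OF 1[OF U_joint_continuous(1) regD(2)[OF b]]]) (auto simp: e r regD[OF b])
  show "continuous_on ({0<..} \<times> UNIV) (\<lambda>(t, x). U (Dc i (\<lambda>k. c t k - b k)) x)"
    by (rule continuous_on_eq[OF 1[OF U_joint_continuous(2) regD(3)[OF b]]]) (auto simp: Dc_diff e r regD[OF b])
  show "continuous_on ({0<..} \<times> UNIV) (\<lambda>(t, x). U (Dc i (Dc j (\<lambda>k. c t k - b k))) x)"
    by (rule continuous_on_eq[OF 1[OF U_joint_continuous(3) regD(4)[OF b]]]) (auto simp: Dc_diff e r regD[OF b])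
qed

lemma H1_norm_continuous:
  assumes b: "reg b"
  shows "continuous_on {0<..} (\<lambda>t. H1_norm (U (\<lambda>k. c t k - b k)))"
proof -
  have sq: "continuous_on {0<..} (\<lambda>t. LINT x|torus. (U (f t) x)\<^sup>2)"
    if "continuous_on ({0<..} \<times> UNIV) (\<lambda>(t, x). U (f t) x)" for f :: "real \<Rightarrow> int ^ 'n \<Rightarrow> complex"
    using continuous_on_power[OF that, of 2] by (intro torus_integral_continuous) (simp add: case_prod_unfold)
  have "continuous_on {0<..} (\<lambda>t. sqrt ((LINT x|torus. (U (\<lambda>k. c t k - b k) x)\<^sup>2)
      + (\<Sum>i\<in>UNIV. LINT x|torus. (U (Dc i (\<lambda>k. c t k - b k)) x)\<^sup>2)))"
    by (intro continuous_on_real_sqrt continuous_on_add continuous_on_sum sq U_joint_diff_continuous b)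
  then show ?thesis
    by (rule continuous_on_eq) (simp add: H1_norm_U reg_diff c_reg b)
qed

lemma W21_norm_continuous:
  assumes b: "reg b"
  shows "continuous_on {0<..} (\<lambda>t. W21_norm (U (\<lambda>k. c t k - b k)))"
proof -
  have ab: "continuous_on {0<..} (\<lambda>t. LINT x|torus. \<bar>U (f t) x\<bar>)"
    if "continuous_on ({0<..} \<times> UNIV) (\<lambda>(t, x). U (f t) x)" for f :: "real \<Rightarrow> int ^ 'n \<Rightarrow> complex"
    using continuous_on_rabs[OF that] by (intro torus_integral_continuous) (simp add: case_prod_unfold)
  have "continuous_on {0<..} (\<lambda>t. (LINT x|torus. \<bar>U (\<lambda>k. c t k - b k) x\<bar>)
      + (\<Sum>j\<in>UNIV. LINT x|torus. \<bar>U (Dc j (\<lambda>k. c t k - b k)) x\<bar>)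
      + (\<Sum>i\<in>UNIV. \<Sum>j\<in>UNIV. LINT x|torus. \<bar>U (Dc i (Dc j (\<lambda>k. c t k - b k))) x\<bar>))"
    by (intro continuous_on_add continuous_on_sum ab U_joint_diff_continuous b)
  then show ?thesis
    by (rule continuous_on_eq) (simp add: W21_norm_U reg_diff c_reg b)
qed

lemma wiener_weight_le:
  assumes "0 \<le> r" "r \<le> 4"
  shows "0 \<le> wiener_weight r k" "wiener_weight r k \<le> 1 + norm (freq k) ^ 4"
proof -
  show "0 \<le> wiener_weight r k"
    by (simp add: wiener_weight_def)
  show "wiener_weight r k \<le> 1 + norm (freq k) ^ 4"
  proof (cases "r = 0 \<or> k = 0")
    case True
    then show ?thesis
      by (auto simp: wiener_weight_def)
  next
    case False
    then have n1: "1 \<le> norm (freq k)"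
      by (intro norm_freq_ge_1) simp
    have "norm (freq k) powr r \<le> norm (freq k) powr 4"
      using n1 assms by (intro powr_mono) auto
    also have "\<dots> = norm (freq k) ^ 4"
      using n1 powr_realpow[of "norm (freq k)" 4] by simp
    finally show ?thesis
      using False by (simp add: wiener_weight_def)
  qed
qed

lemma wiener_integrable:
  assumes a: "reg a" and r: "0 \<le> r" "r \<le> 4"
  shows "integrable (count_space UNIV) (\<lambda>k. wiener_weight r k * norm (a k))"
proof (rule Bochner_Integration.integrable_bound)
  show "integrable (count_space UNIV) (\<lambda>k. norm (freq k) ^ 0 * norm (a k) + norm (freq k) ^ 4 * norm (a k))"
    by (intro Bochner_Integration.integrable_add reg_moment a) simp_all
  show "AE k in count_space UNIV. norm (wiener_weight r k * norm (a k))
      \<le> norm (norm (freq k) ^ 0 * norm (a k) + norm (freq k) ^ 4 * norm (a k))"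
  proof (rule AE_I2)
    fix k
    have "wiener_weight r k * norm (a k) \<le> (1 + norm (freq k) ^ 4) * norm (a k)"
      by (intro mult_right_mono wiener_weight_le r) simp
    then show "norm (wiener_weight r k * norm (a k)) \<le> norm (norm (freq k) ^ 0 * norm (a k) + norm (freq k) ^ 4 * norm (a k))"
      using wiener_weight_le(1)[OF r, of k] by (simp add: distrib_right abs_mult)
  qed
qed simp

lemma U_wiener:
  assumes "reg a" "0 \<le> r" "r \<le> 4"
  shows "U a \<in> wiener r"
    and "wiener_full_norm r (U a) = norm (a 0) + (\<integral>k. wiener_weight r k * norm (a k) \<partial>count_space UNIV)"
  using infsum_eq_integral[OF wiener_integrable[OF assms]] U_L1[OF regD(2)[OF assms(1)]]
  by (simp_all add: wiener_def wiener_full_norm_def wiener_norm_def fourier_coeff_U regD[OF assms(1)])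

lemma wiener_norm_continuous:
  assumes b: "reg b" and r: "0 \<le> r" "r \<le> 4"
  shows "continuous_on {0<..} (\<lambda>t. wiener_full_norm r (U (\<lambda>k. c t k - b k)))"
proof -
  have "continuous_on {0<..} (\<lambda>t. norm (c t 0 - b 0) + (\<integral>k. wiener_weight r k * norm (c t k - b k) \<partial>count_space UNIV))"
  proof (intro continuous_on_add continuous_on_norm continuous_on_diff continuous_on_const c_continuous_pos order_refl continuous_on_positive)
    fix \<tau> :: real assume \<tau>: "0 < \<tau>"
    show "continuous_on {\<tau><..} (\<lambda>t. \<integral>k. wiener_weight r k * norm (c t k - b k) \<partial>count_space UNIV)"
    proof (rule continuous_on_integral_dominated[where g = "\<lambda>k. (Gm 0 \<tau> * gam k + norm (freq k) ^ 0 * norm (b k))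
          + (Gm 4 \<tau> * gam k + norm (freq k) ^ 4 * norm (b k))"])
      show "continuous_on {\<tau><..} (\<lambda>s. wiener_weight r k * norm (c s k - b k))" for k
        using \<tau> by (intro continuous_intros c_continuous_pos) simp
      show "norm (wiener_weight r k * norm (c s k - b k)) \<le> (Gm 0 \<tau> * gam k + norm (freq k) ^ 0 * norm (b k))
          + (Gm 4 \<tau> * gam k + norm (freq k) ^ 4 * norm (b k))" if "s \<in> {\<tau><..}" for s k
      proof -
        have "wiener_weight r k * norm (c s k - b k) \<le> (1 + norm (freq k) ^ 4) * (norm (c s k) + norm (b k))"
          using wiener_weight_le[OF r, of k] by (intro mult_mono norm_triangle_ineq4) auto
        also have "\<dots> = (norm (freq k) ^ 0 * norm (c s k) + norm (freq k) ^ 0 * norm (b k))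
            + (norm (freq k) ^ 4 * norm (c s k) + norm (freq k) ^ 4 * norm (b k))"
          by (simp add: algebra_simps)
        also have "\<dots> \<le> (Gm 0 \<tau> * gam k + norm (freq k) ^ 0 * norm (b k))
            + (Gm 4 \<tau> * gam k + norm (freq k) ^ 4 * norm (b k))"
          using that by (intro add_mono order_refl c_moment_le \<tau>) auto
        finally show ?thesis
          using wiener_weight_le(1)[OF r, of k] by (simp add: abs_mult)
      qed
      show "integrable (count_space UNIV) (\<lambda>k. (Gm 0 \<tau> * gam k + norm (freq k) ^ 0 * norm (b k))
          + (Gm 4 \<tau> * gam k + norm (freq k) ^ 4 * norm (b k)))"
        by (intro Bochner_Integration.integrable_add integrable_mult_right integrable_gam reg_moment b) simp_all
    qed simp
  qed
  then show ?thesis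
    by (rule continuous_on_eq) (simp add: U_wiener reg_diff c_reg b r)
qed

section \<open>Membership of the solution in the Bochner spaces\<close>

lemma abs_U_c_le:
  assumes t: "0 < t"
  shows "\<bar>U (c t) x\<bar> \<le> A 0 t" "\<bar>U (Dc i (c t)) x\<bar> \<le> A 1 t" "\<bar>U (Dc i (Dc j (c t))) x\<bar> \<le> A 2 t"
proof -
  note r = regD[OF c_reg[OF t]]
  show "\<bar>U (c t) x\<bar> \<le> A 0 t"
    using abs_U_le[of "c t" x] by (simp add: A_eq)
  have "(\<integral>k. norm (Dc i (c t) k) \<partial>count_space UNIV) \<le> A 1 t"
    unfolding A_eq using norm_Dc_le[of i "c t"]
    by (intro integral_mono integrable_norm r c_moment_integrable[OF t]) simp
  then show "\<bar>U (Dc i (c t)) x\<bar> \<le> A 1 t"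
    using abs_U_le[of "Dc i (c t)" x] by linarith
  have "(\<integral>k. norm (Dc i (Dc j (c t)) k) \<partial>count_space UNIV) \<le> A 2 t"
    unfolding A_eq using norm_Dc_Dc_le[of i j "c t"]
    by (intro integral_mono integrable_norm r c_moment_integrable[OF t])
  then show "\<bar>U (Dc i (Dc j (c t))) x\<bar> \<le> A 2 t"
    using abs_U_le[of "Dc i (Dc j (c t))" x] by linarith
qed

lemma abs_U_c_le_z: "0 < t \<Longrightarrow> \<bar>U (c t) x\<bar> \<le> z"
  using abs_U_c_le(1)[of t x] A_0_le(2)[of t] by linarith

lemma one_plus_U_ge: "0 < t \<Longrightarrow> 1 - z \<le> 1 + U (c t) x"
  using abs_U_c_le_z[of t x] by linarith

lemma one_plus_U_pos: "0 < t \<Longrightarrow> 0 < 1 + U (c t) x"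
  using one_plus_U_ge[of t x] z by linarith

text \<open>The map s to \<open>N (u s - u t)\<close> is continuous for s > 0 and vanishes at s = t,
  which is the convergence required.\<close>

lemma sol_strongly_measurable:
  assumes T: "0 < T" and u: "\<And>t. 0 < t \<Longrightarrow> u t = U (c t)" and X: "\<And>a. reg a \<Longrightarrow> U a \<in> X"
    and cont: "\<And>b. reg b \<Longrightarrow> continuous_on {0<..} (\<lambda>t. N (U (\<lambda>k. c t k - b k)))"
    and zero: "N (U (\<lambda>_. 0)) = 0"
  shows "strongly_measurable T X N u"
proof (rule strongly_measurableI[OF T])
  show "u t \<in> X" if "0 < t" for t
    unfolding u[OF that] by (intro X c_reg that)
  fix t x assume t: "0 < t" "t < T" and x: "\<And>n. x n \<in> {0<..<T}" "x \<longlonglongrightarrow> t"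
  have "u (x n) - u t = U (\<lambda>k. c (x n) k - c t k)" for n
    using x(1)[of n] t by (simp add: u U_diff regD(2)[OF c_reg])
  moreover have "(\<lambda>n. N (U (\<lambda>k. c (x n) k - c t k))) \<longlonglongrightarrow> 0"
    by (rule continuous_zero_imp_seq[OF cont[OF c_reg[OF t(1)]] _ t(1) x]) (simp add: zero)
  ultimately show "(\<lambda>n. N (u (x n) - u t)) \<longlonglongrightarrow> 0"
    by simp
qed

text \<open>Domination by the integrable function \<open>A 4\<close>; continuity of the norm for t >
  0 supplies its measurability.\<close>

lemma bochner_LpI:
  assumes T: "0 < T" and X: "\<And>t. 0 < t \<Longrightarrow> w t \<in> X" and sm: "strongly_measurable T X N w"
    and cont: "continuous_on {0<..} (\<lambda>t. N (w t))"
    and le: "\<And>t. 0 < t \<Longrightarrow> N (w t) powr p \<le> C * A 4 t"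
  shows "w \<in> bochner_Lp p T X N"
  unfolding bochner_Lp_def
proof (intro CollectI conjI sm)
  show "AE t in lebesgue_on {0<..<T}. w t \<in> X"
    by (rule AE_I2) (simp add: X)
  show "integrable (lebesgue_on {0<..<T}) (\<lambda>t. N (w t) powr p)"
  proof (rule Bochner_Integration.integrable_bound)
    show "integrable (lebesgue_on {0<..<T}) (\<lambda>t. C * A 4 t)"
      by (intro integrable_mult_right A4_integrable T)
    have "(\<lambda>t. N (w t)) \<in> borel_measurable (lebesgue_on {0<..<T})"
      by (intro continuous_imp_measurable_on_sets_lebesgue continuous_on_subset[OF cont]) auto
    then show "(\<lambda>t. N (w t) powr p) \<in> borel_measurable (lebesgue_on {0<..<T})"
      by measurable
    show "AE t in lebesgue_on {0<..<T}. norm (N (w t) powr p) \<le> norm (C * A 4 t)"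
    proof (rule AE_I2)
      fix t assume "t \<in> space (lebesgue_on {0<..<T})"
      then have "N (w t) powr p \<le> C * A 4 t"
        by (intro le) simp
      then show "norm (N (w t) powr p) \<le> norm (C * A 4 t)"
        by (simp add: order_trans[OF _ abs_ge_self])
    qed
  qed
qed

lemma U_0: "U (\<lambda>_. 0) = (\<lambda>_. 0)"
  by (simp add: U_def ser_def fun_eq_iff)

lemma Dc_0: "Dc i (\<lambda>_. 0) = (\<lambda>_. 0)"
  by (simp add: Dc_def fun_eq_iff)

lemma torus_integral_c_le:
  assumes "l1 a" "\<And>x. \<bar>U a x\<bar> \<le> B"
  shows "(LINT x|torus. (U a x)\<^sup>2) \<le> (2 * pi) ^ CARD('n) * B\<^sup>2" "(LINT x|torus. \<bar>U (a :: int ^ 'n \<Rightarrow> complex) x\<bar>) \<le> (2 * pi) ^ CARD('n) * B"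
proof -
  have "(U a x)\<^sup>2 \<le> B\<^sup>2" for x
    using power_mono[OF assms(2)[of x] abs_ge_zero, of 2] by simp
  then show "(LINT x|torus. (U a x)\<^sup>2) \<le> (2 * pi) ^ CARD('n) * B\<^sup>2"
    by (intro torus_integral_le continuous_on_power continuous_on_U assms(1))
  show "(LINT x|torus. \<bar>U a x\<bar>) \<le> (2 * pi) ^ CARD('n) * B"
    by (intro torus_integral_le continuous_on_rabs continuous_on_U assms)
qed

lemma sol_H1:
  assumes T: "0 < T" and u: "\<And>t. 0 < t \<Longrightarrow> u t = U (c t)"
  shows "u \<in> bochner_Lp 2 T H1 H1_norm"
proof (rule bochner_LpI[OF T, where C = "(2 * pi) ^ CARD('n) * (1 + real CARD('n))"])
  show "u t \<in> H1" if "0 < t" for t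
    unfolding u[OF that] by (intro U_H1 c_reg that)
  show "strongly_measurable T H1 H1_norm u"
    by (rule sol_strongly_measurable[OF T u U_H1 H1_norm_continuous], assumption+)
       (subst H1_norm_U[OF reg_0], simp add: U_0 Dc_0)
  show "continuous_on {0<..} (\<lambda>t. H1_norm (u t))"
    using H1_norm_continuous[OF reg_0] by (rule continuous_on_eq) (simp add: u)
  fix t :: real assume t: "0 < t"
  note r = regD[OF c_reg[OF t]]
  define Y where "Y = (LINT x|torus. (U (c t) x)\<^sup>2) + (\<Sum>i\<in>UNIV. LINT x|torus. (U (Dc i (c t)) x)\<^sup>2)"
  have Y: "0 \<le> Y"
    unfolding Y_def by (intro add_nonneg_nonneg sum_nonneg Bochner_Integration.integral_nonneg) auto
  have V: "0 \<le> (2 * pi) ^ CARD('n)"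
    by simp
  have "Y \<le> (2 * pi) ^ CARD('n) * (A 0 t)\<^sup>2 + (\<Sum>i\<in>(UNIV :: 'n set). (2 * pi) ^ CARD('n) * (A 1 t)\<^sup>2)"
    unfolding Y_def by (intro add_mono sum_mono torus_integral_c_le r abs_U_c_le t)
  also have "\<dots> \<le> (2 * pi) ^ CARD('n) * A 4 t + (\<Sum>i\<in>(UNIV :: 'n set). (2 * pi) ^ CARD('n) * A 4 t)"
    by (intro add_mono sum_mono mult_left_mono A_squares t V)
  also have "\<dots> = (2 * pi) ^ CARD('n) * (1 + real CARD('n)) * A 4 t"
    by (simp add: algebra_simps)
  finally show "H1_norm (u t) powr 2 \<le> (2 * pi) ^ CARD('n) * (1 + real CARD('n)) * A 4 t"
    using Y by (simp add: u[OF t] H1_norm_U[OF c_reg[OF t]] Y_def[symmetric])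
qed

lemma sol_W21:
  assumes T: "0 < T" and u: "\<And>t. 0 < t \<Longrightarrow> u t = U (c t)"
  shows "u \<in> bochner_Lp 1 T W21 W21_norm"
proof (rule bochner_LpI[OF T, where C = "(2 * pi) ^ CARD('n) * (1 + real CARD('n) + real CARD('n) * real CARD('n))"])
  show "u t \<in> W21" if "0 < t" for t
    unfolding u[OF that] by (intro U_W21 c_reg that)
  show "strongly_measurable T W21 W21_norm u"
    by (rule sol_strongly_measurable[OF T u U_W21 W21_norm_continuous], assumption+)
       (subst W21_norm_U[OF reg_0], simp add: U_0 Dc_0)
  show "continuous_on {0<..} (\<lambda>t. W21_norm (u t))"
    using W21_norm_continuous[OF reg_0] by (rule continuous_on_eq) (simp add: u)
  fix t :: real assume t: "0 < t"
  note r = regD[OF c_reg[OF t]]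
  have V: "0 \<le> (2 * pi) ^ CARD('n)"
    by simp
  have N: "W21_norm (u t) = (LINT x|torus. \<bar>U (c t) x\<bar>) + (\<Sum>j\<in>UNIV. LINT x|torus. \<bar>U (Dc j (c t)) x\<bar>)
     + (\<Sum>i\<in>UNIV. \<Sum>j\<in>UNIV. LINT x|torus. \<bar>U (Dc i (Dc j (c t))) x\<bar>)"
    by (simp add: u[OF t] W21_norm_U[OF c_reg[OF t]])
  have N0: "0 \<le> W21_norm (u t)"
    unfolding N by (intro add_nonneg_nonneg sum_nonneg Bochner_Integration.integral_nonneg) auto
  have "W21_norm (u t) \<le> (2 * pi) ^ CARD('n) * A 0 t + (\<Sum>j\<in>(UNIV :: 'n set). (2 * pi) ^ CARD('n) * A 1 t)
      + (\<Sum>i\<in>(UNIV :: 'n set). \<Sum>j\<in>(UNIV :: 'n set). (2 * pi) ^ CARD('n) * A 2 t)"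
    unfolding N by (intro add_mono sum_mono torus_integral_c_le r abs_U_c_le t)
  also have "\<dots> \<le> (2 * pi) ^ CARD('n) * A 4 t + (\<Sum>j\<in>(UNIV :: 'n set). (2 * pi) ^ CARD('n) * A 4 t)
      + (\<Sum>i\<in>(UNIV :: 'n set). \<Sum>j\<in>(UNIV :: 'n set). (2 * pi) ^ CARD('n) * A 4 t)"
    by (intro add_mono sum_mono mult_left_mono A_le_4 t V) simp_all
  also have "\<dots> = (2 * pi) ^ CARD('n) * (1 + real CARD('n) + real CARD('n) * real CARD('n)) * A 4 t"
    by (simp add: algebra_simps)
  finally show "W21_norm (u t) powr 1 \<le> (2 * pi) ^ CARD('n) * (1 + real CARD('n) + real CARD('n) * real CARD('n)) * A 4 t"
    using N0 by simp
qed

text \<open>Young's inequality between \<open>|k|\<^sup>4\<close> and \<open>A 4 t\<close>, summed against \<open>|c t k|\<close>.\<close>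

lemma wiener_interpolation:
  assumes t: "0 < t" and p: "1 < p"
  shows "(\<integral>k. wiener_weight (4 / p) k * norm (c t k) \<partial>count_space UNIV) powr p \<le> A 4 t"
proof -
  define S where "S = (\<integral>k. wiener_weight (4 / p) k * norm (c t k) \<partial>count_space UNIV)"
  have r: "0 \<le> 4 / p" "4 / p \<le> 4" "4 / p \<noteq> 0"
    using p by (auto simp: divide_le_eq)
  have S0: "0 \<le> S"
    unfolding S_def
    by (intro Bochner_Integration.integral_nonneg mult_nonneg_nonneg wiener_weight_le(1)[OF r(1,2)] norm_ge_zero)
  note Si = wiener_integrable[OF c_reg[OF t] r(1,2)]
  note Ai = c_moment_integrable[OF t]
  show ?thesis
  \<comment> \<open>Young's inequality is later divided by a power of \<open>A 4 t\<close>, so the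
    value 0 is separated; there all terms vanish.\<close>
  proof (cases "A 4 t = 0")
    case True
    have "S \<le> (\<integral>k. norm (freq k) ^ 0 * norm (c t k) + norm (freq k) ^ 4 * norm (c t k) \<partial>count_space UNIV)"
      unfolding S_def
    proof (rule integral_mono[OF Si])
      show "integrable (count_space UNIV) (\<lambda>k. norm (freq k) ^ 0 * norm (c t k) + norm (freq k) ^ 4 * norm (c t k))"
        by (intro Bochner_Integration.integrable_add Ai)
      show "wiener_weight (4 / p) k * norm (c t k) \<le> norm (freq k) ^ 0 * norm (c t k) + norm (freq k) ^ 4 * norm (c t k)" for k
        using mult_right_mono[OF wiener_weight_le(2)[OF r(1,2), of k], of "norm (c t k)"] by (simp add: distrib_right)
    qed
    also have "\<dots> = A 0 t + A 4 t"
      unfolding A_eq by (rule Bochner_Integration.integral_add[OF Ai Ai])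
    also have "\<dots> \<le> 0"
      using A_le_4[OF t, of 0] True by simp
    finally show ?thesis
      using S0 True by (simp add: S_def[symmetric])
  next
    case False
    then have y: "0 < A 4 t"
      using A_nonneg[of 4 t] by simp
    define y where "y = A 4 t"
    have y0: "0 < y"
      using y by (simp add: y_def)
    have pt: "wiener_weight (4 / p) k * y powr (1 - 1 / p) \<le> 1 / p * norm (freq k) ^ 4 + (1 - 1 / p) * y" for k :: "int ^ 'n"
    proof (cases "k = 0")
      case True
      then show ?thesis
        using p y0 r by (simp add: wiener_weight_def)
    next
      case False
      then have n1: "1 \<le> norm (freq k)"
        by (rule norm_freq_ge_1)
      have "(norm (freq k) ^ 4) powr (1 / p) * y powr (1 - 1 / p) \<le> 1 / p * norm (freq k) ^ 4 + (1 - 1 / p) * y"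
        using p n1 y0 by (intro Youngs_inequality_0) auto
      moreover have "(norm (freq k) ^ 4) powr (1 / p) = norm (freq k) powr (4 / p)"
      proof -
        have "norm (freq k) ^ 4 = norm (freq k) powr 4"
          using n1 powr_realpow[of "norm (freq k)" 4] by simp
        then show ?thesis
          by (simp only: powr_powr) simp
      qed
      ultimately show ?thesis
        using r by (simp add: wiener_weight_def)
    qed
    have "S * y powr (1 - 1 / p) = (\<integral>k. wiener_weight (4 / p) k * norm (c t k) * y powr (1 - 1 / p) \<partial>count_space UNIV)"
      by (simp add: S_def)
    also have "\<dots> \<le> (\<integral>k. 1 / p * (norm (freq k) ^ 4 * norm (c t k)) + (1 - 1 / p) * y * (norm (freq k) ^ 0 * norm (c t k)) \<partial>count_space UNIV)"
    proof (rule integral_mono)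
      show "integrable (count_space UNIV) (\<lambda>k. wiener_weight (4 / p) k * norm (c t k) * y powr (1 - 1 / p))"
        by (intro integrable_mult_left Si)
      show "integrable (count_space UNIV) (\<lambda>k. 1 / p * (norm (freq k) ^ 4 * norm (c t k)) + (1 - 1 / p) * y * (norm (freq k) ^ 0 * norm (c t k)))"
        by (intro Bochner_Integration.integrable_add integrable_mult_right Ai)
      show "wiener_weight (4 / p) k * norm (c t k) * y powr (1 - 1 / p)
          \<le> 1 / p * (norm (freq k) ^ 4 * norm (c t k)) + (1 - 1 / p) * y * (norm (freq k) ^ 0 * norm (c t k))" for k
        using mult_right_mono[OF pt[of k], of "norm (c t k)"] by (simp add: algebra_simps)
    qed
    also have "\<dots> = 1 / p * A 4 t + (1 - 1 / p) * y * A 0 t"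
      unfolding A_eq by (subst Bochner_Integration.integral_add) (simp_all only: Ai integrable_mult_right integral_mult_right_zero)
    also have "\<dots> \<le> 1 / p * y + (1 - 1 / p) * y * 1"
      using A_0_le(2)[OF t] z p y0 by (intro add_mono mult_left_mono) (auto simp: y_def)
    also have "\<dots> = y"
      by (simp add: algebra_simps)
    also have "\<dots> = y powr (1 / p) * y powr (1 - 1 / p)"
      using y0 by (simp flip: powr_add)
    finally have "S \<le> y powr (1 / p)"
      using y0 by simp
    then have "S powr p \<le> (y powr (1 / p)) powr p"
      using S0 p by (intro powr_mono2) auto
    also have "\<dots> = y"
      using p y0 by (simp add: powr_powr)
    finally show ?thesis
      by (simp add: S_def y_def)
  qed
qed

lemma sol_wiener:
  assumes T: "0 < T" and u: "\<And>t. 0 < t \<Longrightarrow> u t = U (c t)" and p: "1 < p"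
  shows "u \<in> bochner_Lp p T (wiener (4 / p)) (wiener_full_norm (4 / p))"
proof (rule bochner_LpI[OF T, where C = 1])
  have r: "0 \<le> 4 / p" "4 / p \<le> 4"
    using p by (auto simp: divide_le_eq)
  show "u t \<in> wiener (4 / p)" if "0 < t" for t
    unfolding u[OF that] by (intro U_wiener c_reg that r)
  show "strongly_measurable T (wiener (4 / p)) (wiener_full_norm (4 / p)) u"
    by (rule sol_strongly_measurable[OF T u U_wiener(1)[OF _ r] wiener_norm_continuous[OF _ r]])
       (simp_all add: U_wiener(2)[OF reg_0 r])
  show "continuous_on {0<..} (\<lambda>t. wiener_full_norm (4 / p) (u t))"
    using wiener_norm_continuous[OF reg_0 r] by (rule continuous_on_eq) (simp add: u)
  show "wiener_full_norm (4 / p) (u t) powr p \<le> 1 * A 4 t" if t: "0 < t" for t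
    using wiener_interpolation[OF t p] c_zero[of t] t by (simp add: u U_wiener(2)[OF c_reg r])
qed

lemma Linf_norm_U_le: "l1 a \<Longrightarrow> Linf_norm (U a) \<le> (\<integral>k. norm (a k) \<partial>count_space UNIV)"
  by (intro Linf_norm_le U_measurable AE_I2 abs_U_le Bochner_Integration.integral_nonneg) simp_all

lemma sol_Linf_norm_le: "0 < t \<Longrightarrow> Linf_norm (U (c t)) \<le> z * exp (- \<delta> * t)"
  using Linf_norm_U_le[OF c_l1[of t]] c_norm_le[of t] by simp

text \<open>The sup norm of a difference is compared with \<open>wiener_full_norm 0\<close>, whose
  continuity in time is known.\<close>

lemma sol_Linf:
  assumes T: "0 < T" and u: "\<And>t. 0 < t \<Longrightarrow> u t = U (c t)"
  shows "u \<in> bochner_Linf T Linf Linf_norm"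
  unfolding bochner_Linf_def
proof (intro CollectI conjI)
  have uL: "u t \<in> Linf" if "0 < t" for t
    unfolding u[OF that] by (intro U_Linf regD(2) c_reg that)
  show "AE t in lebesgue_on {0<..<T}. u t \<in> Linf"
    by (rule AE_I2) (simp add: uL)
  show "\<exists>C. AE t in lebesgue_on {0<..<T}. Linf_norm (u t) \<le> C"
  proof (intro exI AE_I2)
    fix t assume "t \<in> space (lebesgue_on {0<..<T})"
    then have t: "0 < t"
      by simp
    have "z * exp (- \<delta> * t) \<le> z * 1"
      using t z \<delta> by (intro mult_left_mono) auto
    then show "Linf_norm (u t) \<le> z"
      using sol_Linf_norm_le[OF t] by (simp add: u[OF t])
  qed
  show "strongly_measurable T Linf Linf_norm u"
  proof (rule strongly_measurableI[OF T uL])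
    fix t x assume t: "0 < t" "t < T" and x: "\<And>n. x n \<in> {0<..<T}" "x \<longlonglongrightarrow> t"
    have r: "reg (\<lambda>k. c (x n) k - c t k)" for n
      using x(1)[of n] t by (intro reg_diff c_reg) auto
    have eq: "u (x n) - u t = U (\<lambda>k. c (x n) k - c t k)" for n
      using x(1)[of n] t by (simp add: u U_diff regD(2)[OF c_reg])
    have lim: "(\<lambda>n. wiener_full_norm 0 (U (\<lambda>k. c (x n) k - c t k))) \<longlonglongrightarrow> 0"
      by (rule continuous_zero_imp_seq[OF wiener_norm_continuous[OF c_reg[OF t(1)]] _ t(1) x])
         (simp_all add: U_wiener(2)[OF reg_0])
    show "(\<lambda>n. Linf_norm (u (x n) - u t)) \<longlonglongrightarrow> 0"
    proof (rule tendsto_sandwich[OF _ _ tendsto_const lim]; intro always_eventually allI)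
      fix n
      show "0 \<le> Linf_norm (u (x n) - u t)"
        unfolding eq by (intro Linf_norm_nonneg U_measurable regD(2) r)
      show "Linf_norm (u (x n) - u t) \<le> wiener_full_norm 0 (U (\<lambda>k. c (x n) k - c t k))"
        unfolding eq using Linf_norm_U_le[OF regD(2)[OF r[of n]]]
        by (simp add: U_wiener(2)[OF r] wiener_weight_def add_increasing)
    qed
  qed auto
qed

text \<open>The gap between \<sigma> and \<delta> leaves an exponential weight that pays for 2 d
  powers of |k|, hence for summability uniform in s \<ge> \<tau>.\<close>

lemma exp_c_le_gam:
  assumes \<tau>: "0 < \<tau>" "\<tau> \<le> s" and \<sigma>: "\<sigma> < \<delta>"
  shows "exp (\<sigma> * s * norm (freq k)) * norm (c s k)
      \<le> z * (real (2 * CARD('n)) / ((\<delta> - \<sigma>) * \<tau>)) ^ (2 * CARD('n)) * 2 ^ CARD('n) * gam k"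
proof -
  define m where "m = 2 * CARD('n)"
  define a where "a k = of_real (exp (\<sigma> * s * norm (freq k))) * c s k" for k
  have m: "0 < m"
    by (simp add: m_def)
  have s: "0 \<le> s"
    using \<tau> by simp
  have "norm (freq k) ^ 0 * norm (a k) \<le> z * (real m / ((\<delta> - \<sigma>) * \<tau>)) ^ m * 2 ^ CARD('n) * gam k"
  proof (rule moment_le_gam)
    show "a 0 = 0"
      using c_zero[OF s] by (simp add: a_def)
    define x where "x = norm (freq k)"
    have "((\<delta> - \<sigma>) * \<tau> * x / real m) ^ m \<le> ((\<delta> - \<sigma>) * s * x / real m) ^ m"
      using \<tau> \<sigma> by (intro power_mono divide_right_mono mult_right_mono mult_left_mono) (auto simp: x_def)
    also have "\<dots> \<le> exp ((\<delta> - \<sigma>) * s * x)"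
      using \<tau> \<sigma> m by (intro exp_ge_power) (auto simp: x_def)
    finally have "((\<delta> - \<sigma>) * \<tau> * x / real m) ^ m * norm (a k) \<le> exp ((\<delta> - \<sigma>) * s * x) * norm (a k)"
      by (rule mult_right_mono) simp
    also have "\<dots> = exp (\<delta> * s * x) * norm (c s k)"
    proof -
      have "(\<delta> - \<sigma>) * s * x + \<sigma> * s * x = \<delta> * s * x"
        by (simp add: algebra_simps)
      then have "exp ((\<delta> - \<sigma>) * s * x) * exp (\<sigma> * s * x) = exp (\<delta> * s * x)"
        by (simp flip: exp_add)
      then show ?thesis
        by (simp add: a_def x_def norm_mult flip: mult.assoc)
    qed
    also have "\<dots> \<le> z"
      unfolding x_def by (rule c_exp_pointwise[OF s])
    finally have le: "((\<delta> - \<sigma>) * \<tau> / real m) ^ m * (x ^ m * norm (a k)) \<le> z"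
      by (simp add: power_divide power_mult_distrib mult_ac)
    have inv: "(real m / ((\<delta> - \<sigma>) * \<tau>)) ^ m * ((\<delta> - \<sigma>) * \<tau> / real m) ^ m = 1"
      using \<tau> \<sigma> m by (simp flip: power_mult_distrib)
    have "(real m / ((\<delta> - \<sigma>) * \<tau>)) ^ m * (((\<delta> - \<sigma>) * \<tau> / real m) ^ m * (x ^ m * norm (a k)))
        \<le> (real m / ((\<delta> - \<sigma>) * \<tau>)) ^ m * z"
      using \<tau> \<sigma> by (intro mult_left_mono le) auto
    then show "norm (freq k) ^ (2 * CARD('n) + 0) * norm (a k) \<le> z * (real m / ((\<delta> - \<sigma>) * \<tau>)) ^ m"
      unfolding mult.assoc[symmetric] inv by (simp add: x_def m_def mult.commute)
  qed
  then show ?thesis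
    by (simp add: a_def m_def norm_mult)
qed

lemma sol_ell1:
  assumes T: "0 < T" and u: "\<And>t. 0 < t \<Longrightarrow> u t = U (c t)" and \<sigma>: "0 < \<sigma>" "\<sigma> < \<delta>"
  shows "(\<lambda>t k. of_real (exp (\<sigma> * t * norm (freq k))) * fourier_coeff (u t) k) \<in> bochner_Linf T ell1 ell1_norm"
proof -
  define a where "a t k = of_real (exp (\<sigma> * t * norm (freq k))) * c t k" for t k
  define v where "v t k = of_real (exp (\<sigma> * t * norm (freq k))) * fourier_coeff (u t) k" for t k
  have v: "v t = a t" if "0 < t" for t
    using that by (simp add: v_def a_def fun_eq_iff u fourier_coeff_U regD[OF c_reg])
  \<comment> \<open>\<open>H \<tau>\<close> provides summability and continuity for times beyond
    \<tau>. The bound of the norm that holds down to t = 0 is z, from the exponential estimate with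
    rate \<delta>.\<close>
  define H where "H \<tau> k = z * (real (2 * CARD('n)) / ((\<delta> - \<sigma>) * \<tau>)) ^ (2 * CARD('n)) * 2 ^ CARD('n) * gam k" for \<tau> and k :: "int ^ 'n"
  have H: "integrable (count_space UNIV) (H \<tau>)" for \<tau>
    unfolding H_def by (intro integrable_mult_right integrable_gam)
  have aH: "norm (a s k) \<le> H \<tau> k" if "0 < \<tau>" "\<tau> \<le> s" for s \<tau> k
    using exp_c_le_gam[OF that \<sigma>(2), of k] by (simp add: a_def H_def norm_mult)
  have al1: "l1 (a t)" if "0 < t" for t
    by (rule Bochner_Integration.integrable_bound[OF H[of t]])
       (use aH[OF that order_refl] in \<open>auto intro!: AE_I2 order_trans[OF _ abs_ge_self]\<close>)
  have norm_eq: "ell1_norm b = (\<integral>k. norm (b k) \<partial>count_space UNIV)" "b \<in> ell1" if "l1 b" for b :: "int ^ 'n \<Rightarrow> complex"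
    using infsum_eq_integral[OF integrable_norm[OF that]] by (simp_all add: ell1_norm_def ell1_def)
  have acont: "continuous_on {\<tau><..} (\<lambda>s. a s k)" if "0 < \<tau>" for \<tau> k
    unfolding a_def using that by (intro continuous_intros c_continuous_pos) simp
  have "v \<in> bochner_Linf T ell1 ell1_norm"
    unfolding bochner_Linf_def
  proof (intro CollectI conjI)
    have X: "v t \<in> ell1" if "0 < t" for t
      unfolding v[OF that] by (intro norm_eq al1 that)
    show "AE t in lebesgue_on {0<..<T}. v t \<in> ell1"
      by (rule AE_I2) (simp add: X)
    show "\<exists>C. AE t in lebesgue_on {0<..<T}. ell1_norm (v t) \<le> C"
    proof (intro exI AE_I2)
      fix t assume "t \<in> space (lebesgue_on {0<..<T})"
      then have t: "0 < t"
        by simp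
      have "ennreal (\<integral>k. norm (a t k) \<partial>count_space UNIV) = (\<integral>\<^sup>+k. ennreal (norm (a t k)) \<partial>count_space UNIV)"
        by (rule nn_integral_eq_integral[OF integrable_norm[OF al1[OF t]], symmetric]) simp
      also have "\<dots> \<le> (\<integral>\<^sup>+k. ennreal (exp (\<delta> * t * norm (freq k)) * norm (c t k)) \<partial>count_space UNIV)"
        unfolding a_def norm_mult using t \<sigma>
        by (intro nn_integral_mono ennreal_leI mult_right_mono) (auto intro!: mult_right_mono)
      also have "\<dots> \<le> ennreal z"
        using t by (intro c_exp_bound) simp
      finally show "ell1_norm (v t) \<le> z"
        using z by (simp add: v[OF t] norm_eq al1[OF t])
    qed
    show "strongly_measurable T ell1 ell1_norm v"
    proof (rule strongly_measurableI[OF T X])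
      fix t x assume t: "0 < t" "t < T" and x: "\<And>n. x n \<in> {0<..<T}" "x \<longlonglongrightarrow> t"
      have "continuous_on {0<..} (\<lambda>s. \<integral>k. norm (a s k - a t k) \<partial>count_space UNIV)"
      proof (rule continuous_on_positive)
        fix \<tau> :: real assume \<tau>: "0 < \<tau>"
        show "continuous_on {\<tau><..} (\<lambda>s. \<integral>k. norm (a s k - a t k) \<partial>count_space UNIV)"
        proof (rule continuous_on_integral_dominated[where g = "\<lambda>k. H \<tau> k + norm (a t k)"])
          show "continuous_on {\<tau><..} (\<lambda>s. norm (a s k - a t k))" for k
            by (intro continuous_intros acont \<tau>)
          show "norm (norm (a s k - a t k)) \<le> H \<tau> k + norm (a t k)" if "s \<in> {\<tau><..}" for s k
            using aH[OF \<tau>, of s k] that norm_triangle_ineq4[of "a s k" "a t k"] by simp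
          show "integrable (count_space UNIV) (\<lambda>k. H \<tau> k + norm (a t k))"
            by (intro Bochner_Integration.integrable_add H integrable_norm al1 t)
        qed simp
      qed
      then have "(\<lambda>n. \<integral>k. norm (a (x n) k - a t k) \<partial>count_space UNIV) \<longlonglongrightarrow> 0"
        by (rule continuous_zero_imp_seq[OF _ _ t(1) x]) simp
      moreover have "ell1_norm (v (x n) - v t) = (\<integral>k. norm (a (x n) k - a t k) \<partial>count_space UNIV)" for n
      proof -
        have "v (x n) - v t = (\<lambda>k. a (x n) k - a t k)"
          using x(1)[of n] t by (simp add: v fun_eq_iff)
        moreover have "l1 (\<lambda>k. a (x n) k - a t k)"
          using x(1)[of n] t by (intro Bochner_Integration.integrable_diff al1) auto
        ultimately show ?thesis
          by (simp add: norm_eq)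
      qed
      ultimately show "(\<lambda>n. ell1_norm (v (x n) - v t)) \<longlonglongrightarrow> 0"
        by simp
    qed auto
  qed
  then show ?thesis
    by (simp add: v_def[abs_def])
qed

section \<open>The flux of the solution\<close>

lemma fluxU_joint_continuous: "continuous_on ({0<..} \<times> UNIV) (\<lambda>(t, x). fluxU i j (c t) x)"
proof -
  note J = U_joint_continuous[unfolded case_prod_unfold]
  have "continuous_on ({0<..} \<times> UNIV) (\<lambda>p. U (Dc i (Dc j (c (fst p)))) (snd p)
      - U (Dc i (c (fst p))) (snd p) * U (Dc j (c (fst p))) (snd p) / (1 + U (c (fst p)) (snd p)))"
  proof (intro continuous_on_diff continuous_on_divide continuous_on_mult continuous_on_add continuous_on_const J ballI)
    fix p :: "real \<times> (real ^ 'n)" assume "p \<in> {0<..} \<times> UNIV"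
    then show "1 + U (c (fst p)) (snd p) \<noteq> 0"
      using one_plus_U_pos[of "fst p" "snd p"] by auto
  qed
  then show ?thesis
    by (simp add: fluxU_def case_prod_unfold)
qed

lemma fluxU_continuous: "0 < t \<Longrightarrow> continuous_on UNIV (fluxU i j (c t))"
  using continuous_on_compose2[OF fluxU_joint_continuous[of i j], of UNIV "\<lambda>x. (t, x)"]
  by (force intro!: continuous_intros)

text \<open>1 + u \<ge> 1 - z bounds the denominator, and the quadratic numerator is at most A_1^2
  \<le> A_4.\<close>

lemma abs_fluxU_le: "0 < t \<Longrightarrow> \<bar>fluxU i j (c t) x\<bar> \<le> (1 + 1 / (1 - z)) * A 4 t"
proof -
  assume t: "0 < t"
  have "\<bar>U (Dc i (c t)) x * U (Dc j (c t)) x / (1 + U (c t) x)\<bar> \<le> (A 1 t * A 1 t) / (1 - z)"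
    unfolding abs_divide abs_mult using one_plus_U_ge[OF t, of x] one_plus_U_pos[OF t, of x] z
    by (intro frac_le mult_mono abs_U_c_le t mult_nonneg_nonneg A_nonneg) auto
  also have "\<dots> \<le> A 4 t / (1 - z)"
    using A_squares(2)[OF t] z by (intro divide_right_mono) (auto simp: power2_eq_square)
  finally have "\<bar>U (Dc i (c t)) x * U (Dc j (c t)) x / (1 + U (c t) x)\<bar> \<le> A 4 t / (1 - z)" .
  moreover have "\<bar>U (Dc i (Dc j (c t))) x\<bar> \<le> A 4 t"
    using abs_U_c_le(3)[OF t, of i j x] A_le_4[OF t, of 2] by simp
  moreover have "(1 + 1 / (1 - z)) * A 4 t = A 4 t + A 4 t / (1 - z)"
    by (simp add: distrib_right)
  ultimately show ?thesis
    unfolding fluxU_def by linarith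
qed

lemma flux_L1:
  assumes t: "0 < t"
  shows "flux i j (U (c t)) \<in> L1"
  unfolding L1_def
proof (intro CollectI conjI)
  show "periodic (flux i j (U (c t)))"
    by (rule flux_U[OF c_reg[OF t]])
  show "integrable torus (flux i j (U (c t)))"
  proof (rule integrable_cong_AE_imp)
    show "integrable torus (fluxU i j (c t))"
      by (intro integrable_torus_continuous fluxU_continuous t)
    show "AE x in torus. fluxU i j (c t) x = flux i j (U (c t)) x"
      using flux_U(1)[OF c_reg[OF t], of i j] by eventually_elim simp
  qed (rule flux_U[OF c_reg[OF t]])
qed

text \<open>All norms are computed with \<open>fluxU\<close>, which agrees with the flux almost
  everywhere and is jointly continuous for t > 0.\<close>

lemma sol_flux:
  assumes T: "0 < T" and u: "\<And>t. 0 < t \<Longrightarrow> u t = U (c t)"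
  shows "(\<lambda>t. flux i j (u t)) \<in> bochner_Lp 1 T L1 L1_norm"
proof (rule bochner_LpI[OF T, where C = "(2 * pi) ^ CARD('n) * (1 + 1 / (1 - z))"])
  have N: "L1_norm (flux i j (u t)) = (LINT x|torus. \<bar>fluxU i j (c t) x\<bar>)" if t: "0 < t" for t
    using flux_U[OF c_reg[OF t], of i j] borel_measurable_torus[OF fluxU_continuous[OF t, of i j]]
    unfolding u[OF t] by (subst L1_norm_cong) (auto simp: L1_norm_def)
  show X: "flux i j (u t) \<in> L1" if "0 < t" for t
    unfolding u[OF that] by (rule flux_L1[OF that])
  show "continuous_on {0<..} (\<lambda>t. L1_norm (flux i j (u t)))"
  proof (rule continuous_on_eq)
    show "continuous_on {0<..} (\<lambda>t. LINT x|torus. \<bar>fluxU i j (c t) x\<bar>)"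
      using continuous_on_rabs[OF fluxU_joint_continuous[of i j]]
      by (intro torus_integral_continuous) (simp add: case_prod_unfold)
  qed (simp add: N)
  show "L1_norm (flux i j (u t)) powr 1 \<le> (2 * pi) ^ CARD('n) * (1 + 1 / (1 - z)) * A 4 t" if t: "0 < t" for t
  proof -
    have "(LINT x|torus. \<bar>fluxU i j (c t) x\<bar>) \<le> (2 * pi) ^ CARD('n) * ((1 + 1 / (1 - z)) * A 4 t)"
      by (intro torus_integral_le continuous_on_rabs fluxU_continuous t abs_fluxU_le)
    moreover have "0 \<le> (LINT x|torus. \<bar>fluxU i j (c t) x\<bar>)"
      by (intro Bochner_Integration.integral_nonneg) simp
    ultimately show ?thesis
      by (simp add: N[OF t] mult.assoc)
  qed
  show "strongly_measurable T L1 L1_norm (\<lambda>t. flux i j (u t))"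
  proof (rule strongly_measurableI[OF T X])
    fix t x assume t: "0 < t" "t < T" and x: "\<And>n. x n \<in> {0<..<T}" "x \<longlonglongrightarrow> t"
    have c2: "continuous_on ({0<..} \<times> UNIV) (\<lambda>p :: real \<times> (real ^ 'n). fluxU i j (c t) (snd p))"
      by (intro continuous_on_compose2[OF fluxU_continuous[OF t(1)]] continuous_intros) auto
    have "continuous_on {0<..} (\<lambda>s. LINT x|torus. \<bar>fluxU i j (c s) x - fluxU i j (c t) x\<bar>)"
      using continuous_on_rabs[OF continuous_on_diff[OF fluxU_joint_continuous[of i j] c2]]
      by (intro torus_integral_continuous) (simp add: case_prod_unfold)
    then have "(\<lambda>n. LINT y|torus. \<bar>fluxU i j (c (x n)) y - fluxU i j (c t) y\<bar>) \<longlonglongrightarrow> 0"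
      by (rule continuous_zero_imp_seq[OF _ _ t(1) x]) simp
    moreover have "L1_norm (flux i j (u (x n)) - flux i j (u t)) = (LINT y|torus. \<bar>fluxU i j (c (x n)) y - fluxU i j (c t) y\<bar>)" for n
    proof -
      have xn: "0 < x n"
        using x(1)[of n] by simp
      have "AE y in torus. (flux i j (u (x n)) - flux i j (u t)) y = fluxU i j (c (x n)) y - fluxU i j (c t) y"
        using flux_U(1)[OF c_reg[OF xn], of i j] flux_U(1)[OF c_reg[OF t(1)], of i j]
        by eventually_elim (simp add: u xn t)
      moreover have "flux i j (u (x n)) - flux i j (u t) \<in> borel_measurable torus"
        using L1_measurable[OF X[OF xn]] L1_measurable[OF X[OF t(1)]] by (simp add: fun_diff_def)
      moreover have "(\<lambda>y. fluxU i j (c (x n)) y - fluxU i j (c t) y) \<in> borel_measurable torus"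
        by (intro borel_measurable_diff borel_measurable_torus fluxU_continuous xn t)
      ultimately have "L1_norm (flux i j (u (x n)) - flux i j (u t)) = L1_norm (\<lambda>y. fluxU i j (c (x n)) y - fluxU i j (c t) y)"
        by (intro L1_norm_cong)
      then show ?thesis
        by (simp add: L1_norm_def)
    qed
    ultimately show "(\<lambda>n. L1_norm (flux i j (u (x n)) - flux i j (u t))) \<longlonglongrightarrow> 0"
      by simp
  qed
qed

end

section \<open>The weak formulation\<close>

lemma nn_integral_count_space_swap:
  fixes f :: "'k::countable \<Rightarrow> 'x \<Rightarrow> ennreal"
  assumes M: "sigma_finite_measure M" and f: "\<And>k. f k \<in> borel_measurable M"
  shows "(\<integral>\<^sup>+k. \<integral>\<^sup>+x. f k x \<partial>M \<partial>count_space UNIV) = (\<integral>\<^sup>+x. \<integral>\<^sup>+k. f k x \<partial>count_space UNIV \<partial>M)"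
proof -
  interpret C: sigma_finite_measure "count_space (UNIV :: 'k set)"
    by (rule sigma_finite_count)
  interpret M: sigma_finite_measure M
    by (rule M)
  interpret P: pair_sigma_finite "count_space (UNIV :: 'k set)" M ..
  have "(\<lambda>(k, x). f k x) \<in> borel_measurable (count_space UNIV \<Otimes>\<^sub>M M)"
    using f by (intro measurable_pair_measure_countable1) auto
  then show ?thesis
    by (rule P.Fubini'[symmetric])
qed

section \<open>Test functions and their modes\<close>

lemma spacetime_time_derivative:
  fixes f :: "real \<times> (real ^ 'n::finite) \<Rightarrow> real"
  assumes f: "smooth_on spacetime f" and t: "0 \<le> t"
  shows "((\<lambda>s. f (s, x)) has_vector_derivative dt f (t, x)) (at t within {0..})"
proof -
  have "f differentiable (at (t, x) within spacetime)"
    using smooth_on_continuous(2)[OF f] t by (simp add: differentiable_on_def)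
  from line_derivative[OF this, of "(1, 0)" "{0..}" t] show ?thesis
    by (simp add: Basis_prod_def)
qed

lemma spacetime_space_derivative:
  fixes f :: "real \<times> (real ^ 'n::finite) \<Rightarrow> real"
  assumes f: "smooth_on spacetime f" and t: "0 \<le> t"
  shows "((\<lambda>s. f (t, x + axis i s)) has_vector_derivative dx i f (t, x)) (at 0)"
proof -
  have "f differentiable (at (t, x) within spacetime)"
    using smooth_on_continuous(2)[OF f] t by (simp add: differentiable_on_def)
  from line_derivative[OF this, of "(0, axis i 1)" UNIV 0] t show ?thesis
    by (simp add: Basis_prod_def flip: axis_eq_scaleR)
qed

lemma periodic_dx:
  fixes f :: "real \<times> (real ^ 'n::finite) \<Rightarrow> real"
  assumes f: "smooth_on spacetime f" and t: "0 \<le> t" and p: "periodic (\<lambda>x. f (t, x))"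
  shows "periodic (\<lambda>x. dx i f (t, x))"
  unfolding periodic_def
proof (intro allI)
  fix x l
  have "(x + axis l (2 * pi)) + axis i s = (x + axis i s) + axis l (2 * pi)" for s
    by (simp add: algebra_simps)
  then have "f (t, (x + axis l (2 * pi)) + axis i s) = f (t, x + axis i s)" for s
    using p[unfolded periodic_def, rule_format, of "x + axis i s" l] by (simp only:)
  then show "dx i f (t, x + axis l (2 * pi)) = dx i f (t, x)"
    using spacetime_space_derivative[OF f t, of "x + axis l (2 * pi)" i] spacetime_space_derivative[OF f t, of x i]
    by (simp add: vector_derivative_unique_at)
qed

lemma smooth_dx: "smooth_on spacetime f \<Longrightarrow> smooth_on spacetime (dx i f)"
  by (rule smooth_on_continuous(3)) (auto simp: Basis_prod_def)

lemma smooth_dt: "smooth_on spacetime f \<Longrightarrow> smooth_on spacetime (dt f)"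
  by (rule smooth_on_continuous(3)) (auto simp: Basis_prod_def)

lemma smooth_slice_continuous:
  assumes "smooth_on spacetime f" "0 \<le> t"
  shows "continuous_on UNIV (\<lambda>x. f (t, x))"
  by (rule continuous_on_compose2[OF smooth_on_continuous(1)[OF assms(1)]])
     (use assms(2) in \<open>auto intro!: continuous_intros\<close>)

text \<open>Taken against \<open>wave k\<close> and not \<open>wave (- k)\<close>: when a series is
  integrated against f, its k-th coefficient is multiplied by this number.\<close>

definition mode :: "(real \<times> (real ^ 'n::finite) \<Rightarrow> real) \<Rightarrow> int ^ 'n \<Rightarrow> real \<Rightarrow> complex" where
  "mode f k t = (LINT x|torus. wave k x * of_real (f (t, x)))"

lemma mode_integrand_continuous:
  assumes "smooth_on spacetime f"
  shows "continuous_on ({0..} \<times> UNIV) (\<lambda>(t, x). wave k x * complex_of_real (f (t, x)))"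
  unfolding case_prod_unfold using smooth_on_continuous(1)[OF assms] by (auto intro!: continuous_intros)

lemma mode_continuous: "smooth_on spacetime f \<Longrightarrow> continuous_on {0..} (mode f k)"
  unfolding mode_def by (intro torus_integral_continuous mode_integrand_continuous)

lemma mode_dx:
  assumes "smooth_on spacetime f" "0 \<le> t" "periodic (\<lambda>x. f (t, x))"
  shows "mode (dx i f) k t = - (\<i> * of_real (freq k $ i) * mode f k t)"
  unfolding mode_def
  by (intro integral_torus_wave_derivative smooth_slice_continuous smooth_dx spacetime_space_derivative assms)

lemma mode_dx_dx:
  assumes "smooth_on spacetime f" "0 \<le> t" "periodic (\<lambda>x. f (t, x))"
  shows "mode (dx i (dx j f)) k t = - (of_real (freq k $ i * freq k $ j) * mode f k t)"
  by (simp add: mode_dx assms smooth_dx periodic_dx mult_ac flip: mult.assoc[of \<i> \<i>])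

text \<open>Differentiation under the integral sign, one-sided at t = 0 to match derivatives within
  the half-space.\<close>

lemma mode_dt:
  fixes f :: "real \<times> (real ^ 'n::finite) \<Rightarrow> real"
  assumes f: "smooth_on spacetime f" and t: "0 \<le> t"
  shows "(mode f k has_vector_derivative mode (dt f) k t) (at t within {0..})"
proof -
  define Q where "Q = (cbox (\<chi> i. - pi) (\<chi> i. pi) :: (real ^ 'n) set)"
  have eq: "mode g k s = integral Q (\<lambda>x. wave k x * of_real (g (s, x)))"
    if "smooth_on spacetime g" "0 \<le> s" for g s
    unfolding mode_def Q_def
    by (intro integral_torus integrable_torus_continuous continuous_intros smooth_slice_continuous that)
  have "((\<lambda>s. integral Q (\<lambda>x. wave k x * of_real (f (s, x)))) has_vector_derivative
      integral Q (\<lambda>x. wave k x * of_real (dt f (t, x)))) (at t within {0..})"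
    unfolding Q_def
  proof (rule leibniz_rule_vector_derivative)
    show "((\<lambda>s. wave k x * complex_of_real (f (s, x))) has_vector_derivative wave k x * of_real (dt f (s, x))) (at s within {0..})"
      if "s \<in> {0..}" for s x
    proof -
      have "((\<lambda>s. complex_of_real (f (s, x))) has_vector_derivative of_real (dt f (s, x))) (at s within {0..})"
        using that by (intro bounded_linear.has_vector_derivative[OF bounded_linear_of_real] spacetime_time_derivative f) simp
      then show ?thesis
        by (rule has_vector_derivative_mult_right)
    qed
    show "(\<lambda>x. wave k x * complex_of_real (f (s, x))) integrable_on cbox (\<chi> i. - pi) (\<chi> i. pi)" if "s \<in> {0..}" for s
    proof -
      have "continuous_on UNIV (\<lambda>x. wave k x * complex_of_real (f (s, x)))"
        using that by (intro continuous_intros smooth_slice_continuous f) simp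
      then show ?thesis
        by (rule integrable_continuous[OF continuous_on_subset]) simp
    qed
    show "continuous_on ({0..} \<times> cbox (\<chi> i. - pi) (\<chi> i. pi)) (\<lambda>(s, x). wave k x * complex_of_real (dt f (s, x)))"
      by (rule continuous_on_subset[OF mode_integrand_continuous[OF smooth_dt[OF f]]]) auto
  qed (use t in auto)
  then have "((\<lambda>s. integral Q (\<lambda>x. wave k x * of_real (f (s, x)))) has_vector_derivative mode (dt f) k t) (at t within {0..})"
    by (simp only: eq[OF smooth_dt[OF f] t])
  then show ?thesis
  proof (rule has_vector_derivative_transform[rotated 2])
    show "t \<in> {0..}"
      using t by simp
    show "mode f k s = integral Q (\<lambda>x. wave k x * of_real (f (s, x)))" if "s \<in> {0..}" for s
      using that by (intro eq f) simp
  qed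
qed

text \<open>Uniform in k, which suffices because the sequences paired with the modes are
  summable.\<close>

lemma mode_bound:
  fixes f :: "real \<times> (real ^ 'n::finite) \<Rightarrow> real"
  assumes f: "smooth_on spacetime f"
  obtains B where "0 \<le> B" "\<And>k t. t \<in> {0..T} \<Longrightarrow> norm (mode f k t) \<le> B"
proof -
  define Q where "Q = (cbox (\<chi> i. - pi) (\<chi> i. pi) :: (real ^ 'n) set)"
  have "compact (f ` ({0..T} \<times> Q))"
    unfolding Q_def
    by (intro compact_continuous_image compact_Times compact_cbox compact_Icc continuous_on_subset[OF smooth_on_continuous(1)[OF f]]) auto
  then obtain C where C: "\<And>p. p \<in> {0..T} \<times> Q \<Longrightarrow> norm (f p) \<le> C"
    by (meson bounded_iff compact_imp_bounded imageI)
  show ?thesis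
  proof (rule that[of "\<bar>C\<bar> * (2 * pi) ^ CARD('n)"])
    fix k :: "int ^ 'n" and t assume t: "t \<in> {0..T}"
    have "norm (mode f k t) \<le> (LINT x|torus. norm (wave k x * complex_of_real (f (t, x))))"
      unfolding mode_def by (rule integral_norm_bound)
    also have "\<dots> \<le> (LINT x|(torus :: (real ^ 'n) measure). \<bar>C\<bar>)"
    proof (rule integral_mono)
      show "integrable torus (\<lambda>x. norm (wave k x * complex_of_real (f (t, x))))"
        using t by (intro integrable_torus_continuous continuous_intros smooth_slice_continuous f) auto
      show "norm (wave k x * complex_of_real (f (t, x))) \<le> \<bar>C\<bar>" if "x \<in> space torus" for x
        using C[of "(t, x)"] t that by (simp add: norm_mult torus_space Q_def)
    qed (rule integrable_torus_continuous, simp)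
    also have "\<dots> = \<bar>C\<bar> * (2 * pi) ^ CARD('n)"
      by (simp add: measure_torus)
    finally show "norm (mode f k t) \<le> \<bar>C\<bar> * (2 * pi) ^ CARD('n)" .
  qed simp
qed

section \<open>The weak formulation, mode by mode\<close>

context wiener_datum
begin

definition flux_coeff :: "'n \<Rightarrow> 'n \<Rightarrow> real \<Rightarrow> int ^ 'n \<Rightarrow> complex" where
  "flux_coeff i j t k = Dc i (Dc j (c t)) k - Bc i j (c t) k"

lemma c_fin_mom: "0 < t \<Longrightarrow> fin_mom (\<lambda>_. 1) (c t)"
  using c_reg by (simp add: reg_def)

lemma Bc_c:
  assumes t: "0 < t"
  shows "l1 (Bc i j (c t))"
    and "(\<integral>k. norm (Bc i j (c t) k) \<partial>count_space UNIV) \<le> A 4 t / (1 - z)"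
    and "AE x in torus. ser (Dc i (c t)) x * ser (Dc j (c t)) x * (1 / (1 + ser (c t) x)) = ser (Bc i j (c t)) x"
proof -
  have zt: "mom1 0 (c t) \<le> z"
    using A_0_le(2)[OF t] by (simp add: A_def)
  note B = Bc_bd[OF submult_1 c_fin_mom[OF t] zt z(2), of i j]
  show l1: "l1 (Bc i j (c t))"
    using B(3) by (simp add: wien_def Bc_def)
  have "ennreal (\<integral>k. norm (Bc i j (c t) k) \<partial>count_space UNIV) = (\<integral>\<^sup>+k. ennreal (norm (Bc i j (c t) k)) \<partial>count_space UNIV)"
    by (rule nn_integral_eq_integral[OF integrable_norm[OF l1], symmetric]) simp
  also have "\<dots> \<le> ennreal ((A 1 t)\<^sup>2 / (1 - z))"
    using B(1) by (simp add: bd_def wnorm_def mwt_def Bc_def A_def)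
  also have "\<dots> \<le> ennreal (A 4 t / (1 - z))"
    using A_squares(2)[OF t] z by (intro ennreal_leI divide_right_mono) auto
  finally show "(\<integral>k. norm (Bc i j (c t) k) \<partial>count_space UNIV) \<le> A 4 t / (1 - z)"
    using A_nonneg[of 4 t] z by simp
  show "AE x in torus. ser (Dc i (c t)) x * ser (Dc j (c t)) x * (1 / (1 + ser (c t) x)) = ser (Bc i j (c t)) x"
    using wien_AE_eq_ser[OF B(3)] by (simp add: Bc_def)
qed

lemma flux_coeff:
  assumes t: "0 < t"
  shows "l1 (flux_coeff i j t)" "(\<integral>k. norm (flux_coeff i j t k) \<partial>count_space UNIV) \<le> (1 + 1 / (1 - z)) * A 4 t"
    and "AE x in torus. complex_of_real (fluxU i j (c t) x) = ser (flux_coeff i j t) x"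
proof -
  note r = regD[OF c_reg[OF t]]
  show l1: "l1 (flux_coeff i j t)"
    unfolding flux_coeff_def by (intro Bochner_Integration.integrable_diff r Bc_c t)
  have "(\<integral>k. norm (flux_coeff i j t k) \<partial>count_space UNIV) \<le> (\<integral>k. norm (freq k) ^ 2 * norm (c t k) + norm (Bc i j (c t) k) \<partial>count_space UNIV)"
  proof (rule integral_mono)
    show "integrable (count_space UNIV) (\<lambda>k. norm (flux_coeff i j t k))"
      by (intro integrable_norm l1)
    show "integrable (count_space UNIV) (\<lambda>k. norm (freq k) ^ 2 * norm (c t k) + norm (Bc i j (c t) k))"
      by (intro Bochner_Integration.integrable_add integrable_norm Bc_c c_moment_integrable t)
    show "norm (flux_coeff i j t k) \<le> norm (freq k) ^ 2 * norm (c t k) + norm (Bc i j (c t) k)" for k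
      unfolding flux_coeff_def using norm_triangle_ineq4[of "Dc i (Dc j (c t)) k" "Bc i j (c t) k"] norm_Dc_Dc_le[of i j "c t" k]
      by linarith
  qed
  also have "\<dots> = A 2 t + (\<integral>k. norm (Bc i j (c t) k) \<partial>count_space UNIV)"
    unfolding A_eq by (intro Bochner_Integration.integral_add integrable_norm Bc_c c_moment_integrable t)
  also have "\<dots> \<le> A 4 t + A 4 t / (1 - z)"
    by (intro add_mono Bc_c A_le_4 t) simp
  finally show "(\<integral>k. norm (flux_coeff i j t k) \<partial>count_space UNIV) \<le> (1 + 1 / (1 - z)) * A 4 t"
    by (simp add: distrib_right)
  show "AE x in torus. complex_of_real (fluxU i j (c t) x) = ser (flux_coeff i j t) x"
    using Bc_c(3)[OF t, of i j]
  proof eventually_elim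
    case (elim x)
    have "complex_of_real (fluxU i j (c t) x) = ser (Dc i (Dc j (c t))) x
        - ser (Dc i (c t)) x * ser (Dc j (c t)) x * (1 / (1 + ser (c t) x))"
      by (simp add: fluxU_def U_ser herm_Dc r(1))
    also have "\<dots> = ser (flux_coeff i j t) x"
      unfolding elim flux_coeff_def[abs_def] by (rule ser_diff[OF r(4) Bc_c(1)[OF t], symmetric])
    finally show ?case .
  qed
qed

text \<open>|k|^4 is the double sum of k_i^2 k_j^2, so the linear part distributes over the second
  derivatives contained in the fluxes.\<close>

lemma rhs_eq_Fc: "rhs (c t) k = (\<Sum>i\<in>UNIV. \<Sum>j\<in>UNIV. of_real (freq k $ i * freq k $ j) * flux_coeff i j t k)"
proof -
  have n2: "(norm (freq k))\<^sup>2 = (\<Sum>i\<in>UNIV. (freq k $ i)\<^sup>2)"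
    by (simp add: norm_eq_sqrt_inner inner_vec_def power2_eq_square sum_nonneg)
  have "norm (freq k) ^ 4 = (norm (freq k))\<^sup>2 * (norm (freq k))\<^sup>2"
    by (simp add: eval_nat_numeral)
  also have "\<dots> = (\<Sum>i\<in>UNIV. \<Sum>j\<in>UNIV. (freq k $ i)\<^sup>2 * (freq k $ j)\<^sup>2)"
    unfolding n2 by (rule sum_product)
  finally have n4: "norm (freq k) ^ 4 = (\<Sum>i\<in>UNIV. \<Sum>j\<in>UNIV. (freq k $ i)\<^sup>2 * (freq k $ j)\<^sup>2)" .
  have "(\<Sum>i\<in>UNIV. \<Sum>j\<in>UNIV. of_real (freq k $ i * freq k $ j) * flux_coeff i j t k)
      = (\<Sum>i\<in>UNIV. \<Sum>j\<in>UNIV. - (of_real ((freq k $ i)\<^sup>2 * (freq k $ j)\<^sup>2) * c t k)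
          - of_real (freq k $ i * freq k $ j) * Bc i j (c t) k)"
    by (intro sum.cong refl) (simp add: flux_coeff_def Dc_def power2_eq_square algebra_simps)
  also have "\<dots> = - (of_real (\<Sum>i\<in>UNIV. \<Sum>j\<in>UNIV. (freq k $ i)\<^sup>2 * (freq k $ j)\<^sup>2) * c t k)
      - (\<Sum>i\<in>UNIV. \<Sum>j\<in>UNIV. of_real (freq k $ i * freq k $ j) * Bc i j (c t) k)"
    by (simp add: sum_subtractf sum_negf sum_distrib_right)
  also have "\<dots> = rhs (c t) k"
    by (simp add: rhs_def NL_def n4)
  finally show ?thesis ..
qed

text \<open>Fubini with the majorant \<open>A 4\<close>, whose integrability up to t = 0 permits the
  interchange on the whole interval.\<close>

lemma swap_time_modes:
  fixes g :: "int ^ 'n \<Rightarrow> real \<Rightarrow> complex"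
  assumes T: "0 < T" and g: "\<And>k. continuous_on {0<..<T} (g k)"
    and le: "\<And>t. 0 < t \<Longrightarrow> t < T \<Longrightarrow> (\<integral>\<^sup>+k. ennreal (norm (g k t)) \<partial>count_space UNIV) \<le> ennreal (C * A 4 t)"
  defines "M \<equiv> lebesgue_on {0<..<T}"
  shows "(\<integral>t. (\<integral>k. g k t \<partial>count_space UNIV) \<partial>M) = (\<integral>k. (\<integral>t. g k t \<partial>M) \<partial>count_space UNIV)"
    and "integrable M (\<lambda>t. \<integral>k. g k t \<partial>count_space UNIV)"
    and "integrable (count_space UNIV) (\<lambda>k. \<integral>t. g k t \<partial>M)"
    and "integrable M (g k)"
proof -
  have sf: "sigma_finite_measure M"
    using finite_measure_lebesgue_on[of "{0<..<T}"] unfolding M_def finite_measure_def by simp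
  have meas: "g k \<in> borel_measurable M" for k
    unfolding M_def by (rule continuous_imp_measurable_on_sets_lebesgue[OF g]) simp
  have i4: "integrable M (\<lambda>t. C * A 4 t)"
    unfolding M_def by (intro integrable_mult_right A4_integrable T)
  have "(\<integral>\<^sup>+k. \<integral>\<^sup>+t. ennreal (norm (g k t)) \<partial>M \<partial>count_space UNIV) = (\<integral>\<^sup>+t. \<integral>\<^sup>+k. ennreal (norm (g k t)) \<partial>count_space UNIV \<partial>M)"
    by (rule nn_integral_count_space_swap[OF sf]) (use meas in measurable)
  also have "\<dots> \<le> (\<integral>\<^sup>+t. ennreal (norm (C * A 4 t)) \<partial>M)"
  proof (rule nn_integral_mono)
    fix t assume "t \<in> space M"
    then have "(\<integral>\<^sup>+k. ennreal (norm (g k t)) \<partial>count_space UNIV) \<le> ennreal (C * A 4 t)"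
      by (intro le) (auto simp: M_def)
    also have "\<dots> \<le> ennreal (norm (C * A 4 t))"
      by (rule ennreal_leI) simp
    finally show "(\<integral>\<^sup>+k. ennreal (norm (g k t)) \<partial>count_space UNIV) \<le> ennreal (norm (C * A 4 t))" .
  qed
  also have "\<dots> < \<infinity>"
    using i4 unfolding integrable_iff_bounded by blast
  finally have fin: "(\<integral>\<^sup>+k. \<integral>\<^sup>+t. ennreal (norm (g k t)) \<partial>M \<partial>count_space UNIV) < \<infinity>" .
  note sw = integral_count_space_swap[OF sf meas fin]
  show "(\<integral>t. (\<integral>k. g k t \<partial>count_space UNIV) \<partial>M) = (\<integral>k. (\<integral>t. g k t \<partial>M) \<partial>count_space UNIV)"
    "integrable M (\<lambda>t. \<integral>k. g k t \<partial>count_space UNIV)"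
    "integrable (count_space UNIV) (\<lambda>k. \<integral>t. g k t \<partial>M)"
    by (rule sw)+
  have "(\<integral>\<^sup>+t. ennreal (norm (g k t)) \<partial>M) = (\<integral>\<^sup>+l. (\<integral>\<^sup>+t. ennreal (norm (g l t)) \<partial>M) * indicator {k} l \<partial>count_space UNIV)"
    by (subst nn_integral_count_space'[of "{k}"]) auto
  also have "\<dots> \<le> (\<integral>\<^sup>+l. \<integral>\<^sup>+t. ennreal (norm (g l t)) \<partial>M \<partial>count_space UNIV)"
    by (intro nn_integral_mono) (auto simp: indicator_def)
  finally show "integrable M (g k)"
    using meas[of k] fin by (auto simp: integrable_iff_bounded intro: le_less_trans)
qed

text \<open>For each frequency the product of \<open>c t k\<close> and the mode of \<phi> has
  derivative g1 + g2. Integrated over (0, T) it contributes nothing at T and the datum at 0;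
  summation over k, interchanged with the time integral, gives the identity.\<close>

lemma weak_formulation:
  fixes \<phi> :: "real \<times> (real ^ 'n) \<Rightarrow> real"
  assumes T: "0 < T" and u: "\<And>t. 0 < t \<Longrightarrow> u t = U (c t)" and \<phi>: "test_function T \<phi>"
    and u0: "u0 \<in> L1" "AE x in torus. u0 x = U v x"
  shows "- (LINT t|lebesgue_on {0<..<T}. LINT x|torus. dt \<phi> (t, x) * u t x)
        - (LINT x|torus. \<phi> (0, x) * u0 x)
        + (LINT t|lebesgue_on {0<..<T}. LINT x|torus.
             (\<Sum>i\<in>UNIV. \<Sum>j\<in>UNIV. flux i j (u t) x * dx i (dx j \<phi>) (t, x))) = 0"
proof -
  let ?M = "lebesgue_on {0<..<T}"
  have sm: "smooth_on spacetime \<phi>" and per: "\<And>t. 0 \<le> t \<Longrightarrow> periodic (\<lambda>x. \<phi> (t, x))"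
    using \<phi> by (auto simp: test_function_def)
  have \<phi>T: "\<phi> (T, x) = 0" for x
  proof -
    obtain T' where "T' < T" "\<And>t x. 0 \<le> t \<Longrightarrow> T' \<le> t \<Longrightarrow> \<phi> (t, x) = 0"
      using \<phi> by (auto simp: test_function_def)
    then show ?thesis
      using T by simp
  qed
  define P where "P t = (LINT x|torus. dt \<phi> (t, x) * u t x)" for t
  define R where "R t = (LINT x|torus. (\<Sum>i\<in>UNIV. \<Sum>j\<in>UNIV. flux i j (u t) x * dx i (dx j \<phi>) (t, x)))" for t
  define g1 where "g1 k t = c t k * mode (dt \<phi>) k t" for k t
  define g2 where "g2 k t = rhs (c t) k * mode \<phi> k t" for k t
  obtain B1 where B1: "0 \<le> B1" "\<And>k t. t \<in> {0..T} \<Longrightarrow> norm (mode (dt \<phi>) k t) \<le> B1"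
    using mode_bound[OF smooth_dt[OF sm]] by metis
  have "\<exists>B. 0 \<le> B \<and> (\<forall>k. \<forall>t\<in>{0..T}. norm (mode (dx i (dx j \<phi>)) k t) \<le> B)" for i j
    using mode_bound[OF smooth_dx[OF smooth_dx[OF sm]], of T i j] by metis
  then obtain B2 where B2: "\<And>i j. 0 \<le> B2 i j" "\<And>i j k t. t \<in> {0..T} \<Longrightarrow> norm (mode (dx i (dx j \<phi>)) k t) \<le> B2 i j"
    by metis
  have P_eq: "complex_of_real (P t) = (\<integral>k. g1 k t \<partial>count_space UNIV)" if t: "0 < t" for t
  proof -
    note r = regD[OF c_reg[OF t]]
    have "complex_of_real (P t) = (LINT x|torus. ser (c t) x * of_real (dt \<phi> (t, x)))"
      unfolding P_def u[OF t] by (simp add: mult.commute flip: U_ser[OF r(1)] integral_complex_of_real of_real_mult)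
    also have "\<dots> = (\<integral>k. c t k * (LINT x|torus. wave k x * of_real (dt \<phi> (t, x))) \<partial>count_space UNIV)"
      using t by (intro ser_swap r integrable_torus_continuous continuous_intros smooth_slice_continuous smooth_dt sm) simp
    finally show ?thesis
      by (simp add: g1_def mode_def)
  qed
  \<comment> \<open>The factor k_i k_j is absorbed into \<phi> as a second derivative, at the cost
    of a sign.\<close>
  have g2_eq: "g2 k t = - (\<Sum>i\<in>UNIV. \<Sum>j\<in>UNIV. flux_coeff i j t k * mode (dx i (dx j \<phi>)) k t)" if "0 \<le> t" for k t
    unfolding g2_def rhs_eq_Fc sum_distrib_right
    by (simp add: mode_dx_dx[OF sm that per[OF that]] sum_negf mult_ac)
  have mode_int: "l1 (\<lambda>k. flux_coeff i j t k * mode (dx i (dx j \<phi>)) k t)" if t: "0 < t" "t < T" for i j t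
  proof (rule Bochner_Integration.integrable_bound)
    show "l1 (\<lambda>k. flux_coeff i j t k * of_real (B2 i j))"
      by (intro integrable_mult_left flux_coeff t)
    show "AE k in count_space UNIV. norm (flux_coeff i j t k * mode (dx i (dx j \<phi>)) k t) \<le> norm (flux_coeff i j t k * of_real (B2 i j))"
      using B2 t by (intro AE_I2) (simp add: norm_mult mult_left_mono)
  qed simp
  have R_eq: "complex_of_real (R t) = - (\<integral>k. g2 k t \<partial>count_space UNIV)" if t: "0 < t" "t < T" for t
  proof -
    have t0: "0 \<le> t"
      using t by simp
    have d2: "continuous_on UNIV (\<lambda>x. dx i (dx j \<phi>) (t, x))" for i j
      by (intro smooth_slice_continuous smooth_dx sm t0)
    have "R t = (LINT x|torus. (\<Sum>i\<in>UNIV. \<Sum>j\<in>UNIV. fluxU i j (c t) x * dx i (dx j \<phi>) (t, x)))"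
      unfolding R_def
    proof (rule integral_cong_AE)
      have "AE x in torus. \<forall>i\<in>UNIV. \<forall>j\<in>UNIV. flux i j (u t) x = fluxU i j (c t) x"
        unfolding u[OF t(1)] using flux_U(1)[OF c_reg[OF t(1)]] by (intro AE_finite_allI) auto
      then show "AE x in torus. (\<Sum>i\<in>UNIV. \<Sum>j\<in>UNIV. flux i j (u t) x * dx i (dx j \<phi>) (t, x))
          = (\<Sum>i\<in>UNIV. \<Sum>j\<in>UNIV. fluxU i j (c t) x * dx i (dx j \<phi>) (t, x))"
        by eventually_elim simp
      show "(\<lambda>x. \<Sum>i\<in>UNIV. \<Sum>j\<in>UNIV. flux i j (u t) x * dx i (dx j \<phi>) (t, x)) \<in> borel_measurable torus"
        unfolding u[OF t(1)]
        by (intro borel_measurable_sum borel_measurable_times flux_U c_reg t borel_measurable_torus[OF d2])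
      show "(\<lambda>x. \<Sum>i\<in>UNIV. \<Sum>j\<in>UNIV. fluxU i j (c t) x * dx i (dx j \<phi>) (t, x)) \<in> borel_measurable torus"
        by (intro borel_measurable_sum borel_measurable_times borel_measurable_torus fluxU_continuous d2 t)
    qed
    also have "\<dots> = (\<Sum>i\<in>UNIV. \<Sum>j\<in>UNIV. LINT x|torus. fluxU i j (c t) x * dx i (dx j \<phi>) (t, x))"
    proof -
      have i: "integrable torus (\<lambda>x. fluxU i j (c t) x * dx i (dx j \<phi>) (t, x))" for i j
        by (intro integrable_torus_continuous continuous_on_mult fluxU_continuous d2 t)
      show ?thesis
        by (simp add: Bochner_Integration.integral_sum i Bochner_Integration.integrable_sum)
    qed
    finally have "complex_of_real (R t) = (\<Sum>i\<in>UNIV. \<Sum>j\<in>UNIV. complex_of_real (LINT x|torus. fluxU i j (c t) x * dx i (dx j \<phi>) (t, x)))"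
      by simp
    also have "\<dots> = (\<Sum>i\<in>UNIV. \<Sum>j\<in>UNIV. \<integral>k. flux_coeff i j t k * mode (dx i (dx j \<phi>)) k t \<partial>count_space UNIV)"
    proof (intro sum.cong refl)
      fix i j
      have "complex_of_real (LINT x|torus. fluxU i j (c t) x * dx i (dx j \<phi>) (t, x))
          = (LINT x|torus. complex_of_real (fluxU i j (c t) x) * of_real (dx i (dx j \<phi>) (t, x)))"
        by (simp flip: integral_complex_of_real of_real_mult)
      also have "\<dots> = (LINT x|torus. ser (flux_coeff i j t) x * of_real (dx i (dx j \<phi>) (t, x)))"
      proof (rule integral_cong_AE)
        show "AE x in torus. complex_of_real (fluxU i j (c t) x) * of_real (dx i (dx j \<phi>) (t, x)) = ser (flux_coeff i j t) x * of_real (dx i (dx j \<phi>) (t, x))"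
          using flux_coeff(3)[OF t(1), of i j] by eventually_elim simp
        show "(\<lambda>x. complex_of_real (fluxU i j (c t) x) * of_real (dx i (dx j \<phi>) (t, x))) \<in> borel_measurable torus"
          by (intro borel_measurable_torus continuous_intros fluxU_continuous d2 t)
        show "(\<lambda>x. ser (flux_coeff i j t) x * of_real (dx i (dx j \<phi>) (t, x))) \<in> borel_measurable torus"
          by (intro borel_measurable_torus continuous_intros continuous_on_ser flux_coeff d2 t)
      qed
      also have "\<dots> = (\<integral>k. flux_coeff i j t k * (LINT x|torus. wave k x * of_real (dx i (dx j \<phi>) (t, x))) \<partial>count_space UNIV)"
        by (intro ser_swap flux_coeff integrable_torus_continuous continuous_intros d2 t)
      finally show "complex_of_real (LINT x|torus. fluxU i j (c t) x * dx i (dx j \<phi>) (t, x))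
          = (\<integral>k. flux_coeff i j t k * mode (dx i (dx j \<phi>)) k t \<partial>count_space UNIV)"
        by (simp add: mode_def)
    qed
    also have "\<dots> = (\<integral>k. (\<Sum>i\<in>UNIV. \<Sum>j\<in>UNIV. flux_coeff i j t k * mode (dx i (dx j \<phi>)) k t) \<partial>count_space UNIV)"
      using mode_int[OF t] by (simp add: Bochner_Integration.integral_sum Bochner_Integration.integrable_sum)
    also have "\<dots> = (\<integral>k. - g2 k t \<partial>count_space UNIV)"
      by (simp add: g2_eq[OF t0])
    finally show ?thesis
      by simp
  qed
  have cont_c: "continuous_on {0<..<T} (\<lambda>t. c t k)" and cont_rhs: "continuous_on {0<..<T} (\<lambda>t. rhs (c t) k)"
    and cont_m: "smooth_on spacetime f \<Longrightarrow> continuous_on {0<..<T} (mode f k)" for k and f :: "real \<times> (real ^ 'n) \<Rightarrow> real"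
    by (rule continuous_on_subset[OF c_continuous], auto)
       (rule continuous_on_subset[OF rhs_c_continuous], auto,
        rule continuous_on_subset[OF mode_continuous], auto)
  have g1c: "continuous_on {0<..<T} (g1 k)" and g2c: "continuous_on {0<..<T} (g2 k)" for k
    unfolding g1_def g2_def by (intro continuous_on_mult cont_c cont_rhs cont_m smooth_dt sm)+
  have g1_le: "(\<integral>\<^sup>+k. ennreal (norm (g1 k t)) \<partial>count_space UNIV) \<le> ennreal (B1 * A 4 t)" if t: "0 < t" "t < T" for t
  proof -
    have "(\<integral>\<^sup>+k. ennreal (norm (g1 k t)) \<partial>count_space UNIV) \<le> (\<integral>\<^sup>+k. ennreal (B1 * (norm (freq k) ^ 0 * norm (c t k))) \<partial>count_space UNIV)"
    proof (intro nn_integral_mono ennreal_leI)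
      fix k
      have "norm (c t k) * norm (mode (dt \<phi>) k t) \<le> norm (c t k) * B1"
        using t by (intro mult_left_mono B1) auto
      then show "norm (g1 k t) \<le> B1 * (norm (freq k) ^ 0 * norm (c t k))"
        by (simp add: g1_def norm_mult mult.commute)
    qed
    also have "\<dots> = ennreal (\<integral>k. B1 * (norm (freq k) ^ 0 * norm (c t k)) \<partial>count_space UNIV)"
      using B1(1) by (intro nn_integral_eq_integral integrable_mult_right c_moment_integrable t AE_I2) simp
    also have "\<dots> = ennreal (B1 * A 0 t)"
      by (simp only: integral_mult_right_zero A_eq)
    also have "\<dots> \<le> ennreal (B1 * A 4 t)"
      using B1(1) by (intro ennreal_leI mult_left_mono A_le_4 t) simp_all
    finally show ?thesis .
  qed
  define C2 where "C2 = (\<Sum>i\<in>UNIV. \<Sum>j\<in>UNIV. B2 i j * (1 + 1 / (1 - z)))"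
  have g2_le: "(\<integral>\<^sup>+k. ennreal (norm (g2 k t)) \<partial>count_space UNIV) \<le> ennreal (C2 * A 4 t)" if t: "0 < t" "t < T" for t
  proof -
    have int: "integrable (count_space UNIV) (\<lambda>k. B2 i j * norm (flux_coeff i j t k))" for i j
      by (intro integrable_mult_right integrable_norm flux_coeff t)
    have "norm (g2 k t) \<le> (\<Sum>i\<in>UNIV. \<Sum>j\<in>UNIV. B2 i j * norm (flux_coeff i j t k))" for k
      unfolding g2_eq[OF less_imp_le[OF t(1)]] norm_minus_cancel
    proof (intro sum_norm_le)
      fix i j
      have "norm (flux_coeff i j t k) * norm (mode (dx i (dx j \<phi>)) k t) \<le> norm (flux_coeff i j t k) * B2 i j"
        using t by (intro mult_left_mono B2) auto
      then show "norm (flux_coeff i j t k * mode (dx i (dx j \<phi>)) k t) \<le> B2 i j * norm (flux_coeff i j t k)"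
        by (simp add: norm_mult mult.commute)
    qed
    then have "(\<integral>\<^sup>+k. ennreal (norm (g2 k t)) \<partial>count_space UNIV)
        \<le> (\<integral>\<^sup>+k. ennreal (\<Sum>i\<in>UNIV. \<Sum>j\<in>UNIV. B2 i j * norm (flux_coeff i j t k)) \<partial>count_space UNIV)"
      by (intro nn_integral_mono ennreal_leI)
    also have "\<dots> = ennreal (\<integral>k. (\<Sum>i\<in>UNIV. \<Sum>j\<in>UNIV. B2 i j * norm (flux_coeff i j t k)) \<partial>count_space UNIV)"
      using B2(1) by (intro nn_integral_eq_integral Bochner_Integration.integrable_sum int AE_I2 sum_nonneg) simp
    also have "\<dots> = ennreal (\<Sum>i\<in>UNIV. \<Sum>j\<in>UNIV. B2 i j * (\<integral>k. norm (flux_coeff i j t k) \<partial>count_space UNIV))"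
      using int by (simp add: Bochner_Integration.integral_sum Bochner_Integration.integrable_sum)
    also have "\<dots> \<le> ennreal (\<Sum>i\<in>UNIV. \<Sum>j\<in>UNIV. B2 i j * ((1 + 1 / (1 - z)) * A 4 t))"
      using B2(1) by (intro ennreal_leI sum_mono mult_left_mono flux_coeff t) auto
    also have "\<dots> = ennreal (C2 * A 4 t)"
      by (simp add: C2_def sum_distrib_right mult.assoc)
    finally show ?thesis .
  qed
  note s1 = swap_time_modes[where g = g1, OF T g1c g1_le]
  note s2 = swap_time_modes[where g = g2, OF T g2c g2_le]
  have mode_id: "(LINT t|?M. g1 k t) + (LINT t|?M. g2 k t) = - (v k * mode \<phi> k 0)" for k
  proof -
    \<comment> \<open>The interior form of the fundamental theorem is used: the equation holds for t
      > 0, and at 0 there is only continuity.\<close>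
    have "((\<lambda>t. g1 k t + g2 k t) has_integral (c T k * mode \<phi> k T - c 0 k * mode \<phi> k 0)) {0..T}"
    proof (rule fundamental_theorem_of_calculus_interior)
      show "continuous_on {0..T} (\<lambda>t. c t k * mode \<phi> k t)"
        by (intro continuous_on_mult continuous_on_subset[OF c_continuous] continuous_on_subset[OF mode_continuous[OF sm]]) auto
      fix t assume t: "t \<in> {0<..<T}"
      have "(mode \<phi> k has_vector_derivative mode (dt \<phi>) k t) (at t within {0..})"
        using t by (intro mode_dt sm) simp
      then have "(mode \<phi> k has_vector_derivative mode (dt \<phi>) k t) (at t)"
        using t by (subst (asm) at_within_interior) auto
      from has_vector_derivative_mult[OF c_deriv this, of k] t
      show "((\<lambda>t. c t k * mode \<phi> k t) has_vector_derivative g1 k t + g2 k t) (at t)"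
        by (simp add: g1_def g2_def)
    qed (use T in simp)
    moreover have "mode \<phi> k T = 0"
      by (simp add: mode_def \<phi>T)
    ultimately have "integral {0..T} (\<lambda>t. g1 k t + g2 k t) = - (v k * mode \<phi> k 0)"
      by (simp add: integral_unique c_0)
    moreover have "(LINT t|?M. g1 k t + g2 k t) = integral {0<..<T} (\<lambda>t. g1 k t + g2 k t)"
      using s1(4) s2(4) by (intro lebesgue_integral_eq_integral Bochner_Integration.integrable_add) auto
    moreover have "integral {0<..<T} (\<lambda>t. g1 k t + g2 k t) = integral {0..T} (\<lambda>t. g1 k t + g2 k t)"
      by (rule integral_open_interval_real[symmetric])
    ultimately show ?thesis
      using s1(4) s2(4) by (simp add: Bochner_Integration.integral_add)
  qed
  have P_int: "complex_of_real (LINT t|?M. P t) = (\<integral>k. (LINT t|?M. g1 k t) \<partial>count_space UNIV)"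
  proof -
    have "complex_of_real (LINT t|?M. P t) = (LINT t|?M. complex_of_real (P t))"
      by simp
    also have "\<dots> = (LINT t|?M. \<integral>k. g1 k t \<partial>count_space UNIV)"
      by (intro Bochner_Integration.integral_cong refl P_eq) simp
    also have "\<dots> = (\<integral>k. (LINT t|?M. g1 k t) \<partial>count_space UNIV)"
      by (rule s1(1))
    finally show ?thesis .
  qed
  have R_int: "complex_of_real (LINT t|?M. R t) = - (\<integral>k. (LINT t|?M. g2 k t) \<partial>count_space UNIV)"
  proof -
    have "complex_of_real (LINT t|?M. R t) = (LINT t|?M. complex_of_real (R t))"
      by simp
    also have "\<dots> = (LINT t|?M. - (\<integral>k. g2 k t \<partial>count_space UNIV))"
      by (intro Bochner_Integration.integral_cong refl R_eq) simp_all
    also have "\<dots> = - (LINT t|?M. \<integral>k. g2 k t \<partial>count_space UNIV)"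
      by simp
    also have "(LINT t|?M. \<integral>k. g2 k t \<partial>count_space UNIV) = (\<integral>k. (LINT t|?M. g2 k t) \<partial>count_space UNIV)"
      by (rule s2(1))
    finally show ?thesis .
  qed
  have c0: "continuous_on UNIV (\<lambda>x. \<phi> (0, x))"
    by (intro smooth_slice_continuous sm) simp
  have "complex_of_real (LINT x|torus. \<phi> (0, x) * u0 x) = complex_of_real (LINT x|torus. U v x * \<phi> (0, x))"
  proof (intro arg_cong[where f = complex_of_real] integral_cong_AE)
    show "AE x in torus. \<phi> (0, x) * u0 x = U v x * \<phi> (0, x)"
      using u0(2) by eventually_elim simp
  qed (intro borel_measurable_times borel_measurable_torus[OF c0] L1_measurable[OF u0(1)] U_measurable[OF v_l1])+
  also have "\<dots> = (LINT x|torus. ser v x * of_real (\<phi> (0, x)))"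
    by (simp flip: U_ser[OF v_herm] integral_complex_of_real of_real_mult)
  also have "\<dots> = (\<integral>k. v k * mode \<phi> k 0 \<partial>count_space UNIV)"
    unfolding mode_def by (intro ser_swap v_l1 integrable_torus_continuous continuous_intros c0)
  finally have u0_int: "complex_of_real (LINT x|torus. \<phi> (0, x) * u0 x) = (\<integral>k. v k * mode \<phi> k 0 \<partial>count_space UNIV)" .
  have "complex_of_real (LINT t|?M. P t) - complex_of_real (LINT t|?M. R t)
      = (\<integral>k. (LINT t|?M. g1 k t) + (LINT t|?M. g2 k t) \<partial>count_space UNIV)"
    using s1(3) s2(3) by (simp add: P_int R_int Bochner_Integration.integral_add)
  also have "\<dots> = - complex_of_real (LINT x|torus. \<phi> (0, x) * u0 x)"
    unfolding mode_id u0_int by simp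
  finally have "complex_of_real (- (LINT t|?M. P t) - (LINT x|torus. \<phi> (0, x) * u0 x) + (LINT t|?M. R t)) = 0"
    by (simp add: algebra_simps)
  then show ?thesis
    unfolding P_def R_def of_real_eq_0_iff .
qed

lemma sol_strong_solution:
  assumes T: "0 < T" and u: "\<And>t. 0 < t \<Longrightarrow> u t = U (c t)"
    and u0: "u0 \<in> L1" "AE x in torus. u0 x = U v x"
  shows "strong_solution T u0 u"
  unfolding strong_solution_def
proof (intro conjI allI impI)
  show "AE t in lebesgue_on {0<..<T}. AE x in torus. 0 < 1 + u t x"
    by (intro AE_I2) (simp add: u one_plus_U_pos)
qed (intro sol_Linf sol_H1 sol_W21 sol_flux weak_formulation T u u0; assumption)+

end

theorem theorem2p1:
  fixes u0 :: "real ^ 'n::finite \<Rightarrow> real"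
  assumes "CARD('n) \<in> {1, 2, 3}"
    and "u0 \<in> wiener 0"
    and "(LINT x|torus. u0 x) = 0"
    and "wiener_norm 0 u0 < 1"
    and "(real CARD('n))\<^sup>2 * P1 (wiener_norm 0 u0) < 1"
  shows "\<exists>u :: real \<Rightarrow> real ^ 'n \<Rightarrow> real.
     (\<forall>T>0. strong_solution T u0 u) \<and>
     (AE x in torus. u 0 x = u0 x) \<and>
     (\<forall>T>0. u \<in> bochner_Linf T Linf Linf_norm \<and>
        (\<forall>p>1. u \<in> bochner_Lp p T (wiener (4 / p)) (wiener_full_norm (4 / p)))) \<and>
     (\<forall>t\<ge>0. u t \<in> Linf \<and>
        Linf_norm (u t) \<le>
          wiener_norm 0 u0 * exp (- (1 - (real CARD('n))\<^sup>2 * P1 (wiener_norm 0 u0)) * t)) \<and>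
     (\<forall>\<sigma>>0. 1 - \<sigma> - (real CARD('n))\<^sup>2 * P1 (wiener_norm 0 u0) > 0 \<longrightarrow>
        (\<forall>T>0. (\<lambda>t k. of_real (exp (\<sigma> * t * norm (freq k))) * fourier_coeff (u t) k)
           \<in> bochner_Linf T ell1 ell1_norm))"
proof -
  define v where "v = fourier_coeff u0"
  have u0_L1: "u0 \<in> L1" and "(\<lambda>k. norm (v k)) summable_on UNIV"
    using assms(2) by (auto simp: wiener_def wiener_weight_def v_def)
  then have l1: "l1 v"
    using abs_summable_equivalent[of v UNIV] by (simp add: abs_summable_on_def)
  have norm_v: "(\<integral>k. norm (v k) \<partial>count_space UNIV) = wiener_norm 0 u0"
    using infsum_eq_integral(2)[OF integrable_norm[OF l1]] by (simp add: wiener_norm_def wiener_weight_def v_def)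
  have herm: "herm v"
    unfolding herm_def v_def fourier_coeff_eq_fc by (intro allI fc_uminus_of_real) simp
  have "v 0 = 0"
    using assms(3) by (simp add: v_def fourier_coeff_def)
  then interpret wiener_datum v
    by unfold_locales (use l1 herm norm_v assms(4,5) in simp_all)
  have z_eq: "z = wiener_norm 0 u0"
    by (simp add: z_def norm_v)
  have \<delta>_eq: "\<delta> = 1 - (real CARD('n))\<^sup>2 * P1 (wiener_norm 0 u0)"
    by (simp add: \<delta>_def z_eq)
  have u0_eq: "AE x in torus. u0 x = U v x"
    using u0_L1 by (intro real_AE_eq_U herm l1) (auto simp: L1_def v_def)
  \<comment> \<open>At t = 0 the given representative is kept, since the series agrees with it only
    almost everywhere.\<close>
  define u where "u t = (if t = 0 then u0 else U (c t))" for t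
  have u: "u t = U (c t)" if "0 < t" for t
    using that by (simp add: u_def)
  have u0_le: "AE x in torus. \<bar>u0 x\<bar> \<le> z"
    using u0_eq
  proof eventually_elim
    case (elim x)
    then show ?case
      using abs_U_le[of v x] by (simp add: z_def)
  qed
  have "u t \<in> Linf \<and> Linf_norm (u t) \<le> z * exp (- \<delta> * t)" if "0 \<le> t" for t
  proof (cases "t = 0")
    case True
    then show ?thesis
      using u0_le u0_L1 Linf_norm_le[OF L1_measurable[OF u0_L1] u0_le z(1)]
      by (auto simp: u_def Linf_def L1_def L1_measurable[OF u0_L1])
  next
    case False
    then show ?thesis
      using that sol_Linf_norm_le[of t] U_Linf[OF regD(2)[OF c_reg[of t]]] by (simp add: u)
  qed
  moreover have "(\<lambda>t k. of_real (exp (\<sigma> * t * norm (freq k))) * fourier_coeff (u t) k) \<in> bochner_Linf T ell1 ell1_norm"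
    if "0 < \<sigma>" "1 - \<sigma> - (real CARD('n))\<^sup>2 * P1 (wiener_norm 0 u0) > 0" "0 < T" for \<sigma> T
    using that by (intro sol_ell1 u) (auto simp: \<delta>_eq)
  moreover have "AE x in torus. u 0 x = u0 x"
    by (simp add: u_def)
  ultimately show ?thesis
    unfolding z_eq \<delta>_eq
    by (intro exI[of _ u] conjI allI impI sol_strong_solution sol_Linf sol_wiener u u0_L1 u0_eq) auto
qed

end
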